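(* Let $n\ge 2$ be an integer, $p>1$, $\alpha\in\mathbb{R}$. If $\alpha\notin\{2p-n,\,np-n\}$ and $q>p$, then the equation $$\Delta\left(|x|^\alpha|\Delta U|^{p-2}\Delta U\right)+\operatorname{div}\left(|x|^{-\beta_{1,q}}|\nabla U|^{q-2}\nabla U\right)=0$$ has a unique nontrivial solution $U\in\mathcal D^{2,p}_{\rm r}(\mathbb{R}^n;|x|^{\alpha}dx)$, where functions that coincide up to a change of sign and a transform of the type $u(x)\mapsto\rho^{\frac{n-2p+\alpha}{p}}u(\rho x)$, $\rho>0$, are identified. More precisely, $U$ achieves the best constant $$S_{2,q,1}(\alpha)=\inf_{\substack{u\in\mathcal D^{2,p}_{\rm r}(\mathbb{R}^n;|x|^\alpha dx)\\ u\ne 0}}\frac{\displaystyle\int_{\mathbb{R}^n}|x|^{\alpha}|\Delta u|^p\,dx}{\left(\displaystyle\int_{\mathbb{R}^n}|x|^{-\beta_{1,q}}|\nabla u|^q\,dx\right)^{p/q}}$$ and it is given by $$U(x)=k\int_{|x|}^\infty t^{1-\frac{\alpha}{p-1}}\left(1+t^{\frac{(np-n-\alpha)(q-p)}{p(p-1)}}\right)^{\frac{p}{p-q}}dt\quad\text{if }\alpha>2p-n,$$ $$U(x)=k\int_{0}^{|x|} t^{1-\frac{\alpha}{p-1}}\left(1+t^{\frac{(np-n-\alpha)(q-p)}{p(p-1)}}\right)^{\frac{p}{p-q}}dt\quad\text{if }\alpha<2p-n,$$ where $$k=\left(\frac{q}{p}\,\frac{|np-n-\alpha|^p}{(p-1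)^{p-1}}\right)^{\frac{1}{q-p}}.$$
   Context: $\beta_{1,q}=n-q\,\frac{n-p+\alpha}{p}$. $C^2_{c,r}(\mathbb{R}^n\setminus\{0\})$ is the space of radially symmetric functions in $C^2_c(\mathbb{R}^n\setminus\{0\})$. For $\alpha\notin\{2p-n,np-n\}$, $\mathcal D^{2,p}_{\rm r}(\mathbb{R}^n;|x|^\alpha dx)$ is the completion of $C^2_{c,r}(\mathbb{R}^n\setminus\{0\})$ with respect to the norm $\left(\int_{\mathbb{R}^n}|x|^\alpha|\Delta u|^p\,dx\right)^{1/p}$; it is continuously embedded in $L^p(\mathbb{R}^n;|x|^{\alpha-2p}dx)$, so its elements are radial functions on $\mathbb{R}^n\setminus\{0\}$ (derivatives in the weak sense on $\mathbb{R}^n\setminus\{0\}$). A solution is meant in the weak sense: $\int_{\mathbb{R}^n}|x|^\alpha|\Delta U|^{p-2}\Delta U\,\Delta\varphi\,dx=\int_{\mathbb{R}^n}|x|^{-\beta_{1,q}}|\nabla U|^{q-2}\nabla U\cdot\nabla\varphi\,dx$ for all $\varphi\in\mathcal D^{2,p}_{\rm r}(\mathbb{R}^n;|x|^\alpha dx)$. *)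

theory Defs
  imports "HOL-Analysis.Analysis"
begin

text \<open>
  Functions on \<open>\<real>\<^sup>n \<setminus> {0}\<close> are total functions considered up to equality almost everywhere,
  so their value at the origin is irrelevant. The dimension \<open>n\<close> is \<open>DIM('a)\<close>.
\<close>

definition beta1 :: "real \<Rightarrow> real \<Rightarrow> real \<Rightarrow> real \<Rightarrow> real" where
  "beta1 n p \<alpha> q = n - q * ((n - p + \<alpha>) / p)"

subsection \<open>Test functions\<close>

definition partial_deriv :: "'a::euclidean_space \<Rightarrow> ('a \<Rightarrow> real) \<Rightarrow> 'a \<Rightarrow> real" where
  "partial_deriv b f x = frechet_derivative f (at x) b"

fun Ck :: "nat \<Rightarrow> ('a::euclidean_space \<Rightarrow> real) \<Rightarrow> bool" where
  "Ck 0 f \<longleftrightarrow> continuous_on UNIV f"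
| "Ck (Suc k) f \<longleftrightarrow> (\<forall>x. f differentiable (at x)) \<and> (\<forall>b\<in>Basis. Ck k (partial_deriv b f))"

text \<open>\<open>C\<^sup>k\<^sub>c(\<real>\<^sup>n \<setminus> {0})\<close>, its elements being extended by zero to the origin.\<close>

definition Ckc :: "nat \<Rightarrow> ('a::euclidean_space \<Rightarrow> real) set" where
  "Ckc k = {f. Ck k f \<and> compact (closure {x. f x \<noteq> 0}) \<and> 0 \<notin> closure {x. f x \<noteq> 0}}"

definition radial :: "('a::euclidean_space \<Rightarrow> real) \<Rightarrow> bool" where
  "radial f \<longleftrightarrow> (\<forall>x y. norm x = norm y \<longrightarrow> f x = f y)"

definition laplacian :: "('a::euclidean_space \<Rightarrow> real) \<Rightarrow> 'a \<Rightarrow> real" where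
  "laplacian f x = (\<Sum>b\<in>Basis. partial_deriv b (partial_deriv b f) x)"

subsection \<open>Weak derivatives on the punctured space\<close>

definition loc_integrable :: "('a::euclidean_space \<Rightarrow> 'b::euclidean_space) \<Rightarrow> bool" where
  "loc_integrable f \<longleftrightarrow> (\<forall>K. compact K \<and> 0 \<notin> K \<longrightarrow> set_integrable lborel K f)"

text \<open>A weak derivative of order \<open>k\<close> is tested against \<open>C\<^sup>k\<^sub>c\<close>, as in Gilbarg and Trudinger.\<close>

definition is_weak_gradient :: "('a::euclidean_space \<Rightarrow> real) \<Rightarrow> ('a \<Rightarrow> 'a) \<Rightarrow> bool" where
  "is_weak_gradient u G \<longleftrightarrow> loc_integrable u \<and> loc_integrable G \<and>
     (\<forall>\<phi>\<in>Ckc 1. \<forall>b\<in>Basis.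
        (LINT x|lborel. u x * partial_deriv b \<phi> x) = - (LINT x|lborel. (G x \<bullet> b) * \<phi> x))"

definition is_weak_laplacian :: "('a::euclidean_space \<Rightarrow> real) \<Rightarrow> ('a \<Rightarrow> real) \<Rightarrow> bool" where
  "is_weak_laplacian u f \<longleftrightarrow> loc_integrable u \<and> loc_integrable f \<and>
     (\<forall>\<phi>\<in>Ckc 2. (LINT x|lborel. u x * laplacian \<phi> x) = (LINT x|lborel. f x * \<phi> x))"

text \<open>
  Weak derivatives are unique up to null sets, and they exist for all elements of the space
  \<open>Dr\<close> below, so the choice of a representative is immaterial.
\<close>

definition wgrad :: "('a::euclidean_space \<Rightarrow> real) \<Rightarrow> 'a \<Rightarrow> 'a" where
  "wgrad u = (SOME G. is_weak_gradient u G)"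

definition wlap :: "('a::euclidean_space \<Rightarrow> real) \<Rightarrow> 'a \<Rightarrow> real" where
  "wlap u = (SOME f. is_weak_laplacian u f)"

subsection \<open>The radial space\<close>

definition Ckcr :: "nat \<Rightarrow> ('a::euclidean_space \<Rightarrow> real) set" where
  "Ckcr k = {f \<in> Ckc k. radial f}"

definition D_norm :: "real \<Rightarrow> real \<Rightarrow> ('a::euclidean_space \<Rightarrow> real) \<Rightarrow> real" where
  "D_norm p \<alpha> f =
     (LINT x|lborel. norm x powr \<alpha> * \<bar>laplacian f x\<bar> powr p) powr (1 / p)"

text \<open>
  The completion of \<open>C\<^sup>2\<^sub>c\<^sub>,\<^sub>r\<close>, realised inside \<open>L\<^sup>p(|x|\<^sup>\<alpha>\<^sup>-\<^sup>2\<^sup>p dx)\<close> by means of the continuous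
  embedding available for \<open>\<alpha> \<notin> {2p - n, np - n}\<close>: an element is the \<open>L\<^sup>p(|x|\<^sup>\<alpha>\<^sup>-\<^sup>2\<^sup>p dx)\<close>-limit of
  a sequence in \<open>C\<^sup>2\<^sub>c\<^sub>,\<^sub>r\<close> that is Cauchy for \<open>D_norm\<close>.
\<close>

definition Dr :: "real \<Rightarrow> real \<Rightarrow> ('a::euclidean_space \<Rightarrow> real) set" where
  "Dr p \<alpha> = {u. u \<in> borel_measurable lborel \<and>
     (\<exists>\<phi> :: nat \<Rightarrow> 'a \<Rightarrow> real. (\<forall>j. \<phi> j \<in> Ckcr 2) \<and>
        (\<forall>\<epsilon>>0. \<exists>N. \<forall>j\<ge>N. \<forall>k\<ge>N. D_norm p \<alpha> (\<lambda>x. \<phi> j x - \<phi> k x) < \<epsilon>) \<and>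
        (\<lambda>j. \<integral>\<^sup>+x. ennreal (norm x powr (\<alpha> - 2 * p) * \<bar>\<phi> j x - u x\<bar> powr p) \<partial>lborel)
          \<longlonglongrightarrow> 0)}"

definition nonzero :: "('a::euclidean_space \<Rightarrow> real) \<Rightarrow> bool" where
  "nonzero u \<longleftrightarrow> \<not> (AE x in lborel. u x = 0)"

subsection \<open>Weak solutions, identification and best constant\<close>

text \<open>
  The convention \<open>0 powr s = 0\<close> gives \<open>|\<xi>|\<^sup>s\<^sup>-\<^sup>2 \<xi> = 0\<close> for \<open>\<xi> = 0\<close>, also when \<open>s < 2\<close>.
\<close>

definition weak_solution :: "real \<Rightarrow> real \<Rightarrow> real \<Rightarrow> ('a::euclidean_space \<Rightarrow> real) \<Rightarrow> bool" where
  "weak_solution p \<alpha> q U \<longleftrightarrow> U \<in> Dr p \<alpha> \<and>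
     (\<forall>\<phi>\<in>Dr p \<alpha>.
        integrable lborel
          (\<lambda>x. norm x powr \<alpha> * (\<bar>wlap U x\<bar> powr (p - 2) * wlap U x * wlap \<phi> x)) \<and>
        integrable lborel
          (\<lambda>x. norm x powr (- beta1 (real DIM('a)) p \<alpha> q) *
                 (norm (wgrad U x) powr (q - 2) * (wgrad U x \<bullet> wgrad \<phi> x))) \<and>
        (LINT x|lborel. norm x powr \<alpha> * (\<bar>wlap U x\<bar> powr (p - 2) * wlap U x * wlap \<phi> x)) =
        (LINT x|lborel. norm x powr (- beta1 (real DIM('a)) p \<alpha> q) *
                 (norm (wgrad U x) powr (q - 2) * (wgrad U x \<bullet> wgrad \<phi> x))))"

definition identified ::
  "real \<Rightarrow> real \<Rightarrow> ('a::euclidean_space \<Rightarrow> real) \<Rightarrow> ('a \<Rightarrow> real) \<Rightarrow> bool" where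
  "identified p \<alpha> u v \<longleftrightarrow> (\<exists>s\<in>{1, -1}. \<exists>\<rho>>0. AE x in lborel.
     v x = s * (\<rho> powr ((real DIM('a) - 2 * p + \<alpha>) / p) * u (\<rho> *\<^sub>R x)))"

text \<open>
  Nothing is lost by using real-valued integrals here. The numerator is finite on \<open>Dr\<close>, and an
  infinite denominator would give the value \<open>0\<close> of the quotient also with \<open>integral\<^sup>L\<close> and
  \<open>x / 0 = 0\<close>.
\<close>

definition rayleigh_quotient :: "real \<Rightarrow> real \<Rightarrow> real \<Rightarrow> ('a::euclidean_space \<Rightarrow> real) \<Rightarrow> real" where
  "rayleigh_quotient p \<alpha> q u =
     (LINT x|lborel. norm x powr \<alpha> * \<bar>wlap u x\<bar> powr p) /
     (LINT x|lborel. norm x powr (- beta1 (real DIM('a)) p \<alpha> q) * norm (wgrad u x) powr q)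
       powr (p / q)"

definition best_constant :: "'a::euclidean_space itself \<Rightarrow> real \<Rightarrow> real \<Rightarrow> real \<Rightarrow> real" where
  "best_constant _ p \<alpha> q = (INF u\<in>{u :: 'a \<Rightarrow> real. u \<in> Dr p \<alpha> \<and> nonzero u}. rayleigh_quotient p \<alpha> q u)"

definition profile :: "real \<Rightarrow> real \<Rightarrow> real \<Rightarrow> real \<Rightarrow> real \<Rightarrow> real" where
  "profile n p \<alpha> q t =
     t powr (1 - \<alpha> / (p - 1)) *
     (1 + t powr (((n * p - n - \<alpha>) * (q - p)) / (p * (p - 1)))) powr (p / (p - q))"

definition kconst :: "real \<Rightarrow> real \<Rightarrow> real \<Rightarrow> real \<Rightarrow> real" where
  "kconst n p \<alpha> q =
     (q / p * (\<bar>n * p - n - \<alpha>\<bar> powr p / (p - 1) powr (p - 1))) powr (1 / (q - p))"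

end

theory Submission
  imports Defs
begin

text \<open>
  Let \<open>\<sigma> = (n p - n - \<alpha>) / (p - 1)\<close> and \<open>\<mu> = (p - 1) / p\<close>. For a radial function \<open>u = H(|x|)\<close> put
  \<open>r = |x|\<close>, \<open>s = r\<^sup>\<sigma>\<close> and \<open>W(s) = r\<^sup>n\<^sup>-\<^sup>1 H'(r)\<close>. Then \<open>\<integral>|x|\<^sup>\<alpha> |\<Delta>u|\<^sup>p dx\<close> and
  \<open>\<integral>|x|\<^sup>-\<^sup>\<beta> |\<nabla>u|\<^sup>q dx\<close> are multiples of \<open>\<integral>|W'|\<^sup>p ds\<close> and \<open>\<integral>s\<^sup>-\<^sup>1\<^sup>-\<^sup>q\<^sup>\<mu> |W|\<^sup>q ds\<close>, so that the
  minimisation problem becomes Bliss' inequality on the half-line, which is proved by transporting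
  the measure \<open>s\<^sup>-\<^sup>1\<^sup>-\<^sup>q\<^sup>\<mu> |W|\<^sup>q ds\<close> to the one belonging to the extremal function. The weak equation
  becomes the Emden-Fowler system \<open>W' = |P|\<^sup>1\<^sup>/\<^sup>(\<^sup>p\<^sup>-\<^sup>1\<^sup>) sgn P\<close>, \<open>P' = - c s\<^sup>-\<^sup>1\<^sup>-\<^sup>q\<^sup>\<mu> |W|\<^sup>q\<^sup>-\<^sup>1 sgn W\<close>.
  Its conserved energy vanishes by integrability, which makes the system integrable in closed form:
  its solutions are the extremal functions. Finally, \<open>H\<close> is the primitive of \<open>r\<^sup>1\<^sup>-\<^sup>n W(r\<^sup>\<sigma>)\<close> that
  vanishes at the origin (\<open>\<alpha> < 2 p - n\<close>) or at infinity (\<open>\<alpha> > 2 p - n\<close>).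
\<close>

subsection \<open>Integration of functions of the norm\<close>

text \<open>The substitution is dictated by the radial Laplacian, r powr (1 - n) times the
  r-derivative of the flux W: only W' enters, and \<sigma> is the power of r for which weight and
  Jacobian cancel. The excluded values of \<alpha> are those with \<sigma> = 0, where s = r powr
  \<sigma> degenerates, or \<delta> = 0, where r powr \<delta> distinguishes neither end of the
  half-line. Hoelder's bound |W(s)| \<le> C s powr \<mu>, with C the L^p norm of W', controls all
  limits: it becomes |H'| \<le> C r powr (\<delta> - 1), which can be integrated from the end where
  r powr \<delta> vanishes. The obstacle is that the space is a closure and its weak derivatives are
  choices, so every statement has to travel along approximating sequences. The way back from W to H
  is delicate: for a compactly supported W, the primitive H is constant near both ends but in
  general vanishes near only one. The difference H(r) - H(r / \<epsilon>) restores compact support.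
  The flux of the extremal function has to be cut off first, on a logarithmic scale. Existence is
  then a verification, as the transport bound is attained by the explicit candidate.\<close>

lemma sets_borel_eq_sigma_sets_Ioc_off_0:
 "sets (borel::real measure) = sigma_sets UNIV {{a<..b} |a b. 0 < a \<or> b \<le> 0}" (is "_ = sigma_sets UNIV ?E")
proof -
 have 1: "{a<..b} \<in> sigma_sets UNIV ?E" for a b :: real
 proof -
  have pos: "{0<..b} \<in> sigma_sets UNIV ?E" if "0 < b"
  proof -
   have "{0<..b} = (\<Union>i. {b / real (Suc i)<..b})"
   proof safe
    fix x assume "x \<in> {0<..b}"
    moreover from this obtain i where "b / x < real i" using reals_Archimedean2 by blast
    ultimately have "b / real (Suc i) < x" by (auto simp: field_simps)
    then show "x \<in> (\<Union>i. {b / real (Suc i)<..b})" using \<open>x \<in> _\<close> by auto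
   next
    fix x i assume "x \<in> {b / real (Suc i)<..b}"
    then show "x \<in> {0<..b}" using divide_nonneg_nonneg[OF less_imp_le[OF that] of_nat_0_le_iff, of "Suc i"]
     unfolding greaterThanAtMost_iff by linarith
   qed
   also have "\<dots> \<in> sigma_sets UNIV ?E"
    using that by (intro sigma_sets.Union sigma_sets.Basic) (auto intro!: exI)
   finally show ?thesis .
  qed
  show ?thesis
  proof (cases "0 < a \<or> b \<le> 0")
   case True then show ?thesis by (intro sigma_sets.Basic) auto
  next
   case False
   then have "{a<..b} = {a<..0} \<union> {0<..b}" by auto
   also have "\<dots> \<in> sigma_sets UNIV ?E"
    using False by (intro sigma_sets_Un pos sigma_sets.Basic) auto
   finally show ?thesis .
  qed
 qed
 have "sets (borel::real measure) = sigma_sets UNIV (range (\<lambda>(a,b). {a<..b}))"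
  by (subst borel_sigma_sets_Ioc) (simp add: sets_measure_of)
 also have "\<dots> = sigma_sets UNIV ?E"
  by (rule sigma_sets_eqI) (use 1 in \<open>auto intro: sigma_sets.Basic\<close>)
 finally show ?thesis .
qed

definition sphere_area :: "'a::euclidean_space itself \<Rightarrow> real" where
 "sphere_area _ = real DIM('a) * unit_ball_vol (real DIM('a))"

lemma sphere_area_pos: "sphere_area TYPE('a::euclidean_space) > 0"
 by (simp add: sphere_area_def)

text \<open>Polar coordinates for functions of the norm, from the volumes of balls. The preimage of
  \<open>{a<..b}\<close> with 0 < a is a shell, a difference of closed balls for \<sigma> > 0 and of
  open balls for \<sigma> < 0, and its volume is the increment of a primitive of the density. For
  \<sigma> < 0 the preimage of \<open>{0<..b}\<close> is the complement of a ball and has infinite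
  volume; therefore the generator consists of intervals that either stay away from 0 or lie to its
  left.\<close>

lemma distr_norm_powr:
 fixes \<sigma> :: real
 assumes \<sigma>: "\<sigma> \<noteq> 0"
 defines "c \<equiv> sphere_area TYPE('a) / \<bar>\<sigma>\<bar>"
 shows "distr (lborel :: 'a::euclidean_space measure) borel (\<lambda>x. norm x powr \<sigma>) =
     density lborel (\<lambda>s. ennreal (c * (s powr (DIM('a) / \<sigma> - 1) * indicator {0<..} s)))"
  (is "?M = ?N")
proof (rule measure_eqI_generator_eq_countable[OF _ _ _ sets_borel_eq_sigma_sets_Ioc_off_0[THEN trans[rotated]] sets_borel_eq_sigma_sets_Ioc_off_0[THEN trans[rotated]]])
 let ?E = "{{a<..b} |a b :: real. 0 < a \<or> b \<le> 0}"
 have cp: "c > 0" using sphere_area_pos[where 'a='a] \<sigma> by (simp add: c_def)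
 show "Int_stable ?E"
 proof (rule Int_stableI)
  fix A B :: "real set" assume "A \<in> ?E" "B \<in> ?E"
  then obtain a b a' b' where "A = {a<..b}" "B = {a'<..b'}" "0 < a \<or> b \<le> 0" "0 < a' \<or> b' \<le> 0"
   by auto
  then have "A \<inter> B = {max a a'<..min b b'}" "0 < max a a' \<or> min b b' \<le> 0" by auto
  then show "A \<inter> B \<in> ?E" by blast
 qed
 let ?n = "real DIM('a)"
 let ?F = "\<lambda>s. unit_ball_vol ?n * s powr (?n / \<sigma>)"
 have Npos: "emeasure ?N {a<..b} = ennreal \<bar>?F b - ?F a\<bar>" if "0 < a" "a \<le> b" for a b
 proof -
  define g where "g = (\<lambda>s. c * s powr (?n / \<sigma> - 1))"
  have "emeasure ?N {a<..b} = (\<integral>\<^sup>+s. ennreal (g s) * indicator {a..b} s \<partial>lborel)"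
   using that unfolding g_def
   by (subst emeasure_density, simp, simp, intro nn_integral_cong_AE eventually_mono[OF AE_lborel_singleton[of a]])
    (auto split: split_indicator)
  also have "\<dots> = ennreal (sgn \<sigma> * ?F b - sgn \<sigma> * ?F a)"
  proof (rule nn_integral_FTC_Icc)
   fix x assume "x \<in> {a..b}"
   then have "x > 0" using that by simp
   then show "DERIV (\<lambda>s. sgn \<sigma> * ?F s) x :> g x"
    using \<sigma> by (auto intro!: derivative_eq_intros simp: g_def c_def sphere_area_def powr_diff sgn_if abs_if)
   show "0 \<le> g x" using cp by (simp add: g_def)
  qed (use that in \<open>auto simp: g_def\<close>)
  also have "sgn \<sigma> * ?F b - sgn \<sigma> * ?F a = \<bar>?F b - ?F a\<bar>"
  proof (cases "\<sigma> > 0")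
   case True
   then have "a powr (?n / \<sigma>) \<le> b powr (?n / \<sigma>)" using that by (intro powr_mono2) auto
   then show ?thesis using True by (simp add: mult_left_mono)
  next
   case False
   then have "b powr (?n / \<sigma>) \<le> a powr (?n / \<sigma>)" using that \<sigma> by (intro powr_mono2') (auto simp: divide_nonneg_neg)
   then have "?F b \<le> ?F a" by (simp add: mult_left_mono)
   then show ?thesis using False \<sigma> by simp
  qed
  finally show ?thesis .
 qed
 have Mpos: "emeasure ?M {a<..b} = ennreal \<bar>?F b - ?F a\<bar>" if "0 < a" "a \<le> b" for a b
 proof -
  define u v where "u = a powr (1/\<sigma>)" and "v = b powr (1/\<sigma>)"
  have uv: "u > 0" "v > 0" using that by (auto simp: u_def v_def)
  have F: "?F a = unit_ball_vol ?n * u ^ DIM('a)" "?F b = unit_ball_vol ?n * v ^ DIM('a)"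
   using that uv by (simp_all add: u_def v_def powr_powr field_simps flip: powr_realpow)
  have M: "emeasure ?M {a<..b} = emeasure lborel {x::'a. a < norm x powr \<sigma> \<and> norm x powr \<sigma> \<le> b}"
   by (subst emeasure_distr) (auto simp: vimage_def)
  have sph: "norm x powr \<sigma> = t \<longleftrightarrow> norm x = t powr (1/\<sigma>)" if "t > 0" for x :: 'a and t
   using that \<sigma> by (auto simp: powr_powr)
  show ?thesis
  proof (cases "\<sigma> > 0")
   case True
   have le: "norm x powr \<sigma> \<le> t \<longleftrightarrow> norm x \<le> t powr (1/\<sigma>)" if "t > 0" for x :: 'a and t
   proof -
    have "t = (t powr (1/\<sigma>)) powr \<sigma>" using that \<sigma> by (simp add: powr_powr)
    then show ?thesis using True powr_le_cancel_iff[of "\<sigma>"]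
     by (metis norm_ge_zero powr_ge_zero powr_mono2 powr_less_mono2 linorder_not_le order.strict_implies_order)
   qed
   have "u \<le> v" using True that by (auto simp: u_def v_def intro!: powr_mono2)
   have "{x::'a. a < norm x powr \<sigma> \<and> norm x powr \<sigma> \<le> b} = cball 0 v - cball 0 u"
    using le[of a] le[of b] that by (auto simp: u_def v_def not_le[symmetric])
   also have "emeasure lborel \<dots> = emeasure lborel (cball 0 v :: 'a set) - emeasure lborel (cball 0 u :: 'a set)"
    using \<open>u \<le> v\<close> uv by (intro emeasure_Diff) (auto simp: emeasure_cball)
   also have "\<dots> = ennreal (?F b - ?F a)"
    unfolding F using uv by (simp add: emeasure_cball ennreal_minus)
   finally have "emeasure ?M {a<..b} = ennreal (?F b - ?F a)" using M by simp
   moreover have "?F a \<le> ?F b" unfolding F using \<open>u \<le> v\<close> uv by (simp add: mult_left_mono power_mono)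
   ultimately show ?thesis by simp
  next
   case False
   then have neg: "\<sigma> < 0" using \<sigma> by simp
   have less: "norm x powr \<sigma> < t \<longleftrightarrow> t powr (1/\<sigma>) < norm x" if "t > 0" "x \<noteq> 0" for x :: 'a and t
   proof -
    have "t = (t powr (1/\<sigma>)) powr \<sigma>" using that \<sigma> by (simp add: powr_powr)
    then show ?thesis using neg that
     by (metis powr_less_mono2_neg linorder_neqE_linordered_idom norm_ge_zero zero_less_norm_iff order.asym powr_gt_zero less_irrefl)
   qed
   have "v \<le> u" using neg that by (auto simp: u_def v_def intro!: powr_mono2')
   have iff: "a < norm x powr \<sigma> \<and> norm x powr \<sigma> \<le> b \<longleftrightarrow> x \<in> ball 0 u - ball 0 v" for x :: 'a
   proof (cases "x = 0")
    case True then show ?thesis using uv that by simp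
   next
    case False
    then show ?thesis using less[of b x] less[of a x] sph[of a x] sph[of b x] that
     by (simp add: u_def v_def, smt (verit))
   qed
   then have "{x::'a. a < norm x powr \<sigma> \<and> norm x powr \<sigma> \<le> b} = ball 0 u - ball 0 v"
    by blast
   also have "emeasure lborel \<dots> = emeasure lborel (ball 0 u :: 'a set) - emeasure lborel (ball 0 v :: 'a set)"
    using \<open>v \<le> u\<close> uv by (intro emeasure_Diff) (auto simp: emeasure_ball)
   also have "\<dots> = ennreal (?F a - ?F b)"
    unfolding F using uv by (simp add: emeasure_ball ennreal_minus)
   finally have "emeasure ?M {a<..b} = ennreal (?F a - ?F b)" using M by simp
   moreover have "?F b \<le> ?F a" unfolding F using \<open>v \<le> u\<close> uv by (simp add: mult_left_mono power_mono)
   ultimately show ?thesis by simp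
  qed
 qed
 \<comment> \<open>Since \<open>0 powr \<sigma> = 0\<close> for negative \<sigma> as well, only the
   origin is mapped to a number that is not positive.\<close>
 have Mneg: "emeasure ?M {a<..b} = 0" if "b \<le> 0" for a b
 proof -
  have "(\<lambda>x::'a. norm x powr \<sigma>) -` {a<..b} \<subseteq> {0}"
  proof
   fix x :: 'a assume "x \<in> (\<lambda>x. norm x powr \<sigma>) -` {a<..b}"
   then have "norm x powr \<sigma> \<le> b" by simp
   then have "norm x powr \<sigma> \<le> 0" using that by linarith
   then have "norm x powr \<sigma> = 0" using powr_ge_zero[of "norm x" \<sigma>] by linarith
   then show "x \<in> {0}" by simp
  qed
  then have "emeasure lborel ((\<lambda>x::'a. norm x powr \<sigma>) -` {a<..b}) \<le> emeasure lborel {0::'a}"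
   by (intro emeasure_mono) auto
  then show ?thesis by (subst emeasure_distr) auto
 qed
 show "emeasure ?M X = emeasure ?N X" if "X \<in> ?E" for X
 proof -
  from that obtain a b where X: "X = {a<..b}" and ab: "0 < a \<or> b \<le> 0" by auto
  consider "a > b" | "0 < a" "a \<le> b" | "b \<le> 0" using ab by linarith
  then show ?thesis
  proof cases
   case 2 then show ?thesis using Mpos Npos X by simp
  next
   case 3
   have "emeasure ?N X = 0" unfolding X using 3
    by (subst emeasure_density) (auto simp: nn_integral_0_iff_AE split: split_indicator)
   then show ?thesis using Mneg[OF 3] X by simp
  qed (simp add: X)
 qed
 \<comment> \<open>A countable cover by members of the generator, each of finite measure, as
   uniqueness of measures requires.\<close>
 let ?A = "range (\<lambda>i::nat. {- real i<..0}) \<union> range (\<lambda>i::nat. {1 / real (Suc i)<..real i})"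
 have "0 < 1 / real (Suc i)" for i by simp
 then show "?A \<subseteq> ?E" by blast
 show "\<Union> ?A = UNIV"
 proof safe
  fix x :: real
  show "x \<in> \<Union> ?A"
  proof (cases "x > 0")
   case True
   obtain i where i: "max x (1 / x) < real i" using reals_Archimedean2 by blast
   then have "1 / real (Suc i) < x" "x \<le> real i" using True by (auto simp: field_simps)
   then show ?thesis by auto
  next
   case False
   obtain i where i: "- x < real i" using reals_Archimedean2 by blast
   then show ?thesis using False by (intro UnionI[of "{- real i<..0}"]) auto
  qed
 qed auto
 show "countable ?A" by simp
 fix X assume "X \<in> ?A"
 then consider i where "X = {- real i<..0}" | i where "X = {1 / real (Suc i)<..real i}" by auto
 then show "emeasure ?M X \<noteq> \<infinity>"
 proof cases
  case 1
  then show ?thesis using Mneg[of 0] by simp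
 next
  case 2
  show ?thesis
  proof (cases "1 / real (Suc i) \<le> real i")
   case True
   then show ?thesis using Mpos[of "1 / real (Suc i)" "real i"] unfolding 2 by simp
  next
   case False
   then have "X = {}" unfolding 2 by auto
   then show ?thesis by simp
  qed
 qed
qed (auto simp: )

abbreviation Borel :: "('a::topological_space \<Rightarrow> 'b::topological_space) set" where
 "Borel \<equiv> borel_measurable borel"

abbreviation Lp_int :: "real \<Rightarrow> (real \<Rightarrow> real) \<Rightarrow> real" where
 "Lp_int p f \<equiv> LINT s|lborel. \<bar>f s\<bar> powr p"

abbreviation Lp_dist :: "real \<Rightarrow> (real \<Rightarrow> real) \<Rightarrow> (real \<Rightarrow> real) \<Rightarrow> real" where
 "Lp_dist p f g \<equiv> LINT s|lborel. \<bar>f s - g s\<bar> powr p"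

text \<open>With r = s powr (1 / \<sigma>) the polar density r powr (n - 1) dr turns into s powr (n
  / \<sigma> - 1) ds / |\<sigma>|.\<close>

lemma
 fixes f :: "real \<Rightarrow> real"
 assumes \<sigma>: "\<sigma> \<noteq> 0" and [measurable]: "f \<in> Borel"
 shows integrable_norm_powr_iff: "integrable lborel (\<lambda>x::'a::euclidean_space. f (norm x powr \<sigma>)) \<longleftrightarrow>
  integrable lborel (\<lambda>s. (s powr (DIM('a) / \<sigma> - 1) * indicator {0<..} s) * f s)" (is ?A)
 and integral_norm_powr: "(LINT (x::'a)|lborel. f (norm x powr \<sigma>)) =
  sphere_area TYPE('a) / \<bar>\<sigma>\<bar> * (LINT s|lborel. (s powr (DIM('a) / \<sigma> - 1) * indicator {0<..} s) * f s)" (is ?B)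
proof -
 define c where "c = sphere_area TYPE('a) / \<bar>\<sigma>\<bar>"
 define w where "w = (\<lambda>s. s powr (DIM('a) / \<sigma> - 1) * indicator {0<..} s :: real)"
 have cp: "c > 0" using sphere_area_pos[where 'a='a] \<sigma> by (simp add: c_def)
 have [measurable]: "w \<in> Borel" by (simp add: w_def)
 have "0 \<le> c * w s" for s using cp by (simp add: w_def)
 then have cw: "AE s in lborel. 0 \<le> c * w s" by simp
 have distr: "distr (lborel::'a measure) borel (\<lambda>x. norm x powr \<sigma>) = density lborel (\<lambda>s. ennreal (c * w s))"
  using distr_norm_powr[OF \<sigma>, where 'a='a] by (simp add: c_def w_def)
 have "integrable lborel (\<lambda>x::'a. f (norm x powr \<sigma>)) \<longleftrightarrow> integrable (distr (lborel::'a measure) borel (\<lambda>x. norm x powr \<sigma>)) f"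
  by (subst integrable_distr_eq) simp_all
 also have "\<dots> \<longleftrightarrow> integrable lborel (\<lambda>s. (c * w s) *\<^sub>R f s)"
  unfolding distr by (subst integrable_density[OF _ _ cw]) simp_all
 also have "\<dots> \<longleftrightarrow> integrable lborel (\<lambda>s. c * (w s * f s))"
  by (simp add: mult.assoc)
 also have "\<dots> \<longleftrightarrow> integrable lborel (\<lambda>s. w s * f s)"
  using cp by simp
 finally show ?A by (simp add: w_def)
 have "(LINT (x::'a)|lborel. f (norm x powr \<sigma>)) = integral\<^sup>L (distr (lborel::'a measure) borel (\<lambda>x. norm x powr \<sigma>)) f"
  by (subst integral_distr) simp_all
 also have "\<dots> = integral\<^sup>L lborel (\<lambda>s. (c * w s) *\<^sub>R f s)"
  unfolding distr by (subst integral_density[OF _ _ cw]) simp_all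
 also have "\<dots> = c * (LINT s|lborel. w s * f s)"
  by (simp add: mult.assoc)
 finally show ?B by (simp add: w_def c_def)
qed

subsection \<open>Convergence in the mean of order \<open>p\<close>\<close>

text \<open>Young's inequality with a small parameter and a crude constant: if t \<le> \<epsilon> a
  the first term suffices, otherwise a < t / \<epsilon> and the second one does. It makes the
  pairing of the power p - 1 of a fixed L^p function with an L^p-null sequence tend to 0.\<close>

lemma powr_mult_le_eps:
 fixes a t \<epsilon> p :: real
 assumes "1 < p" "0 \<le> a" "0 \<le> t" "0 < \<epsilon>"
 shows "a powr (p - 1) * t \<le> \<epsilon> * a powr p + \<epsilon> powr (1 - p) * t powr p"
proof -
 have powr_split: "y powr (p - 1) * y = y powr p" if "0 \<le> y" for y :: real
  using that assms by (cases "y = 0") (simp_all add: powr_diff)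
 show ?thesis
 proof (cases "t \<le> \<epsilon> * a")
  case True
  then have "a powr (p - 1) * t \<le> a powr (p - 1) * (\<epsilon> * a)" by (intro mult_left_mono) auto
  also have "\<dots> = \<epsilon> * a powr p" using powr_split[OF \<open>0 \<le> a\<close>] by (simp add: algebra_simps)
  finally show ?thesis using assms by (simp add: add_increasing2)
 next
  case False
  then have "a \<le> t / \<epsilon>" using assms by (simp add: field_simps)
  then have "a powr (p - 1) * t \<le> (t / \<epsilon>) powr (p - 1) * t"
   using assms by (intro mult_right_mono powr_mono2) auto
  also have "\<dots> = \<epsilon> powr (1 - p) * (t powr (p - 1) * t)"
   using assms by (simp add: powr_divide powr_minus_divide[of \<epsilon> "p - 1", simplified])
  also have "\<dots> = \<epsilon> powr (1 - p) * t powr p" using powr_split[OF \<open>0 \<le> t\<close>] by simp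
  finally show ?thesis using assms by (simp add: add_increasing)
 qed
qed

text \<open>The factor is harmless where only finiteness or convergence to 0 is at stake;
  \<open>powr_add_le_eps\<close> serves where the constant matters.\<close>

lemma powr_add_le:
 fixes a b p :: real
 assumes "0 \<le> p"
 shows "\<bar>a + b\<bar> powr p \<le> 2 powr p * (\<bar>a\<bar> powr p + \<bar>b\<bar> powr p)"
proof -
 have "\<bar>a + b\<bar> powr p \<le> (2 * max \<bar>a\<bar> \<bar>b\<bar>) powr p"
  using assms by (intro powr_mono2) auto
 also have "\<dots> = 2 powr p * max \<bar>a\<bar> \<bar>b\<bar> powr p"
  by (subst powr_mult) auto
 also have "\<dots> \<le> 2 powr p * (\<bar>a\<bar> powr p + \<bar>b\<bar> powr p)"
  by (intro mult_left_mono) (auto simp: max_def)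
 finally show ?thesis .
qed

lemma nn_integral_Fatou_bound:
 fixes u :: "nat \<Rightarrow> 'a \<Rightarrow> ennreal"
 assumes [measurable]: "\<And>i. u i \<in> borel_measurable M"
  and lim: "AE x in M. (\<lambda>i. u i x) \<longlonglongrightarrow> v x"
  and bd: "\<And>i. i \<ge> N \<Longrightarrow> (\<integral>\<^sup>+x. u i x \<partial>M) \<le> B"
 shows "(\<integral>\<^sup>+x. v x \<partial>M) \<le> B"
proof -
 have "(\<integral>\<^sup>+x. v x \<partial>M) = (\<integral>\<^sup>+x. liminf (\<lambda>i. u i x) \<partial>M)"
  using lim by (intro nn_integral_cong_AE) (auto elim!: eventually_mono dest: lim_imp_Liminf[rotated])
 also have "\<dots> \<le> liminf (\<lambda>i. \<integral>\<^sup>+x. u i x \<partial>M)" by (rule nn_integral_liminf) simp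
 also have "\<dots> \<le> limsup (\<lambda>i. \<integral>\<^sup>+x. u i x \<partial>M)" by (rule Liminf_le_Limsup) simp
 also have "\<dots> \<le> B" using bd by (intro Limsup_bounded) (auto simp: eventually_sequentially)
 finally show ?thesis .
qed

lemma summable_geometric_bound_imp_convergent:
 fixes f :: "nat \<Rightarrow> real"
 assumes "\<And>i. \<bar>f (Suc i) - f i\<bar> \<le> C * (1 / 2) ^ i"
 shows "convergent f"
proof -
 have "summable (\<lambda>i. C * (1 / 2) ^ i :: real)" by (intro summable_mult summable_geometric) simp
 then have "summable (\<lambda>i. f (Suc i) - f i)"
  by (rule summable_comparison_test'[where N = 0]) (use assms in auto)
 then have "convergent (\<lambda>n. \<Sum>i<n. f (Suc i) - f i)" by (simp add: summable_iff_convergent)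
 then have "convergent (\<lambda>n. (f n - f 0) + f 0)"
  by (intro convergent_add) (simp_all add: sum_lessThan_telescope convergent_const)
 then show ?thesis by simp
qed

text \<open>Along a subsequence whose increments have p-th power integrals at most
  \<open>e i\<close>, a weighted series T of p-th powers has finite integral. Wherever T is finite,
  each increment is bounded by a geometric sequence, so the subsequence converges. Fatou's lemma
  then compares the whole sequence with the limit.\<close>

lemma Riesz_Fischer:
 fixes f :: "nat \<Rightarrow> 'a \<Rightarrow> real"
 assumes p: "0 < p" and [measurable]: "\<And>i. f i \<in> borel_measurable M"
  and cauchy: "\<And>e. 0 < e \<Longrightarrow> \<exists>N. \<forall>j\<ge>N. \<forall>k\<ge>N. (\<integral>\<^sup>+x. ennreal (\<bar>f j x - f k x\<bar> powr p) \<partial>M) \<le> ennreal e"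
 obtains g where "g \<in> borel_measurable M" "(\<lambda>j. \<integral>\<^sup>+x. ennreal (\<bar>f j x - g x\<bar> powr p) \<partial>M) \<longlonglongrightarrow> 0"
proof -
 \<comment> \<open>The factor \<open>2 powr - (p * i)\<close> cancels the weight in T; the remaining
   \<open>(1 / 2) ^ i\<close> is summable.\<close>
 define e where "e = (\<lambda>i::nat. (1 / 2) ^ i * (2 powr - (p * i)) :: real)"
 have e_pos: "e i > 0" for i by (simp add: e_def)
 have "\<forall>i. \<exists>N. \<forall>j\<ge>N. \<forall>k\<ge>N. (\<integral>\<^sup>+x. ennreal (\<bar>f j x - f k x\<bar> powr p) \<partial>M) \<le> ennreal (e i)"
  using cauchy[OF e_pos] by blast
 then obtain N where N: "\<And>i j k. j \<ge> N i \<Longrightarrow> k \<ge> N i \<Longrightarrow> (\<integral>\<^sup>+x. ennreal (\<bar>f j x - f k x\<bar> powr p) \<partial>M) \<le> ennreal (e i)"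
  by metis
 define r where "r = rec_nat (N 0) (\<lambda>i m. max (Suc m) (N (Suc i)))"
 have r_Suc: "r (Suc i) = max (Suc (r i)) (N (Suc i))" for i by (simp add: r_def)
 have rN: "r i \<ge> N i" for i by (cases i) (simp_all add: r_def)
 have r_mono: "strict_mono r" unfolding strict_mono_Suc_iff by (simp add: r_Suc less_max_iff_disj)
 define a where "a = (\<lambda>i x. \<bar>f (r (Suc i)) x - f (r i) x\<bar>)"
 have [measurable]: "a i \<in> borel_measurable M" for i by (simp add: a_def)
 have a_int: "(\<integral>\<^sup>+x. ennreal (2 powr (p * i) * a i x powr p) \<partial>M) \<le> ennreal ((1 / 2) ^ i)" for i
 proof -
  have "(\<integral>\<^sup>+x. ennreal (2 powr (p * i) * a i x powr p) \<partial>M) = ennreal (2 powr (p * i)) * (\<integral>\<^sup>+x. ennreal (a i x powr p) \<partial>M)"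
   by (subst nn_integral_cmult[symmetric]) (auto simp: ennreal_mult)
  also have "\<dots> \<le> ennreal (2 powr (p * i)) * ennreal (e i)"
   unfolding a_def using rN[of i] r_mono
   by (intro mult_left_mono N) (auto simp: strict_mono_less_eq intro: order_trans[OF rN[of i]])
  also have "\<dots> = ennreal ((1 / 2) ^ i)"
   by (subst ennreal_mult[symmetric]) (auto simp: e_def powr_minus field_simps)
  finally show ?thesis .
 qed
 define T where "T = (\<lambda>x. \<Sum>i. ennreal (2 powr (p * i) * a i x powr p))"
 have [measurable]: "T \<in> borel_measurable M" unfolding T_def by (intro borel_measurable_suminf_order) simp
 have "(\<integral>\<^sup>+x. T x \<partial>M) = (\<Sum>i. \<integral>\<^sup>+x. ennreal (2 powr (p * i) * a i x powr p) \<partial>M)"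
  unfolding T_def by (rule nn_integral_suminf) simp
 also have "\<dots> \<le> (\<Sum>i. ennreal ((1 / 2) ^ i))"
  by (intro suminf_le a_int) auto
 also have "\<dots> = ennreal (\<Sum>i. (1 / 2) ^ i)"
  by (intro suminf_ennreal2) auto
 also have "\<dots> < \<infinity>" by simp
 finally have "(\<integral>\<^sup>+x. T x \<partial>M) \<noteq> \<infinity>" by simp
 then have "AE x in M. T x \<noteq> \<infinity>"
  by (intro nn_integral_noteq_infinite) simp_all
 then have conv: "AE x in M. convergent (\<lambda>i. f (r i) x)"
 proof eventually_elim
  fix x assume "T x \<noteq> \<infinity>"
  then obtain C where C: "T x = ennreal C" "C \<ge> 0"
   by (cases "T x") auto
  have le: "a i x \<le> C powr (1 / p) * (1 / 2) ^ i" for i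
  proof -
   have "ennreal (2 powr (p * i) * a i x powr p) \<le> T x"
    unfolding T_def by (intro sum_le_suminf[where I = "{i}", simplified]) auto
   then have "2 powr (p * i) * a i x powr p \<le> C" using C by simp
   moreover have "2 powr (p * i) * a i x powr p = (2 ^ i * a i x) powr p"
    by (simp add: powr_mult powr_powr a_def mult.commute flip: powr_realpow)
   ultimately have "((2 ^ i * a i x) powr p) powr (1 / p) \<le> C powr (1 / p)"
    using p by (intro powr_mono2) auto
   then have "2 ^ i * a i x \<le> C powr (1 / p)"
    using p by (simp add: powr_powr a_def)
   then show ?thesis by (simp add: field_simps power_one_over)
  qed
  show "convergent (\<lambda>i. f (r i) x)"
   using le by (intro summable_geometric_bound_imp_convergent[where C = "C powr (1 / p)"]) (auto simp: a_def)
 qed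
 define g where "g = (\<lambda>x. lim (\<lambda>i. f (r i) x))"
 have g_meas: "g \<in> borel_measurable M" unfolding g_def by (intro borel_measurable_lim_metric) auto
 have lim: "AE x in M. (\<lambda>i. f (r i) x) \<longlonglongrightarrow> g x"
  using conv by eventually_elim (simp add: g_def convergent_LIMSEQ_iff)
 have bound: "(\<integral>\<^sup>+x. ennreal (\<bar>f j x - g x\<bar> powr p) \<partial>M) \<le> ennreal (e i)" if "j \<ge> N i" for i j
 proof (rule nn_integral_Fatou_bound[where N = i and u = "\<lambda>k x. ennreal (\<bar>f j x - f (r k) x\<bar> powr p)"])
  show "AE x in M. (\<lambda>k. ennreal (\<bar>f j x - f (r k) x\<bar> powr p)) \<longlonglongrightarrow> ennreal (\<bar>f j x - g x\<bar> powr p)"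
   using lim by eventually_elim (use p in \<open>auto intro!: tendsto_intros tendsto_powr2\<close>)
  fix k assume "k \<ge> i"
  then have "r i \<le> r k" using r_mono by (simp add: strict_mono_less_eq)
  then show "(\<integral>\<^sup>+x. ennreal (\<bar>f j x - f (r k) x\<bar> powr p) \<partial>M) \<le> ennreal (e i)"
   using that rN[of i] by (intro N) auto
 qed simp
 have e_lim: "e \<longlonglongrightarrow> 0"
 proof (rule tendsto_sandwich[OF _ _ tendsto_const])
  show "\<forall>\<^sub>F i in sequentially. e i \<le> (1 / 2) ^ i"
  proof (intro always_eventually allI)
   fix i :: nat
   have "(2::real) powr - (p * i) \<le> 2 powr 0" using p by (intro powr_mono) auto
   then show "e i \<le> (1 / 2) ^ i" unfolding e_def by (intro mult_left_le) auto
  qed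
 qed (use e_pos in \<open>auto intro!: always_eventually LIMSEQ_realpow_zero simp: less_imp_le\<close>)
 have "(\<lambda>j. \<integral>\<^sup>+x. ennreal (\<bar>f j x - g x\<bar> powr p) \<partial>M) \<longlonglongrightarrow> 0"
 proof (rule order_tendstoI)
  fix z :: ennreal assume z: "0 < z"
  have "(\<lambda>i. ennreal (e i)) \<longlonglongrightarrow> ennreal 0" using e_lim by (intro tendsto_intros)
  then have "eventually (\<lambda>i. ennreal (e i) < z) sequentially" using z by (auto dest: order_tendstoD)
  then obtain i where "ennreal (e i) < z" by (auto simp: eventually_sequentially)
  then show "\<forall>\<^sub>F j in sequentially. (\<integral>\<^sup>+x. ennreal (\<bar>f j x - g x\<bar> powr p) \<partial>M) < z"
   unfolding eventually_sequentially using le_less_trans[OF bound[of i]] by blast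
 qed auto
 with g_meas that show thesis by blast
qed

lemma integrable_powr_triangle:
 fixes f g :: "'a \<Rightarrow> real"
 assumes "0 \<le> p" and [measurable]: "f \<in> borel_measurable M" "g \<in> borel_measurable M"
  and "integrable M (\<lambda>x. \<bar>f x\<bar> powr p)" "(\<integral>\<^sup>+x. ennreal (\<bar>f x - g x\<bar> powr p) \<partial>M) < \<infinity>"
 shows "integrable M (\<lambda>x. \<bar>g x\<bar> powr p)"
proof (rule Bochner_Integration.integrable_bound)
 have "integrable M (\<lambda>x. \<bar>f x - g x\<bar> powr p)"
  using assms by (intro integrableI_nonneg) auto
 then show "integrable M (\<lambda>x. 2 powr p * (\<bar>f x\<bar> powr p + \<bar>f x - g x\<bar> powr p))"
  using assms by auto
 have "\<bar>g x\<bar> powr p \<le> 2 powr p * (\<bar>f x\<bar> powr p + \<bar>f x - g x\<bar> powr p)" for x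
  using powr_add_le[OF \<open>0 \<le> p\<close>, of "f x" "g x - f x"] by (simp add: abs_minus_commute)
 then show "AE x in M. norm (\<bar>g x\<bar> powr p) \<le> norm (2 powr p * (\<bar>f x\<bar> powr p + \<bar>f x - g x\<bar> powr p))"
  by (auto intro!: AE_I2)
qed simp

text \<open>Hoelder's inequality against the constant 1: the pointwise inequality
  \<open>young\<close> with a free parameter c is integrated, and c is optimised afterwards.\<close>

lemma integral_Icc_le_powr:
 fixes f :: "real \<Rightarrow> real"
 assumes p: "1 < p" and [measurable]: "f \<in> Borel" and s: "0 < s"
  and int: "set_integrable lborel {0..s} (\<lambda>t. \<bar>f t\<bar> powr p)"
 shows "set_integrable lborel {0..s} f"
  and "\<bar>LINT t:{0..s}|lborel. f t\<bar> \<le> s powr ((p - 1) / p) * (LINT t:{0..s}|lborel. \<bar>f t\<bar> powr p) powr (1 / p)"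
proof -
 have young: "t \<le> c * ((p - 1) / p) + t powr p * (c powr (1 - p) / p)" if "0 \<le> t" "0 < c" for t c :: real
 proof -
  have "(t / c) * 1 \<le> (t / c) powr p / p + 1 powr (p / (p - 1)) / (p / (p - 1))"
   using p that by (intro Youngs_inequality) (auto simp: field_simps)
  then have "c * (t / c) \<le> c * ((t / c) powr p / p + 1 / (p / (p - 1)))"
   using that by (intro mult_left_mono) auto
  then show ?thesis using that p by (simp add: powr_divide powr_diff field_simps)
 qed
 let ?A = "LINT t:{0..s}|lborel. \<bar>f t\<bar> powr p"
 have c_int: "set_integrable lborel {0..s} (\<lambda>_. c)" for c :: real
  using s by (simp add: set_integrable_def integrable_indicator_iff)
 have bint: "set_integrable lborel {0..s} (\<lambda>t. c * ((p - 1) / p) + \<bar>f t\<bar> powr p * (c powr (1 - p) / p))" for c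
  by (intro set_integral_add c_int set_integrable_mult_left) (use int in auto)
 show fint: "set_integrable lborel {0..s} f"
  by (rule set_integrable_bound[OF bint[of 1]]) (use young[of _ 1] in \<open>auto simp: set_borel_measurable_def intro!: AE_I2 order_trans[OF _ abs_ge_self]\<close>)
 have le: "\<bar>LINT t:{0..s}|lborel. f t\<bar> \<le> s * c * ((p - 1) / p) + ?A * (c powr (1 - p) / p)" if "0 < c" for c
 proof -
  have "\<bar>LINT t:{0..s}|lborel. f t\<bar> \<le> (LINT t:{0..s}|lborel. \<bar>f t\<bar>)"
   using integral_abs_bound[of lborel "\<lambda>t. indicator {0..s} t *\<^sub>R f t"] by (simp add: set_lebesgue_integral_def abs_mult)
  also have "\<dots> \<le> (LINT t:{0..s}|lborel. c * ((p - 1) / p) + \<bar>f t\<bar> powr p * (c powr (1 - p) / p))"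
   using young[OF _ that] by (intro set_integral_mono set_integrable_abs fint bint) auto
  also have "\<dots> = (LINT t:{0..s}|lborel. c * ((p - 1) / p)) + (LINT t:{0..s}|lborel. \<bar>f t\<bar> powr p * (c powr (1 - p) / p))"
   by (intro set_integral_add c_int set_integrable_mult_left) (use int in auto)
  also have "\<dots> = s * c * ((p - 1) / p) + ?A * (c powr (1 - p) / p)"
   using s by (simp add: set_lebesgue_integral_def)
  finally show ?thesis .
 qed
 have A0: "?A \<ge> 0" by (simp add: set_lebesgue_integral_def)
 \<comment> \<open>At the optimal c, \<open>a * c powr (1 - p)\<close> equals s * c, so the two
   terms add up to s * c.\<close>
 have split: "s * c * ((p - 1) / p) + a * (c powr (1 - p) / p) = s powr ((p - 1) / p) * a powr (1 / p)"
  if "c = (a / s) powr (1 / p)" "a > 0" for a c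
 proof -
  have "c powr (1 - p) = (a / s) powr (1 / p) / (a / s)"
   using that p s by (simp add: powr_powr diff_divide_distrib powr_diff)
  then have "a * (c powr (1 - p) / p) = s * c / p" using that s by (simp add: field_simps)
  moreover have "s * c = s powr ((p - 1) / p) * a powr (1 / p)"
   using that s p by (simp add: powr_divide diff_divide_distrib powr_diff)
  ultimately show ?thesis using p by (simp add: field_simps)
 qed
 show "\<bar>LINT t:{0..s}|lborel. f t\<bar> \<le> s powr ((p - 1) / p) * ?A powr (1 / p)"
 proof (cases "?A = 0")
  case False
  then show ?thesis using le[of "(?A / s) powr (1 / p)"] split[OF refl, of ?A] A0 s by simp
 next
  case True
  define k where "k = (p - 1) / p"
  have k: "0 < k" using p by (simp add: k_def)
  \<comment> \<open>With a vanishing p-integral there is no optimal c; the bound is s * c * k and c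
    is sent to 0.\<close>
  have "\<bar>LINT t:{0..s}|lborel. f t\<bar> \<le> e" if "e > 0" for e
   using le[of "e / (s * k)"] that s k True by (simp flip: k_def)
  then have "\<bar>LINT t:{0..s}|lborel. f t\<bar> \<le> 0" by (meson dense_ge)
  then show ?thesis by simp
 qed
qed

subsection \<open>Functions of class \<open>C\<^sup>k\<close>\<close>

lemma partial_deriv_eq: "(f has_derivative f') (at x) \<Longrightarrow> partial_deriv b f x = f' b"
 unfolding partial_deriv_def by (simp add: frechet_derivative_at[symmetric])

lemma has_real_derivative_line:
 fixes f :: "'a::euclidean_space \<Rightarrow> real"
 assumes "f differentiable (at (x + t *\<^sub>R b))"
 shows "DERIV (\<lambda>t. f (x + t *\<^sub>R b)) t :> partial_deriv b f (x + t *\<^sub>R b)"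
proof -
 let ?D = "frechet_derivative f (at (x + t *\<^sub>R b))"
 have D: "(f has_derivative ?D) (at (x + t *\<^sub>R b))"
  using assms frechet_derivative_works by blast
 have "((\<lambda>t. x + t *\<^sub>R b) has_derivative (\<lambda>h. h *\<^sub>R b)) (at t)"
  by (auto intro!: derivative_eq_intros)
 from has_derivative_compose[OF this D]
 have "((\<lambda>t. f (x + t *\<^sub>R b)) has_derivative (\<lambda>h. ?D (h *\<^sub>R b))) (at t)" .
 moreover have "?D (h *\<^sub>R b) = partial_deriv b f (x + t *\<^sub>R b) * h" for h
  using linear_scale[OF has_derivative_linear[OF D]] by (simp add: partial_deriv_def)
 ultimately show ?thesis unfolding has_field_derivative_def by simp
qed

lemma partial_deriv_cong_open:
 assumes "open S" "x \<in> S" "\<And>y. y \<in> S \<Longrightarrow> f y = g y"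
 shows "partial_deriv b f x = partial_deriv b g x"
proof -
 have "(f has_derivative D) (at x) \<longleftrightarrow> (g has_derivative D) (at x)" for D
  using has_derivative_transform_within_open[OF _ assms(1,2), of f D UNIV g]
   has_derivative_transform_within_open[OF _ assms(1,2), of g D UNIV f] assms(3) by auto
 then show ?thesis by (simp add: partial_deriv_def frechet_derivative_def)
qed

lemma Ck_continuous: "Ck k f \<Longrightarrow> continuous_on UNIV f"
 by (cases k) (auto intro!: continuous_at_imp_continuous_on differentiable_imp_continuous_within)

lemma Ck_SucD: "Ck (Suc k) f \<Longrightarrow> Ck k f"
proof (induction k arbitrary: f)
 case 0 then show ?case by (metis Ck.simps(1) Ck_continuous)
next
 case (Suc k) then show ?case by (metis Ck.simps(2))
qed

lemma Ck_const: "Ck k (\<lambda>_. c)"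
proof (induction k arbitrary: c)
 case (Suc k)
 have "partial_deriv b (\<lambda>_::'a. c) = (\<lambda>_. 0)" for b by (rule ext, rule partial_deriv_eq) auto
 then show ?case using Suc by simp
qed simp

lemma Ck_inner: "Ck k (\<lambda>x. x \<bullet> c)"
proof (cases k)
 case (Suc k')
 have "partial_deriv b (\<lambda>x. x \<bullet> c) = (\<lambda>_. b \<bullet> c)" for b
  by (rule ext, rule partial_deriv_eq) (auto intro!: derivative_eq_intros)
 then show ?thesis using Suc by (auto simp: Ck_const intro!: derivative_intros)
qed (auto intro!: continuous_intros)

lemma partial_deriv_add:
 assumes "f differentiable (at x)" "g differentiable (at x)"
 shows "partial_deriv b (\<lambda>x. f x + g x) x = partial_deriv b f x + partial_deriv b g x"
 using has_derivative_add[OF assms[unfolded frechet_derivative_works]]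
 by (subst partial_deriv_eq) (auto simp: partial_deriv_def)

lemma partial_deriv_mult:
 fixes f g :: "'a::euclidean_space \<Rightarrow> real"
 assumes "f differentiable (at x)" "g differentiable (at x)"
 shows "partial_deriv b (\<lambda>x. f x * g x) x = f x * partial_deriv b g x + partial_deriv b f x * g x"
 using has_derivative_mult[OF assms[unfolded frechet_derivative_works]]
 by (subst partial_deriv_eq) (auto simp: partial_deriv_def)

lemma partial_deriv_compose:
 fixes f :: "'a::euclidean_space \<Rightarrow> real"
 assumes "f differentiable (at x)" "DERIV \<eta> (f x) :> \<eta>'"
 shows "partial_deriv b (\<lambda>x. \<eta> (f x)) x = \<eta>' * partial_deriv b f x"
 using has_derivative_compose[OF assms(1)[unfolded frechet_derivative_works] assms(2)[unfolded has_field_derivative_def]]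
 by (subst partial_deriv_eq) (auto simp: partial_deriv_def)

lemma Ck_add: "Ck k f \<Longrightarrow> Ck k g \<Longrightarrow> Ck k (\<lambda>x. f x + g x)"
proof (induction k arbitrary: f g)
 case (Suc k)
 then have "partial_deriv b (\<lambda>x. f x + g x) = (\<lambda>x. partial_deriv b f x + partial_deriv b g x)" for b
  by (intro ext partial_deriv_add) auto
 then show ?case using Suc by (auto intro: differentiable_add)
qed (auto intro: continuous_intros)

lemma Ck_mult: "Ck k f \<Longrightarrow> Ck k g \<Longrightarrow> Ck k (\<lambda>x. f x * g x)"
proof (induction k arbitrary: f g)
 case (Suc k)
 then have "partial_deriv b (\<lambda>x. f x * g x) = (\<lambda>x. f x * partial_deriv b g x + partial_deriv b f x * g x)" for b
  by (intro ext partial_deriv_mult) auto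
 then show ?case using Suc Suc.prems[THEN Ck_SucD] by (auto intro!: Ck_add Suc.IH differentiable_mult)
qed (auto intro: continuous_intros)

lemma Ck_uminus: "Ck k f \<Longrightarrow> Ck k (\<lambda>x. - f x)"
 using Ck_mult[OF Ck_const[of k "-1"], of f] by simp

lemma Ck_diff: "Ck k f \<Longrightarrow> Ck k g \<Longrightarrow> Ck k (\<lambda>x. f x - g x)"
 using Ck_add[of k f "\<lambda>x. - g x"] Ck_uminus[of k g] by simp

lemma Ck_power: "Ck k f \<Longrightarrow> Ck k (\<lambda>x. f x ^ n)"
 by (induction n) (auto intro: Ck_const Ck_mult)

lemma Ck_sum: "finite A \<Longrightarrow> (\<And>i. i \<in> A \<Longrightarrow> Ck k (f i)) \<Longrightarrow> Ck k (\<lambda>x. \<Sum>i\<in>A. f i x)"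
 by (induction A rule: finite_induct) (auto intro: Ck_const Ck_add)

lemma Ck_prod: "finite A \<Longrightarrow> (\<And>i. i \<in> A \<Longrightarrow> Ck k (f i)) \<Longrightarrow> Ck k (\<lambda>x. \<Prod>i\<in>A. f i x)"
 by (induction A rule: finite_induct) (auto intro: Ck_const Ck_mult)

lemma partial_deriv_real: "DERIV f x :> D \<Longrightarrow> partial_deriv b f x = D * b"
 unfolding has_field_derivative_def by (rule partial_deriv_eq)

lemma Ck_Suc_real:
 assumes "\<And>x. DERIV \<eta> x :> \<eta>' x"
 shows "Ck (Suc k) \<eta> \<longleftrightarrow> Ck k \<eta>'"
proof -
 have "partial_deriv 1 \<eta> = \<eta>'" using partial_deriv_real[OF assms] by auto
 moreover have "\<eta> differentiable (at x)" for x
  using assms[of x] unfolding has_field_derivative_def differentiable_def by blast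
 ultimately show ?thesis by simp
qed

lemma Ck_compose: "Ck k (\<eta>::real \<Rightarrow> real) \<Longrightarrow> Ck k f \<Longrightarrow> Ck k (\<lambda>x. \<eta> (f x))"
proof (induction k arbitrary: \<eta> f)
 case 0 then show ?case by (auto intro: continuous_on_compose2)
next
 case (Suc k)
 have "DERIV \<eta> y :> partial_deriv 1 \<eta> y" for y
  using has_real_derivative_line[of \<eta> 0 y 1] Suc.prems(1) by simp
 then have "partial_deriv b (\<lambda>x. \<eta> (f x)) = (\<lambda>x. partial_deriv 1 \<eta> (f x) * partial_deriv b f x)" for b
  using Suc.prems(2) by (intro ext partial_deriv_compose) auto
 moreover have "(\<lambda>x. \<eta> (f x)) differentiable (at x)" for x
 proof -
  have "f differentiable (at x)" "\<eta> differentiable (at (f x))" using Suc.prems by auto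
  from differentiable_chain_at[OF this] show ?thesis by (simp add: o_def)
 qed
 ultimately show ?case
  using Suc Suc.prems(2)[THEN Ck_SucD] by (auto intro!: Ck_mult)
qed

lemma max_power_has_real_derivative:
 "DERIV (\<lambda>t. max 0 t ^ Suc (Suc n)) t :> real (Suc (Suc n)) * max 0 t ^ Suc n"
proof -
 consider "t < 0" | "t > 0" | "t = 0" by linarith
 then show ?thesis
 proof cases
  case 1
  have "DERIV (\<lambda>t. max 0 t ^ Suc (Suc n)) t :> 0"
   by (rule has_field_derivative_transform_within[where f = "\<lambda>_. 0" and d = "- t"])
    (use 1 in \<open>auto simp: dist_real_def max_def\<close>)
  then show ?thesis using 1 by (simp add: max_def)
 next
  case 2
  have "DERIV (\<lambda>t. t ^ Suc (Suc n)) t :> real (Suc (Suc n)) * t ^ Suc n"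
   using DERIV_pow[of "Suc (Suc n)" t] by simp
  then have "DERIV (\<lambda>t. max 0 t ^ Suc (Suc n)) t :> real (Suc (Suc n)) * t ^ Suc n"
   by (rule has_field_derivative_transform_within[where d = t]) (use 2 in \<open>auto simp: dist_real_def max_def\<close>)
  then show ?thesis using 2 by (simp add: max_def)
 next
  case 3
  have "(\<lambda>h::real. max 0 h ^ Suc (Suc n) / h) \<midarrow>0\<rightarrow> 0"
  proof (rule Lim_null_comparison)
   show "\<forall>\<^sub>F h in at (0::real). norm (max 0 h ^ Suc (Suc n) / h) \<le> \<bar>h\<bar> ^ Suc n"
   proof (intro always_eventually allI)
    fix h :: real
    show "norm (max 0 h ^ Suc (Suc n) / h) \<le> \<bar>h\<bar> ^ Suc n"
    proof (cases "h \<le> 0")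
     case True
     then have "max 0 h ^ Suc (Suc n) / h = 0" by (simp add: max_absorb1)
     then show ?thesis using zero_le_power[of "\<bar>h\<bar>" "Suc n"] by (simp only: norm_zero abs_ge_zero)
    qed (simp add: max_absorb2)
   qed
   show "(\<lambda>h::real. \<bar>h\<bar> ^ Suc n) \<midarrow>0\<rightarrow> 0" by (auto intro!: tendsto_eq_intros)
  qed
  then show ?thesis using 3 by (simp add: has_field_derivative_iff)
 qed
qed

text \<open>Cubes of positive parts are of class C^2 and vanish on a half-line, which makes them the
  factors of the bumps in \<open>box_bump\<close>.\<close>

lemma Ck_2_max_cube: "Ck 2 (\<lambda>t::real. max 0 t ^ 3)"
proof -
 have 2: "DERIV (\<lambda>t. 3 * max 0 t ^ 2) t :> 6 * max 0 t" for t :: real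
  using DERIV_cmult[OF max_power_has_real_derivative[of 0 t], of 3] by (simp add: numeral_2_eq_2)
 have 3: "DERIV (\<lambda>t. max 0 t ^ 3) t :> 3 * max 0 t ^ 2" for t :: real
  using max_power_has_real_derivative[of 1 t] by (simp add: eval_nat_numeral)
 have "Ck 0 (\<lambda>t::real. 6 * max 0 t)" by (auto intro!: continuous_intros)
 then have "Ck (Suc 0) (\<lambda>t::real. 3 * max 0 t ^ 2)" using Ck_Suc_real[OF 2] by blast
 then show ?thesis using Ck_Suc_real[OF 3, of "Suc 0"] numeral_2_eq_2 by metis
qed

lemma CkcI:
 assumes "Ck k f" "compact K" "0 \<notin> K" "\<And>x. x \<notin> K \<Longrightarrow> f x = 0"
 shows "f \<in> Ckc k"
proof -
 have "{x. f x \<noteq> 0} \<subseteq> K" using assms(4) by auto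
 then have "closure {x. f x \<noteq> 0} \<subseteq> K" using assms(2) by (simp add: closure_minimal compact_imp_closed)
 then have "compact (closure {x. f x \<noteq> 0})"
  using assms(2) compact_Int_closed[of K "closure {x. f x \<noteq> 0}"] by (simp add: Int_absorb1)
 then show ?thesis using assms \<open>closure _ \<subseteq> K\<close> by (auto simp: Ckc_def)
qed

lemma CkcE:
 assumes "f \<in> Ckc k"
 obtains K where "Ck k f" "compact K" "0 \<notin> K" "\<And>x. x \<notin> K \<Longrightarrow> f x = 0"
proof (rule that[of "closure {x. f x \<noteq> 0}"])
 show "f x = 0" if "x \<notin> closure {x. f x \<noteq> 0}" for x
  using that closure_subset[of "{x. f x \<noteq> 0}"] by blast
qed (use assms in \<open>auto simp: Ckc_def\<close>)

lemma CkcD: "f \<in> Ckc k \<Longrightarrow> Ck k f"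
 by (simp add: Ckc_def)

lemma Ckc_SucD: "f \<in> Ckc (Suc k) \<Longrightarrow> f \<in> Ckc k"
 using Ck_SucD by (auto simp: Ckc_def)

lemma Ckc_2D: "f \<in> Ckc 2 \<Longrightarrow> f \<in> Ckc 1"
 using Ckc_SucD[of f 1] by (simp add: numeral_2_eq_2)

lemma Ckc_mult: "f \<in> Ckc k \<Longrightarrow> Ck k g \<Longrightarrow> (\<lambda>x. f x * g x) \<in> Ckc k"
 by (erule CkcE, rule CkcI) (auto intro: Ck_mult)

lemma Ckc_partial_deriv:
 assumes "f \<in> Ckc (Suc k)" "b \<in> Basis"
 shows "partial_deriv b f \<in> Ckc k"
proof -
 obtain K where K: "Ck (Suc k) f" "compact K" "0 \<notin> K" "\<And>x. x \<notin> K \<Longrightarrow> f x = 0"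
  using assms by (auto elim: CkcE)
 have "partial_deriv b f x = 0" if "x \<notin> K" for x
 proof -
  have "partial_deriv b f x = partial_deriv b (\<lambda>_. 0) x"
   by (rule partial_deriv_cong_open[of "- K"]) (use K that in \<open>auto intro: compact_imp_closed\<close>)
  also have "\<dots> = 0" by (rule partial_deriv_eq) auto
  finally show ?thesis .
 qed
 then show ?thesis using K assms(2) by (intro CkcI[of _ _ K]) auto
qed

lemma Ckc_laplacian: "f \<in> Ckc 2 \<Longrightarrow> laplacian f \<in> Ckc 0"
proof -
 assume f: "f \<in> Ckc 2"
 obtain K where K: "compact K" "0 \<notin> K" "\<And>x. x \<notin> K \<Longrightarrow> f x = 0"
  using f by (auto elim: CkcE)
 have pp: "partial_deriv b (partial_deriv b f) \<in> Ckc 0" if "b \<in> Basis" for b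
  using f that by (intro Ckc_partial_deriv) (auto simp: numeral_2_eq_2)
 let ?L = "\<Union>b\<in>Basis. closure {x. partial_deriv b (partial_deriv b f) x \<noteq> 0}"
 show ?thesis
 proof (rule CkcI)
  show "Ck 0 (laplacian f)"
   unfolding laplacian_def by (intro Ck_sum) (use pp in \<open>auto simp: Ckc_def\<close>)
  show "compact ?L" "0 \<notin> ?L" using pp by (auto simp: Ckc_def)
  fix x assume "x \<notin> ?L"
  then show "laplacian f x = 0"
   unfolding laplacian_def
  proof (intro sum.neutral ballI)
   fix b :: 'a assume "b \<in> Basis"
   then have "x \<notin> closure {x. partial_deriv b (partial_deriv b f) x \<noteq> 0}" using \<open>x \<notin> ?L\<close> by blast
   then show "partial_deriv b (partial_deriv b f) x = 0"
    using closure_subset[of "{x. partial_deriv b (partial_deriv b f) x \<noteq> 0}"] by blast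
  qed
 qed
qed

lemma Ckc_bounded:
 assumes "f \<in> Ckc k"
 obtains M where "\<And>x. \<bar>f x\<bar> \<le> M" "0 \<le> M"
proof -
 obtain K where K: "Ck k f" "compact K" "\<And>x. x \<notin> K \<Longrightarrow> f x = 0"
  using assms by (auto elim: CkcE)
 have "bounded (f ` K)"
  by (intro compact_imp_bounded compact_continuous_image continuous_on_subset[OF Ck_continuous[OF K(1)]] K) auto
 then obtain B where B: "\<And>x. x \<in> K \<Longrightarrow> \<bar>f x\<bar> \<le> B" unfolding bounded_iff by auto
 have "\<bar>f x\<bar> \<le> max B 0" for x using B[of x] K(3)[of x] by (cases "x \<in> K") auto
 then show thesis by (intro that) auto
qed

lemma Ckc_borel: "f \<in> Ckc k \<Longrightarrow> f \<in> Borel"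
 by (auto simp: Ckc_def intro: borel_measurable_continuous_onI Ck_continuous)

lemma loc_integrable_mult_Ckc:
 fixes g :: "'a::euclidean_space \<Rightarrow> real"
 assumes g: "loc_integrable g" and f: "f \<in> Ckc k"
 shows "integrable lborel (\<lambda>x. g x * f x)"
proof -
 obtain K where K: "compact K" "0 \<notin> K" "\<And>x. x \<notin> K \<Longrightarrow> f x = 0"
  using f by (auto elim: CkcE)
 obtain M where M: "\<And>x. \<bar>f x\<bar> \<le> M" "0 \<le> M" using Ckc_bounded[OF f] by blast
 have gK: "integrable lborel (\<lambda>x. indicator K x *\<^sub>R g x)"
  using g K unfolding loc_integrable_def set_integrable_def by blast
 have eq: "g x * f x = (indicator K x *\<^sub>R g x) * f x" for x using K(3)[of x] by (auto simp: indicator_def)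
 show ?thesis
 proof (rule Bochner_Integration.integrable_bound)
  show "integrable lborel (\<lambda>x. M * \<bar>indicator K x *\<^sub>R g x\<bar>)" using gK by (intro integrable_mult_right integrable_abs)
  show "(\<lambda>x. g x * f x) \<in> borel_measurable lborel"
   unfolding eq using gK Ckc_borel[OF f] by (intro borel_measurable_times) auto
  have "\<bar>(indicator K x *\<^sub>R g x) * f x\<bar> \<le> M * \<bar>indicator K x *\<^sub>R g x\<bar>" for x
   using mult_right_mono[OF M(1)[of x], of "\<bar>indicator K x *\<^sub>R g x\<bar>"] by (simp add: abs_mult mult.commute)
  then show "AE x in lborel. norm (g x * f x) \<le> norm (M * \<bar>indicator K x *\<^sub>R g x\<bar>)"
   using M unfolding eq by (intro AE_I2) (simp add: abs_mult)
 qed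
qed

lemma loc_integrable_continuous:
 fixes f :: "'a::euclidean_space \<Rightarrow> 'b::euclidean_space"
 shows "continuous_on (- {0}) f \<Longrightarrow> loc_integrable f"
 unfolding loc_integrable_def set_integrable_def
 by (auto intro!: borel_integrable_compact elim!: continuous_on_subset)

lemma Ckc_integrable: "f \<in> Ckc k \<Longrightarrow> integrable lborel f"
 using loc_integrable_mult_Ckc[OF loc_integrable_continuous[OF continuous_on_const, of "1::real"], of f k] by simp

text \<open>Translation invariance of Lebesgue measure replaces Fubini's theorem here.\<close>

lemma integral_partial_deriv_0:
 fixes f :: "'a::euclidean_space \<Rightarrow> real"
 assumes f: "f \<in> Ckc 1" and b: "b \<in> Basis"
 shows "(LINT x|lborel. partial_deriv b f x) = 0"
proof -
 obtain K where K: "Ck 1 f" "compact K" "0 \<notin> K" "\<And>x. x \<notin> K \<Longrightarrow> f x = 0"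
  using f by (auto elim: CkcE)
 have diff: "f differentiable (at x)" for x using K(1) by simp
 have pf: "partial_deriv b f \<in> Ckc 0" using Ckc_partial_deriv[of f 0] f b by simp
 obtain M where M: "\<And>x. \<bar>partial_deriv b f x\<bar> \<le> M" "0 \<le> M" using Ckc_bounded[OF pf] by blast
 define h where "h = (\<lambda>j. 1 / real (Suc j))"
 have h: "0 < h j" "h j \<le> 1" for j by (auto simp: h_def)
 have h_lim: "h \<longlonglongrightarrow> 0" unfolding h_def by (rule lim_1_over_n[THEN LIMSEQ_Suc])
 define Q where "Q = (\<lambda>j x. (f (x + h j *\<^sub>R b) - f x) / h j)"
 obtain R where R: "\<And>x. x \<in> K \<Longrightarrow> norm x \<le> R" using compact_imp_bounded[OF K(2)] by (auto simp: bounded_iff)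
 have fi: "integrable lborel f" by (rule Ckc_integrable[OF f])
 have [measurable]: "f \<in> Borel" by (rule Ckc_borel[OF f])
 have ft: "integrable lborel (\<lambda>x. f (x + c))" "(LINT x|lborel. f (x + c)) = (LINT x|lborel. f x)" for c
 proof -
  have *: "distr lborel borel (\<lambda>x. c + x) = (lborel :: 'a measure)"
   using lborel_affine[of 1 c] by (simp add: density_1)
  have "integrable (distr lborel borel (\<lambda>x. c + x)) f" using fi unfolding * .
  then show "integrable lborel (\<lambda>x. f (x + c))" by (subst (asm) integrable_distr_eq) (auto simp: add.commute)
  have "(LINT x|distr lborel borel (\<lambda>x. c + x). f x) = (LINT x|lborel. f (c + x))"
   by (subst integral_distr) auto
  then show "(LINT x|lborel. f (x + c)) = (LINT x|lborel. f x)" unfolding * by (simp add: add.commute)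
 qed
 have Q0: "(LINT x|lborel. Q j x) = 0" for j
  unfolding Q_def using fi ft by simp
 have Qb: "norm (Q j x) \<le> M * indicator (cball 0 (R + 1)) x" for j x
 proof (cases "norm x \<le> R + 1")
  case True
  have "\<exists>z. 0 < z \<and> z < h j \<and> f (x + h j *\<^sub>R b) - f (x + 0 *\<^sub>R b) = (h j - 0) * partial_deriv b f (x + z *\<^sub>R b)"
   using h(1) has_real_derivative_line[OF diff] by (intro MVT2) auto
  then obtain z where "f (x + h j *\<^sub>R b) - f x = h j * partial_deriv b f (x + z *\<^sub>R b)" by auto
  then have "Q j x = partial_deriv b f (x + z *\<^sub>R b)" using h(1)[of j] by (simp add: Q_def)
  then show ?thesis using M(1) True by simp
 next
  case False
  have "R + 1 < norm x" using False by simp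
  also have "norm x \<le> norm (x + h j *\<^sub>R b) + norm (h j *\<^sub>R b)"
   using norm_triangle_ineq4[of "x + h j *\<^sub>R b" "h j *\<^sub>R b"] by simp
  also have "\<dots> \<le> norm (x + h j *\<^sub>R b) + 1" using h[of j] b by simp
  finally have "x \<notin> K" "x + h j *\<^sub>R b \<notin> K" using R[of x] R[of "x + h j *\<^sub>R b"] False by auto
  then show ?thesis using K(4) M by (simp add: Q_def)
 qed
 have "(\<lambda>j. LINT x|lborel. Q j x) \<longlonglongrightarrow> (LINT x|lborel. partial_deriv b f x)"
 proof (rule integral_dominated_convergence[where w = "\<lambda>x. M * indicator (cball 0 (R + 1)) x"])
  show "partial_deriv b f \<in> borel_measurable lborel" using Ckc_borel[OF pf] by simp
  show "Q j \<in> borel_measurable lborel" for j unfolding Q_def by simp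
  have "emeasure lborel (cball 0 (R + 1) :: 'a set) < \<infinity>" by (rule emeasure_bounded_finite[OF bounded_cball])
  then show "integrable lborel (\<lambda>x::'a. M * indicator (cball 0 (R + 1)) x :: real)"
   by (intro integrable_mult_right integrable_real_indicator) auto
  show "AE x in lborel. (\<lambda>j. Q j x) \<longlonglongrightarrow> partial_deriv b f x"
  proof (rule AE_I2)
   fix x
   have "((\<lambda>t. f (x + t *\<^sub>R b)) has_real_derivative partial_deriv b f (x + 0 *\<^sub>R b)) (at 0)"
    by (rule has_real_derivative_line[OF diff])
   then have "((\<lambda>t. (f (x + t *\<^sub>R b) - f x) / t) \<longlongrightarrow> partial_deriv b f x) (at 0)"
    by (simp add: has_field_derivative_iff)
   then show "(\<lambda>j. Q j x) \<longlonglongrightarrow> partial_deriv b f x"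
    unfolding Q_def by (rule filterlim_compose[where g = "\<lambda>t. (f (x + t *\<^sub>R b) - f x) / t"])
     (use h_lim h(1) in \<open>auto simp: filterlim_at intro!: always_eventually less_imp_neq[symmetric]\<close>)
  qed
 qed (use Qb in auto)
 then show ?thesis unfolding Q0 by (metis LIMSEQ_const_iff)
qed

lemma integral_by_parts_Ckc:
 assumes f: "f \<in> Ckc 1" and g: "g \<in> Ckc 1" and b: "b \<in> Basis"
 shows "(LINT x|lborel. f x * partial_deriv b g x) = - (LINT x|lborel. partial_deriv b f x * g x)"
proof -
 have df: "partial_deriv b f \<in> Ckc 0" "partial_deriv b g \<in> Ckc 0"
  using Ckc_partial_deriv[of _ 0] f g b by auto
 have fg: "f \<in> Ckc 0" "g \<in> Ckc 0" using Ckc_SucD[of _ 0] f g by auto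
 have "0 = (LINT x|lborel. partial_deriv b (\<lambda>x. f x * g x) x)"
  by (rule integral_partial_deriv_0[OF Ckc_mult[OF f CkcD[OF g]] b, symmetric])
 also have "partial_deriv b (\<lambda>x. f x * g x) = (\<lambda>x. f x * partial_deriv b g x + partial_deriv b f x * g x)"
  using f g by (intro ext partial_deriv_mult) (auto simp: Ckc_def)
 also have "(LINT x|lborel. f x * partial_deriv b g x + partial_deriv b f x * g x) =
   (LINT x|lborel. f x * partial_deriv b g x) + (LINT x|lborel. partial_deriv b f x * g x)"
  using df fg by (intro Bochner_Integration.integral_add Ckc_integrable[where k = 0] Ckc_mult) (auto simp: Ckc_def)
 finally show ?thesis by simp
qed

lemma integral_laplacian_Ckc:
 assumes f: "f \<in> Ckc 2" and g: "g \<in> Ckc 2"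
 shows "(LINT x|lborel. f x * laplacian g x) = (LINT x|lborel. laplacian f x * g x)"
proof -
 have d1: "partial_deriv b h \<in> Ckc 1" if "h \<in> Ckc 2" "b \<in> Basis" for h and b :: 'a
  using that by (intro Ckc_partial_deriv) (auto simp: numeral_2_eq_2)
 have d2: "partial_deriv b (partial_deriv b h) \<in> Ckc 0" if "h \<in> Ckc 2" "b \<in> Basis" for h and b :: 'a
  using Ckc_partial_deriv[of "partial_deriv b h" 0 b] d1[OF that] that by simp
 have c0: "h \<in> Ckc 0" if "h \<in> Ckc 2" for h :: "'a \<Rightarrow> real"
  using Ckc_SucD[of h 0] Ckc_2D[OF that] by simp
 have i: "integrable lborel (\<lambda>x. h x * k x)" if "h \<in> Ckc 0" "k \<in> Ckc 0" for h k :: "'a \<Rightarrow> real"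
  using that by (intro Ckc_integrable[where k = 0] Ckc_mult) (auto simp: Ckc_def)
 have "(LINT x|lborel. f x * laplacian g x) = (\<Sum>b\<in>Basis. LINT x|lborel. f x * partial_deriv b (partial_deriv b g) x)"
  unfolding laplacian_def sum_distrib_left
  by (intro Bochner_Integration.integral_sum i c0 d2 f g)
 also have "\<dots> = (\<Sum>b\<in>Basis. LINT x|lborel. partial_deriv b (partial_deriv b f) x * g x)"
 proof (intro sum.cong refl)
  fix b :: 'a assume b: "b \<in> Basis"
  show "(LINT x|lborel. f x * partial_deriv b (partial_deriv b g) x) = (LINT x|lborel. partial_deriv b (partial_deriv b f) x * g x)"
   using integral_by_parts_Ckc[OF Ckc_2D[OF f] d1[OF g b] b] integral_by_parts_Ckc[OF d1[OF f b] Ckc_2D[OF g] b] by simp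
 qed
 also have "\<dots> = (LINT x|lborel. laplacian f x * g x)"
  unfolding laplacian_def sum_distrib_right
  by (intro Bochner_Integration.integral_sum[symmetric] i c0 d2 f g)
 finally show ?thesis .
qed


subsection \<open>Weak derivatives: uniqueness and limits\<close>

text \<open>A product of cubes of positive parts, two for each coordinate, scaled to values at most
  1. Positivity exactly on the open box is what makes the powers in
  \<open>set_integral_box_0\<close> converge to its indicator.\<close>

lemma box_bump:
 fixes a b :: "'a::euclidean_space"
 obtains g :: "'a \<Rightarrow> real" where "Ck 2 g" "\<And>x. 0 \<le> g x \<and> g x \<le> 1" "\<And>x. g x > 0 \<longleftrightarrow> x \<in> box a b"
proof -
 define B where "B = (\<lambda>x. \<Prod>i\<in>Basis. max 0 (x \<bullet> i - a \<bullet> i) ^ 3 * max 0 (b \<bullet> i - x \<bullet> i) ^ 3)"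
 have B: "Ck 2 B" unfolding B_def
  by (intro Ck_prod finite_Basis Ck_mult Ck_compose[OF Ck_2_max_cube] Ck_diff Ck_inner Ck_const)
 have B0: "0 \<le> B x" for x unfolding B_def by (intro prod_nonneg) auto
 have Bpos: "B x > 0 \<longleftrightarrow> x \<in> box a b" for x
 proof
  assume "x \<in> box a b"
  then show "B x > 0" unfolding B_def by (intro prod_pos) (auto simp: mem_box)
 next
  assume *: "B x > 0"
  show "x \<in> box a b" unfolding mem_box
  proof
   fix i :: 'a assume i: "i \<in> Basis"
   have "max 0 (x \<bullet> i - a \<bullet> i) ^ 3 * max 0 (b \<bullet> i - x \<bullet> i) ^ 3 \<noteq> 0"
    using * i unfolding B_def by (metis (no_types, lifting) finite_Basis prod_zero_iff less_irrefl)
   then show "a \<bullet> i < x \<bullet> i \<and> x \<bullet> i < b \<bullet> i" by (auto simp: max_def split: if_splits)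
  qed
 qed
 have "compact (B ` cbox a b)"
  by (intro compact_continuous_image continuous_on_subset[OF Ck_continuous[OF B]]) auto
 then obtain M where M: "\<And>x. x \<in> cbox a b \<Longrightarrow> B x \<le> M" using compact_imp_bounded bounded_iff
  by (metis abs_le_D1 imageI real_norm_def)
 define N where "N = max 1 M"
 have "B x \<le> N" for x
  using M[of x] Bpos[of x] box_subset_cbox[of a b] by (cases "x \<in> box a b") (auto simp: N_def)
 then show thesis
  by (intro that[of "\<lambda>x. (1 / N) * B x"] Ck_mult Ck_const B)
   (use B0 Bpos in \<open>auto simp: N_def zero_less_divide_iff zero_less_mult_iff\<close>)
qed

text \<open>With g the bump of the box, \<open>1 - (1 - g x) ^ j\<close> is again a test function,
  lies between 0 and 1 and converges to the indicator of the box. Dominated convergence carries the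
  hypothesis from test functions to boxes.\<close>

lemma set_integral_box_0:
 fixes f :: "'a::euclidean_space \<Rightarrow> real"
 assumes f: "loc_integrable f" and z: "\<And>\<phi>. \<phi> \<in> Ckc 2 \<Longrightarrow> (LINT x|lborel. f x * \<phi> x) = 0"
  and ab: "0 \<notin> cbox a b"
 shows "(LINT x:box a b|lborel. f x) = 0"
proof -
 obtain g :: "'a \<Rightarrow> real" where g: "Ck 2 g" "\<And>x. 0 \<le> g x \<and> g x \<le> 1" "\<And>x. g x > 0 \<longleftrightarrow> x \<in> box a b"
  using box_bump[of a b] by blast
 define \<phi> where "\<phi> = (\<lambda>j x. 1 - (1 - g x) ^ j)"
 have g0: "g x = 0" if "x \<notin> cbox a b" for x
  using g(2)[of x] g(3)[of x] that box_subset_cbox[of a b] by force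
 have \<phi>: "\<phi> j \<in> Ckc 2" for j
  unfolding \<phi>_def by (rule CkcI[of _ _ "cbox a b"]) (auto intro!: Ck_diff Ck_const Ck_power g simp: ab g0)
 have \<phi>01: "0 \<le> \<phi> j x \<and> \<phi> j x \<le> 1" for j x
  using g(2)[of x] by (auto simp: \<phi>_def power_le_one)
 have fi: "integrable lborel (\<lambda>x. indicator (cbox a b) x * f x)"
  using f ab by (auto simp: loc_integrable_def set_integrable_def)
 have "(\<lambda>j. LINT x|lborel. f x * \<phi> j x) \<longlonglongrightarrow> (LINT x|lborel. indicator (box a b) x * f x)"
 proof (rule integral_dominated_convergence)
  show "integrable lborel (\<lambda>x. \<bar>indicator (cbox a b) x * f x\<bar>)" using fi by (rule integrable_abs)
  show "(\<lambda>x. f x * \<phi> j x) \<in> borel_measurable lborel" for j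
   using loc_integrable_mult_Ckc[OF f \<phi>] by blast
  have eq: "indicator (box a b) x * f x = indicator (box a b) x * (indicator (cbox a b) x * f x)" for x
   using box_subset_cbox[of a b] by (auto simp: indicator_def)
  show "(\<lambda>x. indicator (box a b) x * f x) \<in> borel_measurable lborel"
   by (subst eq) (use fi in \<open>auto intro!: borel_measurable_times\<close>)
  show "AE x in lborel. norm (f x * \<phi> j x) \<le> \<bar>indicator (cbox a b) x * f x\<bar>" for j
  proof (rule AE_I2)
   fix x show "norm (f x * \<phi> j x) \<le> \<bar>indicator (cbox a b) x * f x\<bar>"
   proof (cases "x \<in> cbox a b")
    case True
    then show ?thesis using \<phi>01[of j x] by (simp add: abs_mult mult_left_le)
   qed (simp add: \<phi>_def g0)
  qed
  show "AE x in lborel. (\<lambda>j. f x * \<phi> j x) \<longlonglongrightarrow> indicator (box a b) x * f x"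
  proof (rule AE_I2)
   fix x
   show "(\<lambda>j. f x * \<phi> j x) \<longlonglongrightarrow> indicator (box a b) x * f x"
   proof (cases "x \<in> box a b")
    case True
    then have "(\<lambda>j. (1 - g x) ^ j) \<longlonglongrightarrow> 0"
     using g(2)[of x] g(3)[of x] by (intro LIMSEQ_realpow_zero) auto
    from tendsto_mult[OF tendsto_const[of "f x"] tendsto_diff[OF tendsto_const[of 1] this]]
    have "(\<lambda>j. f x * \<phi> j x) \<longlonglongrightarrow> f x * (1 - 0)" unfolding \<phi>_def .
    then show ?thesis using True by simp
   next
    case False
    then have "g x = 0" using g(2)[of x] g(3)[of x] by force
    then show ?thesis using False by (simp add: \<phi>_def)
   qed
  qed
 qed
 then have "(LINT x|lborel. indicator (box a b) x * f x) = 0"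
  unfolding z[OF \<phi>] by (metis LIMSEQ_const_iff)
 then show ?thesis by (simp add: set_lebesgue_integral_def)
qed

text \<open>Boxes are stable under intersection and generate the Borel sets, so vanishing integrals
  over boxes pass to all Borel subsets of a box that stays away from the origin. Countably many such
  boxes exhaust the punctured space.\<close>

lemma du_Bois_Reymond:
 fixes f :: "'a::euclidean_space \<Rightarrow> real"
 assumes f: "loc_integrable f" and z: "\<And>\<phi>. \<phi> \<in> Ckc 2 \<Longrightarrow> (LINT x|lborel. f x * \<phi> x) = 0"
 shows "AE x in lborel. f x = 0"
proof -
 have cb: "AE x in lborel. x \<in> cbox u v \<longrightarrow> f x = 0" if uv: "0 \<notin> cbox u v" for u v
 proof -
  define h where "h = (\<lambda>x. indicator (box u v) x * f x)"
  have hi: "integrable lborel h"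
  proof -
   have "set_integrable lborel (cbox u v) f"
    using f uv by (simp add: loc_integrable_def)
   then have "set_integrable lborel (box u v) f"
    by (rule set_integrable_subset) (simp_all add: box_subset_cbox)
   then show ?thesis by (simp add: set_integrable_def h_def)
  qed
  have hs: "set_integrable lborel A h" if "A \<in> sets lborel" for A
   unfolding set_integrable_def using hi that by (intro integrable_mult_indicator) auto
  let ?G = "range (\<lambda>(a, b). box a b :: 'a set)"
  have box0: "(LINT x:box a b|lborel. h x) = 0" for a b
  proof -
   \<comment> \<open>The intersection is a box again, and its closure lies in
     \<open>cbox u v\<close>, hence away from the origin.\<close>
   obtain c d where cd: "box a b \<inter> box u v = box c d" "box a b \<inter> box u v = {} \<or> cbox c d \<subseteq> cbox u v"
   proof -
    define c where "c = (\<Sum>i\<in>Basis. max (a\<bullet>i) (u\<bullet>i) *\<^sub>R i)"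
    define d where "d = (\<Sum>i\<in>Basis. min (b\<bullet>i) (v\<bullet>i) *\<^sub>R i)"
    have "cbox c d \<subseteq> cbox u v" by (auto simp: c_def d_def mem_box)
    then show thesis using box_Int_box[of a b u v] by (intro that[of c d]) (auto simp: c_def d_def)
   qed
   have "(LINT x:box a b|lborel. h x) = (LINT x:box a b \<inter> box u v|lborel. f x)"
    by (auto simp: set_lebesgue_integral_def h_def indicator_def intro!: Bochner_Integration.integral_cong)
   also have "\<dots> = 0"
   proof (cases "box a b \<inter> box u v = {}")
    case False
    then have "0 \<notin> cbox c d" using cd uv by blast
    then show ?thesis unfolding cd(1) using set_integral_box_0[OF f z] by blast
   qed (simp add: set_lebesgue_integral_def)
   finally show ?thesis .
  qed
  have "(LINT x:A|lborel. h x) = 0" if A: "A \<in> sets lborel" for A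
  proof -
   have tot: "(LINT x|lborel. h x) = 0"
   proof -
    have "(\<lambda>x. indicator (box u v) x *\<^sub>R h x) = h" by (auto simp: h_def indicator_def fun_eq_iff)
    then show ?thesis using box0[of u v] by (simp add: set_lebesgue_integral_def)
   qed
   have st: "Int_stable ?G"
    unfolding Int_stable_def by (auto simp: box_Int_box)
   have "A \<in> sigma_sets UNIV ?G"
    using A by (subst (asm) sets_lborel, subst (asm) borel_eq_box) (simp add: sets_measure_of)
   from st subset_UNIV[of ?G, folded Pow_UNIV] this show ?thesis
   proof (induction rule: sigma_sets_induct_disjoint)
    case (basic A) then show ?case using box0 by auto
   next
    case empty show ?case by (simp add: set_lebesgue_integral_def)
   next
    case (compl A)
    then have Am: "A \<in> sets lborel" by (simp add: borel_eq_box[where 'a='a])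
    have "(LINT x:A \<union> (UNIV - A)|lborel. h x) = (LINT x:A|lborel. h x) + (LINT x:UNIV - A|lborel. h x)"
     by (rule set_integral_Un) (use Am in \<open>auto intro!: hs\<close>)
    moreover have "A \<union> (UNIV - A) = UNIV" by auto
    ultimately show ?case using compl tot by (simp add: set_lebesgue_integral_def)
   next
    case (union A)
    then have Am: "A i \<in> sets lborel" for i by (auto simp: borel_eq_box[where 'a='a])
    have "(LINT x:(\<Union>i. A i)|lborel. h x) = (\<Sum>i. LINT x:A i|lborel. h x)"
     by (rule lebesgue_integral_countable_add) (use Am union in \<open>auto intro!: hs simp: disjoint_family_on_def\<close>)
    then show ?case using union by simp
   qed
  qed
  then have h0: "AE x in lborel. h x = 0"
   using density_unique_real[OF hi integrable_zero] by (simp add: set_lebesgue_integral_def)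
  have "cbox u v - box u v \<in> null_sets lborel"
   by (simp add: null_sets_def emeasure_lborel_cbox_eq emeasure_lborel_box_eq emeasure_Diff box_subset_cbox)
  then have "AE x in lborel. x \<notin> cbox u v - box u v" by (rule AE_not_in)
  with h0 show ?thesis by eventually_elim (auto simp: h_def)
 qed
 obtain D where D: "countable D" "D \<subseteq> Pow (- {0::'a})" "\<And>X. X \<in> D \<Longrightarrow> \<exists>a b. X = cbox a b" "\<Union>D = - {0}"
  using open_countable_Union_open_cbox[of "- {0::'a}"] by (metis open_Compl closed_singleton)
 have "AE x in lborel. \<forall>X\<in>D. x \<in> X \<longrightarrow> f x = 0"
  using D(1)
 proof (subst AE_ball_countable, simp, intro ballI)
  fix X assume X: "X \<in> D"
  then obtain a b where "X = cbox a b" using D(3) by blast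
  moreover have "0 \<notin> X" using X D(2) by blast
  ultimately show "AE x in lborel. x \<in> X \<longrightarrow> f x = 0" using cb by blast
 qed
 moreover have "AE x in lborel. x \<noteq> (0::'a)" by (rule AE_lborel_singleton)
 ultimately show ?thesis
  by eventually_elim (use D(4) in blast)
qed

lemma ennreal_tendsto_0I:
 assumes "\<And>\<eta>. 0 < \<eta> \<Longrightarrow> eventually (\<lambda>j. F j \<le> ennreal \<eta>) A"
 shows "(F \<longlongrightarrow> 0) A"
proof (rule order_tendstoI)
 fix z :: ennreal assume "0 < z"
 then obtain y where y: "0 < y" "y < z" using dense by blast
 then obtain \<eta> where \<eta>: "y = ennreal \<eta>" "0 < \<eta>" by (cases y) auto
 show "eventually (\<lambda>j. F j < z) A"
  using assms[OF \<eta>(2)] by eventually_elim (use y \<eta> in auto)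
qed auto

lemma ennreal_tendsto_0D: "(F \<longlongrightarrow> (0::ennreal)) A \<Longrightarrow> 0 < \<eta> \<Longrightarrow> eventually (\<lambda>j. F j \<le> ennreal \<eta>) A"
 by (drule order_tendstoD(2)[of _ _ _ "ennreal \<eta>"]) (auto elim: eventually_mono)

lemma ennreal_tendsto_0_bound:
 fixes F G :: "'b \<Rightarrow> ennreal"
 assumes "(G \<longlongrightarrow> 0) A" "\<And>j. F j \<le> G j"
 shows "(F \<longlongrightarrow> 0) A"
 by (rule tendsto_sandwich[OF _ _ tendsto_const assms(1)]) (use assms(2) in auto)

section \<open>Local convergence in L^1 away from the origin\<close>

abbreviation L1_dist :: "'a::euclidean_space set \<Rightarrow> ('a \<Rightarrow> 'b::euclidean_space) \<Rightarrow> ('a \<Rightarrow> 'b) \<Rightarrow> ennreal" where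
 "L1_dist K f g \<equiv> \<integral>\<^sup>+x. ennreal (norm (f x - g x)) * indicator K x \<partial>lborel"

text \<open>The nonnegative integral gives the notion a meaning before the limit is known to be
  locally integrable, which \<open>L1loc_lim_loc_integrable\<close> then deduces. Integrals against
  test functions pass to the limit under it.\<close>

definition L1loc_lim :: "(nat \<Rightarrow> 'a::euclidean_space \<Rightarrow> 'b::euclidean_space) \<Rightarrow> ('a \<Rightarrow> 'b) \<Rightarrow> bool" where
 "L1loc_lim f g \<longleftrightarrow> (\<forall>K. compact K \<and> 0 \<notin> K \<longrightarrow>
   (\<lambda>j. L1_dist K (f j) g) \<longlonglongrightarrow> 0)"

lemma L1loc_lim_loc_integrable:
 fixes g :: "'a::euclidean_space \<Rightarrow> 'b::euclidean_space"
 assumes f: "\<And>j. loc_integrable (f j)" and g[measurable]: "g \<in> Borel"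
  and fm[measurable]: "\<And>j. f j \<in> Borel" and lim: "L1loc_lim f g"
 shows "loc_integrable g"
 unfolding loc_integrable_def
proof (intro allI impI)
 fix K :: "'a set" assume K: "compact K \<and> 0 \<notin> K"
 then have [measurable]: "K \<in> sets borel" by (simp add: borel_compact)
 have "(\<lambda>j. L1_dist K (f j) g) \<longlonglongrightarrow> 0"
  using lim K by (auto simp: L1loc_lim_def)
 from ennreal_tendsto_0D[OF this, of 1] obtain j where
  j: "L1_dist K (f j) g \<le> ennreal 1"
  by (auto simp: eventually_sequentially)
 have "set_integrable lborel K (\<lambda>x. f j x - g x)"
  unfolding set_integrable_def
 proof (rule integrableI_bounded)
  have "(\<integral>\<^sup>+x. ennreal (norm (indicator K x *\<^sub>R (f j x - g x))) \<partial>lborel) =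
    L1_dist K (f j) g"
   by (intro nn_integral_cong) (auto simp: indicator_def)
  also have "\<dots> < \<infinity>" using j by (simp add: le_less_trans)
  finally show "(\<integral>\<^sup>+x. ennreal (norm (indicator K x *\<^sub>R (f j x - g x))) \<partial>lborel) < \<infinity>" .
 qed measurable
 moreover have "set_integrable lborel K (f j)" using f K by (auto simp: loc_integrable_def)
 ultimately have "set_integrable lborel K (\<lambda>x. f j x - (f j x - g x))"
  using set_integral_diff(1) by blast
 then show "set_integrable lborel K g" by simp
qed

lemma L1loc_lim_integral:
 fixes g :: "'a::euclidean_space \<Rightarrow> real"
 assumes f: "\<And>j. loc_integrable (f j)" and g: "loc_integrable g" and lim: "L1loc_lim f g"
  and \<phi>: "\<phi> \<in> Ckc k"
 shows "(\<lambda>j. LINT x|lborel. f j x * \<phi> x) \<longlonglongrightarrow> (LINT x|lborel. g x * \<phi> x)"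
proof -
 obtain K where K: "compact K" "0 \<notin> K" "\<And>x. x \<notin> K \<Longrightarrow> \<phi> x = 0" using \<phi> by (auto elim: CkcE)
 then have Km[measurable]: "K \<in> sets borel" by (simp add: borel_compact)
 obtain M where M: "\<And>x. \<bar>\<phi> x\<bar> \<le> M" "0 \<le> M" using Ckc_bounded[OF \<phi>] by blast
 have fi: "integrable lborel (\<lambda>x. f j x * \<phi> x)" and gi: "integrable lborel (\<lambda>x. g x * \<phi> x)" for j
  using loc_integrable_mult_Ckc[OF f \<phi>] loc_integrable_mult_Ckc[OF g \<phi>] by auto
 have "set_integrable lborel K (\<lambda>x. f j x - g x)" for j
  using f g K by (intro set_integral_diff) (auto simp: loc_integrable_def)
 then have hm: "(\<lambda>x. ennreal (norm (f j x - g x)) * indicator K x) \<in> borel_measurable lborel" for j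
 proof -
  assume *: "\<And>j. set_integrable lborel K (\<lambda>x. f j x - g x)"
  have "(\<lambda>x. ennreal (norm (indicator K x *\<^sub>R (f j x - g x)))) \<in> borel_measurable lborel"
   using *[of j] unfolding set_integrable_def by measurable
  also have "(\<lambda>x. ennreal (norm (indicator K x *\<^sub>R (f j x - g x)))) = (\<lambda>x. ennreal (norm (f j x - g x)) * indicator K x)"
   by (auto simp: indicator_def fun_eq_iff)
  finally show ?thesis .
 qed
 have le: "ennreal \<bar>(LINT x|lborel. f j x * \<phi> x) - (LINT x|lborel. g x * \<phi> x)\<bar> \<le>
   ennreal M * L1_dist K (f j) g" for j
 proof -
  have "(LINT x|lborel. f j x * \<phi> x) - (LINT x|lborel. g x * \<phi> x) = (LINT x|lborel. f j x * \<phi> x - g x * \<phi> x)"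
   using fi gi by simp
  then have "ennreal \<bar>(LINT x|lborel. f j x * \<phi> x) - (LINT x|lborel. g x * \<phi> x)\<bar>
    \<le> (\<integral>\<^sup>+x. ennreal (norm (f j x * \<phi> x - g x * \<phi> x)) \<partial>lborel)"
   using integral_norm_bound_ennreal[OF Bochner_Integration.integrable_diff[OF fi gi], of j] by simp
  also have "\<dots> \<le> (\<integral>\<^sup>+x. ennreal M * (ennreal (norm (f j x - g x)) * indicator K x) \<partial>lborel)"
  proof (rule nn_integral_mono)
   fix x
   show "ennreal (norm (f j x * \<phi> x - g x * \<phi> x)) \<le> ennreal M * (ennreal (norm (f j x - g x)) * indicator K x)"
   proof (cases "x \<in> K")
    case True
    have "norm (f j x * \<phi> x - g x * \<phi> x) = \<bar>\<phi> x\<bar> * \<bar>f j x - g x\<bar>"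
     by (simp add: abs_mult flip: left_diff_distrib)
    also have "\<dots> \<le> M * \<bar>f j x - g x\<bar>" using M by (intro mult_right_mono) auto
    finally show ?thesis using True M by (simp add: ennreal_leI flip: ennreal_mult')
   qed (simp add: K)
  qed
  also have "\<dots> = ennreal M * L1_dist K (f j) g"
   by (rule nn_integral_cmult[OF hm])
  finally show ?thesis .
 qed
 have "(\<lambda>j. L1_dist K (f j) g) \<longlonglongrightarrow> 0"
  using lim K by (auto simp: L1loc_lim_def)
 then have "(\<lambda>j. ennreal M * L1_dist K (f j) g) \<longlonglongrightarrow> 0"
  using ennreal_tendsto_cmult[of "ennreal M"] by fastforce
 then have "(\<lambda>j. ennreal \<bar>(LINT x|lborel. f j x * \<phi> x) - (LINT x|lborel. g x * \<phi> x)\<bar>) \<longlonglongrightarrow> ennreal 0"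
  unfolding ennreal_0 by (rule ennreal_tendsto_0_bound[OF _ le])
 then have "(\<lambda>j. \<bar>(LINT x|lborel. f j x * \<phi> x) - (LINT x|lborel. g x * \<phi> x)\<bar>) \<longlonglongrightarrow> 0"
  by (subst (asm) tendsto_ennreal_iff) auto
 then show ?thesis by (simp add: tendsto_rabs_zero_iff LIM_zero_iff)
qed

lemma loc_integrable_inner: "loc_integrable F \<Longrightarrow> loc_integrable (\<lambda>x. F x \<bullet> b)"
 unfolding loc_integrable_def set_integrable_def
proof (intro allI impI)
 fix K :: "'a set"
 assume "\<forall>K. compact K \<and> 0 \<notin> K \<longrightarrow> integrable lborel (\<lambda>x. indicator K x *\<^sub>R F x)" "compact K \<and> 0 \<notin> K"
 then have "integrable lborel (\<lambda>x. (indicator K x *\<^sub>R F x) \<bullet> b)" by (intro integrable_inner_left) auto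
 then show "integrable lborel (\<lambda>x. indicator K x *\<^sub>R (F x \<bullet> b))" by simp
qed

lemma L1loc_lim_inner:
 assumes [measurable]: "\<And>j. F j \<in> Borel" "G \<in> Borel"
  and lim: "L1loc_lim F G" and b: "b \<in> Basis"
 shows "L1loc_lim (\<lambda>j x. F j x \<bullet> b) (\<lambda>x. G x \<bullet> b)"
 unfolding L1loc_lim_def
proof (intro allI impI)
 fix K :: "'a set" assume K: "compact K \<and> 0 \<notin> K"
 have "(\<lambda>j. \<integral>\<^sup>+x. ennreal (norm (F j x - G x)) * indicator K x \<partial>lborel) \<longlonglongrightarrow> 0"
  using lim K by (auto simp: L1loc_lim_def)
 moreover have "(\<integral>\<^sup>+x. ennreal (norm (F j x \<bullet> b - G x \<bullet> b)) * indicator K x \<partial>lborel) \<le>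
   (\<integral>\<^sup>+x. ennreal (norm (F j x - G x)) * indicator K x \<partial>lborel)" for j
  using Basis_le_norm[OF b] by (intro nn_integral_mono mult_right_mono ennreal_leI) (auto simp flip: inner_diff_left)
 ultimately show "(\<lambda>j. \<integral>\<^sup>+x. ennreal (norm (F j x \<bullet> b - G x \<bullet> b)) * indicator K x \<partial>lborel) \<longlonglongrightarrow> 0"
  by (rule ennreal_tendsto_0_bound)
qed

text \<open>On a compact set off the origin the weight is bounded below, and |y| \<le> \<epsilon> +
  \<epsilon> powr (1 - p) |y| powr p bounds the L^1 distance by a small multiple of the volume of K
  plus a multiple of the weighted p-integral.\<close>

lemma L1loc_lim_weighted:
 fixes f :: "nat \<Rightarrow> 'a::euclidean_space \<Rightarrow> real"
 assumes p: "1 < p" and [measurable]: "\<And>j. f j \<in> Borel" "g \<in> Borel"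
  and lim: "(\<lambda>j. \<integral>\<^sup>+x. ennreal (norm x powr a * \<bar>f j x - g x\<bar> powr p) \<partial>lborel) \<longlonglongrightarrow> 0"
 shows "L1loc_lim f g"
 unfolding L1loc_lim_def
proof (intro allI impI)
 fix K :: "'a set" assume K: "compact K \<and> 0 \<notin> K"
 then have [measurable]: "K \<in> sets borel" by (simp add: borel_compact)
 obtain c where c: "0 < c" "\<And>x. x \<in> K \<Longrightarrow> c \<le> norm x powr a"
 proof (cases "K = {}")
  case False
  have "continuous_on K (\<lambda>x. norm x powr a)"
   using K by (intro continuous_intros) auto
  then obtain y where "y \<in> K" "\<And>x. x \<in> K \<Longrightarrow> norm y powr a \<le> norm x powr a"
   using continuous_attains_inf[of K] K False by blast
  then show thesis using K by (intro that[of "norm y powr a"]) auto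
 qed (auto intro: that[of 1])
 define m where "m = measure lborel K"
 have m: "emeasure lborel K = ennreal m" "0 \<le> m"
  unfolding m_def using emeasure_compact_finite[of K] K by (auto intro!: emeasure_eq_ennreal_measure)
 show "(\<lambda>j. L1_dist K (f j) g) \<longlonglongrightarrow> 0"
 proof (rule ennreal_tendsto_0I)
  fix \<eta> :: real assume \<eta>: "0 < \<eta>"
  \<comment> \<open>Half of \<eta> is reserved for the volume term; adding 1 to m allows a null set
    K.\<close>
  define \<epsilon> where "\<epsilon> = \<eta> / (2 * (m + 1))"
  have \<epsilon>: "0 < \<epsilon>" "\<epsilon> * m \<le> \<eta> / 2" using \<eta> m(2) by (auto simp: \<epsilon>_def field_simps)
  define C where "C = \<epsilon> powr (1 - p) / c"
  have C: "0 < C" using c \<epsilon> by (simp add: C_def)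
  have "eventually (\<lambda>j. (\<integral>\<^sup>+x. ennreal (norm x powr a * \<bar>f j x - g x\<bar> powr p) \<partial>lborel) \<le> ennreal (\<eta> / (2 * C))) sequentially"
   using C \<eta> by (intro ennreal_tendsto_0D[OF lim]) auto
  then show "eventually (\<lambda>j. L1_dist K (f j) g \<le> ennreal \<eta>) sequentially"
  proof eventually_elim
   fix j assume j: "(\<integral>\<^sup>+x. ennreal (norm x powr a * \<bar>f j x - g x\<bar> powr p) \<partial>lborel) \<le> ennreal (\<eta> / (2 * C))"
   have "L1_dist K (f j) g \<le>
    (\<integral>\<^sup>+x. ennreal \<epsilon> * indicator K x + ennreal C * ennreal (norm x powr a * \<bar>f j x - g x\<bar> powr p) \<partial>lborel)"
   proof (rule nn_integral_mono)
    fix x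
    show "ennreal (norm (f j x - g x)) * indicator K x \<le> ennreal \<epsilon> * indicator K x + ennreal C * ennreal (norm x powr a * \<bar>f j x - g x\<bar> powr p)"
    proof (cases "x \<in> K")
     case True
     have "\<bar>f j x - g x\<bar> \<le> \<epsilon> + \<epsilon> powr (1 - p) * \<bar>f j x - g x\<bar> powr p"
      using powr_mult_le_eps[OF p, of 1 "\<bar>f j x - g x\<bar>" \<epsilon>] \<epsilon> by simp
     also have "\<epsilon> powr (1 - p) * \<bar>f j x - g x\<bar> powr p \<le> C * (norm x powr a * \<bar>f j x - g x\<bar> powr p)"
     proof -
      have "c * \<bar>f j x - g x\<bar> powr p \<le> norm x powr a * \<bar>f j x - g x\<bar> powr p"
       using c(2)[OF True] by (intro mult_right_mono) auto
      then have "C * (c * \<bar>f j x - g x\<bar> powr p) \<le> C * (norm x powr a * \<bar>f j x - g x\<bar> powr p)"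
       using C by (intro mult_left_mono) auto
      then show ?thesis using c(1) by (simp add: C_def)
     qed
     finally have "ennreal (norm (f j x - g x)) \<le> ennreal (\<epsilon> + C * (norm x powr a * \<bar>f j x - g x\<bar> powr p))"
      by (intro ennreal_leI) auto
     also have "\<dots> = ennreal \<epsilon> + ennreal C * ennreal (norm x powr a * \<bar>f j x - g x\<bar> powr p)"
      using \<epsilon> C by (subst ennreal_plus) (auto simp: ennreal_mult)
     finally show ?thesis using True by simp
    qed simp
   qed
   also have "\<dots> = ennreal \<epsilon> * ennreal m + ennreal C * (\<integral>\<^sup>+x. ennreal (norm x powr a * \<bar>f j x - g x\<bar> powr p) \<partial>lborel)"
    by (subst nn_integral_add) (simp_all add: nn_integral_cmult nn_integral_cmult_indicator m)
   also have "\<dots> \<le> ennreal \<epsilon> * ennreal m + ennreal C * ennreal (\<eta> / (2 * C))"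
    using j by (intro add_left_mono mult_left_mono) auto
   also have "\<dots> = ennreal (\<epsilon> * m + C * (\<eta> / (2 * C)))"
   proof -
    have 1: "ennreal \<epsilon> * ennreal m = ennreal (\<epsilon> * m)" using \<epsilon> m by (simp add: ennreal_mult)
    have 2: "ennreal C * ennreal (\<eta> / (2 * C)) = ennreal (C * (\<eta> / (2 * C)))"
     using C \<eta> by (intro ennreal_mult[symmetric]) auto
    show ?thesis unfolding 1 2 using \<epsilon> m C \<eta> by (intro ennreal_plus[symmetric]) auto
   qed
   also have "\<dots> \<le> ennreal \<eta>" using \<epsilon>(2) C by (intro ennreal_leI) auto
   finally show "L1_dist K (f j) g \<le> ennreal \<eta>" .
  qed
 qed
qed

text \<open>F has to be continuous and to represent the classical derivatives only off the origin,
  because the radial formulas for which it is used are singular there.\<close>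

lemma weak_gradient_limit:
 fixes u :: "'a::euclidean_space \<Rightarrow> real"
 assumes \<phi>: "\<And>j. \<phi> j \<in> Ckc 1" and um: "u \<in> Borel" and u: "L1loc_lim \<phi> u"
  and Fm: "\<And>j. F j \<in> Borel" and Gm: "G \<in> Borel"
  and F: "\<And>j. continuous_on (- {0}) (F j)" and G: "L1loc_lim F G"
  and D: "\<And>j b x. b \<in> Basis \<Longrightarrow> x \<noteq> 0 \<Longrightarrow> partial_deriv b (\<phi> j) x = F j x \<bullet> b"
 shows "is_weak_gradient u G"
proof -
 have \<phi>i: "loc_integrable (\<phi> j)" for j
  using Ck_continuous[OF CkcD[OF \<phi>[of j]]] by (intro loc_integrable_continuous) (auto intro: continuous_on_subset)
 have Fi: "loc_integrable (F j)" for j by (intro loc_integrable_continuous F)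
 have ui: "loc_integrable u" using Ckc_borel[OF \<phi>] by (intro L1loc_lim_loc_integrable[OF \<phi>i um _ u]) auto
 have Gi: "loc_integrable G" by (intro L1loc_lim_loc_integrable[OF Fi Gm Fm G])
 have "(LINT x|lborel. u x * partial_deriv b \<psi> x) = - (LINT x|lborel. (G x \<bullet> b) * \<psi> x)"
  if \<psi>: "\<psi> \<in> Ckc 1" and b: "b \<in> Basis" for \<psi> b
 proof (rule LIMSEQ_unique)
  have d\<psi>: "partial_deriv b \<psi> \<in> Ckc 0" using Ckc_partial_deriv[of \<psi> 0 b] \<psi> b by simp
  show "(\<lambda>j. LINT x|lborel. \<phi> j x * partial_deriv b \<psi> x) \<longlonglongrightarrow> (LINT x|lborel. u x * partial_deriv b \<psi> x)"
   by (rule L1loc_lim_integral[OF \<phi>i ui u d\<psi>])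
  have "(\<lambda>j. - (LINT x|lborel. (F j x \<bullet> b) * \<psi> x)) \<longlonglongrightarrow> - (LINT x|lborel. (G x \<bullet> b) * \<psi> x)"
   by (intro tendsto_minus L1loc_lim_integral[OF _ _ _ \<psi>] loc_integrable_inner Fi Gi L1loc_lim_inner Fm Gm G b)
  moreover have "(LINT x|lborel. \<phi> j x * partial_deriv b \<psi> x) = - (LINT x|lborel. (F j x \<bullet> b) * \<psi> x)" for j
  proof -
   have "(LINT x|lborel. partial_deriv b (\<phi> j) x * \<psi> x) = (LINT x|lborel. (F j x \<bullet> b) * \<psi> x)"
   proof (rule integral_cong_AE)
    show "(\<lambda>x. partial_deriv b (\<phi> j) x * \<psi> x) \<in> borel_measurable lborel"
     using Ckc_borel[OF Ckc_partial_deriv[of "\<phi> j" 0 b]] \<phi>[of j] b Ckc_borel[OF \<psi>] by simp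
    show "(\<lambda>x. (F j x \<bullet> b) * \<psi> x) \<in> borel_measurable lborel"
     using Fm[of j] Ckc_borel[OF \<psi>] by simp
    show "AE x in lborel. partial_deriv b (\<phi> j) x * \<psi> x = (F j x \<bullet> b) * \<psi> x"
     using AE_lborel_singleton[of 0] by eventually_elim (simp add: D b)
   qed
   then show ?thesis using integral_by_parts_Ckc[OF \<phi> \<psi> b] by simp
  qed
  ultimately show "(\<lambda>j. LINT x|lborel. \<phi> j x * partial_deriv b \<psi> x) \<longlonglongrightarrow> - (LINT x|lborel. (G x \<bullet> b) * \<psi> x)"
   by simp
 qed
 then show ?thesis using ui Gi by (simp add: is_weak_gradient_def)
qed

lemma weak_laplacian_limit:
 fixes u :: "'a::euclidean_space \<Rightarrow> real"
 assumes \<phi>: "\<And>j. \<phi> j \<in> Ckc 2" and um: "u \<in> Borel" and u: "L1loc_lim \<phi> u"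
  and fm: "f \<in> Borel" and f: "L1loc_lim (\<lambda>j. laplacian (\<phi> j)) f"
 shows "is_weak_laplacian u f"
proof -
 have \<phi>i: "loc_integrable (\<phi> j)" for j
  using Ck_continuous[OF CkcD[OF \<phi>[of j]]] by (intro loc_integrable_continuous) (auto intro: continuous_on_subset)
 have Fi: "loc_integrable (laplacian (\<phi> j))" for j
  using Ck_continuous[OF CkcD[OF Ckc_laplacian[OF \<phi>[of j]]]] by (intro loc_integrable_continuous) (auto intro: continuous_on_subset)
 have ui: "loc_integrable u" using Ckc_borel[OF \<phi>] by (intro L1loc_lim_loc_integrable[OF \<phi>i um _ u]) auto
 have fi: "loc_integrable f" using Ckc_borel[OF Ckc_laplacian[OF \<phi>]] by (intro L1loc_lim_loc_integrable[OF Fi fm _ f]) auto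
 have "(LINT x|lborel. u x * laplacian \<psi> x) = (LINT x|lborel. f x * \<psi> x)" if \<psi>: "\<psi> \<in> Ckc 2" for \<psi>
 proof (rule LIMSEQ_unique)
  show "(\<lambda>j. LINT x|lborel. \<phi> j x * laplacian \<psi> x) \<longlonglongrightarrow> (LINT x|lborel. u x * laplacian \<psi> x)"
   by (rule L1loc_lim_integral[OF \<phi>i ui u Ckc_laplacian[OF \<psi>]])
  show "(\<lambda>j. LINT x|lborel. \<phi> j x * laplacian \<psi> x) \<longlonglongrightarrow> (LINT x|lborel. f x * \<psi> x)"
   unfolding integral_laplacian_Ckc[OF \<phi> \<psi>] by (rule L1loc_lim_integral[OF Fi fi f \<psi>])
 qed
 then show ?thesis using ui fi by (simp add: is_weak_laplacian_def)
qed

lemma loc_integrable_diff: "loc_integrable f \<Longrightarrow> loc_integrable g \<Longrightarrow> loc_integrable (\<lambda>x. f x - g x)"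
 unfolding loc_integrable_def by (auto intro: set_integral_diff)

text \<open>\<open>wlap\<close> is a choice among all weak Laplacians. Exhibiting one makes the
  choice legitimate, and \<open>du_Bois_Reymond\<close> shows that it agrees with the exhibited one
  almost everywhere.\<close>

lemma wlap_AE:
 fixes u :: "'a::euclidean_space \<Rightarrow> real"
 assumes f: "is_weak_laplacian u f"
 shows "AE x in lborel. wlap u x = f x"
proof -
 have g: "is_weak_laplacian u (wlap u)" unfolding wlap_def by (rule someI[where P = "is_weak_laplacian u", OF f])
 have "AE x in lborel. wlap u x - f x = 0"
 proof (rule du_Bois_Reymond)
  show "loc_integrable (\<lambda>x. wlap u x - f x)"
   using f g by (auto simp: is_weak_laplacian_def intro: loc_integrable_diff)
  fix \<phi> :: "'a \<Rightarrow> real" assume \<phi>: "\<phi> \<in> Ckc 2"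
  have "integrable lborel (\<lambda>x. wlap u x * \<phi> x)" "integrable lborel (\<lambda>x. f x * \<phi> x)"
   using f g \<phi> by (auto simp: is_weak_laplacian_def intro: loc_integrable_mult_Ckc)
  then show "(LINT x|lborel. (wlap u x - f x) * \<phi> x) = 0"
   using f g \<phi> by (simp add: left_diff_distrib is_weak_laplacian_def)
 qed
 then show ?thesis by simp
qed

lemma wgrad_AE:
 fixes u :: "'a::euclidean_space \<Rightarrow> real"
 assumes G: "is_weak_gradient u G"
 shows "AE x in lborel. wgrad u x = G x"
proof -
 have H: "is_weak_gradient u (wgrad u)" unfolding wgrad_def by (rule someI[where P = "is_weak_gradient u", OF G])
 have "AE x in lborel. wgrad u x \<bullet> b - G x \<bullet> b = 0" if b: "b \<in> Basis" for b
 proof (rule du_Bois_Reymond)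
  have li: "loc_integrable (\<lambda>x. wgrad u x \<bullet> b)" "loc_integrable (\<lambda>x. G x \<bullet> b)"
   using G H by (auto simp: is_weak_gradient_def intro: loc_integrable_inner)
  then show "loc_integrable (\<lambda>x. wgrad u x \<bullet> b - G x \<bullet> b)" by (rule loc_integrable_diff)
  fix \<phi> :: "'a \<Rightarrow> real" assume \<phi>: "\<phi> \<in> Ckc 2"
  have "integrable lborel (\<lambda>x. (wgrad u x \<bullet> b) * \<phi> x)" "integrable lborel (\<lambda>x. (G x \<bullet> b) * \<phi> x)"
   using li \<phi> by (auto intro: loc_integrable_mult_Ckc)
  then show "(LINT x|lborel. (wgrad u x \<bullet> b - G x \<bullet> b) * \<phi> x) = 0"
   using G H Ckc_2D[OF \<phi>] b by (simp add: left_diff_distrib is_weak_gradient_def)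
 qed
 then have "AE x in lborel. \<forall>b\<in>Basis. wgrad u x \<bullet> b - G x \<bullet> b = 0"
  by (intro AE_finite_allI) auto
 then show ?thesis by eventually_elim (auto intro: euclidean_eqI)
qed

subsection \<open>Calculus on the half-line\<close>

text \<open>One margin \<delta> over the borderline 1 / s serves both ends; applications take the
  minimum of the margins available at 0 and at infinity.\<close>

lemma integrable_powr_bounds:
 fixes f :: "real \<Rightarrow> real"
 assumes \<delta>: "0 < \<delta>" and [measurable]: "f \<in> Borel"
  and f0: "\<And>s. 0 < s \<Longrightarrow> s \<le> 1 \<Longrightarrow> \<bar>f s\<bar> \<le> C * s powr (\<delta> - 1)"
  and f1: "\<And>s. 1 \<le> s \<Longrightarrow> \<bar>f s\<bar> \<le> C * s powr (- \<delta> - 1)"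
 shows "integrable lborel (\<lambda>s. indicator {0<..} s * f s)"
proof (rule Bochner_Integration.integrable_bound)
 have C: "0 \<le> C" using f0[of 1] by simp
 have "(\<lambda>s. s powr (\<delta> - 1)) absolutely_integrable_on {0..1}"
  using \<delta> by (subst absolutely_integrable_on_iff_nonneg) (auto intro!: integrable_on_powr_from_0)
 then have 1: "integrable lborel (\<lambda>s. indicator {0..1} s * s powr (\<delta> - 1))"
  unfolding set_integrable_def by (subst (asm) integrable_completion) auto
 have "(\<lambda>s. s powr (- \<delta> - 1)) absolutely_integrable_on {1..}"
  using \<delta> has_integral_powr_to_inf[of "- \<delta> - 1" 1]
  by (subst absolutely_integrable_on_iff_nonneg) (auto simp: integrable_on_def)
 then have 2: "integrable lborel (\<lambda>s. indicator {1..} s * s powr (- \<delta> - 1))"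
  unfolding set_integrable_def by (subst (asm) integrable_completion) auto
 show "integrable lborel (\<lambda>s. C * (indicator {0..1} s * s powr (\<delta> - 1) + indicator {1..} s * s powr (- \<delta> - 1)))"
  using 1 2 by (intro integrable_mult_right Bochner_Integration.integrable_add)
 show "AE s in lborel. norm (indicator {0<..} s * f s) \<le> norm (C * (indicator {0..1} s * s powr (\<delta> - 1) + indicator {1..} s * s powr (- \<delta> - 1)))"
 proof (rule AE_I2)
  fix s :: real
  have *: "norm (indicator {0<..} s * f s) \<le> C * (indicator {0..1} s * s powr (\<delta> - 1) + indicator {1..} s * s powr (- \<delta> - 1))"
   using f0[of s] f1[of s] C by (cases "s \<le> 0"; cases "s \<le> 1"; cases "s = 1") (auto simp: algebra_simps)
  then show "norm (indicator {0<..} s * f s) \<le> norm (C * (indicator {0..1} s * s powr (\<delta> - 1) + indicator {1..} s * s powr (- \<delta> - 1)))"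
   by (rule order_trans) simp
 qed
qed simp

lemma abs_powr_has_real_derivative:
 fixes x r :: real
 assumes r: "1 < r"
 shows "DERIV (\<lambda>x. \<bar>x\<bar> powr r) x :> r * \<bar>x\<bar> powr (r - 1) * sgn x"
proof -
 consider "x < 0" | "x > 0" | "x = 0" by linarith
 then show ?thesis
 proof cases
  case 1
  have "DERIV (\<lambda>x. (- x) powr r) x :> - (r * (- x) powr (r - 1))"
   using 1 by (auto intro!: derivative_eq_intros)
  then have "DERIV (\<lambda>x. \<bar>x\<bar> powr r) x :> - (r * (- x) powr (r - 1))"
   by (rule has_field_derivative_transform_within[where d = "- x"]) (use 1 in \<open>auto simp: dist_real_def\<close>)
  then show ?thesis using 1 by simp
 next
  case 2
  have "DERIV (\<lambda>x. x powr r) x :> r * x powr (r - 1)"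
   using 2 by (auto intro!: derivative_eq_intros)
  then have "DERIV (\<lambda>x. \<bar>x\<bar> powr r) x :> r * x powr (r - 1)"
   by (rule has_field_derivative_transform_within[where d = x]) (use 2 in \<open>auto simp: dist_real_def\<close>)
  then show ?thesis using 2 by simp
 next
  case 3
  have "(\<lambda>h::real. \<bar>h\<bar> powr r / h) \<midarrow>0\<rightarrow> 0"
  proof (rule Lim_null_comparison)
   show "\<forall>\<^sub>F h in at (0::real). norm (\<bar>h\<bar> powr r / h) \<le> \<bar>h\<bar> powr (r - 1)"
    by (intro always_eventually) (auto simp: powr_diff)
   have "((\<lambda>h::real. \<bar>h\<bar> powr (r - 1)) \<longlongrightarrow> \<bar>0\<bar> powr (r - 1)) (at 0)"
    using r by (intro tendsto_intros tendsto_powr2) (auto intro: always_eventually)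
   then show "(\<lambda>h::real. \<bar>h\<bar> powr (r - 1)) \<midarrow>0\<rightarrow> 0" using r by simp
  qed
  then show ?thesis using 3 r by (simp add: has_field_derivative_iff)
 qed
qed

lemma abs_powr_comp_has_real_derivative:
 fixes r s :: real
 assumes "1 < r" "DERIV W s :> W'"
 shows "DERIV (\<lambda>s. \<bar>W s\<bar> powr r) s :> r * \<bar>W s\<bar> powr (r - 1) * sgn (W s) * W'"
 using DERIV_chain2[OF abs_powr_has_real_derivative[OF assms(1)] assms(2)] .

text \<open>Applied to functions that vanish for t \<le> 0, so that it is the integral from 0; it
  then vanishes for y \<le> 0.\<close>

definition prim :: "(real \<Rightarrow> real) \<Rightarrow> real \<Rightarrow> real" where
 "prim f y = (LINT t:{..y}|lborel. f t)"

text \<open>f agrees with the continuous V only almost everywhere. This is how an L^p function known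
  through an equation almost everywhere acquires a differentiable primitive.\<close>

lemma prim_has_real_derivative_local:
 assumes f: "\<And>y. set_integrable lborel {..y} f" and c: "continuous_on {0<..} V"
  and fV: "AE s in lborel. 0 < s \<longrightarrow> f s = V s" and \<theta>: "0 < \<theta>"
 shows "DERIV (prim f) \<theta> :> V \<theta>"
proof -
 define a b where "a = \<theta> / 2" and "b = 2 * \<theta>"
 have ab: "0 < a" "a < \<theta>" "\<theta> < b" using \<theta> by (auto simp: a_def b_def)
 have si: "set_integrable lborel A f" if "A \<in> sets borel" "A \<subseteq> {..y}" for A y
  using that by (intro set_integrable_subset[OF f[of y]]) simp_all
 have eq: "prim f a + integral {a..y} V = prim f y" if "y \<in> {a<..<b}" for y
 proof -
  have "{..y} = {..<a} \<union> {a..y}" using that by auto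
  then have "prim f y = (LINT t:{..<a} \<union> {a..y}|lborel. f t)" by (simp add: prim_def)
  also have "\<dots> = (LINT t:{..<a}|lborel. f t) + (LINT t:{a..y}|lborel. f t)"
   using that by (intro set_integral_Un) (auto intro: si[of _ y])
  also have "(LINT t:{..<a}|lborel. f t) = prim f a"
   unfolding prim_def set_lebesgue_integral_def
  proof (rule integral_cong_AE)
   show "AE t in lborel. indicator {..<a} t *\<^sub>R f t = indicator {..a} t *\<^sub>R f t"
    using AE_lborel_singleton[of a] by eventually_elim (auto simp: indicator_def)
   have "{..<a} \<subseteq> {..a}" by auto
   then have "set_integrable lborel {..<a} f" by (intro si[of _ a]) simp_all
   then show "(\<lambda>t. indicator {..<a} t *\<^sub>R f t) \<in> borel_measurable lborel"
    unfolding set_integrable_def by (rule borel_measurable_integrable)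
   show "(\<lambda>t. indicator {..a} t *\<^sub>R f t) \<in> borel_measurable lborel"
    using f[of a] unfolding set_integrable_def by (rule borel_measurable_integrable)
  qed
  also have "(LINT t:{a..y}|lborel. f t) = (LINT t:{a..y}|lborel. V t)"
   unfolding set_lebesgue_integral_def
  proof (rule integral_cong_AE)
   show "AE t in lborel. indicator {a..y} t *\<^sub>R f t = indicator {a..y} t *\<^sub>R V t"
    using fV by eventually_elim (use ab in \<open>auto simp: indicator_def\<close>)
   show "(\<lambda>t. indicator {a..y} t *\<^sub>R f t) \<in> borel_measurable lborel"
    using si[of "{a..y}" y] by (auto simp: set_integrable_def)
   have "(\<lambda>t. indicator {a..y} t *\<^sub>R V t) \<in> Borel"
    by (rule borel_measurable_continuous_on_indicator) (use ab in \<open>auto intro!: continuous_on_subset[OF c]\<close>)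
   then show "(\<lambda>t. indicator {a..y} t *\<^sub>R V t) \<in> borel_measurable lborel" by simp
  qed
  also have "(LINT t:{a..y}|lborel. V t) = integral {a..y} V"
  proof (rule set_borel_integral_eq_integral)
   show "set_integrable lborel {a..y} V" unfolding set_integrable_def
    by (rule borel_integrable_compact) (use ab in \<open>auto intro!: continuous_on_subset[OF c]\<close>)
  qed
  finally show ?thesis by simp
 qed
 have "((\<lambda>y. integral {a..y} V) has_real_derivative V \<theta>) (at \<theta> within {a..b})"
  using ab by (intro integral_has_real_derivative continuous_on_subset[OF c]) auto
 then have "DERIV (\<lambda>y. integral {a..y} V) \<theta> :> V \<theta>"
  using ab by (simp add: at_within_Icc_at)
 then have "DERIV (\<lambda>y. prim f a + integral {a..y} V) \<theta> :> 0 + V \<theta>"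
  by (intro DERIV_add) auto
 then have "DERIV (\<lambda>y. prim f a + integral {a..y} V) \<theta> :> V \<theta>" by simp
 then show ?thesis
  by (rule has_field_derivative_transform_within_open[of _ _ _ "{a<..<b}"]) (use ab eq in auto)
qed

lemma prim_has_real_derivative:
 assumes f: "integrable lborel f" and c: "continuous_on {0<..} f" and \<theta>: "0 < \<theta>"
 shows "DERIV (prim f) \<theta> :> f \<theta>"
proof (rule prim_has_real_derivative_local[OF _ c _ \<theta>])
 show "set_integrable lborel {..y} f" for y
  unfolding set_integrable_def using f by (intro integrable_mult_indicator) auto
qed simp

lemma prim_at_top: "integrable lborel f \<Longrightarrow> (prim f \<longlongrightarrow> (LINT t|lborel. f t)) at_top"
 unfolding prim_def set_lebesgue_integral_def by (rule tendsto_integral_at_top) simp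

lemma prim_mono:
 assumes "integrable lborel f" "\<And>t. 0 \<le> f t" "x \<le> y"
 shows "prim f x \<le> prim f y"
 unfolding prim_def set_lebesgue_integral_def
 using assms by (intro integral_mono integrable_mult_indicator) (auto simp: indicator_def)

lemma prim_le_total:
 assumes "integrable lborel f" "\<And>t. 0 \<le> f t"
 shows "prim f x \<le> (LINT t|lborel. f t)"
 unfolding prim_def set_lebesgue_integral_def
 using assms by (intro integral_mono integrable_mult_indicator) (auto simp: indicator_def)

lemma prim_eq_0:
 assumes "\<And>t. t \<le> y \<Longrightarrow> f t = 0"
 shows "prim f y = 0"
 unfolding prim_def set_lebesgue_integral_def using assms
 by (intro integral_eq_zero_AE AE_I2) (auto simp: indicator_def)

lemma prim_nonneg: "(\<And>t. 0 \<le> f t) \<Longrightarrow> 0 \<le> prim f y"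
 unfolding prim_def set_lebesgue_integral_def by (intro integral_nonneg_AE AE_I2) auto

lemma prim_le_linear:
 assumes "integrable lborel f" "\<And>t. t \<le> 0 \<Longrightarrow> f t = 0" "\<And>t. 0 < t \<Longrightarrow> t \<le> y \<Longrightarrow> f t \<le> M" "0 \<le> y" "0 \<le> M"
 shows "prim f y \<le> M * y"
proof -
 have "prim f y \<le> (LINT t|lborel. M * indicator {0..y} t)"
  unfolding prim_def set_lebesgue_integral_def
 proof (rule integral_mono)
  show "integrable lborel (\<lambda>t. indicator {..y} t *\<^sub>R f t)" using assms by (intro integrable_mult_indicator) auto
  show "integrable lborel (\<lambda>t. M * indicator {0..y} t :: real)" using assms(4) by (intro integrable_mult_right) (simp add: integrable_indicator_iff)
  show "indicator {..y} t *\<^sub>R f t \<le> M * indicator {0..y} t" for t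
   using assms(2)[of t] assms(3)[of t] assms(5) by (cases "t \<le> 0") (auto simp: indicator_def)
 qed
 also have "\<dots> = M * y" using assms(4) by simp
 finally show ?thesis .
qed

text \<open>The test functions of the half-line, extended by 0 to the whole line. They are of class
  C^1 because the flux of a C^2 profile H contains H'; the derivative is carried as a second
  argument.\<close>

definition C1c :: "(real \<Rightarrow> real) \<Rightarrow> (real \<Rightarrow> real) \<Rightarrow> bool" where
 "C1c W W' \<longleftrightarrow> (\<forall>s. DERIV W s :> W' s) \<and> continuous_on UNIV W' \<and>
   (\<exists>a b. 0 < a \<and> a < b \<and> (\<forall>s. s \<notin> {a..b} \<longrightarrow> W s = 0))"

lemma C1cE:
 assumes "C1c W W'"
 obtains a b where "0 < a" "a < b" "\<And>s. s \<notin> {a..b} \<Longrightarrow> W s = 0" "\<And>s. s \<notin> {a..b} \<Longrightarrow> W' s = 0" "W a = 0" "W b = 0"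
  "\<And>s. DERIV W s :> W' s" "continuous_on UNIV W'" "continuous_on UNIV W"
proof -
 obtain a b where ab: "0 < a" "a < b" "\<And>s. s \<notin> {a..b} \<Longrightarrow> W s = 0" using assms by (auto simp: C1c_def)
 have d: "\<And>s. DERIV W s :> W' s" and c: "continuous_on UNIV W'" using assms by (auto simp: C1c_def)
 have "W' s = 0" if "s \<notin> {a..b}" for s
 proof -
  have "DERIV (\<lambda>_. 0) s :> 0" by simp
  then have "DERIV W s :> 0"
   by (rule has_field_derivative_transform_within_open[of _ _ _ "- {a..b}"]) (use that ab in auto)
  then show ?thesis using d DERIV_unique by blast
 qed
 moreover have Wc: "continuous_on UNIV W" using d by (auto intro!: continuous_at_imp_continuous_on DERIV_isCont)
 have Wcl: "closed {s. W s = 0}"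
  using continuous_closed_preimage_constant[OF Wc, of 0] by simp
 have "W a = 0"
 proof -
  have "a \<in> closure {..<a}" by simp
  also have "closure {..<a} \<subseteq> {s. W s = 0}" using ab(3) by (intro closure_minimal Wcl) auto
  finally show ?thesis by simp
 qed
 moreover have "W b = 0"
 proof -
  have "b \<in> closure {b<..}" by simp
  also have "closure {b<..} \<subseteq> {s. W s = 0}" using ab(3) by (intro closure_minimal Wcl) auto
  finally show ?thesis by simp
 qed
 ultimately show thesis using that[OF ab] d c Wc by blast
qed

lemma integrable_continuous_Icc_support:
 fixes f :: "real \<Rightarrow> real"
 assumes c: "continuous_on {a..b} f" and z: "\<And>s. s \<notin> {a..b} \<Longrightarrow> f s = 0"
 shows "integrable lborel f"
proof -
 have "integrable lborel (\<lambda>s. indicator {a..b} s *\<^sub>R f s)"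
  by (rule borel_integrable_compact) (use c in auto)
 also have "(\<lambda>s. indicator {a..b} s *\<^sub>R f s) = f" using z by (auto simp: indicator_def fun_eq_iff)
 finally show ?thesis .
qed

lemma DERIV_0_half_line:
 fixes f :: "real \<Rightarrow> real"
 assumes "\<And>s. 0 < s \<Longrightarrow> DERIV f s :> 0"
 obtains c where "\<And>s. 0 < s \<Longrightarrow> f s = c"
proof -
 have "\<exists>c. \<forall>s\<in>{0<..}. f s = c"
  using has_field_derivative_zero_constant[of "{0<..}" f] has_field_derivative_at_within[of f 0] assms by simp
 then show thesis using that unfolding Ball_def greaterThan_iff by blast
qed

lemma DERIV_continuous_half_line:
 fixes f :: "real \<Rightarrow> real"
 shows "(\<And>s. 0 < s \<Longrightarrow> DERIV f s :> f' s) \<Longrightarrow> continuous_on {0<..} f"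
 by (auto intro!: continuous_at_imp_continuous_on DERIV_isCont)

lemma DERIV_le_imp_diff_le:
 fixes f g :: "real \<Rightarrow> real"
 assumes "a \<le> b" and "\<And>s. a \<le> s \<Longrightarrow> s \<le> b \<Longrightarrow> DERIV f s :> f' s"
  and "\<And>s. a \<le> s \<Longrightarrow> s \<le> b \<Longrightarrow> DERIV g s :> g' s"
  and "\<And>s. a \<le> s \<Longrightarrow> s \<le> b \<Longrightarrow> f' s \<le> g' s"
 shows "f b - f a \<le> g b - g a"
proof -
 have "g a - f a \<le> g b - f b"
 proof (rule DERIV_nonneg_imp_nondecreasing[OF assms(1)])
  fix s assume "a \<le> s" "s \<le> b"
  then show "\<exists>y. DERIV (\<lambda>s. g s - f s) s :> y \<and> 0 \<le> y"
   using assms(2-4)[of s] by (intro exI[of _ "g' s - f' s"]) (auto intro: DERIV_diff)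
 qed
 then show ?thesis by simp
qed

subsection \<open>The extremal function of Bliss' inequality\<close>

locale bliss =
 fixes p q :: real
 assumes p: "1 < p" and pq: "p < q"
begin

text \<open>\<mu> is the reciprocal of the exponent conjugate to p. The number m is the exponent in
  the extremal function s (1 + s^m)^(-1/m), and d is the power of 1 + s^m that divides both of its
  densities (\<open>bub'_powr\<close>, \<open>bub_powr\<close>).\<close>

definition \<mu> :: real where "\<mu> = (p - 1) / p"
definition m :: real where "m = (q - p) / p"
definition d :: real where "d = q / m"

lemma \<mu>: "0 < \<mu>" "\<mu> < 1" "\<mu> * p = p - 1" "1 / p = 1 - \<mu>"
 using p by (auto simp: \<mu>_def field_simps)

lemma m: "0 < m" "q * \<mu> = q - 1 - m" "q / p = 1 + m" "q = p + p * m"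
 using p pq by (auto simp: m_def \<mu>_def field_simps)

lemma q: "1 < q" "0 < q * \<mu>" using p pq \<mu> by auto

lemma d: "1 < d" "0 < d" "m * d = q" "p * (1 / m + 1) = d" "1 / m + (p - 1) * (1 / m + 1) + 1 = d"
proof -
 have "m < q" using p pq m(2) q by simp
 then show "1 < d" "0 < d" using m(1) by (auto simp: d_def)
 show md: "m * d = q" using m(1) by (simp add: d_def)
 have "m * (p * (1 / m + 1)) = p + p * m" using m(1) by (simp add: algebra_simps)
 then show pd: "p * (1 / m + 1) = d" using md m(1,4) by (metis mult_cancel_left less_irrefl)
 have "1 / m + (p - 1) * (1 / m + 1) + 1 = p * (1 / m + 1)" by (simp add: algebra_simps diff_divide_distrib)
 then show "1 / m + (p - 1) * (1 / m + 1) + 1 = d" using pd by simp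
qed

lemma one_plus_pos: "0 < 1 + s powr r" for s r :: real
 by (smt (verit) powr_ge_zero)

definition bub :: "real \<Rightarrow> real" where "bub s = s * (1 + s powr m) powr (- (1 / m))"
definition bub' :: "real \<Rightarrow> real" where "bub' s = (1 + s powr m) powr (- (1 / m) - 1)"

lemma bub_pos: "0 < s \<Longrightarrow> 0 < bub s"
 using one_plus_pos[of s m] by (simp add: bub_def)

lemma bub'_pos: "0 < bub' s"
 using one_plus_pos[of s m] by (simp add: bub'_def)

lemma powr_m_mult: "0 < s \<Longrightarrow> s * s powr (m - 1) = s powr m"
 by (simp add: powr_diff)

lemma bub_has_real_derivative:
 assumes "0 < s"
 shows "DERIV bub s :> bub' s"
proof -
 let ?y = "1 + s powr m"
 have y: "0 < ?y" by (rule one_plus_pos)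
 have "DERIV bub s :> ?y powr (- (1 / m)) + s * (- (1 / m) * ?y powr (- (1 / m) - 1) * (m * s powr (m - 1)))"
  unfolding bub_def using assms y m(1) by (auto intro!: derivative_eq_intros)
 moreover have "?y powr (- (1 / m)) + s * (- (1 / m) * ?y powr (- (1 / m) - 1) * (m * s powr (m - 1)))
   = ?y powr (- (1 / m)) - ?y powr (- (1 / m) - 1) * s powr m"
  using m(1) powr_m_mult[OF assms] by (simp add: algebra_simps)
 moreover have "?y powr (- (1 / m)) = ?y powr (- (1 / m) - 1) * ?y"
  using y by (simp add: powr_diff)
 ultimately show ?thesis by (simp add: bub'_def algebra_simps)
qed

lemma bub'_powr: "bub' s powr p = (1 + s powr m) powr (- d)"
proof -
 have "(- (1 / m) - 1) * p = - d" using d(4) by (simp add: algebra_simps)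
 then show ?thesis using one_plus_pos[of s m] by (simp add: bub'_def powr_powr)
qed

lemma bub_powr: "0 < s \<Longrightarrow> s powr (- 1 - q * \<mu>) * bub s powr q = s powr m * (1 + s powr m) powr (- d)"
proof -
 assume s: "0 < s"
 have "bub s powr q = s powr q * (1 + s powr m) powr (- d)"
  using s one_plus_pos[of s m] by (simp add: bub_def powr_mult powr_powr d_def)
 moreover have "s powr (- 1 - q * \<mu>) * s powr q = s powr m"
  using m(2) by (simp flip: powr_add)
 ultimately show ?thesis by (simp add: mult.assoc[symmetric])
qed

text \<open>By \<open>bub_powr\<close> and \<open>bub'_powr\<close>, \<open>jst\<close> is the
  weighted q-density of the extremal function and \<open>mst\<close> its energy density. For s > 0
  their quotient mst / jst is s powr (- m), the relation that closes the transport argument.\<close>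

definition jst :: "real \<Rightarrow> real" where "jst s = indicator {0<..} s * (s powr m * (1 + s powr m) powr (- d))"
definition mst :: "real \<Rightarrow> real" where "mst s = indicator {0<..} s * (1 + s powr m) powr (- d)"

lemma one_plus_powr_le:
 assumes "0 < s" "0 \<le> r"
 shows "(1 + s powr m) powr (- r) \<le> 1" "(1 + s powr m) powr (- r) \<le> s powr (- (m * r))"
proof -
 have "1 powr r \<le> (1 + s powr m) powr r" using assms by (intro powr_mono2) auto
 then show "(1 + s powr m) powr (- r) \<le> 1" using one_plus_pos[of s m] by (simp add: powr_minus inverse_le_1_iff)
 have "s powr (m * r) = (s powr m) powr r" by (simp add: powr_powr)
 also have "\<dots> \<le> (1 + s powr m) powr r" using assms by (intro powr_mono2) auto
 finally show "(1 + s powr m) powr (- r) \<le> s powr (- (m * r))"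
  using assms by (simp add: powr_minus le_imp_inverse_le)
qed

lemma jst_bounds: "0 \<le> jst s" "s \<le> 0 \<Longrightarrow> jst s = 0" "0 < s \<Longrightarrow> 0 < jst s" "0 < s \<Longrightarrow> jst s \<le> s powr m"
 using one_plus_powr_le(1)[of s d] d(2) one_plus_pos[of s m] by (auto simp: jst_def mult_left_le indicator_def)

lemma mst_bounds: "0 \<le> mst s" "s \<le> 0 \<Longrightarrow> mst s = 0" "0 < s \<Longrightarrow> mst s \<le> 1"
 using one_plus_powr_le(1)[of s d] d(2) by (auto simp: mst_def)

lemma jst_integrable: "integrable lborel jst"
 unfolding jst_def
proof (rule integrable_powr_bounds[where C = 1 and \<delta> = "min 1 (q * \<mu>)"])
 fix s :: real assume s: "0 < s" "s \<le> 1"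
 have "s powr m * (1 + s powr m) powr (- d) \<le> 1 * 1"
  using s m(1) one_plus_powr_le(1)[of s d] d(2) powr_le1[of m s] by (intro mult_mono) auto
 also have "\<dots> \<le> s powr (min 1 (q * \<mu>) - 1)" using s powr_mono'[of "min 1 (q * \<mu>) - 1" 0 s] by simp
 finally show "\<bar>s powr m * (1 + s powr m) powr (- d)\<bar> \<le> 1 * s powr (min 1 (q * \<mu>) - 1)" by simp
next
 fix s :: real assume s: "1 \<le> s"
 have "s powr m * (1 + s powr m) powr (- d) \<le> s powr m * s powr (- q)"
  using one_plus_powr_le(2)[of s d] d(2,3) s by (intro mult_left_mono) auto
 also have "\<dots> = s powr (- (q * \<mu>) - 1)" using m(2) s by (simp flip: powr_add)
 also have "\<dots> \<le> s powr (- min 1 (q * \<mu>) - 1)" using s by (intro powr_mono) auto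
 finally show "\<bar>s powr m * (1 + s powr m) powr (- d)\<bar> \<le> 1 * s powr (- min 1 (q * \<mu>) - 1)" by simp
qed (use q in auto)

lemma mst_integrable: "integrable lborel mst"
 unfolding mst_def
proof (rule integrable_powr_bounds[where C = 1 and \<delta> = "min 1 (q - 1)"])
 fix s :: real assume s: "0 < s" "s \<le> 1"
 have "(1 + s powr m) powr (- d) \<le> 1" using one_plus_powr_le(1)[of s d] d(2) s by simp
 also have "\<dots> \<le> s powr (min 1 (q - 1) - 1)" using s powr_mono'[of "min 1 (q - 1) - 1" 0 s] by simp
 finally show "\<bar>(1 + s powr m) powr (- d)\<bar> \<le> 1 * s powr (min 1 (q - 1) - 1)" by simp
next
 fix s :: real assume s: "1 \<le> s"
 have "(1 + s powr m) powr (- d) \<le> s powr (- q)"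
  using one_plus_powr_le(2)[of s d] d(2,3) s by simp
 also have "\<dots> \<le> s powr (- min 1 (q - 1) - 1)" using s by (intro powr_mono) auto
 finally show "\<bar>(1 + s powr m) powr (- d)\<bar> \<le> 1 * s powr (- min 1 (q - 1) - 1)" by simp
qed (use q in auto)

lemma jst_continuous: "continuous_on {0<..} jst"
proof -
 have "continuous_on {0<..} (\<lambda>s. s powr m * (1 + s powr m) powr (- d))"
  by (intro continuous_intros) (use one_plus_pos in \<open>auto simp: less_imp_neq[symmetric]\<close>)
 then show ?thesis by (rule continuous_on_eq) (auto simp: jst_def)
qed

lemma mst_continuous: "continuous_on {0<..} mst"
proof -
 have "continuous_on {0<..} (\<lambda>s. (1 + s powr m) powr (- d))"
  by (intro continuous_intros) (use one_plus_pos in \<open>auto simp: less_imp_neq[symmetric]\<close>)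
 then show ?thesis by (rule continuous_on_eq) (auto simp: mst_def)
qed

definition Jst :: real where "Jst = (LINT s|lborel. jst s)"
definition Nst :: real where "Nst = (LINT s|lborel. mst s)"

text \<open>The equation of the extremal function tested with the function itself. The boundary term
  F has derivative \<open>mst - \<mu> * q * jst\<close> and tends to 0 at both ends, as F s is at
  most s and at most s powr (- (q * \<mu>)).\<close>

lemma Nst_eq: "Nst = \<mu> * q * Jst"
proof -
 \<comment> \<open>For s > 0 this is \<open>bub s * bub' s powr (p - 1)\<close>, because d = p (1 /
   m + 1).\<close>
 define F where "F = (\<lambda>s::real. s * (1 + s powr m) powr (1 - d))"
 have F': "DERIV F s :> mst s - \<mu> * q * jst s" if s: "0 < s" for s
 proof -
  let ?y = "1 + s powr m"
  have y: "0 < ?y" by (rule one_plus_pos)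
  have "DERIV F s :> ?y powr (1 - d) + s * ((1 - d) * ?y powr (1 - d - 1) * (m * s powr (m - 1)))"
   unfolding F_def using s y by (auto intro!: derivative_eq_intros)
  also have "s * ((1 - d) * ?y powr (1 - d - 1) * (m * s powr (m - 1))) = (m - m * d) * (s * s powr (m - 1)) * ?y powr (- d)"
   by (simp add: algebra_simps)
  also have "s * s powr (m - 1) = s powr m" by (rule powr_m_mult[OF s])
  also have "?y powr (1 - d) = ?y * ?y powr (- d)" using y by (simp add: powr_diff powr_minus field_simps)
  also have "?y * ?y powr (- d) + (m - m * d) * s powr m * ?y powr (- d) = mst s - \<mu> * q * jst s"
  proof -
   have kq: "\<mu> * q = q - 1 - m" using m(2) by (simp add: mult.commute)
   show ?thesis unfolding kq d(3) using s by (simp add: mst_def jst_def algebra_simps)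
  qed
  finally show ?thesis .
 qed
 define D where "D = (\<lambda>s. prim mst s - \<mu> * q * prim jst s - F s)"
 have "DERIV D s :> 0" if "0 < s" for s
  unfolding D_def using prim_has_real_derivative[OF mst_integrable mst_continuous that]
   prim_has_real_derivative[OF jst_integrable jst_continuous that] F'[OF that]
  by (auto intro!: derivative_eq_intros)
 from DERIV_0_half_line[OF this] obtain c where "\<And>s. 0 < s \<Longrightarrow> D s = c" by blast
 then have const: "D s = D 1" if "0 < s" for s
  using that by (metis zero_less_one)
 have Dst: "\<bar>D s\<bar> \<le> (2 + \<mu> * q) * s" if "0 < s" "s \<le> 1" for s
 proof -
  have "prim mst s \<le> 1 * s" using that mst_bounds by (intro prim_le_linear mst_integrable) auto
  moreover have "prim jst s \<le> 1 * s"
  proof (intro prim_le_linear jst_integrable)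
   fix t assume "0 < t" "t \<le> s"
   then have "jst t \<le> t powr m" "t powr m \<le> 1" using jst_bounds that m(1) by (auto intro: powr_le1)
   then show "jst t \<le> 1" by simp
  qed (use that jst_bounds in auto)
  moreover have "0 \<le> prim mst s" "0 \<le> prim jst s" using mst_bounds jst_bounds by (auto intro: prim_nonneg)
  moreover have "0 \<le> F s" "F s \<le> s"
   using one_plus_powr_le(1)[of s "d - 1"] d(1) that by (auto simp: F_def mult_left_le)
  moreover have "\<mu> * q * prim jst s \<le> \<mu> * q * s" "0 \<le> \<mu> * q * prim jst s"
   using calculation q \<mu> by (auto intro!: mult_left_mono mult_nonneg_nonneg)
  ultimately show ?thesis unfolding D_def distrib_right by linarith
 qed
 have D0: "D 1 = 0"
 proof (rule tendsto_unique[of "at_right 0"])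
  show "(D \<longlongrightarrow> D 1) (at_right 0)"
   using eventually_at_right_less[of 0] by (intro tendsto_eventually) (auto elim!: eventually_mono intro: const)
  show "(D \<longlongrightarrow> 0) (at_right 0)"
  proof (rule Lim_null_comparison)
   show "\<forall>\<^sub>F s in at_right 0. norm (D s) \<le> (2 + \<mu> * q) * s"
    using eventually_at_right_real[OF zero_less_one]
   proof eventually_elim
    fix s :: real assume "s \<in> {0<..<1}"
    then show "norm (D s) \<le> (2 + \<mu> * q) * s" using Dst[of s] by simp
   qed
   show "((\<lambda>s. (2 + \<mu> * q) * s) \<longlongrightarrow> 0) (at_right 0)" by (auto intro!: tendsto_eq_intros)
  qed
 qed simp
 have "(D \<longlongrightarrow> Nst - \<mu> * q * Jst - 0) at_top"
  unfolding D_def Nst_def Jst_def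
 proof (intro tendsto_diff tendsto_mult tendsto_const prim_at_top mst_integrable jst_integrable)
  show "(F \<longlongrightarrow> 0) at_top"
  proof (rule Lim_null_comparison)
   show "\<forall>\<^sub>F s in at_top. norm (F s) \<le> s powr (- (q * \<mu>))"
    using eventually_gt_at_top[of 0]
   proof eventually_elim
    fix s :: real assume s: "0 < s"
    have "F s \<le> s * s powr (- (m * (d - 1)))"
     using one_plus_powr_le(2)[of s "d - 1"] d(1) s by (auto simp: F_def intro!: mult_left_mono)
    also have "\<dots> = s powr (1 - m * (d - 1))" using s powr_add[of s 1 "- (m * (d - 1))"] by simp
    also have "1 - m * (d - 1) = - (q * \<mu>)" using d(3) m(2) by (simp add: algebra_simps)
    finally show "norm (F s) \<le> s powr (- (q * \<mu>))" using s by (simp add: F_def)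
   qed
   show "((\<lambda>s. s powr (- (q * \<mu>))) \<longlongrightarrow> 0) at_top"
    using q by (intro tendsto_neg_powr filterlim_ident) auto
  qed
 qed
 moreover have "(D \<longlongrightarrow> 0) at_top"
 proof (rule tendsto_eventually)
  show "\<forall>\<^sub>F s in at_top. D s = 0"
   using eventually_gt_at_top[of 0] by eventually_elim (rule const[unfolded D0])
 qed
 ultimately show ?thesis using tendsto_unique[of at_top D] by fastforce
qed

lemma Jst_pos: "0 < Jst" and Nst_pos: "0 < Nst"
proof -
 have J0: "0 \<le> Jst" unfolding Jst_def by (intro integral_nonneg_AE AE_I2 jst_bounds)
 have "Jst \<noteq> 0"
 proof
  assume "Jst = 0"
  then have "AE s in lborel. jst s = 0"
   unfolding Jst_def using jst_bounds by (subst (asm) integral_nonneg_eq_0_iff_AE[OF jst_integrable]) auto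
  then have "AE s in lborel. s \<notin> {1..2::real}"
  proof eventually_elim
   fix s assume "jst s = 0"
   then have "\<not> 0 < s" using jst_bounds(3)[of s] by auto
   then show "s \<notin> {1..2}" by auto
  qed
  then have "{1..2::real} \<in> null_sets lborel" by (subst AE_iff_null_sets) auto
  then show False by (simp add: null_sets_def)
 qed
 then show "0 < Jst" using J0 by simp
 then show "0 < Nst" unfolding Nst_eq using \<mu> q by simp
qed

end

subsection \<open>Bliss' inequality by mass transport\<close>

lemma prim_continuous_on:
 assumes "integrable lborel f" "continuous_on {0<..} f" "0 < a"
 shows "continuous_on {a..b} (prim f)"
 using DERIV_isCont[OF prim_has_real_derivative[OF assms(1,2)]] assms(3)
 by (intro continuous_at_imp_continuous_on) auto

context bliss
begin

lemma prim_jst_strict_mono: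
 assumes "0 < x" "x < y"
 shows "prim jst x < prim jst y"
proof (rule DERIV_pos_imp_increasing[OF assms(2)])
 fix t assume "x \<le> t" "t \<le> y"
 then have "0 < t" using assms by simp
 then show "\<exists>z. DERIV (prim jst) t :> z \<and> 0 < z"
  using prim_has_real_derivative[OF jst_integrable jst_continuous] jst_bounds(3) by blast
qed

lemma prim_jst_range: "0 < \<theta> \<Longrightarrow> 0 < prim jst \<theta>" "0 < \<theta> \<Longrightarrow> prim jst \<theta> < Jst"
proof -
 assume \<theta>: "0 < \<theta>"
 have "0 \<le> prim jst (\<theta> / 2)" by (intro prim_nonneg jst_bounds)
 then show "0 < prim jst \<theta>" using prim_jst_strict_mono[of "\<theta> / 2" \<theta>] \<theta> by simp
 have "prim jst (\<theta> + 1) \<le> Jst" unfolding Jst_def by (intro prim_le_total jst_integrable jst_bounds)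
 then show "prim jst \<theta> < Jst" using prim_jst_strict_mono[of \<theta> "\<theta> + 1"] \<theta> by simp
qed

text \<open>Read backwards, \<theta> is at least the mass below it to the power 1 / (m + 1). This
  limits how fast \<theta> powr (- (\<mu> * m)) can blow up as the mass tends to 0.\<close>

lemma prim_jst_le: "0 < \<theta> \<Longrightarrow> prim jst \<theta> \<le> \<theta> powr (m + 1)"
proof -
 assume \<theta>: "0 < \<theta>"
 have "prim jst \<theta> \<le> \<theta> powr m * \<theta>"
 proof (intro prim_le_linear jst_integrable)
  fix t assume "0 < t" "t \<le> \<theta>"
  then have "jst t \<le> t powr m" "t powr m \<le> \<theta> powr m" using jst_bounds m(1) by (auto intro: powr_mono2)
  then show "jst t \<le> \<theta> powr m" by simp
 qed (use \<theta> jst_bounds in auto)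
 then show ?thesis using \<theta> by (simp add: powr_add)
qed

lemma prim_mst_le: "0 < \<theta> \<Longrightarrow> prim mst \<theta> \<le> \<theta>"
 using prim_le_linear[of mst \<theta> 1] mst_integrable mst_bounds by simp

lemma prim_jst_surj:
 assumes "0 < y" "y < Jst"
 shows "\<exists>\<theta>>0. prim jst \<theta> = y"
proof -
 define u where "u = (y / 2) powr (1 / (m + 1))"
 have u: "0 < u" using assms by (simp add: u_def)
 have "u powr (m + 1) = y / 2" using assms m(1) by (simp add: u_def powr_powr)
 then have u2: "prim jst u < y" using prim_jst_le[OF u] assms by simp
 have "eventually (\<lambda>\<theta>. y < prim jst \<theta>) at_top"
  using order_tendstoD(1)[OF prim_at_top[OF jst_integrable], of y] assms by (simp add: Jst_def)
 then have "eventually (\<lambda>\<theta>. y < prim jst \<theta> \<and> u < \<theta>) at_top"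
  using eventually_gt_at_top[of u] by (rule eventually_conj)
 then obtain v where v: "y < prim jst v" "u < v" by (auto simp: eventually_at_top_linorder)
 have "\<exists>x\<ge>u. x \<le> v \<and> prim jst x = y"
 proof (rule IVT')
  show "continuous_on {u..v} (prim jst)" by (rule prim_continuous_on[OF jst_integrable jst_continuous u])
 qed (use u2 v in auto)
 then show ?thesis using u by (auto intro: less_le_trans)
qed

text \<open>The inverse of the distribution function of \<open>jst\<close>. Composed with the
  distribution function J of the weighted q-density of W, it is the monotone map that carries this
  measure to \<open>jst\<close> when both have total mass \<open>Jst\<close>.\<close>

definition transport :: "real \<Rightarrow> real" where
 "transport y = (SOME \<theta>. 0 < \<theta> \<and> prim jst \<theta> = y)"

lemma transport:
 assumes "0 < y" "y < Jst"
 shows "0 < transport y" "prim jst (transport y) = y"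
 using someI_ex[of "\<lambda>\<theta>. 0 < \<theta> \<and> prim jst \<theta> = y"] prim_jst_surj[OF assms]
 unfolding transport_def by auto

lemma transport_prim: "0 < \<theta> \<Longrightarrow> transport (prim jst \<theta>) = \<theta>"
 using transport[OF prim_jst_range] prim_jst_strict_mono by (metis linorder_neqE_linordered_idom less_irrefl)

lemma transport_has_real_derivative:
 assumes y: "0 < y" "y < Jst"
 shows "DERIV transport y :> 1 / jst (transport y)"
proof -
 let ?t = "transport y"
 have t: "0 < ?t" "prim jst ?t = y" using transport[OF y] by auto
 have "isCont transport (prim jst ?t)"
 proof (rule isCont_inverse_function2[where a = "?t / 2" and x = ?t and b = "2 * ?t" and f = "prim jst"])
  fix z assume "?t / 2 \<le> z" "z \<le> 2 * ?t"
  then have "0 < z" using t by linarith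
  then show "transport (prim jst z) = z" "isCont (prim jst) z"
   using transport_prim DERIV_isCont[OF prim_has_real_derivative[OF jst_integrable jst_continuous]] by auto
 qed (use t in auto)
 then have "isCont transport y" using t by simp
 then have "DERIV transport y :> inverse (jst ?t)"
  using prim_has_real_derivative[OF jst_integrable jst_continuous t(1)] jst_bounds(3)[OF t(1)] transport y
  by (intro DERIV_inverse_function[of "prim jst" "jst ?t" transport y 0 Jst]) auto
 then show ?thesis by (simp add: inverse_eq_divide)
qed

text \<open>Young's inequality with exponents p and 1 / \<mu>, the first factor being x. The powers
  of \<theta> and s are such that the second term is \<mu> times the density of W times \<theta>
  powr (- m). Equality holds for w = bub s, x = bub' s and \<theta> = s.\<close>

lemma young_step:
 assumes s: "0 < s" and \<theta>: "0 < \<theta>" and w: "0 \<le> w" and x: "0 \<le> x"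
 shows "w powr (q * \<mu>) * x * (\<theta> powr (- (\<mu> * m)) * s powr (\<mu> * m - q * \<mu>))
  \<le> x powr p / p + \<mu> * (s powr (- 1 - q * \<mu>) * w powr q * \<theta> powr (- m))"
proof -
 let ?y = "w powr (q * \<mu>) * (\<theta> powr (- (\<mu> * m)) * s powr (\<mu> * m - q * \<mu>))"
 have "x * ?y \<le> x powr p / p + ?y powr (1 / \<mu>) / (1 / \<mu>)"
 proof (rule Youngs_inequality[OF p _ _ x])
  show "1 < 1 / \<mu>" using \<mu>(1,2) by (simp add: less_divide_eq)
  show "1 / p + 1 / (1 / \<mu>) = 1" using \<mu>(4) by simp
 qed simp
 moreover have "?y powr (1 / \<mu>) = w powr q * (\<theta> powr (- m) * s powr (- 1 - q * \<mu>))"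
 proof -
  have e: "(\<mu> * m - q * \<mu>) / \<mu> = - 1 - q * \<mu>"
  proof -
   have "(\<mu> * m - q * \<mu>) / \<mu> = m - q" using \<mu>(1) by (simp add: diff_divide_distrib)
   then show ?thesis using m(2) by simp
  qed
  have "?y powr (1 / \<mu>) = w powr (q * \<mu> * (1 / \<mu>)) * (\<theta> powr (- (\<mu> * m) * (1 / \<mu>)) * s powr ((\<mu> * m - q * \<mu>) * (1 / \<mu>)))"
   using w \<theta> s by (simp add: powr_mult powr_powr)
  then show ?thesis using \<mu>(1) e by simp
 qed
 ultimately show ?thesis by (simp add: mult.commute mult.left_commute)
qed

text \<open>Since j / jst \<theta> is the derivative of the transport map, the right-hand side is
  minus the contribution of the powers of \<theta> and s to the derivative of the first term of the
  potential. It is bounded below by the inequality of arithmetic and geometric means with weights 1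
  / d and 1 - 1 / d, applied to 1 and to the logarithmic slope \<tau> of the transport map. Equality
  holds for \<tau> = 1, which is the case for the extremal function.\<close>

lemma amgm_step:
 assumes s: "0 < s" and \<theta>: "0 < \<theta>" and w: "0 \<le> w"
 defines "j \<equiv> s powr (- 1 - q * \<mu>) * w powr q"
 shows "q * \<mu> * (j * (1 + \<theta> powr (- m))) \<le>
  w powr (1 + q * \<mu>) * (\<mu> * m * \<theta> powr (- (\<mu> * m) - 1) * (j / jst \<theta>) * s powr (\<mu> * m - q * \<mu>)
   + (q * \<mu> - \<mu> * m) * (\<theta> powr (- (\<mu> * m)) * s powr (\<mu> * m - q * \<mu> - 1)))"
proof (cases "w = 0")
 case False
 then have w0: "0 < w" using w by simp
 define A where "A = w powr (1 + q * \<mu>) * (\<theta> powr (- (\<mu> * m)) * s powr (\<mu> * m - q * \<mu> - 1))"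
 define \<tau> where "\<tau> = s * j / (\<theta> * jst \<theta>)"
 have jt: "jst \<theta> > 0" by (rule jst_bounds(3)[OF \<theta>])
 have j0: "0 < j" using s w0 by (simp add: j_def)
 have \<tau>0: "0 < \<tau>" using s \<theta> jt j0 by (simp add: \<tau>_def)
 have A0: "0 < A" using s \<theta> w0 by (simp add: A_def)
 have de: "q * \<mu> = d * (\<mu> * m)" using d(3) by (simp add: mult.commute mult.left_commute)
 have "\<tau> powr (1 / d) * 1 powr (1 - 1 / d) \<le> 1 / d * \<tau> + (1 - 1 / d) * 1"
  using d(1) \<tau>0 by (intro Youngs_inequality_0) auto
 then have "d * \<tau> powr (1 / d) \<le> d * (1 / d * \<tau> + (1 - 1 / d) * 1)" using d(2) by (intro mult_left_mono) auto
 then have "d * \<tau> powr (1 / d) \<le> \<tau> + (d - 1)" using d(2) by (simp add: algebra_simps)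
 then have c1: "A * (\<mu> * m) * (d * \<tau> powr (1 / d)) \<le> A * (\<mu> * m) * (\<tau> + (d - 1))"
  using A0 \<mu> m by (intro mult_left_mono) auto
 have c2: "A * (\<mu> * m) * (\<tau> + (d - 1)) = w powr (1 + q * \<mu>) * (\<mu> * m * \<theta> powr (- (\<mu> * m) - 1) * (j / jst \<theta>) * s powr (\<mu> * m - q * \<mu>)
   + (q * \<mu> - \<mu> * m) * (\<theta> powr (- (\<mu> * m)) * s powr (\<mu> * m - q * \<mu> - 1)))"
 proof -
  have 1: "\<theta> powr (- (\<mu> * m) - 1) = \<theta> powr (- (\<mu> * m)) / \<theta>" using \<theta> by (simp add: powr_diff)
  have 2: "s powr (\<mu> * m - q * \<mu>) = s powr (\<mu> * m - q * \<mu> - 1) * s"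
   using s powr_add[of s "\<mu> * m - q * \<mu> - 1" 1] by simp
  have 3: "q * \<mu> - \<mu> * m = (d - 1) * (\<mu> * m)" unfolding de by (simp add: algebra_simps)
  show ?thesis unfolding 1 2 3 A_def \<tau>_def using \<theta> jt by (simp add: field_simps)
 qed
 \<comment> \<open>Both sides are products of powers of s, \<theta>, w and 1 + \<theta> powr m, so
   comparing logarithms leaves linear identities among the exponents.\<close>
 have c3: "A * \<tau> powr (1 / d) = j * (1 + \<theta> powr (- m))"
 proof -
  have jt': "jst \<theta> = \<theta> powr m * (1 + \<theta> powr m) powr (- d)" using \<theta> by (simp add: jst_def)
  have y: "0 < 1 + \<theta> powr m" by (rule one_plus_pos)
  have lnj: "ln j = (- 1 - q * \<mu>) * ln s + q * ln w" using s w0 by (simp add: j_def ln_mult ln_powr)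
  have lnjt: "ln (jst \<theta>) = m * ln \<theta> - d * ln (1 + \<theta> powr m)" unfolding jt' using \<theta> y by (simp add: ln_mult ln_powr)
  have ln\<tau>: "ln \<tau> = ln s + ln j - (ln \<theta> + ln (jst \<theta>))"
   unfolding \<tau>_def using s \<theta> jt j0 by (simp add: ln_div ln_mult)
  have lnA: "ln A = (1 + q * \<mu>) * ln w + (- (\<mu> * m) * ln \<theta> + (\<mu> * m - q * \<mu> - 1) * ln s)"
   unfolding A_def using s \<theta> w0 by (simp add: ln_mult ln_powr)
  have eq: "1 + \<theta> powr (- m) = \<theta> powr (- m) * (1 + \<theta> powr m)"
   using \<theta> by (simp add: powr_minus field_simps)
  have lnR: "ln (j * (1 + \<theta> powr (- m))) = ln j + (- m * ln \<theta> + ln (1 + \<theta> powr m))"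
   unfolding eq using \<theta> y j0 by (simp add: ln_mult ln_powr)
  have dd: "q / d = m" "q * \<mu> / d = \<mu> * m" "(m + 1) / d = m * (1 - \<mu>)"
  proof -
   show "q / d = m" using d(2,3) by (metis nonzero_mult_div_cancel_right less_irrefl)
   then show "q * \<mu> / d = \<mu> * m" by (metis times_divide_eq_left mult.commute)
   have "m + 1 = q * (1 / p)" using m(3) by simp
   also note \<mu>(4)
   finally have "m + 1 = q * (1 - \<mu>)" .
   then show "(m + 1) / d = m * (1 - \<mu>)" using \<open>q / d = m\<close> by (metis times_divide_eq_left)
  qed
  have L: "ln (A * \<tau> powr (1 / d)) = ln A + ln \<tau> / d"
   using A0 \<tau>0 by (simp add: ln_mult ln_powr)
  have t1: "ln \<tau> / d = - (q * \<mu> / d) * ln s + q / d * ln w - (m + 1) / d * ln \<theta> + ln (1 + \<theta> powr m)"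
   unfolding ln\<tau> lnj lnjt using d(2) by (simp add: field_simps)
  have "ln (A * \<tau> powr (1 / d)) = ln (j * (1 + \<theta> powr (- m)))"
  proof -
   have "q * ln w = (1 + m + q * \<mu>) * ln w" using m(2) by simp
   then show ?thesis unfolding L lnA lnR t1 dd lnj by (simp add: algebra_simps)
  qed
  then show ?thesis using A0 \<tau>0 j0 y \<theta> by (subst (asm) ln_inj_iff) (auto intro!: mult_pos_pos add_pos_nonneg)
 qed
 have "q * \<mu> * (j * (1 + \<theta> powr (- m))) = A * (\<mu> * m) * (d * \<tau> powr (1 / d))"
  unfolding de c3[symmetric] by (simp add: mult_ac)
 with c1 c2 show ?thesis by linarith
qed (simp add: j_def)

definition wt :: "real \<Rightarrow> real" where "wt s = indicator {0<..} s * s powr (- 1 - q * \<mu>)"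

abbreviation wt_int :: "(real \<Rightarrow> real) \<Rightarrow> real" where
 "wt_int f \<equiv> LINT s|lborel. wt s * \<bar>f s\<bar> powr q"

lemma wt_nonneg: "0 \<le> wt s" by (simp add: wt_def)

lemma wt_borel [measurable]: "wt \<in> Borel"
 unfolding wt_def by measurable

text \<open>
 Integrating the following inequality over the half-line gives Bliss' inequality: the first term
 of \<open>\<Psi>\<close> vanishes at both ends, and \<open>Nst = \<mu> * q * Jst\<close>.
\<close>

lemma potential_derivative:
 fixes W J :: "real \<Rightarrow> real" and W' :: real
 assumes s: "0 < s" and W: "DERIV W s :> W'"
  and J: "DERIV J s :> wt s * \<bar>W s\<bar> powr q" "0 < J s" "J s < Jst"
 defines "\<theta> \<equiv> \<lambda>s. transport (J s)"
 defines "\<Psi> \<equiv> \<lambda>s. \<bar>W s\<bar> powr (1 + q * \<mu>) * (\<theta> s powr (- (\<mu> * m)) * s powr (\<mu> * m - q * \<mu>))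
   + \<mu> * q * J s + \<mu> * m * prim mst (\<theta> s)"
 shows "\<exists>D. DERIV \<Psi> s :> D \<and> D \<le> (1 + \<mu> * m) * \<bar>W'\<bar> powr p"
proof -
 let ?w = "\<bar>W s\<bar>" and ?t = "\<theta> s"
 define j where "j = s powr (- 1 - q * \<mu>) * ?w powr q"
 have jw: "wt s * \<bar>W s\<bar> powr q = j" using s by (simp add: j_def wt_def)
 have t: "0 < ?t" unfolding \<theta>_def using transport J by auto
 have jt: "0 < jst ?t" by (rule jst_bounds(3)[OF t])
 have \<theta>': "DERIV \<theta> s :> j / jst ?t"
  unfolding \<theta>_def using DERIV_chain2[OF transport_has_real_derivative[OF J(2,3)] J(1)] jw by simp
 have M': "DERIV (\<lambda>s. prim mst (\<theta> s)) s :> mst ?t * (j / jst ?t)"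
  by (rule DERIV_chain2[OF prim_has_real_derivative[OF mst_integrable mst_continuous t] \<theta>'])
 have W1: "DERIV (\<lambda>s. \<bar>W s\<bar> powr (1 + q * \<mu>)) s :> (1 + q * \<mu>) * ?w powr (q * \<mu>) * sgn (W s) * W'"
  using abs_powr_comp_has_real_derivative[OF _ W, of "1 + q * \<mu>"] q(2) by simp
 have T1: "DERIV (\<lambda>s. \<theta> s powr (- (\<mu> * m)) * s powr (\<mu> * m - q * \<mu>)) s :>
   (- (\<mu> * m) * ?t powr (- (\<mu> * m) - 1) * (j / jst ?t)) * s powr (\<mu> * m - q * \<mu>)
   + ?t powr (- (\<mu> * m)) * ((\<mu> * m - q * \<mu>) * s powr (\<mu> * m - q * \<mu> - 1))"
 proof -
  have a: "DERIV (\<lambda>s. \<theta> s powr (- (\<mu> * m))) s :> - (\<mu> * m) * ?t powr (- (\<mu> * m) - 1) * (j / jst ?t)"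
   by (rule DERIV_chain2[OF _ \<theta>']) (use t in \<open>auto intro!: derivative_eq_intros\<close>)
  have b: "DERIV (\<lambda>s. s powr (\<mu> * m - q * \<mu>)) s :> (\<mu> * m - q * \<mu>) * s powr (\<mu> * m - q * \<mu> - 1)"
   using s by (auto intro!: derivative_eq_intros)
  show ?thesis using DERIV_mult[OF a b] by (simp add: algebra_simps)
 qed
 let ?P = "\<theta> s powr (- (\<mu> * m)) * s powr (\<mu> * m - q * \<mu>)"
 define R where "R = ?w powr (1 + q * \<mu>) * (\<mu> * m * ?t powr (- (\<mu> * m) - 1) * (j / jst ?t) * s powr (\<mu> * m - q * \<mu>)
   + (q * \<mu> - \<mu> * m) * (?t powr (- (\<mu> * m)) * s powr (\<mu> * m - q * \<mu> - 1)))"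
 define D where "D = (1 + q * \<mu>) * ?w powr (q * \<mu>) * sgn (W s) * W' * ?P - R + \<mu> * q * j + \<mu> * m * (mst ?t * (j / jst ?t))"
 have "DERIV \<Psi> s :> D"
  unfolding \<Psi>_def D_def R_def
  using DERIV_add[OF DERIV_add[OF DERIV_mult[OF W1 T1] DERIV_cmult[OF J(1)[unfolded jw]]] DERIV_cmult[OF M']]
  by (rule DERIV_cong) (simp add: algebra_simps)
 moreover have "D \<le> (1 + \<mu> * m) * \<bar>W'\<bar> powr p"
 proof -
  have "(1 + q * \<mu>) * ?w powr (q * \<mu>) * sgn (W s) * W' * ?P \<le> (1 + q * \<mu>) * (?w powr (q * \<mu>) * \<bar>W'\<bar> * ?P)"
  proof -
   have "sgn (W s) * W' \<le> \<bar>W'\<bar>" by (auto simp: sgn_if)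
   then have "((1 + q * \<mu>) * ?w powr (q * \<mu>) * ?P) * (sgn (W s) * W') \<le> ((1 + q * \<mu>) * ?w powr (q * \<mu>) * ?P) * \<bar>W'\<bar>"
    using q by (intro mult_left_mono) auto
   then show ?thesis by (simp add: algebra_simps)
  qed
  also have "\<dots> \<le> (1 + q * \<mu>) * (\<bar>W'\<bar> powr p / p + \<mu> * (j * ?t powr (- m)))"
   using young_step[OF s t, of ?w "\<bar>W'\<bar>"] q by (intro mult_left_mono) (auto simp: j_def)
  finally have Y: "(1 + q * \<mu>) * ?w powr (q * \<mu>) * sgn (W s) * W' * ?P \<le> (1 + q * \<mu>) * (\<bar>W'\<bar> powr p / p + \<mu> * (j * ?t powr (- m)))" .
  have A: "q * \<mu> * (j * (1 + ?t powr (- m))) \<le> R"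
   unfolding R_def j_def by (rule amgm_step[OF s t]) simp
  have mj: "mst ?t * (j / jst ?t) = j * ?t powr (- m)"
   using t one_plus_pos[of ?t m] by (simp add: mst_def jst_def powr_minus field_simps)
  have "D \<le> (1 + q * \<mu>) * (\<bar>W'\<bar> powr p / p + \<mu> * (j * ?t powr (- m))) - q * \<mu> * (j * (1 + ?t powr (- m))) + \<mu> * q * j + \<mu> * m * (j * ?t powr (- m))"
   unfolding D_def mj using Y A by linarith
  also have "\<dots> = (1 + q * \<mu>) / p * \<bar>W'\<bar> powr p + \<mu> * (1 + q * \<mu> - q + m) * (j * ?t powr (- m))"
   by (simp add: algebra_simps)
  \<comment> \<open>The multiples of j \<theta> powr (- m) from Young's inequality, from the lower
    bound of R and from \<open>prim mst\<close> cancel; this is the origin of the coefficient \<mu>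
    * m in the potential. Its coefficient \<mu> * q has already cancelled the remaining multiple of
    j.\<close>
  also have "1 + q * \<mu> - q + m = 0" using m(2) by simp
  also have "(1 + q * \<mu>) / p = 1 + \<mu> * m"
  proof -
   have "(1 + q * \<mu>) / p = 1 / p + \<mu> * (q / p)" by (simp add: add_divide_distrib)
   then show ?thesis unfolding m(3) \<mu>(4) by (simp add: algebra_simps)
  qed
  finally show ?thesis by simp
 qed
 ultimately show ?thesis by blast
qed

section \<open>Bliss' inequality for compactly supported functions\<close>

lemma C1c_integrable:
 assumes W: "C1c W W'"
 shows "integrable lborel (\<lambda>s. \<bar>W' s\<bar> powr p)" "integrable lborel (\<lambda>s. wt s * \<bar>W s\<bar> powr q)"
  "continuous_on {0<..} (\<lambda>s. \<bar>W' s\<bar> powr p)" "continuous_on {0<..} (\<lambda>s. wt s * \<bar>W s\<bar> powr q)"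
proof -
 obtain a b where ab: "0 < a" "a < b" "\<And>s. s \<notin> {a..b} \<Longrightarrow> W s = 0" "\<And>s. s \<notin> {a..b} \<Longrightarrow> W' s = 0"
  and c: "continuous_on UNIV W'" "continuous_on UNIV W"
  using C1cE[OF W] by metis
 have 1: "continuous_on UNIV (\<lambda>s. \<bar>W' s\<bar> powr p)"
  using p by (intro continuous_on_powr' continuous_intros c) auto
 then show "continuous_on {0<..} (\<lambda>s. \<bar>W' s\<bar> powr p)" by (rule continuous_on_subset) auto
 have "continuous_on {0<..} (\<lambda>s. s powr (- 1 - q * \<mu>) * \<bar>W s\<bar> powr q)"
  using q by (intro continuous_on_powr' continuous_on_mult continuous_intros continuous_on_subset[OF c(2)]) auto
 then show 2: "continuous_on {0<..} (\<lambda>s. wt s * \<bar>W s\<bar> powr q)"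
  by (rule continuous_on_eq) (auto simp: wt_def)
 show "integrable lborel (\<lambda>s. \<bar>W' s\<bar> powr p)"
  by (rule integrable_continuous_Icc_support[of a b]) (use ab(4) in \<open>auto intro!: continuous_on_subset[OF 1]\<close>)
 show "integrable lborel (\<lambda>s. wt s * \<bar>W s\<bar> powr q)"
  by (rule integrable_continuous_Icc_support[of a b]) (use ab in \<open>auto intro!: continuous_on_subset[OF 2]\<close>)
qed

lemma bliss_normalized:
 assumes W: "C1c W W'" and J1: "wt_int W = Jst"
 shows "Nst \<le> Lp_int p W'"
proof -
 obtain a b where ab: "0 < a" "a < b" "\<And>s. s \<notin> {a..b} \<Longrightarrow> W s = 0" "\<And>s. s \<notin> {a..b} \<Longrightarrow> W' s = 0" "W a = 0" "W b = 0"
  and W': "\<And>s. DERIV W s :> W' s" and c: "continuous_on UNIV W'" "continuous_on UNIV W"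
  using C1cE[OF W] by metis
 define jW where "jW = (\<lambda>s. wt s * \<bar>W s\<bar> powr q)"
 define nW where "nW = (\<lambda>s. \<bar>W' s\<bar> powr p)"
 define J where "J = prim jW"
 have ji: "integrable lborel jW" and ni: "integrable lborel nW"
  and jc: "continuous_on {0<..} jW" and nc: "continuous_on {0<..} nW"
  using C1c_integrable[OF W] by (auto simp: jW_def nW_def)
 have j0: "0 \<le> jW s" for s by (simp add: jW_def wt_nonneg)
 have J': "DERIV J s :> jW s" if "0 < s" for s
  unfolding J_def by (rule prim_has_real_derivative[OF ji jc that])
 have Ja: "J a = 0" unfolding J_def by (rule prim_eq_0) (use ab in \<open>auto simp: jW_def le_less\<close>)
 have Jb: "J b = Jst"
 proof -
  have "(\<lambda>s. indicator {..b} s *\<^sub>R jW s) = jW" using ab by (auto simp: jW_def indicator_def fun_eq_iff)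
  then show ?thesis using J1 by (simp add: J_def prim_def set_lebesgue_integral_def) (simp add: jW_def)
 qed
 have Jmono: "J x \<le> J y" if "x \<le> y" for x y unfolding J_def by (rule prim_mono[OF ji j0 that])
 have IVT: "\<exists>s. a \<le> s \<and> s \<le> b \<and> J s = y" if "0 < y" "y < Jst" for y
 proof (rule IVT')
  show "continuous_on {a..b} J" unfolding J_def by (rule prim_continuous_on[OF ji jc ab(1)])
 qed (use that Ja Jb ab in auto)
 obtain B0 where B0: "\<And>s. \<bar>W' s\<bar> \<le> B0" "0 \<le> B0"
 proof -
  have "compact (W' ` {a..b})" by (intro compact_continuous_image continuous_on_subset[OF c(1)]) auto
  then obtain B where "\<forall>x\<in>W' ` {a..b}. norm x \<le> B" using compact_imp_bounded bounded_iff by metis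
  then have "\<And>s. s \<in> {a..b} \<Longrightarrow> \<bar>W' s\<bar> \<le> B" by auto
  then have "\<bar>W' s\<bar> \<le> max B 0" for s using ab(4)[of s] by (cases "s \<in> {a..b}") (auto intro: le_max_iff_disj[THEN iffD2])
  then show thesis by (intro that[of "max B 0"]) auto
 qed
 define C0 where "C0 = (q + 1) * B0 * b powr (1 + q * \<mu>)"
 have C0: "0 \<le> C0" using B0 q by (simp add: C0_def)
 \<comment> \<open>W is controlled by its own mass: W' is bounded and the weight is bounded below on
   the support, so the derivative of |W| powr (q + 1) is at most C0 times the density of J.\<close>
 have WJ: "\<bar>W s\<bar> powr (q + 1) \<le> C0 * J s" if "a \<le> s" "s \<le> b" for s
 proof -
  have "\<bar>W s\<bar> powr (q + 1) - \<bar>W a\<bar> powr (q + 1) \<le> C0 * J s - C0 * J a"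
  proof (rule DERIV_le_imp_diff_le[OF that(1)])
   fix t assume t: "a \<le> t" "t \<le> s"
   then have t0: "0 < t" "t \<le> b" using ab that by auto
   show "DERIV (\<lambda>s. \<bar>W s\<bar> powr (q + 1)) t :> (q + 1) * \<bar>W t\<bar> powr q * sgn (W t) * W' t"
    using abs_powr_comp_has_real_derivative[OF _ W', of "q + 1" t] q by simp
   show "DERIV (\<lambda>s. C0 * J s) t :> C0 * jW t"
    by (rule DERIV_cmult[OF J'[OF t0(1)]])
   have "sgn (W t) * W' t \<le> B0" using B0(1)[of t] B0(2) by (auto simp: sgn_if)
   then have "((q + 1) * \<bar>W t\<bar> powr q) * (sgn (W t) * W' t) \<le> ((q + 1) * \<bar>W t\<bar> powr q) * B0"
    using q by (intro mult_left_mono) auto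
   moreover have "((q + 1) * \<bar>W t\<bar> powr q * B0) * 1 \<le> ((q + 1) * \<bar>W t\<bar> powr q * B0) * (b powr (1 + q * \<mu>) * t powr (- 1 - q * \<mu>))"
   proof (rule mult_left_mono)
    have "t powr (1 + q * \<mu>) \<le> b powr (1 + q * \<mu>)" using t0 q by (intro powr_mono2) auto
    then have "t powr (1 + q * \<mu>) * t powr (- 1 - q * \<mu>) \<le> b powr (1 + q * \<mu>) * t powr (- 1 - q * \<mu>)"
     by (intro mult_right_mono) auto
    then show "1 \<le> b powr (1 + q * \<mu>) * t powr (- 1 - q * \<mu>)" using t0 by (simp flip: powr_add)
   qed (use q B0 in auto)
   ultimately show "(q + 1) * \<bar>W t\<bar> powr q * sgn (W t) * W' t \<le> C0 * jW t"
    using t0 by (simp add: C0_def jW_def wt_def algebra_simps)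
  qed
  then show ?thesis using ab Ja by simp
 qed
 \<comment> \<open>r turns the power q + 1 into 1 + q * \<mu>, and \<delta> is the power of the mass
   that is left after paying for \<theta> powr (- (\<mu> * m)). It is positive because r \<ge> \<mu>
   > \<mu> * m / (m + 1).\<close>
 define r where "r = (1 + q * \<mu>) / (q + 1)"
 define \<delta> where "\<delta> = r - \<mu> * m / (m + 1)"
 have \<delta>: "0 < \<delta>"
 proof -
  have "\<mu> \<le> r" using q \<mu> by (simp add: r_def field_simps)
  moreover have "\<mu> * m / (m + 1) < \<mu>" using \<mu> m by (simp add: field_simps)
  ultimately show ?thesis by (simp add: \<delta>_def)
 qed
 define K where "K = C0 powr r * a powr (\<mu> * m - q * \<mu>)"
 have em: "\<mu> * m - q * \<mu> \<le> 0"
 proof -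
  have "m \<le> q" using m(2) q by simp
  then show ?thesis using \<mu> by (simp add: mult.commute)
 qed
 have bd: "\<bar>W s\<bar> powr (1 + q * \<mu>) * (\<theta> powr (- (\<mu> * m)) * s powr (\<mu> * m - q * \<mu>)) \<le> K * (prim jst \<theta>) powr \<delta>"
  if s: "a \<le> s" "s \<le> b" and \<theta>: "0 < \<theta>" and Js: "J s = prim jst \<theta>" for s \<theta>
 proof -
  let ?y = "prim jst \<theta>"
  have y: "0 < ?y" by (rule prim_jst_range(1)[OF \<theta>])
  have "\<bar>W s\<bar> powr (1 + q * \<mu>) = (\<bar>W s\<bar> powr (q + 1)) powr r" using q by (simp add: powr_powr r_def)
  also have "\<dots> \<le> (C0 * ?y) powr r"
   using WJ[OF s] Js q by (intro powr_mono2) (auto simp: r_def)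
  also have "\<dots> = C0 powr r * ?y powr r" using C0 y by (simp add: powr_mult)
  finally have 1: "\<bar>W s\<bar> powr (1 + q * \<mu>) \<le> C0 powr r * ?y powr r" .
  have "?y powr (1 / (m + 1)) \<le> (\<theta> powr (m + 1)) powr (1 / (m + 1))"
   using prim_jst_le[OF \<theta>] y m by (intro powr_mono2) auto
  then have "?y powr (1 / (m + 1)) \<le> \<theta>" using \<theta> m by (simp add: powr_powr)
  then have "\<theta> powr (- (\<mu> * m)) \<le> (?y powr (1 / (m + 1))) powr (- (\<mu> * m))"
   using y \<mu> m by (intro powr_mono2') auto
  then have 2: "\<theta> powr (- (\<mu> * m)) \<le> ?y powr (- (\<mu> * m / (m + 1)))" by (simp add: powr_powr)
  have 3: "s powr (\<mu> * m - q * \<mu>) \<le> a powr (\<mu> * m - q * \<mu>)" using em ab s by (intro powr_mono2') auto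
  have "\<bar>W s\<bar> powr (1 + q * \<mu>) * (\<theta> powr (- (\<mu> * m)) * s powr (\<mu> * m - q * \<mu>))
    \<le> (C0 powr r * ?y powr r) * (?y powr (- (\<mu> * m / (m + 1))) * a powr (\<mu> * m - q * \<mu>))"
   by (intro mult_mono 1 2 3) auto
  also have "\<dots> = K * (?y powr r * ?y powr (- (\<mu> * m / (m + 1))))" by (simp add: K_def mult_ac)
  also have "?y powr r * ?y powr (- (\<mu> * m / (m + 1))) = ?y powr \<delta>" by (simp add: \<delta>_def flip: powr_add)
  finally show ?thesis .
 qed
 let ?N = "(LINT s|lborel. nW s)"
 have key: "\<mu> * q * prim jst \<theta>2 + \<mu> * m * prim mst \<theta>2 \<le>
   (1 + \<mu> * m) * ?N + (K * (prim jst \<theta>1) powr \<delta> + \<mu> * q * prim jst \<theta>1 + \<mu> * m * prim mst \<theta>1)"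
  if \<theta>: "0 < \<theta>1" "\<theta>1 < \<theta>2" for \<theta>1 \<theta>2
 proof -
  have y: "prim jst \<theta>1 < prim jst \<theta>2" by (rule prim_jst_strict_mono[OF \<theta>])
  obtain s1 where s1: "a \<le> s1" "s1 \<le> b" "J s1 = prim jst \<theta>1" using IVT[OF prim_jst_range] \<theta> by blast
  obtain s2 where s2: "a \<le> s2" "s2 \<le> b" "J s2 = prim jst \<theta>2" using IVT[OF prim_jst_range, of \<theta>2] \<theta> by (meson order.strict_trans)
  have s12: "s1 \<le> s2" using Jmono[of s2 s1] s1 s2 y by linarith
  define \<Psi> where "\<Psi> = (\<lambda>s. \<bar>W s\<bar> powr (1 + q * \<mu>) * (transport (J s) powr (- (\<mu> * m)) * s powr (\<mu> * m - q * \<mu>))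
   + \<mu> * q * J s + \<mu> * m * prim mst (transport (J s)))"
  have "\<forall>s\<in>{s1..s2}. \<exists>D. DERIV \<Psi> s :> D \<and> D \<le> (1 + \<mu> * m) * nW s"
  proof
   fix s assume s: "s \<in> {s1..s2}"
   then have s0: "0 < s" using s1 ab by simp
   have "0 < J s" using Jmono[of s1 s] s s1 prim_jst_range(1)[OF \<theta>(1)] by simp
   moreover have "J s < Jst" using Jmono[of s s2] s s2 prim_jst_range(2)[of \<theta>2] \<theta> by simp
   ultimately show "\<exists>D. DERIV \<Psi> s :> D \<and> D \<le> (1 + \<mu> * m) * nW s"
    unfolding \<Psi>_def nW_def by (intro potential_derivative[OF s0 W']) (use J'[OF s0] in \<open>auto simp: jW_def\<close>)
  qed
  then obtain D where D: "\<And>s. s \<in> {s1..s2} \<Longrightarrow> DERIV \<Psi> s :> D s" "\<And>s. s \<in> {s1..s2} \<Longrightarrow> D s \<le> (1 + \<mu> * m) * nW s"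
   by metis
  have "\<Psi> s2 - \<Psi> s1 \<le> (1 + \<mu> * m) * prim nW s2 - (1 + \<mu> * m) * prim nW s1"
  proof (rule DERIV_le_imp_diff_le[OF s12])
   fix s assume s: "s1 \<le> s" "s \<le> s2"
   then have "0 < s" using s1 ab by simp
   then show "DERIV (\<lambda>s. (1 + \<mu> * m) * prim nW s) s :> (1 + \<mu> * m) * nW s"
    by (intro DERIV_cmult prim_has_real_derivative ni nc)
  qed (use D in auto)
  also have "\<dots> \<le> (1 + \<mu> * m) * ?N"
  proof -
   have "0 \<le> (1 + \<mu> * m) * prim nW s1" using \<mu> m by (intro mult_nonneg_nonneg prim_nonneg) (auto simp: nW_def)
   moreover have "(1 + \<mu> * m) * prim nW s2 \<le> (1 + \<mu> * m) * ?N"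
    using \<mu> m by (intro mult_left_mono prim_le_total ni) (auto simp: nW_def)
   ultimately show ?thesis by linarith
  qed
  finally have "\<Psi> s2 \<le> (1 + \<mu> * m) * ?N + \<Psi> s1" by simp
  moreover have "\<mu> * q * prim jst \<theta>2 + \<mu> * m * prim mst \<theta>2 \<le> \<Psi> s2"
   using \<theta> s2 transport_prim[of \<theta>2] by (simp add: \<Psi>_def)
  moreover have "\<Psi> s1 \<le> K * (prim jst \<theta>1) powr \<delta> + \<mu> * q * prim jst \<theta>1 + \<mu> * m * prim mst \<theta>1"
   using \<theta> s1 transport_prim[of \<theta>1] bd[OF s1(1,2) \<theta>(1) s1(3)] by (simp add: \<Psi>_def)
  ultimately show ?thesis by linarith
 qed
 have G0: "(prim jst \<longlongrightarrow> 0) (at_right 0)"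
 proof (rule tendsto_sandwich[of "\<lambda>_. 0"])
  show "\<forall>\<^sub>F \<theta> in at_right 0. prim jst \<theta> \<le> \<theta> powr (m + 1)"
   using eventually_at_right_less[of 0] by eventually_elim (simp add: prim_jst_le)
  have "((\<lambda>\<theta>::real. \<theta> powr (m + 1)) \<longlongrightarrow> 0 powr (m + 1)) (at_right 0)"
   using m(1) eventually_at_right_less[of 0] by (intro tendsto_powr2 tendsto_intros) (auto elim: eventually_mono)
  then show "((\<lambda>\<theta>::real. \<theta> powr (m + 1)) \<longlongrightarrow> 0) (at_right 0)" by simp
 qed (auto intro!: always_eventually prim_nonneg jst_bounds)
 have M0: "(prim mst \<longlongrightarrow> 0) (at_right 0)"
 proof (rule tendsto_sandwich[of "\<lambda>_. 0"])
  show "\<forall>\<^sub>F \<theta> in at_right 0. prim mst \<theta> \<le> \<theta>"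
   using eventually_at_right_less[of 0] by eventually_elim (simp add: prim_mst_le)
 qed (auto intro!: always_eventually prim_nonneg mst_bounds)
 have key2: "\<mu> * q * prim jst \<theta>2 + \<mu> * m * prim mst \<theta>2 \<le> (1 + \<mu> * m) * ?N" if \<theta>2: "0 < \<theta>2" for \<theta>2
 proof (rule tendsto_lowerbound[of _ _ "at_right 0"])
  have "((\<lambda>\<theta>1. prim jst \<theta>1 powr \<delta>) \<longlongrightarrow> 0 powr \<delta>) (at_right 0)"
   using \<delta> by (intro tendsto_powr2 G0 tendsto_const always_eventually allI prim_nonneg jst_bounds) auto
  then have G\<delta>: "((\<lambda>\<theta>1. prim jst \<theta>1 powr \<delta>) \<longlongrightarrow> 0) (at_right 0)" by simp
  have "((\<lambda>\<theta>1. (1 + \<mu> * m) * ?N + (K * (prim jst \<theta>1) powr \<delta> + \<mu> * q * prim jst \<theta>1 + \<mu> * m * prim mst \<theta>1)) \<longlongrightarrow>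
    (1 + \<mu> * m) * ?N + (K * 0 + \<mu> * q * 0 + \<mu> * m * 0)) (at_right 0)"
   by (intro tendsto_add tendsto_mult tendsto_const G\<delta> G0 M0)
  then show "((\<lambda>\<theta>1. (1 + \<mu> * m) * ?N + (K * (prim jst \<theta>1) powr \<delta> + \<mu> * q * prim jst \<theta>1 + \<mu> * m * prim mst \<theta>1)) \<longlongrightarrow>
    (1 + \<mu> * m) * ?N) (at_right 0)" by simp
  show "\<forall>\<^sub>F \<theta>1 in at_right 0. \<mu> * q * prim jst \<theta>2 + \<mu> * m * prim mst \<theta>2 \<le>
    (1 + \<mu> * m) * ?N + (K * (prim jst \<theta>1) powr \<delta> + \<mu> * q * prim jst \<theta>1 + \<mu> * m * prim mst \<theta>1)"
   using eventually_at_right_real[OF \<theta>2]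
  proof eventually_elim
   fix t assume "t \<in> {0<..<\<theta>2}"
   then show "\<mu> * q * prim jst \<theta>2 + \<mu> * m * prim mst \<theta>2 \<le>
    (1 + \<mu> * m) * ?N + (K * (prim jst t) powr \<delta> + \<mu> * q * prim jst t + \<mu> * m * prim mst t)"
    using key[of t \<theta>2] by simp
  qed
 qed simp
 have "\<mu> * q * Jst + \<mu> * m * Nst \<le> (1 + \<mu> * m) * ?N"
 proof (rule tendsto_upperbound[of _ _ at_top])
  show "((\<lambda>\<theta>2. \<mu> * q * prim jst \<theta>2 + \<mu> * m * prim mst \<theta>2) \<longlongrightarrow> \<mu> * q * Jst + \<mu> * m * Nst) at_top"
   unfolding Jst_def Nst_def by (intro tendsto_intros prim_at_top jst_integrable mst_integrable)
  show "\<forall>\<^sub>F \<theta>2 in at_top. \<mu> * q * prim jst \<theta>2 + \<mu> * m * prim mst \<theta>2 \<le> (1 + \<mu> * m) * ?N"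
   using eventually_gt_at_top[of 0] by eventually_elim (use key2 in blast)
 qed simp
 also have "\<mu> * q * Jst + \<mu> * m * Nst = (1 + \<mu> * m) * Nst" by (simp add: Nst_eq algebra_simps)
 finally have "Nst \<le> ?N" using \<mu> m by (simp add: add_pos_nonneg)
 then show ?thesis by (simp add: nW_def)
qed

lemma C1c_cmult: "C1c W W' \<Longrightarrow> C1c (\<lambda>s. c * W s) (\<lambda>s. c * W' s)"
 unfolding C1c_def by (auto intro!: DERIV_cmult continuous_intros)

text \<open>Both sides are homogeneous of degree p in W, and the factor c normalises the weighted
  integral to \<open>Jst\<close>.\<close>

lemma bliss_C1c:
 assumes W: "C1c W W'"
 shows "Nst * (wt_int W) powr (p / q) \<le> Lp_int p W' * Jst powr (p / q)"
proof -
 let ?J = "wt_int W" and ?N = "Lp_int p W'"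
 have J0: "0 \<le> ?J" by (intro integral_nonneg_AE AE_I2) (simp add: wt_nonneg)
 have N0: "0 \<le> ?N" by (intro integral_nonneg_AE AE_I2) simp
 show ?thesis
 proof (cases "?J = 0")
  case False
  then have Jp: "0 < ?J" using J0 by simp
  define c where "c = (Jst / ?J) powr (1 / q)"
  have c: "0 < c" using Jp Jst_pos by (simp add: c_def)
  have cq: "c powr q = Jst / ?J" using Jp Jst_pos q by (simp add: c_def powr_powr)
  have cp: "c powr p = (Jst / ?J) powr (p / q)" using Jp Jst_pos q by (simp add: c_def powr_powr)
  have "(LINT s|lborel. wt s * \<bar>c * W s\<bar> powr q) = c powr q * ?J"
   using c by (simp add: abs_mult powr_mult mult.left_commute)
  also have "\<dots> = Jst" using cq Jp by simp
  finally have "Nst \<le> (LINT s|lborel. \<bar>c * W' s\<bar> powr p)" by (rule bliss_normalized[OF C1c_cmult[OF W]])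
  also have "\<dots> = c powr p * ?N" using c by (simp add: abs_mult powr_mult)
  finally have "Nst * ?J powr (p / q) \<le> (c powr p * ?N) * ?J powr (p / q)" by (intro mult_right_mono) auto
  also have "\<dots> = ?N * Jst powr (p / q)" using Jp Jst_pos by (simp add: cp powr_divide)
  finally show ?thesis .
 next
  case True
  then show ?thesis using N0 p q by simp
 qed
qed

end

subsection \<open>The Emden-Fowler equation\<close>

text \<open>The odd power function: |x|^(r - 2) x is \<open>spw (r - 1) x\<close> by
  \<open>spw_eq\<close>. Exponents multiply under composition, so \<open>spw (1 / r)\<close> inverts
  \<open>spw r\<close> for r \<noteq> 0.\<close>

definition spw :: "real \<Rightarrow> real \<Rightarrow> real" where "spw r x = sgn x * \<bar>x\<bar> powr r"

lemma spw_pos: "0 < x \<Longrightarrow> spw r x = x powr r"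
 by (simp add: spw_def)

lemma spw_minus: "spw r (- x) = - spw r x"
 by (simp add: spw_def sgn_minus)

lemma abs_spw: "x \<noteq> 0 \<or> r \<noteq> 0 \<Longrightarrow> \<bar>spw r x\<bar> = \<bar>x\<bar> powr r"
 by (auto simp: spw_def abs_mult abs_sgn_eq)

lemma spw_mult_self: "spw r x * x = \<bar>x\<bar> powr (r + 1)"
 by (cases "x = 0") (auto simp: spw_def powr_add sgn_if)

lemma spw_eq: "\<bar>x\<bar> powr (r - 2) * x = spw (r - 1) x"
proof (cases "x = 0")
 case False
 then have "\<bar>x\<bar> powr (r - 1) = \<bar>x\<bar> powr (r - 2) * \<bar>x\<bar>"
  using powr_add[of "\<bar>x\<bar>" "r - 2" 1] by simp
 then show ?thesis by (simp add: spw_def sgn_mult_abs abs_mult_sgn mult.left_commute)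
qed (simp add: spw_def)

lemma spw_spw: "spw r (spw t x) = spw (r * t) x"
 by (cases "x = 0") (auto simp: spw_def sgn_mult abs_mult powr_powr abs_sgn_eq mult.commute)

lemma spw_1: "spw 1 x = x"
 by (cases "0 \<le> x") (auto simp: spw_def sgn_if)

lemma continuous_on_spw: "0 < r \<Longrightarrow> continuous_on S f \<Longrightarrow> continuous_on S (\<lambda>x. spw r (f x))"
proof -
 assume r: "0 < r" and f: "continuous_on S f"
 have "spw r x = max 0 x powr r - max 0 (- x) powr r" for x
  using r by (auto simp: spw_def sgn_if)
 then show ?thesis using r f by (auto intro!: continuous_intros continuous_on_powr')
qed

lemma prim_at_right_0:
 assumes i: "integrable lborel f" and z: "\<And>t. t \<le> 0 \<Longrightarrow> f t = 0"
 shows "(prim f \<longlongrightarrow> 0) (at_right 0)"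
proof -
 have "((\<lambda>y. LINT t|lborel. indicator {..y} t *\<^sub>R f t) \<longlongrightarrow> (LINT (t::real)|lborel. (0::real))) (at_right 0)"
 proof (rule tendsto_at_right_sequentially[of 0 1])
  fix X :: "nat \<Rightarrow> real" assume X: "\<And>k. 0 < X k" "\<And>k. X k < 1" "decseq X" "X \<longlonglongrightarrow> 0"
  show "(\<lambda>k. LINT t|lborel. indicator {..X k} t *\<^sub>R f t) \<longlonglongrightarrow> (LINT (t::real)|lborel. (0::real))"
  proof (rule integral_dominated_convergence[where w = "\<lambda>t. \<bar>f t\<bar>"])
   show "AE t in lborel. (\<lambda>k. indicator {..X k} t *\<^sub>R f t) \<longlonglongrightarrow> 0"
   proof (rule AE_I2)
    fix t :: real
    show "(\<lambda>k. indicator {..X k} t *\<^sub>R f t) \<longlonglongrightarrow> 0"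
    proof (cases "0 < t")
     case True
     then have "eventually (\<lambda>k. X k < t) sequentially" using X(4) by (auto dest: order_tendstoD)
     then have "eventually (\<lambda>k. indicator {..X k} t *\<^sub>R f t = 0) sequentially"
      by eventually_elim (auto simp: indicator_def)
     then show ?thesis by (rule tendsto_eventually)
    qed (simp add: z)
   qed
  qed (use i in \<open>auto simp: indicator_def\<close>)
 qed simp
 then show ?thesis by (simp add: prim_def[abs_def] set_lebesgue_integral_def)
qed

context bliss
begin

text \<open>The zero energy first excludes zeros of W. It then makes \<open>L\<close> constant, that
  is V = b (W / s) powr (1 + m), a separable equation with the integral \<open>Y\<close>. The
  inequality s V < W at s = 1 gives A > 0, and the energy at s = 1 gives the relation between A and
  K.\<close>

lemma ef_system_pos:
 fixes W P :: "real \<Rightarrow> real" and c :: real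
 assumes c: "0 < c"
  and W': "\<And>s. 0 < s \<Longrightarrow> DERIV W s :> spw (1 / (p - 1)) (P s)"
  and P': "\<And>s. 0 < s \<Longrightarrow> DERIV P s :> - (c * (s powr (- 1 - q * \<mu>) * spw (q - 1) (W s)))"
  and int: "integrable lborel (\<lambda>s. indicator {0<..} s * \<bar>P s\<bar> powr (1 / \<mu>))"
  and Wle: "\<And>s. 0 < s \<Longrightarrow> \<bar>W s\<bar> \<le> s powr \<mu> * prim (\<lambda>s. indicator {0<..} s * \<bar>P s\<bar> powr (1 / \<mu>)) s powr (1 / p)"
  and nz: "\<exists>s>0. 0 < W s"
 shows "\<exists>K>0. \<exists>A>0. \<mu> * A = c / q * K powr (q - p) \<and> (\<forall>s>0. W s = K * s * (1 + A * s powr m) powr (- (1 / m)))"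
proof -
 define n where "n = (\<lambda>s. indicator {0<..} s * \<bar>P s\<bar> powr (1 / \<mu>))"
 have n0: "0 \<le> n s" for s by (simp add: n_def)
 have ni: "integrable lborel n" using int by (simp add: n_def)
 define V where "V = (\<lambda>s. spw (1 / (p - 1)) (P s))"
 have W'V: "DERIV W s :> V s" if "0 < s" for s using W'[OF that] by (simp add: V_def)
 have Wc: "continuous_on {0<..} W" and Pc: "continuous_on {0<..} P"
  using W' P' by (auto intro!: continuous_at_imp_continuous_on DERIV_isCont)
 have k1: "1 / \<mu> = 1 / (p - 1) + 1" "1 < 1 / \<mu>"
  using p by (auto simp: \<mu>_def field_simps)
 have nc: "continuous_on {0<..} n"
 proof -
  have "continuous_on {0<..} (\<lambda>s. \<bar>P s\<bar> powr (1 / \<mu>))"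
   by (intro continuous_on_powr' continuous_on_rabs Pc continuous_on_const) (use \<mu> in auto)
  then show ?thesis by (rule continuous_on_eq) (auto simp: n_def)
 qed
 have VP: "V s * P s = \<bar>P s\<bar> powr (1 / \<mu>)" for s
  unfolding V_def spw_mult_self k1 ..
 \<comment> \<open>the conserved energy; it vanishes since by \<open>int\<close> its terms are small along a sequence tending to \<open>0\<close>\<close>
 define H where "H = (\<lambda>s. \<mu> * (s * \<bar>P s\<bar> powr (1 / \<mu>)) - \<mu> * (W s * P s) + c / q * (s powr (- (q * \<mu>)) * \<bar>W s\<bar> powr q))"
 have "DERIV H s :> 0" if s: "0 < s" for s
 proof -
  let ?g = "c * (s powr (- 1 - q * \<mu>) * spw (q - 1) (W s))"
  have a: "DERIV (\<lambda>s. \<bar>P s\<bar> powr (1 / \<mu>)) s :> 1 / \<mu> * V s * (- ?g)"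
   using abs_powr_comp_has_real_derivative[OF k1(2) P'[OF s]] k1(1) by (simp add: V_def spw_def mult_ac)
  have b: "DERIV (\<lambda>s. \<bar>W s\<bar> powr q) s :> q * spw (q - 1) (W s) * V s"
   using abs_powr_comp_has_real_derivative[OF q(1) W'V[OF s]] by (simp add: spw_def mult_ac)
  have e: "DERIV (\<lambda>s. s powr (- (q * \<mu>))) s :> - (q * \<mu>) * s powr (- 1 - q * \<mu>)"
   using s by (auto intro!: derivative_eq_intros simp: minus_diff_commute)
  have "DERIV H s :>
    \<mu> * (1 * \<bar>P s\<bar> powr (1 / \<mu>) + (1 / \<mu> * V s * (- ?g)) * s) - \<mu> * (V s * P s + (- ?g) * W s)
    + c / q * ((- (q * \<mu>) * s powr (- 1 - q * \<mu>)) * \<bar>W s\<bar> powr q + (q * spw (q - 1) (W s) * V s) * s powr (- (q * \<mu>)))"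
   unfolding H_def
   by (intro DERIV_add DERIV_diff DERIV_cmult DERIV_mult DERIV_ident a b e W'V s P')
  also have "\<mu> * (1 * \<bar>P s\<bar> powr (1 / \<mu>) + (1 / \<mu> * V s * (- ?g)) * s) - \<mu> * (V s * P s + (- ?g) * W s)
    + c / q * ((- (q * \<mu>) * s powr (- 1 - q * \<mu>)) * \<bar>W s\<bar> powr q + (q * spw (q - 1) (W s) * V s) * s powr (- (q * \<mu>))) = 0"
  proof -
   have s1: "s powr (- (q * \<mu>)) = s powr (- 1 - q * \<mu>) * s"
    using s powr_add[of s "- 1 - q * \<mu>" 1] by simp
   have wq: "\<bar>W s\<bar> powr q = spw (q - 1) (W s) * W s" using spw_mult_self[of "q - 1" "W s"] by simp
   have q0: "q \<noteq> 0" "\<mu> \<noteq> 0" using q \<mu> by auto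
   show ?thesis unfolding s1 wq VP using q0 by (simp add: field_simps)
  qed
  finally show ?thesis .
 qed
 from DERIV_0_half_line[OF this] obtain h where h: "\<And>s. 0 < s \<Longrightarrow> H s = h" by blast
 define N where "N = (LINT s|lborel. n s)"
 have N0: "0 \<le> N" unfolding N_def by (intro integral_nonneg_AE AE_I2 n0)
 have small: "\<exists>s. 0 < s \<and> s < \<delta> \<and> s * \<bar>P s\<bar> powr (1 / \<mu>) < \<eta>" if \<delta>: "0 < \<delta>" and \<eta>: "0 < \<eta>" for \<delta> \<eta>
 proof (rule ccontr)
  assume "\<not> ?thesis"
  then have ge: "\<eta> \<le> s * \<bar>P s\<bar> powr (1 / \<mu>)" if "0 < s" "s < \<delta>" for s using that by force
  define u where "u = \<delta> / 2"
  \<comment> \<open>If s |P| powr (1 / \<mu>) stayed above \<eta> near 0, n would dominate \<eta> /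
    s there. The point v makes the integral of \<eta> / s up to u equal to N + 1, more than the
    total integral of n.\<close>
  define v where "v = u * exp (- ((N + 1) / \<eta>))"
  have u: "0 < u" "u < \<delta>" using \<delta> by (auto simp: u_def)
  have v: "0 < v" "v \<le> u" using u N0 \<eta> by (auto simp: v_def mult_left_le)
  have "\<eta> * ln u - \<eta> * ln v \<le> prim n u - prim n v"
  proof (rule DERIV_le_imp_diff_le[OF v(2)])
   fix s assume s: "v \<le> s" "s \<le> u"
   then have s0: "0 < s" "s < \<delta>" using v u by auto
   show "DERIV (\<lambda>s. \<eta> * ln s) s :> \<eta> * (1 / s)"
    using s0 by (auto intro!: derivative_eq_intros simp: inverse_eq_divide)
   show "DERIV (prim n) s :> n s" by (rule prim_has_real_derivative[OF ni nc s0(1)])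
   show "\<eta> * (1 / s) \<le> n s" using ge[OF s0] s0 by (simp add: n_def field_simps)
  qed
  moreover have "prim n u \<le> N" unfolding N_def by (intro prim_le_total ni n0)
  moreover have "0 \<le> prim n v" by (intro prim_nonneg n0)
  moreover have "\<eta> * ln u - \<eta> * ln v = N + 1" using u \<eta> by (simp add: v_def ln_mult right_diff_distrib)
  ultimately show False by simp
 qed
 \<comment> \<open>At a suitable point each of the three terms of H is smaller than |h| / 3: the
   first by \<open>small\<close>, the second by Hoelder's bound for W combined with
   \<open>small\<close>, the third because \<open>prim n\<close> tends to 0 at 0.\<close>
 have "h = 0"
 proof (rule ccontr)
  assume h0: "h \<noteq> 0"
  have pn: "(prim n \<longlongrightarrow> 0) (at_right 0)"
   by (rule prim_at_right_0[OF ni]) (simp add: n_def)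
  have "((\<lambda>s. c / q * prim n s powr (q / p)) \<longlongrightarrow> c / q * 0 powr (q / p)) (at_right 0)"
   using p q by (intro tendsto_mult tendsto_const tendsto_powr2 pn always_eventually allI prim_nonneg n0) auto
  then have "eventually (\<lambda>s. c / q * prim n s powr (q / p) < \<bar>h\<bar> / 3) (at_right 0)"
   using h0 by (intro order_tendstoD(2)) auto
  then obtain \<delta> where \<delta>: "0 < \<delta>" "\<And>s. 0 < s \<Longrightarrow> s < \<delta> \<Longrightarrow> c / q * prim n s powr (q / p) < \<bar>h\<bar> / 3"
   by (auto simp: eventually_at_right_field)
  have "((\<lambda>\<eta>::real. \<mu> * (N powr (1 / p) * \<eta> powr \<mu>)) \<longlongrightarrow> \<mu> * (N powr (1 / p) * 0 powr \<mu>)) (at_right 0)"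
   using \<mu> eventually_at_right_less[of 0] by (intro tendsto_mult tendsto_const tendsto_powr2 tendsto_ident_at) (auto elim: eventually_mono)
  then have e1: "eventually (\<lambda>\<eta>::real. \<mu> * (N powr (1 / p) * \<eta> powr \<mu>) < \<bar>h\<bar> / 3) (at_right 0)"
   using h0 \<mu> by (intro order_tendstoD(2)) auto
  have "((\<lambda>\<eta>::real. \<mu> * \<eta>) \<longlongrightarrow> \<mu> * 0) (at_right 0)" by (intro tendsto_intros)
  then have e2: "eventually (\<lambda>\<eta>::real. \<mu> * \<eta> < \<bar>h\<bar> / 3) (at_right 0)"
   using h0 by (intro order_tendstoD(2)) auto
  have "eventually (\<lambda>\<eta>::real. 0 < \<eta> \<and> \<mu> * (N powr (1 / p) * \<eta> powr \<mu>) < \<bar>h\<bar> / 3 \<and> \<mu> * \<eta> < \<bar>h\<bar> / 3) (at_right 0)"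
   using eventually_at_right_less[of 0] e1 e2 by eventually_elim auto
  then obtain \<eta> :: real where \<eta>: "0 < \<eta>" "\<mu> * (N powr (1 / p) * \<eta> powr \<mu>) < \<bar>h\<bar> / 3" "\<mu> * \<eta> < \<bar>h\<bar> / 3"
   using eventually_happens[of _ "at_right (0::real)"] by auto
  obtain s where s: "0 < s" "s < \<delta>" "s * \<bar>P s\<bar> powr (1 / \<mu>) < \<eta>" using small[OF \<delta>(1) \<eta>(1)] by blast
  have pr: "0 \<le> prim n s" "prim n s \<le> N" unfolding N_def by (auto intro: prim_nonneg prim_le_total n0 ni)
  have Ws: "\<bar>W s\<bar> \<le> s powr \<mu> * prim n s powr (1 / p)" using Wle[OF s(1)] by (simp add: n_def)
  have t1: "\<mu> * (s * \<bar>P s\<bar> powr (1 / \<mu>)) \<le> \<mu> * \<eta>" using s(3) \<mu> by (intro mult_left_mono) auto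
  have t2: "\<bar>W s * P s\<bar> \<le> N powr (1 / p) * \<eta> powr \<mu>"
  proof -
   have "\<bar>P s\<bar> = (\<bar>P s\<bar> powr (1 / \<mu>)) powr \<mu>" using \<mu> by (simp add: powr_powr)
   then have "\<bar>W s * P s\<bar> = \<bar>W s\<bar> * (\<bar>P s\<bar> powr (1 / \<mu>)) powr \<mu>" by (simp add: abs_mult)
   also have "\<dots> \<le> (s powr \<mu> * N powr (1 / p)) * (\<bar>P s\<bar> powr (1 / \<mu>)) powr \<mu>"
    using p pr by (intro mult_right_mono order_trans[OF Ws] mult_left_mono powr_mono2) auto
   also have "\<dots> = N powr (1 / p) * (s * \<bar>P s\<bar> powr (1 / \<mu>)) powr \<mu>"
    using s by (simp add: powr_mult)
   also have "\<dots> \<le> N powr (1 / p) * \<eta> powr \<mu>"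
    using s \<mu> by (intro mult_left_mono powr_mono2) auto
   finally show ?thesis .
  qed
  have t3: "s powr (- (q * \<mu>)) * \<bar>W s\<bar> powr q \<le> prim n s powr (q / p)"
  proof -
   have "\<bar>W s\<bar> powr q \<le> (s powr \<mu> * prim n s powr (1 / p)) powr q" using Ws q by (intro powr_mono2) auto
   also have "\<dots> = s powr (q * \<mu>) * prim n s powr (q / p)" using s by (simp add: powr_mult powr_powr mult.commute)
   finally have "s powr (- (q * \<mu>)) * \<bar>W s\<bar> powr q \<le> s powr (- (q * \<mu>)) * (s powr (q * \<mu>) * prim n s powr (q / p))"
    by (intro mult_left_mono) auto
   moreover have "s powr (- (q * \<mu>)) * s powr (q * \<mu>) = 1" using s by (simp flip: powr_add)
   ultimately show ?thesis by (simp add: mult.assoc[symmetric])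
  qed
  have "\<bar>h\<bar> \<le> \<mu> * (s * \<bar>P s\<bar> powr (1 / \<mu>)) + \<mu> * \<bar>W s * P s\<bar> + c / q * (s powr (- (q * \<mu>)) * \<bar>W s\<bar> powr q)"
  proof -
   have "0 \<le> \<mu> * (s * \<bar>P s\<bar> powr (1 / \<mu>))" "0 \<le> c / q * (s powr (- (q * \<mu>)) * \<bar>W s\<bar> powr q)"
    using s \<mu> c q by auto
   moreover have "\<bar>\<mu> * (W s * P s)\<bar> = \<mu> * \<bar>W s * P s\<bar>" using \<mu> by (simp add: abs_mult)
   ultimately show ?thesis unfolding h[OF s(1), symmetric] H_def by linarith
  qed
  also have "\<dots> \<le> \<mu> * \<eta> + \<mu> * (N powr (1 / p) * \<eta> powr \<mu>) + c / q * prim n s powr (q / p)"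
   using t1 t2 t3 \<mu> c q by (intro add_mono mult_left_mono) auto
  also have "\<dots> < \<bar>h\<bar>" using \<eta> \<delta>(2)[OF s(1,2)] by linarith
  finally show False by simp
 qed
 then have H0: "\<mu> * (W s * P s) = \<mu> * (s * \<bar>P s\<bar> powr (1 / \<mu>)) + c / q * (s powr (- (q * \<mu>)) * \<bar>W s\<bar> powr q)" if "0 < s" for s
  using h[OF that] unfolding H_def by simp
 have WP: "0 < W s * P s" if "0 < s" "W s \<noteq> 0" for s
 proof -
  have "0 < c / q * (s powr (- (q * \<mu>)) * \<bar>W s\<bar> powr q)" using that c q by auto
  moreover have "0 \<le> \<mu> * (s * \<bar>P s\<bar> powr (1 / \<mu>))" using that \<mu> by auto
  ultimately have "0 < \<mu> * (W s * P s)" using H0[OF that(1)] by linarith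
  then show ?thesis using \<mu> by (simp add: zero_less_mult_iff)
 qed
 have WV: "0 \<le> W s * V s" if "0 < s" for s
 proof -
  have "0 \<le> W s * sgn (P s)"
   using WP[OF that] by (cases "W s = 0") (auto simp: zero_less_mult_iff sgn_if)
  then have "0 \<le> (W s * sgn (P s)) * \<bar>P s\<bar> powr (1 / (p - 1))" by (rule mult_nonneg_nonneg) simp
  then show ?thesis by (simp add: V_def spw_def mult.assoc)
 qed
 obtain t where t: "0 < t" "0 < W t" using nz by blast
 \<comment> \<open>W V is nonnegative, so the square of W is nondecreasing; a zero of W forces W to
   vanish everywhere to its left.\<close>
 have sq: "\<bar>W x\<bar> \<le> \<bar>W y\<bar>" if xy: "0 < x" "x \<le> y" for x y
 proof -
  have "W x * W x \<le> W y * W y"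
  proof (rule DERIV_nonneg_imp_nondecreasing[OF xy(2)])
   fix s assume "x \<le> s" "s \<le> y"
   then have s: "0 < s" using xy by simp
   show "\<exists>D. DERIV (\<lambda>s. W s * W s) s :> D \<and> 0 \<le> D"
    using DERIV_mult[OF W'V[OF s] W'V[OF s]] WV[OF s] by (intro exI[of _ "V s * W s + V s * W s"]) (auto simp: mult.commute)
  qed
  then show ?thesis by (simp add: abs_le_square_iff power2_eq_square)
 qed
 have pos_after: "0 < W s" if z: "0 < z" "z < s" and nzero: "\<And>x. z < x \<Longrightarrow> W x \<noteq> 0" and tz: "z < t" for z s
 proof (rule ccontr)
  assume "\<not> 0 < W s"
  then have neg: "W s < 0" using nzero[OF z(2)] by simp
  have "\<exists>x. min s t \<le> x \<and> x \<le> max s t \<and> W x = 0"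
  proof (cases "s \<le> t")
   case True
   then have "\<exists>x. s \<le> x \<and> x \<le> t \<and> W x = 0"
    using neg t z by (intro IVT' continuous_on_subset[OF Wc]) auto
   then show ?thesis using True by auto
  next
   case False
   then have "\<exists>x. t \<le> x \<and> x \<le> s \<and> W x = 0"
    using neg t z by (intro IVT2' continuous_on_subset[OF Wc]) auto
   then show ?thesis using False by auto
  qed
  then obtain x where "min s t \<le> x" "W x = 0" by blast
  then show False using nzero[of x] z tz by auto
 qed
 \<comment> \<open>The powers in the system need not be Lipschitz at 0, so zeros are excluded by the
   energy. At the last zero z it gives P z = 0; to the right of z the positive W makes P decrease,
   whereas W P > 0 makes P positive.\<close>
 have nz': "W s \<noteq> 0" if s: "0 < s" for s
 proof
  assume Ws: "W s = 0"
  have st: "s < t" using sq[of t s] t Ws by (cases "s < t") auto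
  let ?Z = "{x \<in> {s..t}. W x = 0}"
  have "continuous_on {s..t} W" using s by (intro continuous_on_subset[OF Wc]) auto
  then have "closed ?Z" by (intro continuous_closed_preimage_constant) auto
  then have "compact ({s..t} \<inter> ?Z)" by (intro compact_Int_closed) auto
  moreover have "{s..t} \<inter> ?Z = ?Z" by auto
  ultimately have "compact ?Z" by simp
  moreover have "s \<in> ?Z" using Ws st by auto
  then have "?Z \<noteq> {}" by blast
  ultimately obtain z where z: "z \<in> ?Z" "\<And>x. x \<in> ?Z \<Longrightarrow> x \<le> z" using compact_attains_sup[of ?Z] by blast
  then have z': "s \<le> z" "z \<le> t" "W z = 0" by auto
  moreover have "z \<noteq> t" using z'(3) t by auto
  ultimately have z0: "0 < z" "W z = 0" "z < t" using s by simp_all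
  have nzero: "W x \<noteq> 0" if "z < x" for x
  proof (cases "x \<le> t")
   case True
   then show ?thesis using z(1) z(2)[of x] that by force
  next
   case False
   then show ?thesis using sq[of t x] t by auto
  qed
  have Wpos: "0 < W x" if "z < x" for x by (rule pos_after[OF z0(1) that nzero z0(3)])
  have "\<mu> * (z * \<bar>P z\<bar> powr (1 / \<mu>)) = 0" using H0[OF z0(1)] z0(2) q by simp
  then have Pz: "P z = 0" using \<mu> z0 by simp
  have "P t < P z"
  proof (rule DERIV_neg_imp_decreasing_open[OF z0(3)])
   show "\<exists>D. DERIV P x :> D \<and> D < 0" if "z < x" "x < t" for x
   proof -
    have x: "0 < x" "0 < W x" using that z0 Wpos by auto
    show ?thesis using P'[OF x(1)] x c by (intro exI conjI) (auto simp: spw_pos)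
   qed
   show "continuous_on {z..t} P" using z0 by (intro continuous_on_subset[OF Pc]) auto
  qed
  moreover have "0 < P t" using WP[OF t(1)] t(2) by (simp add: zero_less_mult_iff)
  ultimately show False using Pz by simp
 qed
 have Wp: "0 < W s" if s: "0 < s" for s
  using s t by (intro pos_after[of "min s t / 2"] nz') auto
 have Pp: "0 < P s" if s: "0 < s" for s
  using WP[OF s nz'[OF s]] Wp[OF s] by (simp add: zero_less_mult_iff)
 have Vp: "V s = P s powr (1 / (p - 1))" "0 < V s" if s: "0 < s" for s
  using Pp[OF s] by (auto simp: V_def spw_pos)
 have H1: "\<mu> * P s * (W s - s * V s) = c / q * (s powr (- (q * \<mu>)) * W s powr q)" if s: "0 < s" for s
  using H0[OF s] VP[of s] Wp[OF s] by (simp add: algebra_simps)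
 have VW: "s * V s < W s" if s: "0 < s" for s
 proof -
  have "0 < c / q * (s powr (- (q * \<mu>)) * W s powr q)" using s c q Wp[OF s] by auto
  then have "0 < (\<mu> * P s) * (W s - s * V s)" using H1[OF s] by simp
  moreover have "0 < \<mu> * P s" using \<mu>(1) Pp[OF s] by simp
  ultimately have "0 < W s - s * V s" by (rule zero_less_mult_pos)
  then show ?thesis by simp
 qed
 \<comment> \<open>Eliminating s powr (- (q * \<mu>)) * W powr q between the zero energy and the
   equation for P leaves P' / P = - q \<mu> (1 / s - W' / W), a relation between logarithmic
   derivatives.\<close>
 define L where "L = (\<lambda>s. 1 / (p - 1) * ln (P s) + (1 + m) * (ln s - ln (W s)))"
 have "DERIV L s :> 0" if s: "0 < s" for s
 proof -
  let ?g = "c * (s powr (- 1 - q * \<mu>) * spw (q - 1) (W s))"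
  have g: "?g = q * \<mu> * P s * (1 / s - V s / W s)"
  proof -
   have s1: "s powr (- (q * \<mu>)) = s powr (- 1 - q * \<mu>) * s"
    using s powr_add[of s "- 1 - q * \<mu>" 1] by simp
   have wq: "W s powr q = W s powr (q - 1) * W s" using Wp[OF s] powr_add[of "W s" "q - 1" 1] by simp
   have "?g * (s * W s) = q * (c / q * (s powr (- (q * \<mu>)) * W s powr q))"
    unfolding s1 wq using q by (simp add: spw_pos[OF Wp[OF s]])
   also have "\<dots> = q * (\<mu> * P s * (W s - s * V s))" using H1[OF s] by simp
   finally show ?thesis using s Wp[OF s] by (simp add: field_simps)
  qed
  have "DERIV L s :> 1 / (p - 1) * (1 / P s * (- ?g)) + (1 + m) * (1 / s - 1 / W s * V s)"
   unfolding L_def using s Wp[OF s] Pp[OF s]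
   by (intro DERIV_add DERIV_cmult DERIV_diff DERIV_chain2[OF _ P'] DERIV_chain2[OF _ W'V])
    (auto intro!: derivative_eq_intros simp: inverse_eq_divide)
  also have "1 / (p - 1) * (1 / P s * (- ?g)) + (1 + m) * (1 / s - 1 / W s * V s) = 0"
  proof -
   have e1: "1 / (p - 1) * (q * \<mu>) = 1 + m" using p m(3) by (simp add: \<mu>_def)
   have e2: "1 / (p - 1) * (1 / P s * (- ?g)) = - (1 / (p - 1) * (q * \<mu>)) * (1 / s - V s / W s)"
    unfolding g using Pp[OF s] by simp
   have e3: "1 / W s * V s = V s / W s" by simp
   have e4: "- (1 + m) * X + (1 + m) * X = 0" for X by (simp add: algebra_simps)
   show ?thesis unfolding e2 e3 e1 by (rule e4)
  qed
  finally show ?thesis .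
 qed
 from DERIV_0_half_line[OF this] obtain l where l: "\<And>s. 0 < s \<Longrightarrow> L s = l" by blast
 define b where "b = exp l"
 have b: "0 < b" by (simp add: b_def)
 have Vb: "V s = b * (s powr (- 1 - m) * W s powr (1 + m))" if s: "0 < s" for s
 proof -
  have "ln (V s) = l + ((- 1 - m) * ln s + (1 + m) * ln (W s))"
   using l[OF s] Pp[OF s] unfolding Vp(1)[OF s] L_def by (simp add: ln_powr algebra_simps)
  also have "\<dots> = ln (b * (s powr (- 1 - m) * W s powr (1 + m)))"
   using s Wp[OF s] by (simp add: b_def ln_mult ln_powr)
  finally show ?thesis using s Wp[OF s] Vp(2)[OF s] b by (subst (asm) ln_inj_iff) auto
 qed
 \<comment> \<open>Multiplied by W powr (- m - 1), the equation W' = b (W / s) powr (1 + m) equates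
   derivatives of powers; Y is the resulting constant of integration.\<close>
 define Y where "Y = (\<lambda>s. W s powr (- m) - b * s powr (- m))"
 have "DERIV Y s :> 0" if s: "0 < s" for s
 proof -
  have "DERIV Y s :> (- m * W s powr (- m - 1)) * V s - b * (- m * s powr (- m - 1))"
   unfolding Y_def using s Wp[OF s]
   by (intro DERIV_diff DERIV_cmult DERIV_chain2[OF _ W'V]) (auto intro!: derivative_eq_intros)
  also have "(- m * W s powr (- m - 1)) * V s - b * (- m * s powr (- m - 1)) = 0"
  proof -
   have "W s powr (- m - 1) * W s powr (1 + m) = 1" using Wp[OF s] by (simp flip: powr_add)
   then have "W s powr (- m - 1) * V s = b * s powr (- 1 - m)" unfolding Vb[OF s] by (simp add: mult.left_commute)
   moreover have "- 1 - m = - m - 1" by simp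
   ultimately show ?thesis by (metis (no_types, opaque_lifting) diff_self mult.assoc mult.left_commute)
  qed
  finally show ?thesis .
 qed
 from DERIV_0_half_line[OF this] obtain a where a: "\<And>s. 0 < s \<Longrightarrow> Y s = a" by blast
 define A where "A = a / b"
 define K where "K = b powr (- (1 / m))"
 have K: "0 < K" using b by (simp add: K_def)
 have Wm: "W s powr (- m) = b * s powr (- m) * (1 + A * s powr m)" if s: "0 < s" for s
 proof -
  have "W s powr (- m) = a + b * s powr (- m)" using a[OF s] by (simp add: Y_def)
  also have "\<dots> = b * s powr (- m) * (1 + A * s powr m)" using s b by (simp add: A_def powr_minus field_simps)
  finally show ?thesis .
 qed
 have A: "0 < A"
 proof -
  have "V 1 < W 1" using VW[of 1] by simp
  moreover have "V 1 = b * (W 1 powr m * W 1)" using Vb[of 1] Wp[of 1] by (simp add: powr_add mult.commute)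
  ultimately have "b * W 1 powr m < 1" using Wp[of 1] by (simp add: mult.assoc[symmetric])
  then have "b < W 1 powr (- m)" using Wp[of 1] by (simp add: powr_minus field_simps)
  also have "\<dots> = b * (1 + A)" using Wm[of 1] by simp
  finally show ?thesis using b by simp
 qed
 have WK: "W s = K * s * (1 + A * s powr m) powr (- (1 / m))" if s: "0 < s" for s
 proof -
  have y: "0 < 1 + A * s powr m" using A s by (simp add: add_pos_pos)
  have "W s = (W s powr (- m)) powr (- (1 / m))" using Wp[OF s] m by (simp add: powr_powr)
  also have "\<dots> = K * s * (1 + A * s powr m) powr (- (1 / m))"
   unfolding Wm[OF s] using b s y m by (simp add: powr_mult powr_powr K_def)
  finally show ?thesis .
 qed
 \<comment> \<open>The zero energy at s = 1, where the powers of D = 1 + A reduce to D powr (- d) on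
   both sides.\<close>
 have "\<mu> * A = c / q * K powr (q - p)"
 proof -
  define D where "D = 1 + A"
  have D: "0 < D" using A by (simp add: D_def)
  have W1: "W 1 = K * D powr (- (1 / m))" using WK[of 1] by (simp add: D_def)
  have bK: "b = K powr (- m)" using b m by (simp add: K_def powr_powr)
  have V1: "V 1 = K * D powr (- (1 / m) - 1)"
  proof -
   have "V 1 = b * W 1 powr (1 + m)" using Vb[of 1] by simp
   also have "\<dots> = (K powr (- m) * K powr (1 + m)) * D powr (- (1 / m) * (1 + m))"
    unfolding bK W1 using K D by (simp add: powr_mult powr_powr)
   also have "- (1 / m) * (1 + m) = - (1 / m) - 1" using m by (simp add: field_simps)
   also have "K powr (- m) * K powr (1 + m) = K" using K by (simp flip: powr_add)
   finally show ?thesis .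
  qed
  have "P 1 = V 1 powr (p - 1)" using Vp(1)[of 1] Pp[of 1] p by (simp add: powr_powr)
  also have "\<dots> = K powr (p - 1) * D powr ((- (1 / m) - 1) * (p - 1))"
   unfolding V1 using K D by (simp add: powr_mult powr_powr)
  finally have P1: "P 1 = K powr (p - 1) * D powr ((- (1 / m) - 1) * (p - 1))" .
  have WV1: "W 1 - 1 * V 1 = K * D powr (- (1 / m) - 1) * A"
  proof -
   have "D powr (- (1 / m)) = D powr (- (1 / m) - 1) * D" using D powr_add[of D "- (1 / m) - 1" 1] by simp
   then show ?thesis unfolding W1 V1 by (simp add: D_def algebra_simps)
  qed
  have "\<mu> * P 1 * (W 1 - 1 * V 1) = \<mu> * A * ((K powr (p - 1) * K) * (D powr ((- (1 / m) - 1) * (p - 1)) * D powr (- (1 / m) - 1)))"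
   unfolding P1 WV1 by (simp add: mult_ac)
  also have "K powr (p - 1) * K = K powr p" using K powr_add[of K "p - 1" 1] by simp
  also have "D powr ((- (1 / m) - 1) * (p - 1)) * D powr (- (1 / m) - 1) = D powr (- d)"
  proof -
   have "(- (1 / m) - 1) * (p - 1) + (- (1 / m) - 1) = - (p * (1 / m + 1))"
    by (simp add: algebra_simps diff_divide_distrib)
   then have "(- (1 / m) - 1) * (p - 1) + (- (1 / m) - 1) = - d" unfolding d(4) .
   then show ?thesis by (simp flip: powr_add)
  qed
  finally have e: "\<mu> * P 1 * (W 1 - 1 * V 1) = \<mu> * A * (K powr p * D powr (- d))" .
  have "\<mu> * P 1 * (W 1 - 1 * V 1) = c / q * W 1 powr q" using H1[of 1] by simp
  from trans[OF e[symmetric] this]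
  have "\<mu> * A * (K powr p * D powr (- d)) = c / q * W 1 powr q" .
  also have wq: "W 1 powr q = K powr q * D powr (- d)" unfolding W1 using K D by (simp add: powr_mult powr_powr d_def)
  also have "K powr q = K powr p * K powr (q - p)" by (simp flip: powr_add)
  finally have "(\<mu> * A) * (K powr p * D powr (- d)) = (c / q * K powr (q - p)) * (K powr p * D powr (- d))" by simp
  moreover have "K powr p * D powr (- d) \<noteq> 0" using K D by simp
  ultimately show ?thesis by (metis mult_right_cancel)
 qed
 then show ?thesis using K A WK by blast
qed


end

section \<open>From the weak equation to the differential system\<close>

lemma antiderivative_half_line:
 fixes g :: "real \<Rightarrow> real"
 assumes "continuous_on {0<..} g"
 obtains Q where "\<And>s. 0 < s \<Longrightarrow> DERIV Q s :> g s"
proof -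
 have "\<exists>Q. \<forall>s::real. (0::ereal) < s \<longrightarrow> s < \<infinity> \<longrightarrow> (Q has_vector_derivative g s) (at s)"
 proof (rule einterval_antiderivative)
  fix s :: real assume "(0::ereal) < s"
  then have "s \<in> {0<..}" by simp
  then show "isCont g s" using assms by (simp add: continuous_on_eq_continuous_at)
 qed simp
 then obtain Q where "\<And>s. 0 < s \<Longrightarrow> (Q has_vector_derivative g s) (at s)" by auto
 then show thesis using that[of Q] by (simp add: has_real_derivative_iff_has_vector_derivative)
qed

lemma C1c_prim:
 assumes ab: "0 < a" "a < b" and g: "continuous_on UNIV g" "\<And>s. s \<notin> {a..b} \<Longrightarrow> g s = 0"
  and I: "(LINT s|lborel. g s) = 0"
 shows "C1c (prim g) g"
proof -
 have gi: "integrable lborel g"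
  by (rule integrable_continuous_Icc_support[of a b]) (use g in \<open>auto intro: continuous_on_subset\<close>)
 have left: "prim g s = 0" if "s < a" for s by (rule prim_eq_0) (use g(2) that in auto)
 have right: "prim g s = 0" if "b < s" for s
 proof -
  have "(\<lambda>t. indicator {..s} t *\<^sub>R g t) = g" using g(2) that by (auto simp: indicator_def fun_eq_iff)
  then show ?thesis using I by (simp add: prim_def set_lebesgue_integral_def)
 qed
 have "DERIV (prim g) s :> g s" for s
 proof (cases "0 < s")
  case True
  then show ?thesis using g(1) by (intro prim_has_real_derivative[OF gi]) (auto intro: continuous_on_subset)
 next
  case False
  have "DERIV (\<lambda>_. 0) s :> 0" by simp
  then have "DERIV (prim g) s :> 0"
   by (rule has_field_derivative_transform_within_open[of _ _ _ "{..<a}"]) (use False ab left in auto)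
  then show ?thesis using g(2)[of s] False ab by simp
 qed
 then show ?thesis unfolding C1c_def using g ab left right
  by (intro conjI allI exI[of _ a] exI[of _ b]) (auto simp: not_le)
qed

text \<open>Derivatives of test functions are the compactly supported continuous functions with
  integral 0. A test function becomes one after subtraction of a multiple of the fixed bump g, and
  the pairing of F with that multiple produces the constant C.\<close>

lemma du_Bois_Reymond_half_line:
 fixes F :: "real \<Rightarrow> real"
 assumes F: "loc_integrable (\<lambda>s. indicator {0<..} s * F s)"
  and z: "\<And>\<Phi> \<Phi>'. C1c \<Phi> \<Phi>' \<Longrightarrow> (LINT s|lborel. F s * \<Phi>' s) = 0"
 obtains C where "AE s in lborel. 0 < s \<longrightarrow> F s = C"
proof -
 define g where "g = (\<lambda>s::real. max 0 ((s - 1) * (2 - s)))"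
 have gz: "g s = 0" if "s \<notin> {1..2}" for s
 proof -
  have "(s - 1) * (2 - s) \<le> 0" using that by (auto intro: mult_nonpos_nonneg mult_nonneg_nonpos)
  then show ?thesis by (simp add: g_def)
 qed
 have gc: "continuous_on UNIV g" unfolding g_def by (intro continuous_intros)
 have gC: "g \<in> Ckc 0" by (rule CkcI[of _ _ "{1..2}"]) (use gc gz in auto)
 have gi: "integrable lborel g" by (rule Ckc_integrable[OF gC])
 define I where "I = (LINT s|lborel. g s)"
 have I0: "I \<noteq> 0"
 proof
  assume "I = 0"
  then have "AE s in lborel. g s = 0"
   unfolding I_def by (subst (asm) integral_nonneg_eq_0_iff_AE[OF gi]) (auto simp: g_def)
  then have "AE s in lborel. s \<notin> {1<..<2::real}"
  proof eventually_elim
   fix s assume *: "g s = 0"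
   show "s \<notin> {1<..<2}"
   proof
    assume "s \<in> {1<..<2}"
    then have pos: "0 < (s - 1) * (2 - s)" by simp
    then have "g s = (s - 1) * (2 - s)" unfolding g_def by (intro max_absorb2) (rule less_imp_le)
    then show False using * pos by linarith
   qed
  qed
  then have "{1<..<2::real} \<in> null_sets lborel" by (subst AE_iff_null_sets) auto
  then show False by (simp add: null_sets_def)
 qed
 have Fg: "integrable lborel (\<lambda>s. F s * g s)"
 proof -
  have "(\<lambda>s. indicator {0<..} s * F s * g s) = (\<lambda>s. F s * g s)" using gz by (auto simp: indicator_def fun_eq_iff)
  then show ?thesis using loc_integrable_mult_Ckc[OF F gC] by simp
 qed
 define C where "C = (LINT s|lborel. F s * g s) / I"
 have "AE s in lborel. indicator {0<..} s * (F s - C) = 0"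
 proof (rule du_Bois_Reymond)
  have "loc_integrable (\<lambda>s::real. indicator {0<..} s * C)"
  proof (rule loc_integrable_continuous)
   have "continuous_on ({0<..} \<union> {..<0}) (\<lambda>s::real. indicator {0<..} s * C)"
    by (rule continuous_on_open_Un) (auto intro: continuous_on_eq[OF continuous_on_const])
   moreover have "- {0::real} = {0<..} \<union> {..<0}" by auto
   ultimately show "continuous_on (- {0}) (\<lambda>s::real. indicator {0<..} s * C)" by simp
  qed
  from loc_integrable_diff[OF F this]
  show li: "loc_integrable (\<lambda>s. indicator {0<..} s * (F s - C))" by (simp add: right_diff_distrib)
  fix \<phi> :: "real \<Rightarrow> real" assume \<phi>: "\<phi> \<in> Ckc 2"
  obtain K where K: "compact K" "0 \<notin> K" "\<And>x. x \<notin> K \<Longrightarrow> \<phi> x = 0" using \<phi> by (auto elim: CkcE)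
  have \<phi>c: "continuous_on UNIV \<phi>" using \<phi> by (intro Ck_continuous CkcD)
  \<comment> \<open>The test function may live on both half-lines. As it vanishes near 0, its
    restriction to the positive one stays continuous when extended by 0.\<close>
  define f where "f = (\<lambda>s. indicator {0<..} s * \<phi> s)"
  obtain e where e: "0 < e" "ball 0 e \<subseteq> - K"
   using openE[of "- K" 0] K(2) compact_imp_closed[OF K(1)] by (metis ComplI open_Compl)
  obtain R where R: "\<And>x. x \<in> K \<Longrightarrow> \<bar>x\<bar> \<le> R" using compact_imp_bounded[OF K(1)] by (auto simp: bounded_iff)
  have fz: "f s = 0" if "s \<notin> {e..max R (e + 1)}" for s
  proof (cases "s \<in> K")
   case True
   then have "s \<notin> ball 0 e" using e by auto
   then have "s < 0" using R[OF True] that by (auto simp: dist_real_def)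
   then show ?thesis by (simp add: f_def)
  qed (simp add: f_def K)
  have fc: "continuous_on UNIV f"
  proof -
   have "continuous_on {0<..} f"
    by (rule continuous_on_eq[OF continuous_on_subset[OF \<phi>c]]) (auto simp: f_def)
   moreover have "continuous_on {..<e} f"
    by (rule continuous_on_eq[OF continuous_on_const]) (use fz in auto)
   ultimately have "continuous_on ({0<..} \<union> {..<e}) f" by (intro continuous_on_open_Un) auto
   moreover have "{0<..} \<union> {..<e} = UNIV" using e by auto
   ultimately show ?thesis by simp
  qed
  have fi: "integrable lborel f"
   by (rule integrable_continuous_Icc_support[of e "max R (e + 1)"]) (use fc fz in \<open>auto intro: continuous_on_subset\<close>)
  have Ff: "integrable lborel (\<lambda>s. F s * f s)"
   using loc_integrable_mult_Ckc[OF F \<phi>] by (simp add: f_def mult_ac)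
  define c where "c = (LINT s|lborel. f s) / I"
  have "C1c (prim (\<lambda>s. f s - c * g s)) (\<lambda>s. f s - c * g s)"
  proof (rule C1c_prim[of "min e 1" "max (max R (e + 1)) 2"])
   show "continuous_on UNIV (\<lambda>s. f s - c * g s)" by (intro continuous_intros fc gc)
   show "(LINT s|lborel. f s - c * g s) = 0" using fi gi I0 by (simp add: c_def I_def)
   show "f s - c * g s = 0" if "s \<notin> {min e 1..max (max R (e + 1)) 2}" for s
   proof -
    have "s \<notin> {e..max R (e + 1)}" "s \<notin> {1..2}" using that by auto
    then show ?thesis using fz gz by simp
   qed
  qed (use e in auto)
  from z[OF this] have "(LINT s|lborel. F s * f s - c * (F s * g s)) = 0" by (simp add: algebra_simps)
  then have "(LINT s|lborel. F s * f s) = c * (LINT s|lborel. F s * g s)" using Ff Fg by simp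
  also have "\<dots> = C * (LINT s|lborel. f s)" by (simp add: c_def C_def)
  finally have "(LINT s|lborel. F s * f s - C * f s) = 0" using Ff fi by simp
  then show "(LINT s|lborel. indicator {0<..} s * (F s - C) * \<phi> s) = 0" by (simp add: f_def algebra_simps)
 qed
 then have "AE s in lborel. 0 < s \<longrightarrow> F s = C" by eventually_elim auto
 then show thesis by (rule that)
qed

text \<open>The growth bound carries the p-integral up to s only, so it also shows that the
  primitive is small compared with s powr ((p - 1) / p) near 0.\<close>

lemma Lp_prim:
 fixes \<psi> :: "real \<Rightarrow> real"
 assumes p: "1 < p" and [measurable]: "\<psi> \<in> Borel" and z: "\<And>s. s \<le> 0 \<Longrightarrow> \<psi> s = 0"
  and i: "integrable lborel (\<lambda>s. \<bar>\<psi> s\<bar> powr p)"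
 shows "set_integrable lborel {..s} \<psi>"
  and "0 < s \<Longrightarrow> \<bar>prim \<psi> s\<bar> \<le> s powr ((p - 1) / p) * prim (\<lambda>s. \<bar>\<psi> s\<bar> powr p) s powr (1 / p)"
  and "continuous_on {0<..} (prim \<psi>)"
proof -
 have Icc: "set_integrable lborel {0..s} (\<lambda>t. \<bar>\<psi> t\<bar> powr p)" for s
  unfolding set_integrable_def using i by (intro integrable_mult_indicator) auto
 have eq: "(\<lambda>t. indicator {..s} t *\<^sub>R \<psi> t) = (\<lambda>t. indicator {0..s} t *\<^sub>R \<psi> t)" for s
  using z by (auto simp: indicator_def fun_eq_iff)
 have eqp: "(\<lambda>t. indicator {..s} t *\<^sub>R (\<bar>\<psi> t\<bar> powr p)) = (\<lambda>t. indicator {0..s} t *\<^sub>R (\<bar>\<psi> t\<bar> powr p))" for s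
  using z by (auto simp: indicator_def fun_eq_iff)
 show si: "set_integrable lborel {..s} \<psi>" for s
 proof (cases "0 < s")
  case True
  then show ?thesis using integral_Icc_le_powr(1)[OF p _ True Icc] unfolding set_integrable_def eq by simp
 next
  case False
  then have 0: "(\<lambda>t. indicator {..s} t *\<^sub>R \<psi> t) = (\<lambda>_. 0)" using z by (auto simp: indicator_def fun_eq_iff)
  show ?thesis unfolding set_integrable_def 0 by simp
 qed
 have pr: "prim \<psi> s = (LINT t:{0..s}|lborel. \<psi> t)" for s
  unfolding prim_def set_lebesgue_integral_def eq ..
 show "\<bar>prim \<psi> s\<bar> \<le> s powr ((p - 1) / p) * prim (\<lambda>s. \<bar>\<psi> s\<bar> powr p) s powr (1 / p)" if "0 < s" for s
  using integral_Icc_le_powr(2)[OF p _ that Icc] unfolding pr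
  unfolding prim_def set_lebesgue_integral_def eqp by simp
 have s0: "set_integrable lborel {0..s} \<psi>" for s using si[of s] unfolding set_integrable_def eq .
 have hk: "prim \<psi> s = integral {0..s} \<psi>" "\<psi> integrable_on {0..s}" for s
  using set_borel_integral_eq_integral[OF s0] by (auto simp: pr)
 show "continuous_on {0<..} (prim \<psi>)"
 proof (rule continuous_at_imp_continuous_on, intro ballI)
  fix s :: real assume s: "s \<in> {0<..}"
  have "continuous_on {0..s + 1} (\<lambda>s. integral {0..s} \<psi>)" by (rule indefinite_integral_continuous_1[OF hk(2)])
  then have "continuous_on {0<..<s + 1} (prim \<psi>)" unfolding hk by (rule continuous_on_subset) auto
  then show "isCont (prim \<psi>) s" using s by (simp add: continuous_on_eq_continuous_at)
 qed
qed

context bliss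
begin

lemma C1c_integral_by_parts:
 assumes \<Phi>: "C1c \<Phi> \<Phi>'" and Q: "\<And>s. 0 < s \<Longrightarrow> DERIV Q s :> g s" and g: "continuous_on {0<..} g"
 shows "integrable lborel (\<lambda>s. g s * \<Phi> s)" "integrable lborel (\<lambda>s. Q s * \<Phi>' s)"
  "(LINT s|lborel. g s * \<Phi> s) = - (LINT s|lborel. Q s * \<Phi>' s)"
proof -
 obtain a b where ab: "0 < a" "a < b" "\<And>s. s \<notin> {a..b} \<Longrightarrow> \<Phi> s = 0" "\<And>s. s \<notin> {a..b} \<Longrightarrow> \<Phi>' s = 0" "\<Phi> a = 0" "\<Phi> b = 0"
  and \<Phi>': "\<And>s. DERIV \<Phi> s :> \<Phi>' s" and c: "continuous_on UNIV \<Phi>'" "continuous_on UNIV \<Phi>"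
  using C1cE[OF \<Phi>] by metis
 have Qc: "continuous_on {a..b} Q" using DERIV_isCont[OF Q] ab by (intro continuous_at_imp_continuous_on) auto
 have gc: "continuous_on {a..b} g" using ab by (auto intro: continuous_on_subset[OF g])
 have cc: "continuous_on {a..b} \<Phi>" "continuous_on {a..b} \<Phi>'" using c by (auto intro: continuous_on_subset)
 show i: "integrable lborel (\<lambda>s. g s * \<Phi> s)" "integrable lborel (\<lambda>s. Q s * \<Phi>' s)"
  using ab cc Qc gc by (auto intro!: integrable_continuous_Icc_support[of a b] continuous_intros)
 have "(LINT s|lborel. indicator {a..b} s *\<^sub>R (g s * \<Phi> s + Q s * \<Phi>' s)) = Q b * \<Phi> b - Q a * \<Phi> a"
 proof (rule integral_FTC_Icc)
  show "((\<lambda>s. Q s * \<Phi> s) has_vector_derivative g s * \<Phi> s + Q s * \<Phi>' s) (at s within {a..b})" if "a \<le> s" "s \<le> b" for s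
  proof -
   have "DERIV (\<lambda>s. Q s * \<Phi> s) s :> g s * \<Phi> s + Q s * \<Phi>' s"
    using DERIV_mult[OF Q \<Phi>', of s] that ab by (simp add: algebra_simps)
   then show ?thesis
    by (rule has_vector_derivative_at_within[OF has_real_derivative_iff_has_vector_derivative[THEN iffD1]])
  qed
  show "continuous_on {a..b} (\<lambda>s. g s * \<Phi> s + Q s * \<Phi>' s)" by (intro continuous_intros cc Qc gc)
 qed (use ab in auto)
 also have "(\<lambda>s. indicator {a..b} s *\<^sub>R (g s * \<Phi> s + Q s * \<Phi>' s)) = (\<lambda>s. g s * \<Phi> s + Q s * \<Phi>' s)"
 proof
  show "indicator {a..b} s *\<^sub>R (g s * \<Phi> s + Q s * \<Phi>' s) = g s * \<Phi> s + Q s * \<Phi>' s" for s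
   using ab(3,4)[of s] by (cases "s \<in> {a..b}") auto
 qed
 finally show "(LINT s|lborel. g s * \<Phi> s) = - (LINT s|lborel. Q s * \<Phi>' s)" using i ab by simp
qed

text \<open>With Q a primitive of the right-hand side, the weak equation makes
  \<open>spw (p - 1) (\<psi> s) + Q s\<close> orthogonal to all derivatives of test functions, hence
  constant almost everywhere. Then P = C - Q is continuously differentiable and determines \<psi>
  almost everywhere, so that \<open>prim \<psi>\<close> and P satisfy the system in the classical
  sense. The system is odd, which reduces a negative value of W to a positive one.\<close>

lemma ef_weak:
 fixes \<psi> :: "real \<Rightarrow> real"
 assumes c: "0 < c" and [measurable]: "\<psi> \<in> Borel" and z: "\<And>s. s \<le> 0 \<Longrightarrow> \<psi> s = 0"
  and i: "integrable lborel (\<lambda>s. \<bar>\<psi> s\<bar> powr p)"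
  and weak: "\<And>\<Phi> \<Phi>'. C1c \<Phi> \<Phi>' \<Longrightarrow> (LINT s|lborel. spw (p - 1) (\<psi> s) * \<Phi>' s) = c * (LINT s|lborel. wt s * (spw (q - 1) (prim \<psi> s) * \<Phi> s))"
  and nz: "\<exists>s>0. prim \<psi> s \<noteq> 0"
 shows "\<exists>\<epsilon>\<in>{1, -1}. \<exists>K>0. \<exists>A>0. \<mu> * A = c / q * K powr (q - p) \<and>
  (\<forall>s>0. prim \<psi> s = \<epsilon> * (K * s * (1 + A * s powr m) powr (- (1 / m))))"
proof -
 let ?W = "prim \<psi>"
 have Wc: "continuous_on {0<..} ?W" by (rule Lp_prim(3)[OF p _ z i]) auto
 define g where "g = (\<lambda>s. c * (s powr (- 1 - q * \<mu>) * spw (q - 1) (?W s)))"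
 have gc: "continuous_on {0<..} g"
  unfolding g_def using q by (intro continuous_intros continuous_on_spw Wc) auto
 obtain Q where Q: "\<And>s. 0 < s \<Longrightarrow> DERIV Q s :> g s" using antiderivative_half_line[OF gc] by blast
 have Qc: "continuous_on {0<..} Q" using DERIV_isCont[OF Q] by (intro continuous_at_imp_continuous_on) auto
 have spw_b: "\<bar>spw (p - 1) (\<psi> s)\<bar> \<le> 1 + \<bar>\<psi> s\<bar> powr p" for s
 proof -
  have "\<bar>spw (p - 1) (\<psi> s)\<bar> = \<bar>\<psi> s\<bar> powr (p - 1)" using p by (intro abs_spw) auto
  also have "\<dots> \<le> 1 + \<bar>\<psi> s\<bar> powr p"
  proof (cases "\<bar>\<psi> s\<bar> \<le> 1")
   case True
   then have "\<bar>\<psi> s\<bar> powr (p - 1) \<le> 1" using p by (intro powr_le1) auto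
   then show ?thesis by (simp add: add_increasing2)
  next
   case False
   then have "\<bar>\<psi> s\<bar> powr (p - 1) \<le> \<bar>\<psi> s\<bar> powr p" using p by (intro powr_mono) auto
   then show ?thesis by simp
  qed
  finally show ?thesis .
 qed
 have [measurable]: "(\<lambda>s. spw (p - 1) (\<psi> s)) \<in> Borel" unfolding spw_def sgn_if by measurable
 have li1: "loc_integrable (\<lambda>s. spw (p - 1) (\<psi> s))"
  unfolding loc_integrable_def
 proof (intro allI impI)
  fix K :: "real set" assume K: "compact K \<and> 0 \<notin> K"
  have "set_integrable lborel K (\<lambda>s. 1 + \<bar>\<psi> s\<bar> powr p)"
  proof (intro set_integral_add)
   show "set_integrable lborel K (\<lambda>_. 1::real)" unfolding set_integrable_def using K by (intro borel_integrable_compact) auto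
   show "set_integrable lborel K (\<lambda>s. \<bar>\<psi> s\<bar> powr p)"
    unfolding set_integrable_def using i K by (intro integrable_mult_indicator) (auto intro: borel_compact)
  qed
  then show "set_integrable lborel K (\<lambda>s. spw (p - 1) (\<psi> s))"
  proof (rule set_integrable_bound)
   show "set_borel_measurable lborel K (\<lambda>s. spw (p - 1) (\<psi> s))"
    unfolding set_borel_measurable_def using K by (intro borel_measurable_scaleR borel_measurable_indicator) (auto intro: borel_compact)
  qed (use spw_b in \<open>auto intro!: AE_I2 order_trans[OF _ abs_ge_self]\<close>)
 qed
 have li2: "loc_integrable (\<lambda>s. indicator {0<..} s * Q s)"
 proof (rule loc_integrable_continuous)
  have "continuous_on ({0<..} \<union> {..<0}) (\<lambda>s. indicator {0<..} s * Q s)"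
  proof (rule continuous_on_open_Un)
   show "continuous_on {0<..} (\<lambda>s. indicator {0<..} s * Q s)" by (rule continuous_on_eq[OF Qc]) auto
   show "continuous_on {..<0} (\<lambda>s. indicator {0<..} s * Q s)" by (rule continuous_on_eq[OF continuous_on_const[of _ 0]]) auto
  qed auto
  moreover have "- {0::real} = {0<..} \<union> {..<0}" by auto
  ultimately show "continuous_on (- {0}) (\<lambda>s. indicator {0<..} s * Q s)" by simp
 qed
 have "loc_integrable (\<lambda>s. indicator {0<..} s * (spw (p - 1) (\<psi> s) + Q s))"
 proof -
  have "loc_integrable (\<lambda>s. spw (p - 1) (\<psi> s) - (- 1) * (indicator {0<..} s * Q s))"
  proof (intro loc_integrable_diff li1)
   show "loc_integrable (\<lambda>s. (- 1) * (indicator {0<..} s * Q s))"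
    using li2 unfolding loc_integrable_def by (intro allI impI set_integrable_mult_right) auto
  qed
  moreover have "spw (p - 1) (\<psi> s) - (- 1) * (indicator {0<..} s * Q s) = indicator {0<..} s * (spw (p - 1) (\<psi> s) + Q s)" for s
   using z[of s] by (cases "0 < s") (auto simp: spw_def)
  ultimately show ?thesis by simp
 qed
 then obtain C where C: "AE s in lborel. 0 < s \<longrightarrow> spw (p - 1) (\<psi> s) + Q s = C"
 proof (rule du_Bois_Reymond_half_line)
  fix \<Phi> \<Phi>' assume \<Phi>: "C1c \<Phi> \<Phi>'"
  note parts = C1c_integral_by_parts[OF \<Phi> Q gc]
  have "c * (LINT s|lborel. wt s * (spw (q - 1) (?W s) * \<Phi> s)) = (LINT s|lborel. g s * \<Phi> s)"
  proof -
   have eq: "c * (wt s * (spw (q - 1) (?W s) * \<Phi> s)) = g s * \<Phi> s" for s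
   proof (cases "0 < s")
    case False
    obtain a b where "0 < a" "\<And>s. s \<notin> {a..b} \<Longrightarrow> \<Phi> s = 0" using C1cE[OF \<Phi>] by metis
    then have "\<Phi> s = 0" using False by simp
    then show ?thesis by simp
   qed (simp add: wt_def g_def)
   show ?thesis unfolding integral_mult_right_zero[symmetric] eq ..
  qed
  then have "(LINT s|lborel. spw (p - 1) (\<psi> s) * \<Phi>' s) = - (LINT s|lborel. Q s * \<Phi>' s)"
   using weak[OF \<Phi>] parts(3) by simp
  moreover have "integrable lborel (\<lambda>s. spw (p - 1) (\<psi> s) * \<Phi>' s)"
  proof (rule loc_integrable_mult_Ckc[OF li1, of _ 0])
   obtain a b where "0 < a" "\<And>s. s \<notin> {a..b} \<Longrightarrow> \<Phi>' s = 0" "continuous_on UNIV \<Phi>'" using C1cE[OF \<Phi>] by metis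
   then show "\<Phi>' \<in> Ckc 0" by (intro CkcI[of _ _ "{a..b}"]) auto
  qed
  ultimately show "(LINT s|lborel. (spw (p - 1) (\<psi> s) + Q s) * \<Phi>' s) = 0"
   using parts(2) by (simp add: distrib_right)
 qed
 define P where "P = (\<lambda>s. C - Q s)"
 define V where "V = (\<lambda>s. spw (1 / (p - 1)) (P s))"
 have Pc: "continuous_on {0<..} P" unfolding P_def by (intro continuous_intros Qc)
 have Vc: "continuous_on {0<..} V" unfolding V_def using p by (intro continuous_on_spw Pc) auto
 have \<psi>P: "AE s in lborel. 0 < s \<longrightarrow> spw (p - 1) (\<psi> s) = P s" using C by eventually_elim (auto simp: P_def)
 then have \<psi>V: "AE s in lborel. 0 < s \<longrightarrow> \<psi> s = V s"
 proof eventually_elim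
  fix s assume *: "0 < s \<longrightarrow> spw (p - 1) (\<psi> s) = P s"
  have "spw (1 / (p - 1)) (spw (p - 1) (\<psi> s)) = \<psi> s" using p by (simp add: spw_spw spw_1)
  then show "0 < s \<longrightarrow> \<psi> s = V s" unfolding V_def using * by metis
 qed
 have W': "DERIV (?W) s :> V s" if "0 < s" for s
  by (rule prim_has_real_derivative_local[OF Lp_prim(1)[OF p _ z i] Vc \<psi>V that]) auto
 have P': "DERIV P s :> - g s" if "0 < s" for s
  unfolding P_def using Q[OF that] by (auto intro!: derivative_eq_intros)
 define n where "n = (\<lambda>s. indicator {0<..} s * \<bar>P s\<bar> powr (1 / \<mu>))"
 have n\<psi>: "AE s in lborel. n s = \<bar>\<psi> s\<bar> powr p"
  using \<psi>P
 proof eventually_elim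
  fix s assume *: "0 < s \<longrightarrow> spw (p - 1) (\<psi> s) = P s"
  show "n s = \<bar>\<psi> s\<bar> powr p"
  proof (cases "0 < s")
   case True
   have "\<bar>P s\<bar> = \<bar>\<psi> s\<bar> powr (p - 1)" using * True p by (metis abs_spw diff_gt_0_iff_gt less_irrefl)
   moreover have "(p - 1) * (1 / \<mu>) = p" using p by (simp add: \<mu>_def)
   ultimately show ?thesis using True by (simp add: n_def powr_powr)
  qed (use z[of s] in \<open>simp add: n_def\<close>)
 qed
 have nm [measurable]: "n \<in> Borel"
 proof -
  have "(\<lambda>s. indicator {0<..} s *\<^sub>R P s) \<in> Borel"
   by (rule borel_measurable_continuous_on_indicator[OF _ Pc]) simp
  then have "(\<lambda>s. \<bar>indicator {0<..} s *\<^sub>R P s\<bar> powr (1 / \<mu>)) \<in> Borel" by measurable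
  also have "(\<lambda>s. \<bar>indicator {0<..} s *\<^sub>R P s\<bar> powr (1 / \<mu>)) = n" by (auto simp: n_def indicator_def fun_eq_iff)
  finally show ?thesis .
 qed
 have ni: "integrable lborel n"
  using i n\<psi> by (subst integrable_cong_AE[where g = "\<lambda>s. \<bar>\<psi> s\<bar> powr p"]) auto
 have npr: "prim n s = prim (\<lambda>s. \<bar>\<psi> s\<bar> powr p) s" for s
  unfolding prim_def set_lebesgue_integral_def
  by (rule integral_cong_AE) (use n\<psi> in \<open>auto elim!: eventually_mono\<close>)
 have Wle: "\<bar>?W s\<bar> \<le> s powr \<mu> * prim n s powr (1 / p)" if "0 < s" for s
  using Lp_prim(2)[OF p _ z i that] by (simp add: npr \<mu>_def)
 obtain t where t: "0 < t" "?W t \<noteq> 0" using nz by blast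
 show ?thesis
 proof (cases "0 < ?W t")
  case True
  have "\<exists>K>0. \<exists>A>0. \<mu> * A = c / q * K powr (q - p) \<and> (\<forall>s>0. ?W s = K * s * (1 + A * s powr m) powr (- (1 / m)))"
  proof (rule ef_system_pos[OF c])
   show "DERIV (?W) s :> spw (1 / (p - 1)) (P s)" if "0 < s" for s using W'[OF that] by (simp add: V_def)
   show "DERIV P s :> - (c * (s powr (- 1 - q * \<mu>) * spw (q - 1) (?W s)))" if "0 < s" for s
    using P'[OF that] by (simp add: g_def)
  qed (use ni Wle True t in \<open>auto simp: n_def\<close>)
  then show ?thesis by auto
 next
  case False
  have "\<exists>K>0. \<exists>A>0. \<mu> * A = c / q * K powr (q - p) \<and> (\<forall>s>0. - ?W s = K * s * (1 + A * s powr m) powr (- (1 / m)))"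
  proof (rule ef_system_pos[OF c, where P = "\<lambda>s. - P s"])
   show "DERIV (\<lambda>s. - ?W s) s :> spw (1 / (p - 1)) (- P s)" if "0 < s" for s
    using DERIV_minus[OF W'[OF that]] by (simp add: V_def spw_minus)
   show "DERIV (\<lambda>s. - P s) s :> - (c * (s powr (- 1 - q * \<mu>) * spw (q - 1) (- ?W s)))" if "0 < s" for s
    using DERIV_minus[OF P'[OF that]] by (simp add: g_def spw_minus)
  qed (use ni Wle False t in \<open>auto simp: n_def\<close>)
  then obtain K A where "0 < K" "0 < A" "\<mu> * A = c / q * K powr (q - p)"
   "\<forall>s>0. - ?W s = K * s * (1 + A * s powr m) powr (- (1 / m))" by blast
  then show ?thesis by (intro bexI[of _ "-1"] exI[of _ K] conjI exI[of _ A]) auto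
 qed
qed

end

subsection \<open>Limits of compactly supported functions\<close>

text \<open>The leading coefficient may be as close to 1 as desired, at the price of a large C on
  the small term: with (1 + d) powr p = 1 + \<epsilon>, either |y| \<le> d |x| or |x| \<le> |y| / d.
  This keeps the constant of Bliss' inequality sharp in the limit.\<close>

lemma powr_add_le_eps:
 fixes p \<epsilon> :: real
 assumes p: "1 < p" and \<epsilon>: "0 < \<epsilon>"
 obtains C where "0 \<le> C" "\<And>x y :: real. \<bar>x + y\<bar> powr p \<le> (1 + \<epsilon>) * \<bar>x\<bar> powr p + C * \<bar>y\<bar> powr p"
proof -
 define d where "d = (1 + \<epsilon>) powr (1 / p) - 1"
 have d: "0 < d" using p \<epsilon> powr_less_mono2[of "1 / p" 1 "1 + \<epsilon>"] by (simp add: d_def)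
 have dp: "(1 + d) powr p = 1 + \<epsilon>" using p \<epsilon> by (simp add: d_def powr_powr)
 have "\<bar>x + y\<bar> powr p \<le> (1 + \<epsilon>) * \<bar>x\<bar> powr p + (1 + 1 / d) powr p * \<bar>y\<bar> powr p" for x y :: real
 proof (cases "\<bar>y\<bar> \<le> d * \<bar>x\<bar>")
  case True
  have "\<bar>x + y\<bar> powr p \<le> ((1 + d) * \<bar>x\<bar>) powr p" using True p by (intro powr_mono2) (auto simp: algebra_simps)
  also have "\<dots> = (1 + \<epsilon>) * \<bar>x\<bar> powr p" using d by (simp add: powr_mult dp)
  finally show ?thesis by (simp add: add_increasing2)
 next
  case False
  then have "\<bar>x\<bar> \<le> \<bar>y\<bar> / d" using d by (simp add: field_simps)
  then have "\<bar>x + y\<bar> powr p \<le> ((1 + 1 / d) * \<bar>y\<bar>) powr p" using p by (intro powr_mono2) (auto simp: algebra_simps)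
  also have "\<dots> = (1 + 1 / d) powr p * \<bar>y\<bar> powr p" using d by (simp add: powr_mult)
  finally show ?thesis using \<epsilon> by (simp add: add_increasing)
 qed
 then show thesis by (rule that[rotated]) simp
qed

lemma exists_eps_mult_less:
 fixes N B :: real
 assumes "0 \<le> N" "N < B"
 shows "\<exists>\<epsilon>>0. (1 + \<epsilon>) * N < B"
proof -
 define \<epsilon> where "\<epsilon> = (B - N) / (2 * (N + 1))"
 have \<epsilon>: "0 < \<epsilon>" using assms by (simp add: \<epsilon>_def)
 have "\<epsilon> * N \<le> \<epsilon> * (N + 1)" using \<epsilon> by (intro mult_left_mono) auto
 also have "\<dots> = (B - N) / 2" using assms by (simp add: \<epsilon>_def field_simps)
 finally have "(1 + \<epsilon>) * N < B" using assms by (simp add: algebra_simps)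
 with \<epsilon> show ?thesis by blast
qed

lemma C1c_eq_prim:
 assumes "C1c W W'"
 shows "W = prim W'" "W' \<in> Borel" "s \<le> 0 \<Longrightarrow> W' s = 0"
proof -
 obtain a b where ab: "0 < a" "a < b" "\<And>s. s \<notin> {a..b} \<Longrightarrow> W s = 0" "\<And>s. s \<notin> {a..b} \<Longrightarrow> W' s = 0" "W a = 0"
  and W': "\<And>s. DERIV W s :> W' s" and c: "continuous_on UNIV W'"
  using C1cE[OF assms] by metis
 show "W' \<in> Borel" by (rule borel_measurable_continuous_onI[OF c])
 show "s \<le> 0 \<Longrightarrow> W' s = 0" using ab by simp
 have "W s = prim W' s" for s
 proof (cases "a \<le> s")
  case True
  have "(LINT t|lborel. indicator {a..s} t *\<^sub>R W' t) = W s - W a"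
  proof (rule integral_FTC_Icc[OF True])
   show "(W has_vector_derivative W' t) (at t within {a..s})" for t
    by (rule has_vector_derivative_at_within[OF has_real_derivative_iff_has_vector_derivative[THEN iffD1, OF W']])
   show "continuous_on {a..s} W'" by (rule continuous_on_subset[OF c]) auto
  qed
  moreover have "(\<lambda>t. indicator {a..s} t *\<^sub>R W' t) = (\<lambda>t. indicator {..s} t *\<^sub>R W' t)"
   using ab(4) by (auto simp: indicator_def fun_eq_iff)
  ultimately show ?thesis using ab(5) by (simp add: prim_def set_lebesgue_integral_def)
 next
  case False
  have "prim W' s = 0" by (rule prim_eq_0) (use ab(4) False in auto)
  then show ?thesis using ab(3) False by simp
 qed
 then show "W = prim W'" by blast
qed

lemma prim_diff_le:
 fixes f g :: "real \<Rightarrow> real"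
 assumes p: "1 < p" and [measurable]: "f \<in> Borel" "g \<in> Borel"
  and z: "\<And>s. s \<le> 0 \<Longrightarrow> f s = 0" "\<And>s. s \<le> 0 \<Longrightarrow> g s = 0"
  and i: "integrable lborel (\<lambda>s. \<bar>f s\<bar> powr p)" "integrable lborel (\<lambda>s. \<bar>g s\<bar> powr p)" and s: "0 < s"
 shows "integrable lborel (\<lambda>s. \<bar>f s - g s\<bar> powr p)"
  and "\<bar>prim f s - prim g s\<bar> \<le> s powr ((p - 1) / p) * Lp_dist p f g powr (1 / p)"
proof -
 show fg: "integrable lborel (\<lambda>s. \<bar>f s - g s\<bar> powr p)"
 proof (rule Bochner_Integration.integrable_bound)
  show "integrable lborel (\<lambda>s. 2 powr p * (\<bar>f s\<bar> powr p + \<bar>g s\<bar> powr p))" using i by auto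
  show "AE s in lborel. norm (\<bar>f s - g s\<bar> powr p) \<le> norm (2 powr p * (\<bar>f s\<bar> powr p + \<bar>g s\<bar> powr p))"
   using powr_add_le[of p "f _" "- g _"] p by (intro AE_I2) auto
 qed simp
 have "prim f s - prim g s = prim (\<lambda>s. f s - g s) s"
  unfolding prim_def using Lp_prim(1)[OF p _ z(1) i(1)] Lp_prim(1)[OF p _ z(2) i(2)]
  by (intro set_integral_diff(2)[symmetric]) auto
 also have "\<bar>prim (\<lambda>s. f s - g s) s\<bar> \<le> s powr ((p - 1) / p) * prim (\<lambda>s. \<bar>f s - g s\<bar> powr p) s powr (1 / p)"
  using z by (intro Lp_prim(2)[OF p _ _ fg s]) auto
 also have "\<dots> \<le> s powr ((p - 1) / p) * Lp_dist p f g powr (1 / p)"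
  using p by (intro mult_left_mono powr_mono2 prim_le_total fg prim_nonneg) auto
 finally show "\<bar>prim f s - prim g s\<bar> \<le> s powr ((p - 1) / p) * Lp_dist p f g powr (1 / p)" .
qed

context bliss
begin

text \<open>The half-line picture of a Cauchy sequence for \<open>D_norm\<close> together with its
  limit. The functions V themselves converge to \<open>prim \<psi>\<close> at each s > 0, by
  Hoelder's bound (\<open>C1c_limit_pointwise\<close>).\<close>

definition C1c_limit :: "(nat \<Rightarrow> real \<Rightarrow> real) \<Rightarrow> (nat \<Rightarrow> real \<Rightarrow> real) \<Rightarrow> (real \<Rightarrow> real) \<Rightarrow> bool" where
 "C1c_limit V V' \<psi> \<longleftrightarrow> (\<forall>j. C1c (V j) (V' j)) \<and> \<psi> \<in> Borel \<and> (\<forall>s\<le>0. \<psi> s = 0) \<and>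
   integrable lborel (\<lambda>s. \<bar>\<psi> s\<bar> powr p) \<and> (\<lambda>j. Lp_dist p (V' j) \<psi>) \<longlonglongrightarrow> 0"

lemma C1c_limitD:
 assumes "C1c_limit V V' \<psi>"
 shows "C1c (V j) (V' j)" "\<psi> \<in> Borel" "s \<le> 0 \<Longrightarrow> \<psi> s = 0" "integrable lborel (\<lambda>s. \<bar>\<psi> s\<bar> powr p)"
  "(\<lambda>j. Lp_dist p (V' j) \<psi>) \<longlonglongrightarrow> 0"
  "V' j \<in> Borel" "s \<le> 0 \<Longrightarrow> V' j s = 0" "integrable lborel (\<lambda>s. \<bar>V' j s\<bar> powr p)"
  "integrable lborel (\<lambda>s. \<bar>V' j s - \<psi> s\<bar> powr p)"
  "0 < s \<Longrightarrow> \<bar>V j s - prim \<psi> s\<bar> \<le> s powr \<mu> * Lp_dist p (V' j) \<psi> powr (1 / p)"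
proof -
 show V: "C1c (V j) (V' j)" for j using assms by (auto simp: C1c_limit_def)
 show \<psi>: "\<psi> \<in> Borel" "s \<le> 0 \<Longrightarrow> \<psi> s = 0" "integrable lborel (\<lambda>s. \<bar>\<psi> s\<bar> powr p)"
  "(\<lambda>j. Lp_dist p (V' j) \<psi>) \<longlonglongrightarrow> 0" for s
  using assms by (auto simp: C1c_limit_def)
 show V': "V' j \<in> Borel" "s \<le> 0 \<Longrightarrow> V' j s = 0" "integrable lborel (\<lambda>s. \<bar>V' j s\<bar> powr p)" for j s
  using C1c_eq_prim[OF V] C1c_integrable(1)[OF V] by auto
 note pd = prim_diff_le[OF p V'(1) \<psi>(1) V'(2) \<psi>(2) V'(3) \<psi>(3)]
 show "integrable lborel (\<lambda>s. \<bar>V' j s - \<psi> s\<bar> powr p)" by (rule pd(1)[of 1]) auto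
 show "0 < s \<Longrightarrow> \<bar>V j s - prim \<psi> s\<bar> \<le> s powr \<mu> * Lp_dist p (V' j) \<psi> powr (1 / p)"
  using pd(2)[of s j] unfolding \<mu>_def C1c_eq_prim(1)[OF V, of j, symmetric] by auto
qed

lemma C1c_limit_dist_tendsto_0:
 assumes "C1c_limit V V' \<psi>"
 shows "(\<lambda>j. Lp_dist p (V' j) \<psi> powr (1 / p)) \<longlonglongrightarrow> 0"
proof -
 have "(\<lambda>j. Lp_dist p (V' j) \<psi> powr (1 / p)) \<longlonglongrightarrow> 0 powr (1 / p)"
  using p by (intro tendsto_powr2 C1c_limitD(5)[OF assms] tendsto_const always_eventually allI integral_nonneg_AE AE_I2) auto
 then show ?thesis by simp
qed

lemma C1c_limit_pointwise:
 assumes "C1c_limit V V' \<psi>" "0 < s"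
 shows "(\<lambda>j. V j s) \<longlonglongrightarrow> prim \<psi> s"
proof (rule LIM_zero_cancel, rule Lim_null_comparison)
 show "\<forall>\<^sub>F j in sequentially. norm (V j s - prim \<psi> s) \<le> s powr \<mu> * Lp_dist p (V' j) \<psi> powr (1 / p)"
  using C1c_limitD(10)[OF assms] by (intro always_eventually) simp
 show "(\<lambda>j. s powr \<mu> * Lp_dist p (V' j) \<psi> powr (1 / p)) \<longlonglongrightarrow> 0"
  using tendsto_mult[OF tendsto_const C1c_limit_dist_tendsto_0[OF assms(1)], of "s powr \<mu>"] by simp
qed

lemma prim_borel:
 assumes "C1c_limit V V' \<psi>"
 shows "(\<lambda>s. indicator {0<..} s * prim \<psi> s) \<in> Borel"
proof -
 note D = C1c_limitD[OF assms]
 have "continuous_on {0<..} (prim \<psi>)" by (rule Lp_prim(3)[OF p D(2,3,4)])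
 from borel_measurable_continuous_on_indicator[OF _ this]
 show ?thesis by simp
qed

text \<open>As soon as the energies along the sequence are below some B that exceeds the energy of
  \<psi>, Bliss' inequality bounds the weighted integrals and Fatou's lemma transfers the bound to
  the limit. Then B decreases to the energy of \<psi>.\<close>

lemma bliss_C1c_limit:
 assumes L: "C1c_limit V V' \<psi>"
 shows "integrable lborel (\<lambda>s. wt s * \<bar>prim \<psi> s\<bar> powr q)"
  and "Nst * (wt_int (prim \<psi>)) powr (p / q) \<le> Lp_int p \<psi> * Jst powr (p / q)"
proof -
 note D = C1c_limitD[OF L]
 let ?N = "Lp_int p \<psi>"
 have [measurable]: "\<psi> \<in> Borel" "V' j \<in> Borel" for j using D by auto
 have V0: "V j s = 0" if "s \<le> 0" for j s
  using C1cE[OF D(1)[of j]] that by (metis atLeastAtMost_iff less_le_trans not_less)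
 have Vm [measurable]: "V j \<in> Borel" for j
  using C1cE[OF D(1)[of j]] borel_measurable_continuous_onI by metis
 have "(\<lambda>s. wt s * \<bar>indicator {0<..} s * prim \<psi> s\<bar> powr q) \<in> Borel"
  using prim_borel[OF L] by measurable
 also have "(\<lambda>s. wt s * \<bar>indicator {0<..} s * prim \<psi> s\<bar> powr q) = (\<lambda>s. wt s * \<bar>prim \<psi> s\<bar> powr q)"
  by (auto simp: wt_def indicator_def fun_eq_iff)
 finally have Wm [measurable]: "(\<lambda>s. wt s * \<bar>prim \<psi> s\<bar> powr q) \<in> Borel" .
 \<comment> \<open>The largest weighted integral that Bliss' inequality allows for an energy of at
   most B.\<close>
 define Y where "Y = (\<lambda>B. (B * Jst powr (p / q) / Nst) powr (q / p))"
 have N0: "0 \<le> ?N" by (intro integral_nonneg_AE AE_I2) simp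
 have bd: "(\<integral>\<^sup>+s. ennreal (wt s * \<bar>prim \<psi> s\<bar> powr q) \<partial>lborel) \<le> ennreal (Y B)" if B: "?N < B" for B
 proof -
  obtain \<epsilon> where \<epsilon>: "0 < \<epsilon>" "(1 + \<epsilon>) * ?N < B" using exists_eps_mult_less[OF N0 B] by blast
  obtain C where C: "0 \<le> C" "\<And>x y :: real. \<bar>x + y\<bar> powr p \<le> (1 + \<epsilon>) * \<bar>x\<bar> powr p + C * \<bar>y\<bar> powr p"
   using powr_add_le_eps[OF p \<epsilon>(1)] by metis
  have Nj: "Lp_int p (V' j) \<le> (1 + \<epsilon>) * ?N + C * Lp_dist p (V' j) \<psi>" for j
  proof -
   have "Lp_int p (V' j) \<le> (LINT s|lborel. (1 + \<epsilon>) * \<bar>\<psi> s\<bar> powr p + C * \<bar>V' j s - \<psi> s\<bar> powr p)"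
   proof (rule integral_mono)
    show "integrable lborel (\<lambda>s. (1 + \<epsilon>) * \<bar>\<psi> s\<bar> powr p + C * \<bar>V' j s - \<psi> s\<bar> powr p)" using D(4) D(9)[of j] by auto
    show "\<bar>V' j s\<bar> powr p \<le> (1 + \<epsilon>) * \<bar>\<psi> s\<bar> powr p + C * \<bar>V' j s - \<psi> s\<bar> powr p" for s
     using C(2)[of "\<psi> s" "V' j s - \<psi> s"] by simp
   qed (rule D(8))
   also have "\<dots> = (1 + \<epsilon>) * ?N + C * Lp_dist p (V' j) \<psi>" using D(4) D(9)[of j] by simp
   finally show ?thesis .
  qed
  have "(\<lambda>j. (1 + \<epsilon>) * ?N + C * Lp_dist p (V' j) \<psi>) \<longlonglongrightarrow> (1 + \<epsilon>) * ?N + C * 0"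
   by (intro tendsto_intros D(5))
  then have "eventually (\<lambda>j. (1 + \<epsilon>) * ?N + C * Lp_dist p (V' j) \<psi> < B) sequentially"
   using \<epsilon>(2) by (intro order_tendstoD(2)) auto
  then obtain j0 where j0: "\<And>j. j \<ge> j0 \<Longrightarrow> (1 + \<epsilon>) * ?N + C * Lp_dist p (V' j) \<psi> < B"
   by (auto simp: eventually_sequentially)
  have Jj: "wt_int (V j) \<le> Y B" if "j \<ge> j0" for j
  proof -
   let ?J = "wt_int (V j)"
   have J0: "0 \<le> ?J" by (intro integral_nonneg_AE AE_I2) (simp add: wt_nonneg)
   have "Nst * ?J powr (p / q) \<le> Lp_int p (V' j) * Jst powr (p / q)" by (rule bliss_C1c[OF D(1)])
   also have "\<dots> \<le> B * Jst powr (p / q)" using Nj[of j] j0[OF that] by (intro mult_right_mono) auto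
   finally have "?J powr (p / q) \<le> B * Jst powr (p / q) / Nst" using Nst_pos by (simp add: field_simps)
   then have "(?J powr (p / q)) powr (q / p) \<le> Y B" unfolding Y_def using p q by (intro powr_mono2) auto
   then show ?thesis using p q J0 by (simp add: powr_powr)
  qed
  show ?thesis
  proof (rule nn_integral_Fatou_bound[where u = "\<lambda>j s. ennreal (wt s * \<bar>V j s\<bar> powr q)" and N = j0])
   show "AE s in lborel. (\<lambda>j. ennreal (wt s * \<bar>V j s\<bar> powr q)) \<longlonglongrightarrow> ennreal (wt s * \<bar>prim \<psi> s\<bar> powr q)"
   proof (rule AE_I2)
    fix s :: real
    show "(\<lambda>j. ennreal (wt s * \<bar>V j s\<bar> powr q)) \<longlonglongrightarrow> ennreal (wt s * \<bar>prim \<psi> s\<bar> powr q)"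
    proof (cases "0 < s")
     case True
     have "(\<lambda>j. \<bar>V j s\<bar> powr q) \<longlonglongrightarrow> \<bar>prim \<psi> s\<bar> powr q"
      using q by (intro tendsto_powr2 tendsto_rabs C1c_limit_pointwise[OF L True]) auto
     then show ?thesis by (intro tendsto_ennrealI tendsto_mult tendsto_const)
    qed (simp add: wt_def)
   qed
   fix j assume "j \<ge> j0"
   have "(\<integral>\<^sup>+s. ennreal (wt s * \<bar>V j s\<bar> powr q) \<partial>lborel) = ennreal (wt_int (V j))"
    by (rule nn_integral_eq_integral[OF C1c_integrable(2)[OF D(1)]]) (simp add: wt_nonneg)
   also have "\<dots> \<le> ennreal (Y B)" by (intro ennreal_leI Jj \<open>j \<ge> j0\<close>)
   finally show "(\<integral>\<^sup>+s. ennreal (wt s * \<bar>V j s\<bar> powr q) \<partial>lborel) \<le> ennreal (Y B)" .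
  qed simp
 qed
 show int: "integrable lborel (\<lambda>s. wt s * \<bar>prim \<psi> s\<bar> powr q)"
  by (rule integrableI_nonneg) (use bd[of "?N + 1"] in \<open>auto simp: wt_nonneg intro: le_less_trans\<close>)
 let ?J = "wt_int (prim \<psi>)"
 have J0: "0 \<le> ?J" by (intro integral_nonneg_AE AE_I2) (simp add: wt_nonneg)
 have JB: "?J \<le> Y B" if "?N < B" for B
 proof -
  have "ennreal ?J \<le> ennreal (Y B)"
   using bd[OF that] by (subst (asm) nn_integral_eq_integral[OF int]) (auto simp: wt_nonneg)
  then show ?thesis by (simp add: Y_def)
 qed
 have "?J powr (p / q) * Nst / Jst powr (p / q) \<le> ?N"
 proof (rule dense_ge)
  fix B assume B: "?N < B"
  have "?J powr (p / q) \<le> Y B powr (p / q)" using JB[OF B] J0 p q by (intro powr_mono2) auto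
  also have "\<dots> = B * Jst powr (p / q) / Nst"
  proof -
   have "0 \<le> B" by (rule less_imp_le[OF le_less_trans[OF N0 B]])
   then have "0 \<le> B * Jst powr (p / q) / Nst" using Nst_pos by (intro divide_nonneg_pos mult_nonneg_nonneg) auto
   moreover have "(x powr (q / p)) powr (p / q) = x" if "0 \<le> x" for x using that p q by (simp add: powr_powr)
   ultimately show ?thesis unfolding Y_def by blast
  qed
  finally show "?J powr (p / q) * Nst / Jst powr (p / q) \<le> B" using Nst_pos Jst_pos by (simp add: field_simps)
 qed
 then show "Nst * ?J powr (p / q) \<le> ?N * Jst powr (p / q)" using Jst_pos by (simp add: field_simps)
qed

subsection \<open>The extremal function as a weak solution\<close>

text \<open>The derivative of the extremal function, cut off at 0 because \<open>bub'\<close> is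
  positive at negative arguments too and \<open>prim\<close> integrates from minus infinity.\<close>

definition bubd :: "real \<Rightarrow> real" where "bubd s = indicator {0<..} s * bub' s"

abbreviation bubN :: "(real \<Rightarrow> real) \<Rightarrow> real" where
 "bubN f \<equiv> LINT s|lborel. bubd s powr (p - 1) * f s"

abbreviation bubJ :: "(real \<Rightarrow> real) \<Rightarrow> real" where
 "bubJ f \<equiv> LINT s|lborel. wt s * (bub s powr (q - 1) * f s)"

lemma bubd_borel [measurable]: "bubd \<in> Borel"
 unfolding bubd_def bub'_def by measurable

lemma bubd_powr: "\<bar>bubd s\<bar> powr p = mst s"
 using bub'_pos[of s] p bub'_powr[of s] by (auto simp: bubd_def mst_def indicator_def)

lemma bub_le: "0 < s \<Longrightarrow> bub s \<le> s" "0 < s \<Longrightarrow> bub s \<le> 1"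
proof -
 assume s: "0 < s"
 show "bub s \<le> s" using one_plus_powr_le(1)[OF s, of "1 / m"] m s by (simp add: bub_def mult_left_le)
 have "(1 + s powr m) powr (- (1 / m)) \<le> s powr (- 1)"
  using one_plus_powr_le(2)[OF s, of "1 / m"] m(1) by simp
 then have "bub s \<le> s * s powr (- 1)" unfolding bub_def using s by (intro mult_left_mono) auto
 also have "\<dots> = 1" using s by (simp add: powr_minus)
 finally show "bub s \<le> 1" .
qed

lemma bubd_integrable: "integrable lborel (\<lambda>s. \<bar>bubd s\<bar> powr p)"
 unfolding bubd_powr by (rule mst_integrable)

lemma bubd_zero: "s \<le> 0 \<Longrightarrow> bubd s = 0"
 by (simp add: bubd_def)

lemma bub'_continuous: "continuous_on {0<..} bub'"
 unfolding bub'_def using one_plus_pos by (intro continuous_intros) (auto simp: less_imp_neq[symmetric])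

text \<open>Both sides have derivative \<open>bub'\<close> on the half-line and tend to 0 at
  0.\<close>

lemma prim_bubd: "0 < s \<Longrightarrow> prim bubd s = bub s"
proof -
 assume s0: "0 < s"
 have L1: "set_integrable lborel {..y} bubd" for y by (rule Lp_prim(1)[OF p bubd_borel bubd_zero bubd_integrable])
 have ae: "AE s in lborel. 0 < s \<longrightarrow> bubd s = bub' s" by (simp add: bubd_def)
 define D where "D = (\<lambda>s. prim bubd s - bub s)"
 have "DERIV D s :> 0" if s: "0 < s" for s
  unfolding D_def
  using DERIV_diff[OF prim_has_real_derivative_local[OF L1 bub'_continuous ae s] bub_has_real_derivative[OF s]]
  by simp
 from DERIV_0_half_line[OF this] obtain c where c: "\<And>s. 0 < s \<Longrightarrow> D s = c" by blast
 have "(D \<longlongrightarrow> 0) (at_right 0)"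
 proof (rule Lim_null_comparison)
  show "\<forall>\<^sub>F s in at_right 0. norm (D s) \<le> s powr \<mu> * Nst powr (1 / p) + s"
   using eventually_at_right_less[of "0::real"]
  proof eventually_elim
   fix s :: real assume s: "0 < s"
   have "\<bar>prim bubd s\<bar> \<le> s powr \<mu> * prim mst s powr (1 / p)"
    using Lp_prim(2)[OF p bubd_borel bubd_zero bubd_integrable s] by (simp add: bubd_powr \<mu>_def)
   also have "\<dots> \<le> s powr \<mu> * Nst powr (1 / p)"
    unfolding Nst_def using p by (intro mult_left_mono powr_mono2 prim_le_total prim_nonneg mst_integrable mst_bounds) auto
   finally show "norm (D s) \<le> s powr \<mu> * Nst powr (1 / p) + s"
    using bub_le(1)[OF s] bub_pos[OF s] by (simp add: D_def)
  qed
  have "((\<lambda>s::real. s powr \<mu> * Nst powr (1 / p) + s) \<longlongrightarrow> 0 powr \<mu> * Nst powr (1 / p) + 0) (at_right 0)"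
   using \<mu> eventually_at_right_less[of "0::real"]
   by (intro tendsto_add tendsto_mult tendsto_powr2 tendsto_const tendsto_ident_at) (auto elim: eventually_mono)
  then show "((\<lambda>s::real. s powr \<mu> * Nst powr (1 / p) + s) \<longlongrightarrow> 0) (at_right 0)" by simp
 qed
 moreover have "(D \<longlongrightarrow> c) (at_right 0)"
 proof (rule tendsto_eventually)
  show "\<forall>\<^sub>F s in at_right 0. D s = c"
   using eventually_at_right_less[of "0::real"] by eventually_elim (simp add: c)
 qed
 ultimately have "c = 0" using tendsto_unique[of "at_right (0::real)" D] by (metis trivial_limit_at_right_real)
 then show ?thesis using c[OF s0] by (simp add: D_def)
qed

text \<open>The Emden-Fowler equation of the extremal function, with constant \<mu> * q. The factor
  \<open>kconst\<close> adapts this constant to the one that the substitution produces.\<close>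

lemma bub_flux_has_real_derivative:
 assumes s: "0 < s"
 shows "DERIV (\<lambda>s. bub' s powr (p - 1)) s :> - (\<mu> * q * (s powr (- 1 - q * \<mu>) * bub s powr (q - 1)))"
proof -
 let ?y = "1 + s powr m"
 have y: "0 < 1 + t powr m" for t by (rule one_plus_pos)
 have eq: "(\<lambda>s. bub' s powr (p - 1)) = (\<lambda>s. (1 + s powr m) powr (- (\<mu> * q / m)))"
 proof
  fix t
  have "(- (1 / m) - 1) * (p - 1) = - ((p - 1) * (1 + m) / m)" using m by (simp add: field_simps)
  also have "(p - 1) * (1 + m) = \<mu> * q" unfolding m(3)[symmetric] using p by (simp add: \<mu>_def)
  finally show "bub' t powr (p - 1) = (1 + t powr m) powr (- (\<mu> * q / m))"
   using y[of t] by (simp add: bub'_def powr_powr)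
 qed
 have "DERIV (\<lambda>s. (1 + s powr m) powr (- (\<mu> * q / m))) s :>
   - (\<mu> * q / m) * ?y powr (- (\<mu> * q / m) - 1) * (m * s powr (m - 1))"
  using s y[of s] m(1) by (auto intro!: derivative_eq_intros)
 also have "- (\<mu> * q / m) * ?y powr (- (\<mu> * q / m) - 1) * (m * s powr (m - 1)) = - (\<mu> * q * (s powr (m - 1) * ?y powr (- (\<mu> * q / m) - 1)))"
  using m(1) by simp
 also have "s powr (m - 1) * ?y powr (- (\<mu> * q / m) - 1) = s powr (- 1 - q * \<mu>) * bub s powr (q - 1)"
 proof -
  have "bub s powr (q - 1) = s powr (q - 1) * ?y powr (- (1 / m) * (q - 1))"
   using s y[of s] by (simp add: bub_def powr_mult powr_powr)
  moreover have "s powr (- 1 - q * \<mu>) * s powr (q - 1) = s powr (m - 1)" using m(2) by (simp flip: powr_add)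
  moreover have "- (1 / m) * (q - 1) = - (\<mu> * q / m) - 1"
  proof -
   have "q - 1 = \<mu> * q + m" using m(2) by (simp add: mult.commute)
   then show ?thesis using m(1) by (simp add: add_divide_distrib)
  qed
  ultimately show ?thesis by (metis mult.assoc)
 qed
 finally show ?thesis unfolding eq .
qed

text \<open>The majorant for pairing bub powr (q - 1) with any \<open>prim \<psi>\<close>, which is
  at most a multiple of s powr \<mu>. Near 0 the bound bub s \<le> s leaves the margin (q - 1) (1 -
  \<mu>), at infinity bub s \<le> 1 leaves (q - 1) \<mu>.\<close>

lemma bub_tail_integrable: "integrable lborel (\<lambda>s. wt s * (bub s powr (q - 1) * s powr \<mu>))"
proof -
 let ?f = "\<lambda>s::real. s powr (- 1 - q * \<mu>) * (bub s powr (q - 1) * s powr \<mu>)"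
 define \<delta> where "\<delta> = (q - 1) * min \<mu> (1 - \<mu>)"
 have \<delta>: "0 < \<delta>" "\<delta> \<le> (q - 1) * \<mu>" "\<delta> \<le> (q - 1) * (1 - \<mu>)"
  using q \<mu> by (auto simp: \<delta>_def intro!: mult_left_mono)
 have "integrable lborel (\<lambda>s. indicator {0<..} s * ?f s)"
 proof (rule integrable_powr_bounds[OF \<delta>(1), where C = 1])
  show "?f \<in> Borel" unfolding bub_def by measurable
  fix s :: real
  { assume s: "0 < s" "s \<le> 1"
   have "?f s \<le> s powr (- 1 - q * \<mu>) * (s powr (q - 1) * s powr \<mu>)"
    using s q bub_le(1)[OF s(1)] bub_pos[OF s(1)] by (intro mult_left_mono mult_right_mono powr_mono2) auto
   also have "\<dots> = s powr ((q - 1) * (1 - \<mu>) - 1)" by (simp add: algebra_simps flip: powr_add)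
   also have "\<dots> \<le> s powr (\<delta> - 1)" using s \<delta> by (intro powr_mono') auto
   finally show "\<bar>?f s\<bar> \<le> 1 * s powr (\<delta> - 1)" by simp }
  { assume s: "1 \<le> s"
   have "bub s powr (q - 1) \<le> 1" using s q bub_le(2)[of s] bub_pos[of s] by (intro powr_le1) auto
   then have "?f s \<le> s powr (- 1 - q * \<mu>) * (1 * s powr \<mu>)"
    by (intro mult_left_mono mult_right_mono) auto
   also have "\<dots> = s powr (- ((q - 1) * \<mu>) - 1)" by (simp add: algebra_simps flip: powr_add)
   also have "\<dots> \<le> s powr (- \<delta> - 1)" using s \<delta> by (intro powr_mono) auto
   finally show "\<bar>?f s\<bar> \<le> 1 * s powr (- \<delta> - 1)" by simp }
 qed
 also have "(\<lambda>s. indicator {0<..} s * ?f s) = (\<lambda>s. wt s * (bub s powr (q - 1) * s powr \<mu>))"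
  by (auto simp: wt_def fun_eq_iff)
 finally show ?thesis .
qed

text \<open>For test functions the identity is integration by parts with
  \<open>bub_flux_has_real_derivative\<close>. It passes to the limit because the left side is
  continuous in L^p by \<open>powr_mult_le_eps\<close> and the right side is controlled by
  \<open>bub_tail_integrable\<close>.\<close>

lemma bub_weak:
 assumes L: "C1c_limit V V' \<psi>"
 shows "integrable lborel (\<lambda>s. bubd s powr (p - 1) * \<psi> s)"
  and "integrable lborel (\<lambda>s. wt s * (bub s powr (q - 1) * prim \<psi> s))"
  and "bubN \<psi> = \<mu> * q * bubJ (prim \<psi>)"
proof -
 note D = C1c_limitD[OF L]
 have [measurable]: "\<psi> \<in> Borel" "V' j \<in> Borel" for j using D by auto
 have [measurable]: "bub \<in> Borel" unfolding bub_def by measurable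
 have b0: "0 \<le> bubd s" for s using bub'_pos[of s] by (simp add: bubd_def)
 have flux: "integrable lborel (\<lambda>s. bubd s powr (p - 1) * f s)"
  if [measurable]: "f \<in> Borel" and "integrable lborel (\<lambda>s. \<bar>f s\<bar> powr p)" for f
 proof (rule Bochner_Integration.integrable_bound)
  show "integrable lborel (\<lambda>s. mst s + \<bar>f s\<bar> powr p)" using mst_integrable that by auto
  have "bubd s powr (p - 1) * \<bar>f s\<bar> \<le> mst s + \<bar>f s\<bar> powr p" for s
   using powr_mult_le_eps[OF p b0, of "\<bar>f s\<bar>" 1 s] bubd_powr[of s] b0[of s] by simp
  then show "AE s in lborel. norm (bubd s powr (p - 1) * f s) \<le> norm (mst s + \<bar>f s\<bar> powr p)"
   by (intro AE_I2) (auto simp: abs_mult intro!: order_trans[OF _ abs_ge_self])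
 qed simp
 show i1: "integrable lborel (\<lambda>s. bubd s powr (p - 1) * \<psi> s)" by (rule flux) (use D in auto)
 have i1j: "integrable lborel (\<lambda>s. bubd s powr (p - 1) * V' j s)" for j by (rule flux) (use D in auto)
 have pm: "(\<lambda>s. wt s * (bub s powr (q - 1) * prim \<psi> s)) \<in> Borel"
 proof -
  have "(\<lambda>s. wt s * (bub s powr (q - 1) * (indicator {0<..} s * prim \<psi> s))) \<in> Borel"
   using prim_borel[OF L] by measurable
  also have "(\<lambda>s. wt s * (bub s powr (q - 1) * (indicator {0<..} s * prim \<psi> s))) = (\<lambda>s. wt s * (bub s powr (q - 1) * prim \<psi> s))"
   by (auto simp: wt_def indicator_def fun_eq_iff)
  finally show ?thesis .
 qed
 let ?N = "Lp_int p \<psi>"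
 show i2: "integrable lborel (\<lambda>s. wt s * (bub s powr (q - 1) * prim \<psi> s))"
 proof (rule Bochner_Integration.integrable_bound)
  show "integrable lborel (\<lambda>s. ?N powr (1 / p) * (wt s * (bub s powr (q - 1) * s powr \<mu>)))"
   by (intro integrable_mult_right bub_tail_integrable)
  show "AE s in lborel. norm (wt s * (bub s powr (q - 1) * prim \<psi> s)) \<le> norm (?N powr (1 / p) * (wt s * (bub s powr (q - 1) * s powr \<mu>)))"
  proof (rule AE_I2)
   fix s :: real
   show "norm (wt s * (bub s powr (q - 1) * prim \<psi> s)) \<le> norm (?N powr (1 / p) * (wt s * (bub s powr (q - 1) * s powr \<mu>)))"
   proof (cases "0 < s")
    case True
    have "\<bar>prim \<psi> s\<bar> \<le> s powr \<mu> * prim (\<lambda>s. \<bar>\<psi> s\<bar> powr p) s powr (1 / p)"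
     using Lp_prim(2)[OF p D(2,3,4) True] by (simp add: \<mu>_def)
    also have "\<dots> \<le> s powr \<mu> * ?N powr (1 / p)"
     using p by (intro mult_left_mono powr_mono2 prim_le_total prim_nonneg D(4)) auto
    finally have "(wt s * bub s powr (q - 1)) * \<bar>prim \<psi> s\<bar> \<le> (wt s * bub s powr (q - 1)) * (s powr \<mu> * ?N powr (1 / p))"
     by (intro mult_left_mono) (auto simp: wt_nonneg)
    then show ?thesis using wt_nonneg[of s] by (simp add: abs_mult mult_ac)
   qed (simp add: wt_def)
  qed
 qed (use pm in simp)
 have flux_cont: "continuous_on {0<..} (\<lambda>s. s powr (- 1 - q * \<mu>) * bub s powr (q - 1))"
 proof -
  have "continuous_on {0<..} bub" by (rule DERIV_continuous_half_line[OF bub_has_real_derivative])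
  then show ?thesis using q bub_pos by (intro continuous_intros) (auto simp: less_imp_neq[symmetric])
 qed
 have eqj: "integrable lborel (\<lambda>s. wt s * (bub s powr (q - 1) * V j s))"
  "bubN (V' j) = \<mu> * q * bubJ (V j)" for j
 proof -
  let ?g = "\<lambda>s. \<mu> * q * (s powr (- 1 - q * \<mu>) * bub s powr (q - 1))"
  have V0: "V j s = 0" if "s \<le> 0" for s
   using C1cE[OF D(1)[of j]] that by (metis atLeastAtMost_iff less_le_trans not_less)
  have V0': "V' j s = 0" if "s \<le> 0" for s by (rule D(7)[OF that])
  have Q: "DERIV (\<lambda>s. - (bub' s powr (p - 1))) s :> ?g s" if "0 < s" for s
   using DERIV_minus[OF bub_flux_has_real_derivative[OF that]] by simp
  have gc: "continuous_on {0<..} ?g" by (intro continuous_on_mult continuous_on_const flux_cont)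
  note parts = C1c_integral_by_parts[OF D(1) Q gc, of j]
  have e1: "?g s * V j s = \<mu> * q * (wt s * (bub s powr (q - 1) * V j s))" for s
   using V0[of s] by (cases "0 < s") (auto simp: wt_def)
  have e2: "- (bub' s powr (p - 1)) * V' j s = - (bubd s powr (p - 1) * V' j s)" for s
   using V0'[of s] by (cases "0 < s") (auto simp: bubd_def)
  have kq: "\<mu> * q \<noteq> 0" using \<mu> q by auto
  show "integrable lborel (\<lambda>s. wt s * (bub s powr (q - 1) * V j s))"
   using parts(1) kq unfolding e1 by simp
  show "bubN (V' j) = \<mu> * q * bubJ (V j)"
   using parts(3) unfolding e1 e2 by simp
 qed
 have lim1: "(\<lambda>j. bubN (V' j)) \<longlonglongrightarrow> bubN \<psi>"
 proof (rule LIM_zero_cancel, rule tendstoI)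
  fix e :: real assume e: "0 < e"
  \<comment> \<open>Half of e is spent on the fixed term \<epsilon> * Nst; the other term tends to 0
    with the L^p distance.\<close>
  define \<epsilon> where "\<epsilon> = e / (2 * Nst)"
  have \<epsilon>: "0 < \<epsilon>" using e Nst_pos by (simp add: \<epsilon>_def)
  have "(\<lambda>j. \<epsilon> * Nst + \<epsilon> powr (1 - p) * Lp_dist p (V' j) \<psi>) \<longlonglongrightarrow> \<epsilon> * Nst + \<epsilon> powr (1 - p) * 0"
   by (intro tendsto_intros D(5))
  then have "eventually (\<lambda>j. \<epsilon> * Nst + \<epsilon> powr (1 - p) * Lp_dist p (V' j) \<psi> < e) sequentially"
   by (rule order_tendstoD(2)) (use e Nst_pos in \<open>simp add: \<epsilon>_def\<close>)
  then show "eventually (\<lambda>j. dist ((bubN (V' j)) - bubN \<psi>) 0 < e) sequentially"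
  proof eventually_elim
   fix j assume j: "\<epsilon> * Nst + \<epsilon> powr (1 - p) * Lp_dist p (V' j) \<psi> < e"
   have "\<bar>(bubN (V' j)) - bubN \<psi>\<bar>
     = \<bar>LINT s|lborel. bubd s powr (p - 1) * V' j s - bubd s powr (p - 1) * \<psi> s\<bar>"
    using i1 i1j by simp
   also have "\<dots> \<le> (LINT s|lborel. \<bar>bubd s powr (p - 1) * V' j s - bubd s powr (p - 1) * \<psi> s\<bar>)"
    by (rule integral_abs_bound)
   also have "\<dots> \<le> (LINT s|lborel. \<epsilon> * mst s + \<epsilon> powr (1 - p) * \<bar>V' j s - \<psi> s\<bar> powr p)"
   proof (rule integral_mono)
    show "integrable lborel (\<lambda>s. \<bar>bubd s powr (p - 1) * V' j s - bubd s powr (p - 1) * \<psi> s\<bar>)" using i1 i1j by auto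
    show "integrable lborel (\<lambda>s. \<epsilon> * mst s + \<epsilon> powr (1 - p) * \<bar>V' j s - \<psi> s\<bar> powr p)" using mst_integrable D(9)[of j] by auto
    show "\<bar>bubd s powr (p - 1) * V' j s - bubd s powr (p - 1) * \<psi> s\<bar> \<le> \<epsilon> * mst s + \<epsilon> powr (1 - p) * \<bar>V' j s - \<psi> s\<bar> powr p" for s
     using powr_mult_le_eps[OF p b0 _ \<epsilon>, of "\<bar>V' j s - \<psi> s\<bar>" s] bubd_powr[of s] b0[of s]
     by (simp add: abs_mult flip: right_diff_distrib)
   qed
   also have "\<dots> = \<epsilon> * Nst + \<epsilon> powr (1 - p) * Lp_dist p (V' j) \<psi>"
    using mst_integrable D(9)[of j] by (simp add: Nst_def)
   finally show "dist ((bubN (V' j)) - bubN \<psi>) 0 < e"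
    using j by (simp add: dist_real_def)
  qed
 qed
 have lim2: "(\<lambda>j. bubJ (V j)) \<longlonglongrightarrow> bubJ (prim \<psi>)"
 proof (rule LIM_zero_cancel, rule Lim_null_comparison)
  let ?T = "LINT s|lborel. wt s * (bub s powr (q - 1) * s powr \<mu>)"
  let ?e = "\<lambda>j. Lp_dist p (V' j) \<psi> powr (1 / p)"
  show "(\<lambda>j. ?e j * ?T) \<longlonglongrightarrow> 0"
   using tendsto_mult[OF C1c_limit_dist_tendsto_0[OF L] tendsto_const, of ?T] by simp
  show "\<forall>\<^sub>F j in sequentially. norm ((bubJ (V j)) - bubJ (prim \<psi>)) \<le> ?e j * ?T"
  proof (intro always_eventually allI)
   fix j
   have "\<bar>(bubJ (V j)) - bubJ (prim \<psi>)\<bar>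
     = \<bar>LINT s|lborel. wt s * (bub s powr (q - 1) * V j s) - wt s * (bub s powr (q - 1) * prim \<psi> s)\<bar>"
    using i2 eqj(1) by simp
   also have "\<dots> \<le> (LINT s|lborel. \<bar>wt s * (bub s powr (q - 1) * V j s) - wt s * (bub s powr (q - 1) * prim \<psi> s)\<bar>)"
    by (rule integral_abs_bound)
   also have "\<dots> \<le> (LINT s|lborel. ?e j * (wt s * (bub s powr (q - 1) * s powr \<mu>)))"
   proof (rule integral_mono)
    show "integrable lborel (\<lambda>s. \<bar>wt s * (bub s powr (q - 1) * V j s) - wt s * (bub s powr (q - 1) * prim \<psi> s)\<bar>)"
     using i2 eqj(1) by auto
    show "integrable lborel (\<lambda>s. ?e j * (wt s * (bub s powr (q - 1) * s powr \<mu>)))"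
     by (intro integrable_mult_right bub_tail_integrable)
    show "\<bar>wt s * (bub s powr (q - 1) * V j s) - wt s * (bub s powr (q - 1) * prim \<psi> s)\<bar> \<le> ?e j * (wt s * (bub s powr (q - 1) * s powr \<mu>))" for s
    proof (cases "0 < s")
     case True
     have "(wt s * bub s powr (q - 1)) * \<bar>V j s - prim \<psi> s\<bar> \<le> (wt s * bub s powr (q - 1)) * (s powr \<mu> * ?e j)"
      by (intro mult_left_mono D(10) True) (auto simp: wt_nonneg)
     moreover have "\<bar>wt s * (bub s powr (q - 1) * V j s) - wt s * (bub s powr (q - 1) * prim \<psi> s)\<bar> = (wt s * bub s powr (q - 1)) * \<bar>V j s - prim \<psi> s\<bar>"
      using wt_nonneg[of s] by (simp add: abs_mult mult.assoc flip: right_diff_distrib)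
     ultimately show ?thesis by (simp add: mult_ac)
    qed (simp add: wt_def)
   qed
   also have "\<dots> = ?e j * ?T" by simp
   finally show "norm ((bubJ (V j)) - bubJ (prim \<psi>)) \<le> ?e j * ?T" by simp
  qed
 qed
 have "(\<lambda>j. bubN (V' j)) \<longlonglongrightarrow> \<mu> * q * bubJ (prim \<psi>)"
  unfolding eqj(2) by (intro tendsto_mult tendsto_const lim2)
 from LIMSEQ_unique[OF lim1 this]
 show "bubN \<psi> = \<mu> * q * bubJ (prim \<psi>)" .
qed

section \<open>Logarithmic cut-offs of the extremal function\<close>

definition cut :: "nat \<Rightarrow> real \<Rightarrow> real" where
 "cut j s = indicator {0<..} s * max 0 (1 - (ln s / real (Suc j))\<^sup>2) ^ 2"

definition cut' :: "nat \<Rightarrow> real \<Rightarrow> real" where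
 "cut' j s = 2 * max 0 (1 - (ln s / real (Suc j))\<^sup>2) * (- (2 * (ln s / real (Suc j)) * (1 / s / real (Suc j))))"

lemma cut_bounds: "0 \<le> cut j s" "cut j s \<le> 1"
proof -
 have "max 0 (1 - (ln s / real (Suc j))\<^sup>2) ^ 2 \<le> 1" by (intro power_le_one) auto
 then show "0 \<le> cut j s" "cut j s \<le> 1" by (auto simp: cut_def indicator_def)
qed

lemma cut_has_real_derivative:
 assumes s: "0 < s"
 shows "DERIV (cut j) s :> cut' j s"
proof -
 have "DERIV (\<lambda>t. max 0 t ^ 2) t :> 2 * max 0 t" for t :: real
  using max_power_has_real_derivative[of 0 t] by (simp add: numeral_2_eq_2)
 note d = DERIV_chain2[OF this]
 have "DERIV (\<lambda>s. 1 - (ln s / real (Suc j))\<^sup>2) s :> - (2 * (ln s / real (Suc j)) * (1 / s / real (Suc j)))"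
  using s by (auto intro!: derivative_eq_intros simp: inverse_eq_divide)
 from d[OF this]
 have "DERIV (\<lambda>s. max 0 (1 - (ln s / real (Suc j))\<^sup>2) ^ 2) s :> cut' j s" by (simp add: cut'_def)
 then show ?thesis
  by (rule has_field_derivative_transform_within_open[of _ _ _ "{0<..}"]) (use s in \<open>auto simp: cut_def\<close>)
qed

lemma cut_support:
 assumes "s \<notin> {exp (- real (Suc j))..exp (real (Suc j))}"
 shows "cut j s = 0" "0 < s \<Longrightarrow> cut' j s = 0"
proof -
 have *: "max 0 (1 - (ln s / real (Suc j))\<^sup>2) = 0" if s: "0 < s"
 proof -
  have "\<bar>ln s\<bar> \<ge> real (Suc j)"
  proof (cases "s < exp (- real (Suc j))")
   case True
   then have "ln s < - real (Suc j)" using s by (metis exp_less_cancel_iff exp_ln)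
   then show ?thesis by linarith
  next
   case False
   then have "exp (real (Suc j)) < s" using assms by auto
   then have "real (Suc j) < ln s" using s by (metis exp_less_cancel_iff exp_ln)
   then show ?thesis by linarith
  qed
  then have "1 \<le> \<bar>ln s / real (Suc j)\<bar>" by (simp add: field_simps)
  then have "1 \<le> (ln s / real (Suc j))\<^sup>2" using power2_le_iff_abs_le[of 1 "ln s / real (Suc j)"] abs_square_le_1[of "ln s / real (Suc j)"]
   by (metis abs_le_square_iff abs_one one_power2)
  then show ?thesis by simp
 qed
 show "cut j s = 0" using * by (cases "0 < s") (auto simp: cut_def)
 show "0 < s \<Longrightarrow> cut' j s = 0" using * by (auto simp: cut'_def)
qed

text \<open>The cut-off depends on ln s / (j + 1), so its slope is 1 / s up to a factor that tends
  to 0; the number 4 comes from the two squares. Hence bub * cut' is a small multiple of bub / s,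
  which lies in L^p on the half-line.\<close>

lemma cut'_bound: "0 < s \<Longrightarrow> \<bar>cut' j s\<bar> \<le> 4 / (real (Suc j) * s)"
proof -
 assume s: "0 < s"
 define t where "t = ln s / real (Suc j)"
 have "max 0 (1 - t\<^sup>2) * \<bar>t\<bar> \<le> 1"
 proof (cases "\<bar>t\<bar> \<le> 1")
  case True
  have "max 0 (1 - t\<^sup>2) * \<bar>t\<bar> \<le> 1 * 1" using True by (intro mult_mono) auto
  then show ?thesis by simp
 next
  case False
  then have "1 - t\<^sup>2 \<le> 0" using abs_square_le_1[of t] by linarith
  then show ?thesis by (simp add: max_absorb1)
 qed
 then have "(max 0 (1 - t\<^sup>2) * \<bar>t\<bar>) * (4 / (real (Suc j) * s)) \<le> 1 * (4 / (real (Suc j) * s))"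
  using s by (intro mult_right_mono) auto
 moreover have "\<bar>cut' j s\<bar> = (max 0 (1 - t\<^sup>2) * \<bar>t\<bar>) * (4 / (real (Suc j) * s))"
  using s unfolding cut'_def t_def[symmetric] by (simp add: abs_mult field_simps)
 ultimately show ?thesis by simp
qed

lemma cut_tendsto_1: "0 < s \<Longrightarrow> (\<lambda>j. cut j s) \<longlonglongrightarrow> 1"
proof -
 assume s: "0 < s"
 have "(\<lambda>j. ln s / real (Suc j)) \<longlonglongrightarrow> 0"
  using tendsto_mult[OF tendsto_const LIMSEQ_Suc[OF lim_1_over_n], of "ln s"] by simp
 then have "(\<lambda>j. max 0 (1 - (ln s / real (Suc j))\<^sup>2) ^ 2) \<longlonglongrightarrow> max 0 (1 - 0\<^sup>2) ^ 2"
  by (intro tendsto_intros)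
 then show ?thesis using s by (simp add: cut_def)
qed

definition bubc :: "nat \<Rightarrow> real \<Rightarrow> real" where "bubc j s = bub s * cut j s"
definition bubc' :: "nat \<Rightarrow> real \<Rightarrow> real" where
 "bubc' j s = indicator {0<..} s * (bub' s * cut j s + bub s * cut' j s)"

lemma C1cI:
 assumes ab: "0 < a" "a < b" and W: "\<And>s. 0 < s \<Longrightarrow> DERIV W s :> W' s"
  and c: "continuous_on {0<..} W'" and z: "\<And>s. s \<notin> {a..b} \<Longrightarrow> W s = 0" "\<And>s. s \<notin> {a..b} \<Longrightarrow> W' s = 0"
 shows "C1c W W'"
proof -
 have "DERIV W s :> W' s" for s
 proof (cases "0 < s")
  case False
  have "DERIV (\<lambda>_. 0) s :> 0" by simp
  then have "DERIV W s :> 0"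
   by (rule has_field_derivative_transform_within_open[of _ _ _ "{..<a}"]) (use False ab z in auto)
  then show ?thesis using z(2)[of s] False ab by simp
 qed (rule W)
 moreover have "continuous_on UNIV W'"
 proof -
  have "continuous_on {..<a} W'"
   by (rule continuous_on_eq[OF continuous_on_const[of _ 0]]) (use z in auto)
  then have "continuous_on ({0<..} \<union> {..<a}) W'" using c by (intro continuous_on_open_Un) auto
  moreover have "{0<..} \<union> {..<a} = UNIV" using ab by auto
  ultimately show ?thesis by simp
 qed
 ultimately show ?thesis using ab z by (auto simp: C1c_def)
qed

lemma C1c_bubc: "C1c (bubc j) (bubc' j)"
proof (rule C1cI)
 show "0 < exp (- real (Suc j))" "exp (- real (Suc j)) < exp (real (Suc j))" by auto
 show "DERIV (bubc j) s :> bubc' j s" if "0 < s" for s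
  using DERIV_mult[OF bub_has_real_derivative[OF that] cut_has_real_derivative[OF that], of j] that
  by (simp add: bubc_def[abs_def] bubc'_def mult.commute add.commute)
 have "continuous_on {0<..} (\<lambda>s. bub' s * cut j s + bub s * cut' j s)"
 proof -
  have "continuous_on {0<..} bub" "continuous_on {0<..} (cut j)"
   using bub_has_real_derivative cut_has_real_derivative by (auto intro!: continuous_at_imp_continuous_on DERIV_isCont)
  moreover have "continuous_on {0<..} (cut' j)" unfolding cut'_def by (intro continuous_intros) auto
  ultimately show ?thesis by (intro continuous_intros bub'_continuous)
 qed
 then show "continuous_on {0<..} (bubc' j)" by (rule continuous_on_eq) (auto simp: bubc'_def)
 show "bubc j s = 0" "bubc' j s = 0" if "s \<notin> {exp (- real (Suc j))..exp (real (Suc j))}" for s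
  using cut_support[OF that] by (auto simp: bubc_def bubc'_def indicator_def)
qed

lemma bubc_limit: "C1c_limit bubc bubc' bubd"
proof -
 have [measurable]: "bubc' j \<in> Borel" for j by (rule C1c_eq_prim(2)[OF C1c_bubc])
 \<comment> \<open>The p-th power of 5 bub / s: one unit bounds the part with bub', as bub' \<le>
   bub / s, and four units bound the part with cut'.\<close>
 define w where "w = (\<lambda>s. indicator {0<..} s * (5 powr p * (1 + s powr m) powr (- (p / m))))"
 have wi: "integrable lborel w"
  unfolding w_def
 proof (rule integrable_powr_bounds[where C = "5 powr p" and \<delta> = "min 1 (p - 1)"])
  have pm: "0 \<le> p / m" "m * (p / m) = p" using p m by auto
  fix s :: real
  { assume s: "0 < s" "s \<le> 1"
   have "(1 + s powr m) powr (- (p / m)) \<le> 1" using one_plus_powr_le(1)[OF s(1) pm(1)] by simp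
   also have "\<dots> \<le> s powr (min 1 (p - 1) - 1)" using s powr_mono'[of "min 1 (p - 1) - 1" 0 s] by simp
   finally show "\<bar>5 powr p * (1 + s powr m) powr (- (p / m))\<bar> \<le> 5 powr p * s powr (min 1 (p - 1) - 1)" by simp }
  { assume s: "1 \<le> s"
   have "(1 + s powr m) powr (- (p / m)) \<le> s powr (- p)" using one_plus_powr_le(2)[of s "p / m"] s pm by simp
   also have "\<dots> \<le> s powr (- min 1 (p - 1) - 1)" using s by (intro powr_mono) auto
   finally show "\<bar>5 powr p * (1 + s powr m) powr (- (p / m))\<bar> \<le> 5 powr p * s powr (- min 1 (p - 1) - 1)" by simp }
 qed (use p in auto)
 have bub_div: "bub s / s = (1 + s powr m) powr (- (1 / m))" if "0 < s" for s using that by (simp add: bub_def)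
 have b'le: "bub' s \<le> bub s / s" if "0 < s" for s
 proof -
  have "bub' s = (1 + s powr m) powr (- (1 / m)) * (1 + s powr m) powr (- 1)"
  proof -
   have "- (1 / m) - 1 = - (1 / m) + (- 1)" by simp
   then show ?thesis by (simp only: bub'_def powr_add)
  qed
  also have "\<dots> \<le> (1 + s powr m) powr (- (1 / m)) * 1" using one_plus_powr_le(1)[OF that, of 1] by (intro mult_left_mono) auto
  finally show ?thesis using bub_div[OF that] by simp
 qed
 have dist_le: "\<bar>bubc' j s - bubd s\<bar> \<le> \<bar>bubd s\<bar> * (1 - cut j s) + 4 / real (Suc j) * (bub s / s)" if s: "0 < s" for j s
 proof -
  have "bubc' j s - bubd s = - (bub' s * (1 - cut j s)) + bub s * cut' j s" using s by (simp add: bubc'_def bubd_def algebra_simps)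
  also have "\<bar>\<dots>\<bar> \<le> \<bar>bub' s * (1 - cut j s)\<bar> + \<bar>bub s * cut' j s\<bar>" by linarith
  also have "\<bar>bub s * cut' j s\<bar> \<le> bub s * (4 / (real (Suc j) * s))"
  proof -
   have "bub s * \<bar>cut' j s\<bar> \<le> bub s * (4 / (real (Suc j) * s))"
    using bub_pos[OF s] cut'_bound[OF s, of j] by (intro mult_left_mono) auto
   then show ?thesis by (simp only: abs_mult abs_of_pos[OF bub_pos[OF s]])
  qed
  finally show ?thesis using s cut_bounds[of j s] bub'_pos[of s] by (simp add: bubd_def abs_mult field_simps)
 qed
 have "(\<lambda>j. Lp_dist p (bubc' j) bubd) \<longlonglongrightarrow> (LINT (s::real)|lborel. (0::real))"
 proof (rule integral_dominated_convergence[where w = w])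
  show "AE s in lborel. norm (\<bar>bubc' j s - bubd s\<bar> powr p) \<le> w s" for j
  proof (rule AE_I2)
   fix s :: real
   show "norm (\<bar>bubc' j s - bubd s\<bar> powr p) \<le> w s"
   proof (cases "0 < s")
    case True
    have c1: "\<bar>bubd s\<bar> * (1 - cut j s) \<le> (bub s / s) * 1"
     using True b'le[OF True] bub'_pos[of s] cut_bounds[of j s] by (intro mult_mono) (auto simp: bubd_def)
    have "4 / real (Suc j) \<le> 4" by (simp add: field_simps)
    then have c2: "4 / real (Suc j) * (bub s / s) \<le> 4 * (bub s / s)"
     using True bub_pos[OF True] by (intro mult_right_mono) auto
    have "\<bar>bubc' j s - bubd s\<bar> \<le> 5 * (bub s / s)" using dist_le[OF True, of j] c1 c2 by linarith
    then have "\<bar>bubc' j s - bubd s\<bar> powr p \<le> (5 * (bub s / s)) powr p" using p by (intro powr_mono2) auto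
    also have "\<dots> = w s" unfolding bub_div[OF True] using True p one_plus_pos[of s m]
     by (simp add: w_def powr_mult powr_powr)
    finally show ?thesis by simp
   qed (simp add: bubc'_def bubd_def w_def)
  qed
  show "AE s in lborel. (\<lambda>j. \<bar>bubc' j s - bubd s\<bar> powr p) \<longlonglongrightarrow> 0"
  proof (rule AE_I2)
   fix s :: real
   show "(\<lambda>j. \<bar>bubc' j s - bubd s\<bar> powr p) \<longlonglongrightarrow> 0"
   proof (cases "0 < s")
    case True
    have "(\<lambda>j. \<bar>bubc' j s - bubd s\<bar>) \<longlonglongrightarrow> 0"
    proof (rule Lim_null_comparison)
     show "\<forall>\<^sub>F j in sequentially. norm \<bar>bubc' j s - bubd s\<bar> \<le> \<bar>bubd s\<bar> * (1 - cut j s) + 4 * (1 / real (Suc j)) * (bub s / s)"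
      using dist_le[OF True] by (intro always_eventually) simp
     have "(\<lambda>j. \<bar>bubd s\<bar> * (1 - cut j s) + 4 * (1 / real (Suc j)) * (bub s / s)) \<longlonglongrightarrow> \<bar>bubd s\<bar> * (1 - 1) + 4 * 0 * (bub s / s)"
      by (intro tendsto_intros cut_tendsto_1[OF True] LIMSEQ_Suc[OF lim_1_over_n])
     then show "(\<lambda>j. \<bar>bubd s\<bar> * (1 - cut j s) + 4 * (1 / real (Suc j)) * (bub s / s)) \<longlonglongrightarrow> 0" by simp
    qed
    then have "(\<lambda>j. \<bar>bubc' j s - bubd s\<bar> powr p) \<longlonglongrightarrow> 0 powr p" using p by (intro tendsto_powr2) auto
    then show ?thesis by simp
   qed (simp add: bubc'_def bubd_def)
  qed
 qed (use wi in auto)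
 then show ?thesis unfolding C1c_limit_def using C1c_bubc bubd_zero bubd_integrable by simp
qed

end

subsection \<open>Potentials vanishing at one end of the half-line\<close>

text \<open>The end of the half-line at which r powr \<delta> tends to 0, for \<delta> \<noteq>
  0.\<close>

definition end_filter :: "real \<Rightarrow> real filter" where
 "end_filter \<delta> = (if 0 < \<delta> then at_right 0 else at_top)"

lemma tendsto_end_filter_0:
 fixes H :: "real \<Rightarrow> real"
 assumes a: "0 < a" and z: "\<And>r. 0 < r \<Longrightarrow> r \<notin> {a..b} \<Longrightarrow> H r = 0"
 shows "(H \<longlongrightarrow> 0) (end_filter \<delta>)"
proof (rule tendsto_eventually)
 show "eventually (\<lambda>r. H r = 0) (end_filter \<delta>)"
 proof (cases "0 < \<delta>")
  case True
  then show ?thesis using eventually_at_right_real[OF a] z by (auto simp: end_filter_def elim!: eventually_mono)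
 next
  case False
  then show ?thesis using eventually_gt_at_top[of "max b 0"] z by (auto simp: end_filter_def elim!: eventually_mono)
 qed
qed

lemma powr_notin_Icc:
 fixes r e a b :: real
 assumes r: "0 < r" "r \<notin> {min (a powr (1 / e)) (b powr (1 / e))..max (a powr (1 / e)) (b powr (1 / e))}"
  and e: "e \<noteq> 0" and a: "0 < a"
 shows "r powr e \<notin> {a..b}"
proof
 assume s: "r powr e \<in> {a..b}"
 have rs: "(r powr e) powr (1 / e) = r" using r e by (simp add: powr_powr)
 have "(r powr e) powr (1 / e) \<in> {min (a powr (1 / e)) (b powr (1 / e))..max (a powr (1 / e)) (b powr (1 / e))}"
 proof (cases "0 < e")
  case True
  then have "a powr (1 / e) \<le> (r powr e) powr (1 / e)" "(r powr e) powr (1 / e) \<le> b powr (1 / e)"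
   using s a by (auto intro!: powr_mono2 simp del: powr_powr)
  then show ?thesis by (simp del: powr_powr)
 next
  case False
  then have "1 / e \<le> 0" by simp
  then have "b powr (1 / e) \<le> (r powr e) powr (1 / e)" "(r powr e) powr (1 / e) \<le> a powr (1 / e)"
   using s a r by (auto intro!: powr_mono2' simp del: powr_powr)
  then show ?thesis by (simp del: powr_powr)
 qed
 then show False using r unfolding rs by simp
qed

text \<open>The difference of C * r powr \<delta> / \<delta> and g is nondecreasing and tends to 0
  at the end chosen by \<delta>. It is therefore nonnegative for \<delta> > 0 and nonpositive for
  \<delta> < 0; the factor sgn \<delta> unites the two cases.\<close>

lemma pot_bound_upper:
 assumes \<delta>: "\<delta> \<noteq> 0" and g: "\<And>r. 0 < r \<Longrightarrow> DERIV g r :> g' r"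
  and bd: "\<And>r. 0 < r \<Longrightarrow> g' r \<le> C * r powr (\<delta> - 1)" and lim: "(g \<longlongrightarrow> 0) (end_filter \<delta>)" and r: "0 < r"
 shows "sgn \<delta> * g r \<le> C * r powr \<delta> / \<bar>\<delta>\<bar>"
proof -
 define F where "F = (\<lambda>r. C * r powr \<delta> / \<delta> - g r)"
 have mono: "F x \<le> F y" if "0 < x" "x \<le> y" for x y
 proof (rule DERIV_nonneg_imp_nondecreasing[OF that(2)])
  fix s assume "x \<le> s" "s \<le> y"
  then have s: "0 < s" using that by simp
  have "DERIV (\<lambda>r. C * r powr \<delta> / \<delta>) r :> C * r powr (\<delta> - 1)" if "0 < r" for r
   using that \<delta> by (auto intro!: derivative_eq_intros)
  from DERIV_diff[OF this[OF s] g[OF s]]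
  show "\<exists>z. DERIV F s :> z \<and> 0 \<le> z" using bd[OF s] unfolding F_def by (intro exI conjI) auto
 qed
 show ?thesis
 proof (cases "0 < \<delta>")
  case True
  have "((\<lambda>r::real. C * r powr \<delta> / \<delta>) \<longlongrightarrow> C * 0 powr \<delta> / \<delta>) (at_right 0)"
   using True eventually_at_right_less[of "0::real"]
   by (intro tendsto_divide tendsto_mult tendsto_powr2 tendsto_const tendsto_ident_at) (auto elim: eventually_mono)
  then have "(F \<longlongrightarrow> C * 0 powr \<delta> / \<delta> - 0) (at_right 0)"
   unfolding F_def using lim True by (intro tendsto_diff) (auto simp: end_filter_def)
  then have "(F \<longlongrightarrow> 0) (at_right 0)" by simp
  moreover have "eventually (\<lambda>x. F x \<le> F r) (at_right 0)"
   using eventually_at_right_real[OF r] by eventually_elim (auto intro: mono)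
  ultimately have "0 \<le> F r" by (intro tendsto_upperbound) auto
  then show ?thesis using True by (simp add: F_def)
 next
  case False
  then have neg: "\<delta> < 0" using \<delta> by simp
  have "((\<lambda>r::real. C * r powr \<delta> / \<delta>) \<longlongrightarrow> C * 0 / \<delta>) at_top"
   using neg by (intro tendsto_divide tendsto_mult tendsto_const tendsto_neg_powr filterlim_ident) auto
  then have "(F \<longlongrightarrow> C * 0 / \<delta> - 0) at_top"
   unfolding F_def using lim False by (intro tendsto_diff) (auto simp: end_filter_def)
  then have "(F \<longlongrightarrow> 0) at_top" by simp
  moreover have "eventually (\<lambda>x. F r \<le> F x) at_top"
   using eventually_ge_at_top[of r] by eventually_elim (auto intro: mono r)
  ultimately have "F r \<le> 0" by (intro tendsto_lowerbound) auto
  then show ?thesis using neg by (simp add: F_def)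
 qed
qed

lemma pot_bound:
 assumes \<delta>: "\<delta> \<noteq> 0" and g: "\<And>r. 0 < r \<Longrightarrow> DERIV g r :> g' r"
  and bd: "\<And>r. 0 < r \<Longrightarrow> \<bar>g' r\<bar> \<le> C * r powr (\<delta> - 1)" and lim: "(g \<longlongrightarrow> 0) (end_filter \<delta>)" and r: "0 < r"
 shows "\<bar>g r\<bar> \<le> C * r powr \<delta> / \<bar>\<delta>\<bar>"
proof -
 have 1: "sgn \<delta> * g r \<le> C * r powr \<delta> / \<bar>\<delta>\<bar>"
  using bd by (intro pot_bound_upper[OF \<delta> g _ lim r]) (auto intro: abs_le_D1)
 have 2: "sgn \<delta> * (- g r) \<le> C * r powr \<delta> / \<bar>\<delta>\<bar>"
  using bd tendsto_minus[OF lim]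
  by (intro pot_bound_upper[where g = "\<lambda>r. - g r" and g' = "\<lambda>r. - g' r", OF \<delta> DERIV_minus[OF g] _ _ r]) (auto intro: abs_le_D2)
 show ?thesis using 1 2 \<delta> by (auto simp: sgn_if split: if_splits)
qed

text \<open>The primitive of k that vanishes at \<open>end_filter \<delta>\<close>. Because of the
  minus sign, the formula of the theorem for \<alpha> > 2 p - n is a negative multiple of
  it.\<close>

definition pot :: "real \<Rightarrow> (real \<Rightarrow> real) \<Rightarrow> real \<Rightarrow> real" where
 "pot \<delta> k r = (if 0 < \<delta> then LINT t:{0..r}|lborel. k t else - (LINT t:{r..}|lborel. k t))"

text \<open>The bound by r powr (\<delta> - 1) makes k integrable at the end from which
  \<open>pot\<close> integrates.\<close>

lemma
 assumes \<delta>: "\<delta> \<noteq> 0" and k: "continuous_on {0<..} k" and bd: "\<And>r. 0 < r \<Longrightarrow> \<bar>k r\<bar> \<le> C * r powr (\<delta> - 1)"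
 shows pot_has_real_derivative: "0 < r \<Longrightarrow> DERIV (pot \<delta> k) r :> k r"
  and pot_tendsto_0: "(pot \<delta> k \<longlongrightarrow> 0) (end_filter \<delta>)"
proof -
 define f where "f = (\<lambda>t. indicator {0<..} t * k t)"
 have fm [measurable]: "f \<in> Borel"
  using borel_measurable_continuous_on_indicator[OF _ k] by (simp add: f_def)
 have fc: "continuous_on {0<..} f" by (rule continuous_on_eq[OF k]) (simp add: f_def)
 have f0: "f t = 0" if "t \<le> 0" for t using that by (simp add: f_def)
 have fb: "\<bar>f t\<bar> \<le> C * t powr (\<delta> - 1)" if "0 < t" for t using bd[OF that] that by (simp add: f_def)
 have C0: "0 \<le> C" using order_trans[OF abs_ge_zero bd[of 1]] by simp
 have "(0 < r \<longrightarrow> DERIV (pot \<delta> k) r :> k r) \<and> (pot \<delta> k \<longlongrightarrow> 0) (end_filter \<delta>)" for r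
 proof (cases "0 < \<delta>")
  case True
  have si: "set_integrable lborel {..y} f" for y
  proof (cases "0 \<le> y")
   case y: True
   have "(\<lambda>s. s powr (\<delta> - 1)) absolutely_integrable_on {0..y}"
    using True y by (subst absolutely_integrable_on_iff_nonneg) (auto intro!: integrable_on_powr_from_0)
   then have i: "integrable lborel (\<lambda>s. indicator {0..y} s * s powr (\<delta> - 1))"
    unfolding set_integrable_def by (subst (asm) integrable_completion) auto
   show ?thesis unfolding set_integrable_def
   proof (rule Bochner_Integration.integrable_bound)
    show "integrable lborel (\<lambda>s. C * (indicator {0..y} s * s powr (\<delta> - 1)))" using i by (rule integrable_mult_right)
    show "AE t in lborel. norm (indicator {..y} t *\<^sub>R f t) \<le> norm (C * (indicator {0..y} t * t powr (\<delta> - 1)))"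
    proof (rule AE_I2)
     fix t show "norm (indicator {..y} t *\<^sub>R f t) \<le> norm (C * (indicator {0..y} t * t powr (\<delta> - 1)))"
      using fb[of t] f0[of t] C0 by (cases "0 < t") (auto simp: indicator_def abs_mult)
    qed
   qed simp
  next
   case False
   then have 0: "(\<lambda>t. indicator {..y} t *\<^sub>R f t) = (\<lambda>_. 0)" using f0 by (auto simp: indicator_def fun_eq_iff)
   show ?thesis unfolding set_integrable_def 0 by simp
  qed
  have pf: "pot \<delta> k = prim f"
  proof
   fix y
   have "(LINT t:{0..y}|lborel. k t) = (LINT t:{..y}|lborel. f t)"
    unfolding set_lebesgue_integral_def
   proof (rule integral_cong_AE)
    have "AE t in lborel. t \<noteq> (0::real)" by (rule AE_lborel_singleton)
    then show ae: "AE t in lborel. indicator {0..y} t *\<^sub>R k t = indicator {..y} t *\<^sub>R f t"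
     by eventually_elim (auto simp: f_def indicator_def)
    show "(\<lambda>t. indicator {..y} t *\<^sub>R f t) \<in> borel_measurable lborel" by simp
    have "(\<lambda>t. indicator {0..y} t *\<^sub>R k t) = (\<lambda>t. indicator {0..y} t *\<^sub>R f t + indicator ({0} \<inter> {0..y}) t * k 0)"
     by (auto simp: f_def indicator_def fun_eq_iff)
    then show "(\<lambda>t. indicator {0..y} t *\<^sub>R k t) \<in> borel_measurable lborel" by simp
   qed
   then show "pot \<delta> k y = prim f y" using True by (simp add: pot_def prim_def)
  qed
  have d: "DERIV (pot \<delta> k) r :> k r" if "0 < r"
   unfolding pf by (rule prim_has_real_derivative_local[OF si k _ that]) (simp add: f_def)
  \<comment> \<open>f is known to be integrable only up to finite points. Its truncation at 1 is
    integrable and has the same primitive near 0.\<close>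
  define f1 where "f1 = (\<lambda>t. indicator {..1} t *\<^sub>R f t)"
  have "integrable lborel f1" using si[of 1] by (simp add: f1_def set_integrable_def)
  then have "(prim f1 \<longlongrightarrow> 0) (at_right 0)" by (rule prim_at_right_0) (simp add: f1_def f0)
  moreover have "eventually (\<lambda>y. prim f1 y = prim f y) (at_right 0)"
   using eventually_at_right_real[OF zero_less_one]
  proof eventually_elim
   fix y :: real assume "y \<in> {0<..<1}"
   then have "(\<lambda>t. indicator {..y} t *\<^sub>R f1 t) = (\<lambda>t. indicator {..y} t *\<^sub>R f t)"
    by (auto simp: f1_def indicator_def fun_eq_iff)
   then show "prim f1 y = prim f y" by (simp add: prim_def set_lebesgue_integral_def)
  qed
  ultimately have "(prim f \<longlongrightarrow> 0) (at_right 0)" by (rule Lim_transform_eventually)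
  then show ?thesis using d True by (simp add: pf end_filter_def)
 next
  case False
  then have neg: "\<delta> < 0" using \<delta> by simp
  have si: "set_integrable lborel {a..} k" if a: "0 < a" for a
  proof -
   have "(\<lambda>s. s powr (\<delta> - 1)) absolutely_integrable_on {a..}"
    using neg a has_integral_powr_to_inf[of "\<delta> - 1" a]
    by (subst absolutely_integrable_on_iff_nonneg) (auto simp: integrable_on_def)
   then have i: "integrable lborel (\<lambda>s. indicator {a..} s * s powr (\<delta> - 1))"
    unfolding set_integrable_def by (subst (asm) integrable_completion) auto
   have "integrable lborel (\<lambda>t. indicator {a..} t *\<^sub>R f t)"
   proof (rule Bochner_Integration.integrable_bound)
    show "integrable lborel (\<lambda>s. C * (indicator {a..} s * s powr (\<delta> - 1)))" using i by (rule integrable_mult_right)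
    show "AE t in lborel. norm (indicator {a..} t *\<^sub>R f t) \<le> norm (C * (indicator {a..} t * t powr (\<delta> - 1)))"
    proof (rule AE_I2)
     fix t show "norm (indicator {a..} t *\<^sub>R f t) \<le> norm (C * (indicator {a..} t * t powr (\<delta> - 1)))"
      using fb[of t] f0[of t] C0 a by (cases "0 < t") (auto simp: indicator_def abs_mult)
    qed
   qed simp
   also have "(\<lambda>t. indicator {a..} t *\<^sub>R f t) = (\<lambda>t. indicator {a..} t *\<^sub>R k t)"
    using a by (auto simp: f_def indicator_def fun_eq_iff)
   finally show ?thesis unfolding set_integrable_def .
  qed
  have d: "DERIV (pot \<delta> k) r :> k r" if r: "0 < r"
  proof -
   define a b where "a = r / 2" and "b = 2 * r"
   have ab: "0 < a" "a < r" "r < b" using r by (auto simp: a_def b_def)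
   have eq: "integral {a..y} k - (LINT t:{a..}|lborel. k t) = pot \<delta> k y" if y: "y \<in> {a<..<b}" for y
   proof -
    have "set_integrable lborel {a..y} k" by (rule set_integrable_subset[OF si[OF ab(1)]]) auto
    then have i: "(LINT t:{a..y}|lborel. k t) = integral {a..y} k" by (rule set_borel_integral_eq_integral)
    have sub: "set_integrable lborel {a..<y} k" by (rule set_integrable_subset[OF si[OF ab(1)]]) auto
    have "{a..} = {a..<y} \<union> {y..}" using y by auto
    then have "(LINT t:{a..}|lborel. k t) = (LINT t:{a..<y} \<union> {y..}|lborel. k t)" by simp
    also have "\<dots> = (LINT t:{a..<y}|lborel. k t) + (LINT t:{y..}|lborel. k t)"
     using y ab by (intro set_integral_Un sub si) auto
    also have "(LINT t:{a..<y}|lborel. k t) = (LINT t:{a..y}|lborel. k t)"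
     unfolding set_lebesgue_integral_def
    proof (rule integral_cong_AE)
     show "AE t in lborel. indicator {a..<y} t *\<^sub>R k t = indicator {a..y} t *\<^sub>R k t"
      using AE_lborel_singleton[of y] by eventually_elim (auto simp: indicator_def)
     show "(\<lambda>t. indicator {a..<y} t *\<^sub>R k t) \<in> borel_measurable lborel"
      using sub unfolding set_integrable_def by (rule borel_measurable_integrable)
     show "(\<lambda>t. indicator {a..y} t *\<^sub>R k t) \<in> borel_measurable lborel"
      using \<open>set_integrable lborel {a..y} k\<close> unfolding set_integrable_def by (rule borel_measurable_integrable)
    qed
    finally show ?thesis using i False by (simp add: pot_def)
   qed
   have "((\<lambda>y. integral {a..y} k) has_real_derivative k r) (at r within {a..b})"
    using ab by (intro integral_has_real_derivative continuous_on_subset[OF k]) auto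
   then have "DERIV (\<lambda>y. integral {a..y} k) r :> k r"
    using ab by (simp add: at_within_Icc_at)
   then have "DERIV (\<lambda>y. integral {a..y} k - (LINT t:{a..}|lborel. k t)) r :> k r - 0"
    by (intro DERIV_diff) auto
   then have "DERIV (\<lambda>y. integral {a..y} k - (LINT t:{a..}|lborel. k t)) r :> k r" by simp
   then show ?thesis
    by (rule has_field_derivative_transform_within_open[of _ _ _ "{a<..<b}"]) (use ab eq in auto)
  qed
  have "((\<lambda>y. LINT t:{1..y}|lborel. k t) \<longlongrightarrow> (LINT t:{1..}|lborel. k t)) at_top"
   by (rule tendsto_set_lebesgue_integral_at_top) (auto intro: si)
  then have "((\<lambda>y. (LINT t:{1..y}|lborel. k t) - (LINT t:{1..}|lborel. k t)) \<longlongrightarrow> 0) at_top" by (simp add: LIM_zero)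
  moreover have "eventually (\<lambda>y. (LINT t:{1..y}|lborel. k t) - (LINT t:{1..}|lborel. k t) = pot \<delta> k y) at_top"
   using eventually_ge_at_top[of 1]
  proof eventually_elim
   fix y :: real assume y: "1 \<le> y"
   have s1: "set_integrable lborel {1..y} k" by (rule set_integrable_subset[OF si[of 1]]) auto
   have s2: "set_integrable lborel {y<..} k" by (rule set_integrable_subset[OF si[of 1]]) (use y in auto)
   have "{1..} = {1..y} \<union> {y<..}" using y by auto
   then have "(LINT t:{1..}|lborel. k t) = (LINT t:{1..y} \<union> {y<..}|lborel. k t)" by simp
   also have "\<dots> = (LINT t:{1..y}|lborel. k t) + (LINT t:{y<..}|lborel. k t)"
    by (intro set_integral_Un s1 s2) auto
   also have "(LINT t:{y<..}|lborel. k t) = (LINT t:{y..}|lborel. k t)"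
    unfolding set_lebesgue_integral_def
   proof (rule integral_cong_AE)
    show "AE t in lborel. indicator {y<..} t *\<^sub>R k t = indicator {y..} t *\<^sub>R k t"
     using AE_lborel_singleton[of y] by eventually_elim (auto simp: indicator_def)
    show "(\<lambda>t. indicator {y<..} t *\<^sub>R k t) \<in> borel_measurable lborel"
     using s2 unfolding set_integrable_def by (rule borel_measurable_integrable)
    show "(\<lambda>t. indicator {y..} t *\<^sub>R k t) \<in> borel_measurable lborel"
     using si[of y] y unfolding set_integrable_def by (intro borel_measurable_integrable) simp
   qed
   finally show "(LINT t:{1..y}|lborel. k t) - (LINT t:{1..}|lborel. k t) = pot \<delta> k y"
    using False by (simp add: pot_def)
  qed
  ultimately have "(pot \<delta> k \<longlongrightarrow> 0) at_top" by (rule Lim_transform_eventually)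
  then show ?thesis using d False by (simp add: end_filter_def)
 qed
 then show "0 < r \<Longrightarrow> DERIV (pot \<delta> k) r :> k r" "(pot \<delta> k \<longlongrightarrow> 0) (end_filter \<delta>)" by auto
qed

subsection \<open>Radial functions\<close>

lemma has_derivative_norm': "x \<noteq> 0 \<Longrightarrow> (norm has_derivative (\<lambda>h. (h \<bullet> x) / norm x)) (at (x::'a::euclidean_space))"
 using has_derivative_norm[of x] by (simp add: sgn_div_norm divide_inverse_commute)

lemma partial_deriv_radial:
 fixes x :: "'a::euclidean_space"
 assumes "x \<noteq> 0" "DERIV H (norm x) :> H'"
 shows "partial_deriv b (\<lambda>x. H (norm x)) x = H' * ((x \<bullet> b) / norm x)" "(\<lambda>x. H (norm x)) differentiable (at x)"
proof -
 have n: "norm differentiable (at x)" using has_derivative_norm'[OF assms(1)] unfolding differentiable_def by blast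
 have "partial_deriv b norm x = (b \<bullet> x) / norm x" by (rule partial_deriv_eq[OF has_derivative_norm'[OF assms(1)]])
 then show "partial_deriv b (\<lambda>x. H (norm x)) x = H' * ((x \<bullet> b) / norm x)"
  using partial_deriv_compose[OF n assms(2), of b] by (simp add: inner_commute)
 have "H differentiable (at (norm x))" using assms(2) unfolding has_field_derivative_def differentiable_def by blast
 from differentiable_chain_at[OF n this] show "(\<lambda>x. H (norm x)) differentiable (at x)" by (simp add: o_def)
qed

lemma sum_inner_Basis_squares: "(\<Sum>b\<in>Basis. (x \<bullet> b)\<^sup>2) = (norm (x::'a::euclidean_space))\<^sup>2"
 unfolding power2_norm_eq_inner by (subst euclidean_inner) (simp add: power2_eq_square)

lemma laplacian_radial:
 fixes x :: "'a::euclidean_space" and f :: "'a \<Rightarrow> real"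
 assumes x: "x \<noteq> 0" and f: "\<And>y. y \<noteq> 0 \<Longrightarrow> f y = H (norm y)"
  and H': "\<And>r. 0 < r \<Longrightarrow> DERIV H r :> H' r"
  and H'': "\<And>r. 0 < r \<Longrightarrow> DERIV H' r :> H'' r"
 shows "partial_deriv b f x = H' (norm x) * ((x \<bullet> b) / norm x)"
  and "laplacian f x = H'' (norm x) + (real DIM('a) - 1) / norm x * H' (norm x)"
proof -
 have op: "open (- {0::'a})" by auto
 have pd: "partial_deriv b f y = H' (norm y) * ((y \<bullet> b) / norm y)" if y: "y \<noteq> 0" for y b
 proof -
  have "partial_deriv b f y = partial_deriv b (\<lambda>y. H (norm y)) y"
   by (rule partial_deriv_cong_open[OF op]) (use y f in auto)
  also have "\<dots> = H' (norm y) * ((y \<bullet> b) / norm y)" by (rule partial_deriv_radial(1)[OF y H']) (use y in simp)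
  finally show ?thesis .
 qed
 then show "partial_deriv b f x = H' (norm x) * ((x \<bullet> b) / norm x)" using x .
 define r where "r = norm x"
 have r: "0 < r" using x by (simp add: r_def)
 \<comment> \<open>The gradient at y is G (norm y) times y, so each pure second derivative comes
   from one product rule.\<close>
 define G where "G = (\<lambda>r. H' r / r)"
 have G': "DERIV G r :> H'' r / r - H' r / r\<^sup>2"
  unfolding G_def using DERIV_divide[OF H''[OF r] DERIV_ident] r by (simp add: field_simps power2_eq_square)
 have pp: "partial_deriv b (partial_deriv b f) x = G r * (b \<bullet> b) + (H'' r / r - H' r / r\<^sup>2) * ((x \<bullet> b) / r) * (x \<bullet> b)" for b
 proof -
  have "partial_deriv b (partial_deriv b f) x = partial_deriv b (\<lambda>y. G (norm y) * (y \<bullet> b)) x"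
   by (rule partial_deriv_cong_open[OF op]) (use x pd in \<open>auto simp: G_def\<close>)
  also have "\<dots> = G (norm x) * partial_deriv b (\<lambda>y. y \<bullet> b) x + partial_deriv b (\<lambda>y. G (norm y)) x * (x \<bullet> b)"
  proof (rule partial_deriv_mult)
   show "(\<lambda>y. G (norm y)) differentiable (at x)" using partial_deriv_radial(2)[OF x] G' by (simp add: r_def)
   show "(\<lambda>y. y \<bullet> b) differentiable (at x)" by (auto intro!: derivative_intros)
  qed
  also have "partial_deriv b (\<lambda>y. y \<bullet> b) x = b \<bullet> b" by (rule partial_deriv_eq) (auto intro!: derivative_eq_intros)
  also have "partial_deriv b (\<lambda>y. G (norm y)) x = (H'' r / r - H' r / r\<^sup>2) * ((x \<bullet> b) / r)"
   using partial_deriv_radial(1)[OF x, of G] G' by (simp add: r_def)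
  finally show ?thesis by (simp add: r_def)
 qed
 have "laplacian f x = (\<Sum>b\<in>Basis. G r + (H'' r / r - H' r / r\<^sup>2) / r * (x \<bullet> b)\<^sup>2)"
  unfolding laplacian_def by (intro sum.cong refl) (simp add: pp inner_Basis power2_eq_square)
 also have "\<dots> = real DIM('a) * G r + (H'' r / r - H' r / r\<^sup>2) / r * (\<Sum>b\<in>Basis. (x \<bullet> b)\<^sup>2)"
  by (simp add: sum.distrib sum_distrib_left)
 also have "(\<Sum>b\<in>Basis. (x \<bullet> b)\<^sup>2) = r\<^sup>2" by (simp add: r_def sum_inner_Basis_squares)
 finally show "laplacian f x = H'' (norm x) + (real DIM('a) - 1) / norm x * H' (norm x)"
  using r unfolding G_def r_def[symmetric] by (simp add: divide_simps power2_eq_square) (simp add: algebra_simps)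
qed

text \<open>The profile is read off along one coordinate axis, where H' and H'' are the pure partial
  derivatives of f in that direction.\<close>

lemma Ckcr_2_profile:
 fixes f :: "'a::euclidean_space \<Rightarrow> real"
 assumes f: "f \<in> Ckcr 2"
 obtains H H' H'' a b where "0 < a" "a < b" "\<And>x. f x = H (norm x)"
  "\<And>r. 0 < r \<Longrightarrow> DERIV H r :> H' r" "\<And>r. 0 < r \<Longrightarrow> DERIV H' r :> H'' r"
  "continuous_on {0<..} H''" "\<And>r. 0 < r \<Longrightarrow> r \<notin> {a..b} \<Longrightarrow> H r = 0 \<and> H' r = 0 \<and> H'' r = 0"
proof -
 obtain e :: 'a where e: "e \<in> Basis" using nonempty_Basis by blast
 have fc: "f \<in> Ckc 2" and fr: "radial f" using f by (auto simp: Ckcr_def)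
 obtain K where K: "compact K" "0 \<notin> K" "\<And>x. x \<notin> K \<Longrightarrow> f x = 0" using fc by (auto elim: CkcE)
 define H where "H = (\<lambda>r. f (r *\<^sub>R e))"
 define H' where "H' = (\<lambda>r. partial_deriv e f (r *\<^sub>R e))"
 define H'' where "H'' = (\<lambda>r. partial_deriv e (partial_deriv e f) (r *\<^sub>R e))"
 have "Ck (Suc (Suc 0)) f" using CkcD[OF fc] by (simp add: numeral_2_eq_2)
 then have C1: "f differentiable (at x)" and C2: "partial_deriv e f differentiable (at x)" and C3: "continuous_on UNIV (partial_deriv e (partial_deriv e f))" for x
  using e by auto
 have dH: "DERIV H r :> H' r" for r
  using has_real_derivative_line[of f 0 r e] C1 by (simp add: H_def[abs_def] H'_def)
 have dH': "DERIV H' r :> H'' r" for r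
  using has_real_derivative_line[of "partial_deriv e f" 0 r e] C2 by (simp add: H''_def H'_def[abs_def])
 have cH'': "continuous_on {0<..} H''" unfolding H''_def
  by (rule continuous_on_compose2[OF C3]) (auto intro!: continuous_intros)
 obtain a where a: "0 < a" "ball 0 a \<subseteq> - K"
  using openE[of "- K" 0] K(2) compact_imp_closed[OF K(1)] by (metis ComplI open_Compl)
 obtain R where R: "\<And>x. x \<in> K \<Longrightarrow> norm x \<le> R" using compact_imp_bounded[OF K(1)] by (auto simp: bounded_iff)
 define b where "b = max R a + 1"
 have fz: "f x = 0" if "norm x < a \<or> b < norm x" for x
  using that a R[of x] K(3)[of x] by (cases "x \<in> K") (auto simp: b_def dist_norm)
 have z: "H r = 0 \<and> H' r = 0 \<and> H'' r = 0" if r: "0 < r" "r \<notin> {a..b}" for r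
 proof -
  let ?S = "{x::'a. norm x < a \<or> b < norm x}"
  have "?S = {x. norm x < a} \<union> {x. b < norm x}" by auto
  then have op: "open ?S" by (simp add: open_Un open_Collect_less continuous_on_norm_id)
  have rS: "r *\<^sub>R e \<in> ?S" using r e by auto
  have p1: "partial_deriv e f y = 0" if "y \<in> ?S" for y
  proof -
   have "partial_deriv e f y = partial_deriv e (\<lambda>_. 0) y" by (rule partial_deriv_cong_open[OF op that]) (use fz in auto)
   also have "\<dots> = 0" by (rule partial_deriv_eq) auto
   finally show ?thesis .
  qed
  have "partial_deriv e (partial_deriv e f) (r *\<^sub>R e) = partial_deriv e (\<lambda>_. 0) (r *\<^sub>R e)"
   by (rule partial_deriv_cong_open[OF op rS]) (use p1 in auto)
  also have "\<dots> = 0" by (rule partial_deriv_eq) auto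
  finally show ?thesis using fz[of "r *\<^sub>R e"] p1[OF rS] rS by (simp add: H_def H'_def H''_def)
 qed
 have fH: "f x = H (norm x)" for x
 proof -
  have "norm x = norm (norm x *\<^sub>R e)" using e by simp
  then show ?thesis using fr unfolding radial_def H_def by blast
 qed
 show thesis by (rule that[OF a(1) _ fH dH dH' cH'' z]) (auto simp: b_def)
qed

text \<open>The norm is not differentiable at the origin, but its square is a polynomial. With k y =
  H (sqrt y) the function is k of the squared norm, and k is of class C^2 on the whole line because
  it vanishes for y below the square of a.\<close>

lemma radial_Ckcr_2:
 fixes f :: "'a::euclidean_space \<Rightarrow> real"
 assumes ab: "0 < a" "a < b" and f: "\<And>x. x \<noteq> 0 \<Longrightarrow> f x = H (norm x)" "f 0 = 0"
  and H': "\<And>r. 0 < r \<Longrightarrow> DERIV H r :> H' r"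
  and H'': "\<And>r. 0 < r \<Longrightarrow> DERIV H' r :> H'' r"
  and c: "continuous_on {0<..} H''" and z: "\<And>r. 0 < r \<Longrightarrow> r \<notin> {a..b} \<Longrightarrow> H r = 0 \<and> H' r = 0 \<and> H'' r = 0"
 shows "f \<in> Ckcr 2"
proof -
 define k where "k = (\<lambda>y. if 0 < y then H (sqrt y) else 0)"
 define k' where "k' = (\<lambda>y. if 0 < y then H' (sqrt y) * (inverse (sqrt y) / 2) else 0)"
 define k'' where "k'' = (\<lambda>y. if 0 < y then H'' (sqrt y) * (inverse (sqrt y) / 2) * (inverse (sqrt y) / 2)
   + H' (sqrt y) * (- (inverse (sqrt y) ^ 3) / 4) else 0)"
 have kz: "k y = 0 \<and> k' y = 0 \<and> k'' y = 0" if "y < a\<^sup>2" for y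
 proof (cases "0 < y")
  case True
  have "sqrt y < a" using that ab True by (metis real_sqrt_less_iff real_sqrt_abs abs_of_pos)
  then show ?thesis using z[of "sqrt y"] True by (simp add: k_def k'_def k''_def)
 qed (simp add: k_def k'_def k''_def)
 have a2: "0 < a\<^sup>2" using ab by simp
 have sq: "DERIV sqrt y :> inverse (sqrt y) / 2" if "0 < y" for y by (rule DERIV_real_sqrt[OF that])
 have dk: "DERIV k y :> k' y" for y
 proof (cases "0 < y")
  case True
  have "DERIV (\<lambda>y. H (sqrt y)) y :> k' y"
   using DERIV_chain2[OF H' sq[OF True]] True by (simp add: k'_def)
  then show ?thesis by (rule has_field_derivative_transform_within_open[of _ _ _ "{0<..}"]) (use True in \<open>auto simp: k_def\<close>)
 next
  case False
  have "DERIV (\<lambda>_. 0) y :> 0" by simp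
  then have "DERIV k y :> 0"
   by (rule has_field_derivative_transform_within_open[of _ _ _ "{..<a\<^sup>2}"]) (use le_less_trans[OF _ a2] False kz in auto)
  then show ?thesis using False by (simp add: k'_def)
 qed
 have dk': "DERIV k' y :> k'' y" for y
 proof (cases "0 < y")
  case True
  have i: "DERIV (\<lambda>y. inverse (sqrt y) / 2) y :> - (inverse (sqrt y) ^ 3) / 4"
   using sq[OF True] True by (auto intro!: derivative_eq_intros simp: field_simps power3_eq_cube)
  have "DERIV (\<lambda>y. H' (sqrt y) * (inverse (sqrt y) / 2)) y :> k'' y"
   using DERIV_mult[OF DERIV_chain2[OF H'' sq[OF True]] i] True by (simp add: k''_def algebra_simps)
  then show ?thesis by (rule has_field_derivative_transform_within_open[of _ _ _ "{0<..}"]) (use True in \<open>auto simp: k'_def\<close>)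
 next
  case False
  have "DERIV (\<lambda>_. 0) y :> 0" by simp
  then have "DERIV k' y :> 0"
   by (rule has_field_derivative_transform_within_open[of _ _ _ "{..<a\<^sup>2}"]) (use le_less_trans[OF _ a2] False kz in auto)
  then show ?thesis using False by (simp add: k''_def)
 qed
 have ck'': "continuous_on UNIV k''"
 proof -
  have cH': "continuous_on {0<..} H'" by (rule DERIV_continuous_half_line[OF H''])
  have "continuous_on {0<..} (\<lambda>y. H'' (sqrt y) * (inverse (sqrt y) / 2) * (inverse (sqrt y) / 2)
   + H' (sqrt y) * (- (inverse (sqrt y) ^ 3) / 4))"
   by (intro continuous_intros continuous_on_compose2[OF c] continuous_on_compose2[OF cH']) auto
  then have "continuous_on {0<..} k''" by (rule continuous_on_eq) (auto simp: k''_def)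
  moreover have "continuous_on {..<a\<^sup>2} k''" by (rule continuous_on_eq[OF continuous_on_const[of _ 0]]) (use kz in auto)
  ultimately have "continuous_on ({0<..} \<union> {..<a\<^sup>2}) k''" by (intro continuous_on_open_Un) auto
  moreover have "{0<..} \<union> {..<a\<^sup>2} = UNIV" using le_less_trans[OF _ a2] by (auto simp: not_less)
  ultimately show ?thesis by simp
 qed
 have "Ck 0 k''" using ck'' by simp
 then have "Ck (Suc 0) k'" using Ck_Suc_real[OF dk'] by blast
 then have Ck: "Ck 2 k" using Ck_Suc_real[OF dk, of "Suc 0"] numeral_2_eq_2 by metis
 have sqn: "(\<lambda>x::'a. (norm x)\<^sup>2) = (\<lambda>x. \<Sum>b\<in>Basis. (x \<bullet> b)^2)"
  by (simp add: fun_eq_iff sum_inner_Basis_squares)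
 have "Ck 2 (\<lambda>x::'a. (norm x)\<^sup>2)" unfolding sqn by (intro Ck_sum finite_Basis Ck_power Ck_inner)
 from Ck_compose[OF Ck this] have "Ck 2 (\<lambda>x::'a. k ((norm x)\<^sup>2))" .
 moreover have "(\<lambda>x. k ((norm x)\<^sup>2)) = f"
 proof
  fix x show "k ((norm x)\<^sup>2) = f x" using f by (cases "x = 0") (auto simp: k_def)
 qed
 ultimately have "Ck 2 f" by simp
 then have "f \<in> Ckc 2"
 proof (rule CkcI[of _ _ "cball 0 b - ball 0 a"])
  show "compact (cball 0 b - ball 0 a :: 'a set)" by (intro compact_diff) auto
  show "0 \<notin> cball 0 b - ball (0::'a) a" using ab by auto
  show "f x = 0" if "x \<notin> cball 0 b - ball 0 a" for x
   using that z[of "norm x"] f by (cases "x = 0") auto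
 qed
 moreover have "radial f" unfolding radial_def
 proof (intro allI impI)
  fix x y :: 'a assume "norm x = norm y"
  then show "f x = f y" using f by (cases "x = 0"; cases "y = 0") auto
 qed
 ultimately show ?thesis by (simp add: Ckcr_def)
qed

lemma laplacian_diff:
 assumes "f \<in> Ckc 2" "g \<in> Ckc 2"
 shows "laplacian (\<lambda>x. f x - g x) x = laplacian f x - laplacian g x"
proof -
 have C: "Ck (Suc (Suc 0)) f" "Ck (Suc (Suc 0)) g" using assms[THEN CkcD] by (simp_all add: numeral_2_eq_2)
 have pd: "partial_deriv b (\<lambda>x. u x - v x) x = partial_deriv b u x - partial_deriv b v x"
  if "u differentiable (at x)" "v differentiable (at x)" for u v :: "'a \<Rightarrow> real" and b x
  using has_derivative_diff[OF that[unfolded frechet_derivative_works]]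
  by (subst partial_deriv_eq) (auto simp: partial_deriv_def)
 have 1: "partial_deriv b (\<lambda>x. f x - g x) = (\<lambda>x. partial_deriv b f x - partial_deriv b g x)" for b
  using C by (intro ext pd) auto
 have "partial_deriv b (partial_deriv b (\<lambda>x. f x - g x)) x = partial_deriv b (partial_deriv b f) x - partial_deriv b (partial_deriv b g) x" if "b \<in> Basis" for b
  unfolding 1 using C that by (intro pd) auto
 then show ?thesis by (simp add: laplacian_def sum_subtractf)
qed

subsection \<open>Radial functions in Emden-Fowler coordinates\<close>

lemma L1loc_lim_dominated:
 fixes f :: "nat \<Rightarrow> 'a::euclidean_space \<Rightarrow> 'b::euclidean_space"
 assumes [measurable]: "\<And>j. f j \<in> Borel" "g \<in> Borel"
  and bd: "\<And>j x. x \<noteq> 0 \<Longrightarrow> norm (f j x - g x) \<le> e j * norm x powr b" and e: "e \<longlonglongrightarrow> 0"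
 shows "L1loc_lim f g"
 unfolding L1loc_lim_def
proof (intro allI impI)
 fix K :: "'a set" assume K: "compact K \<and> 0 \<notin> K"
 have [measurable]: "K \<in> sets borel" using K by (intro borel_closed compact_imp_closed) simp
 have "continuous_on K (\<lambda>x. norm x powr b)" using K by (intro continuous_intros) auto
 then have "integrable lborel (\<lambda>x. indicator K x *\<^sub>R norm x powr b)"
  using K by (intro borel_integrable_compact) auto
 then have i: "integrable lborel (\<lambda>x. indicator K x * norm x powr b)" by simp
 have le: "L1_dist K (f j) g \<le> ennreal (\<bar>e j\<bar> * (LINT x|lborel. indicator K x * norm x powr b))" for j
 proof -
  have "L1_dist K (f j) g \<le> (\<integral>\<^sup>+x. ennreal (\<bar>e j\<bar> * (indicator K x * norm x powr b)) \<partial>lborel)"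
  proof (rule nn_integral_mono)
   fix x
   have "norm (f j x - g x) \<le> \<bar>e j\<bar> * norm x powr b" if "x \<in> K"
    using bd[of x j] that K mult_right_mono[OF abs_ge_self[of "e j"], of "norm x powr b"] by fastforce
   then show "ennreal (norm (f j x - g x)) * indicator K x \<le> ennreal (\<bar>e j\<bar> * (indicator K x * norm x powr b))"
    by (auto simp: indicator_def intro!: ennreal_leI)
  qed
  also have "\<dots> = ennreal (LINT x|lborel. \<bar>e j\<bar> * (indicator K x * norm x powr b))"
   using i by (intro nn_integral_eq_integral integrable_mult_right AE_I2) auto
  finally show ?thesis by simp
 qed
 have "(\<lambda>j. \<bar>e j\<bar> * (LINT x|lborel. indicator K x * norm x powr b)) \<longlonglongrightarrow> \<bar>0\<bar> * (LINT x|lborel. indicator K x * norm x powr b)"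
  by (intro tendsto_intros e)
 then have "(\<lambda>j. ennreal (\<bar>e j\<bar> * (LINT x|lborel. indicator K x * norm x powr b))) \<longlonglongrightarrow> ennreal 0"
  by (intro tendsto_ennrealI) simp
 then show "(\<lambda>j. L1_dist K (f j) g) \<longlonglongrightarrow> 0"
  by (intro ennreal_tendsto_0_bound[OF _ le]) simp
qed

text \<open>The type token ties the real number n to the dimension, so that exponents can be
  computed with n.\<close>

locale rad = bliss p q for p q :: real +
 fixes \<alpha> n :: real and ty :: "'a::euclidean_space itself"
 assumes n: "n = real DIM('a)" and \<alpha>: "\<alpha> \<noteq> 2 * p - n" "\<alpha> \<noteq> n * p - n"
begin

definition \<sigma> :: real where "\<sigma> = (n * p - n - \<alpha>) / (p - 1)"

text \<open>
 The sign of \<open>\<delta>\<close> decides at which end of the half-line the profiles of the elements of \<open>Dr\<close> vanish.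
\<close>

definition \<delta> :: real where "\<delta> = (2 * p - n - \<alpha>) / p"

lemma nonzero_exponents: "\<sigma> \<noteq> 0" "\<delta> \<noteq> 0"
 using \<alpha> p by (auto simp: \<sigma>_def \<delta>_def)

text \<open>The first identity turns Hoelder's bound for the flux into r powr (\<delta> - 1) for H'.
  The second and third are the weights of the two forms after the substitution, s powr 0 and s powr
  (- 1 - q * \<mu>). The fourth is the scaling exponent in \<open>identified\<close>, the fifth the
  effect of a dilation on the energy.\<close>

lemma exponents:
 "1 - n + \<sigma> * \<mu> = \<delta> - 1" "\<alpha> + p * (\<sigma> - n) + n = \<sigma>" "- beta1 n p \<alpha> q + q * (1 - n) + n = - (q * \<mu>) * \<sigma>"
 "n - 2 * p + \<alpha> = - (p * \<delta>)" "p * (n - 2 - \<sigma>) + \<sigma> = - (p * \<delta>)"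
proof -
 have s: "\<sigma> * (p - 1) = n * p - n - \<alpha>" and d: "p * \<delta> = 2 * p - n - \<alpha>" using p by (auto simp: \<sigma>_def \<delta>_def)
 have "p * (\<sigma> * \<mu>) = \<sigma> * (\<mu> * p)" by simp
 then have k: "p * (\<sigma> * \<mu>) = n * p - n - \<alpha>" unfolding \<mu>(3) s .
 then have "p * (1 - n + \<sigma> * \<mu>) = p * (\<delta> - 1)" using d k by (simp add: algebra_simps)
 then show "1 - n + \<sigma> * \<mu> = \<delta> - 1" using p by simp
 show "\<alpha> + p * (\<sigma> - n) + n = \<sigma>" "n - 2 * p + \<alpha> = - (p * \<delta>)" "p * (n - 2 - \<sigma>) + \<sigma> = - (p * \<delta>)"
  using s d by (auto simp: algebra_simps)
 have b: "p * beta1 n p \<alpha> q = p * n - q * (n - p + \<alpha>)" using p by (simp add: beta1_def right_diff_distrib)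
 have "p * (- beta1 n p \<alpha> q + q * (1 - n) + n) = - q * (n * p - n - \<alpha>)" using b by (simp add: algebra_simps)
 also have "\<dots> = p * (- (q * \<mu>) * \<sigma>)" unfolding k[symmetric] by simp
 finally have "p * (- beta1 n p \<alpha> q + q * (1 - n) + n) = p * (- (q * \<mu>) * \<sigma>)" .
 moreover have "p \<noteq> 0" using p by simp
 ultimately show "- beta1 n p \<alpha> q + q * (1 - n) + n = - (q * \<mu>) * \<sigma>" using mult_left_cancel by blast
qed

text \<open>F is assumed measurable only on the positive half-line, which is where primitives such
  as \<open>prim \<psi>\<close> are known to be continuous.\<close>

lemma
 fixes F :: "real \<Rightarrow> real"
 assumes F: "(\<lambda>s. indicator {0<..} s * F s) \<in> Borel"
 shows radial_integrable_iff: "integrable lborel (\<lambda>x::'a. norm x powr a * F (norm x powr \<sigma>)) \<longleftrightarrow>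
   integrable lborel (\<lambda>s. indicator {0<..} s * s powr ((a + n) / \<sigma> - 1) * F s)"
  and radial_integral: "(LINT x::'a|lborel. norm x powr a * F (norm x powr \<sigma>)) =
   sphere_area TYPE('a) / \<bar>\<sigma>\<bar> * (LINT s|lborel. indicator {0<..} s * s powr ((a + n) / \<sigma> - 1) * F s)"
proof -
 define f where "f = (\<lambda>s. s powr (a / \<sigma>) * (indicator {0<..} s * F s))"
 have fm: "f \<in> Borel" unfolding f_def using F by measurable
 have 1: "(\<lambda>x::'a. norm x powr a * F (norm x powr \<sigma>)) = (\<lambda>x. f (norm x powr \<sigma>))"
 proof
  fix x :: 'a
  show "norm x powr a * F (norm x powr \<sigma>) = f (norm x powr \<sigma>)"
   using nonzero_exponents(1) by (cases "x = 0") (auto simp: f_def powr_powr)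
 qed
 have 2: "(\<lambda>s. indicator {0<..} s * s powr ((a + n) / \<sigma> - 1) * F s) = (\<lambda>s. (s powr (DIM('a) / \<sigma> - 1) * indicator {0<..} s) * f s)"
 proof
  fix s :: real
  show "indicator {0<..} s * s powr ((a + n) / \<sigma> - 1) * F s = (s powr (DIM('a) / \<sigma> - 1) * indicator {0<..} s) * f s"
  proof (cases "0 < s")
   case True
   have "s powr (DIM('a) / \<sigma> - 1) * s powr (a / \<sigma>) = s powr ((a + n) / \<sigma> - 1)"
    by (simp add: powr_add[symmetric] n add_divide_distrib algebra_simps)
   then show ?thesis using True by (simp add: f_def)
  qed simp
 qed
 show "integrable lborel (\<lambda>x::'a. norm x powr a * F (norm x powr \<sigma>)) \<longleftrightarrow>
   integrable lborel (\<lambda>s. indicator {0<..} s * s powr ((a + n) / \<sigma> - 1) * F s)"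
  unfolding 1 2 by (rule integrable_norm_powr_iff[OF nonzero_exponents(1) fm])
 show "(LINT x::'a|lborel. norm x powr a * F (norm x powr \<sigma>)) =
   sphere_area TYPE('a) / \<bar>\<sigma>\<bar> * (LINT s|lborel. indicator {0<..} s * s powr ((a + n) / \<sigma> - 1) * F s)"
  unfolding 1 2 by (rule integral_norm_powr[OF nonzero_exponents(1) fm])
qed

section \<open>The two forms of the equation in the variable s\<close>

abbreviation lap_form :: "('a \<Rightarrow> real) \<Rightarrow> ('a \<Rightarrow> real) \<Rightarrow> 'a \<Rightarrow> real" where
 "lap_form f g x \<equiv> norm x powr \<alpha> * (\<bar>f x\<bar> powr (p - 2) * f x * g x)"

abbreviation grad_form :: "('a \<Rightarrow> 'a) \<Rightarrow> ('a \<Rightarrow> 'a) \<Rightarrow> 'a \<Rightarrow> real" where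
 "grad_form F G x \<equiv> norm x powr (- beta1 n p \<alpha> q) * (norm (F x) powr (q - 2) * (F x \<bullet> G x))"

text \<open>For a profile with H' = r powr (1 - n) * W (r powr \<sigma>) this is H' x / r. The
  Laplacian is r powr (1 - n) times the r-derivative of W (r powr \<sigma>), which is why
  \<open>lapW\<close> is applied to the derivative of W.\<close>

definition gradW :: "(real \<Rightarrow> real) \<Rightarrow> 'a \<Rightarrow> 'a" where
 "gradW W x = (norm x powr (- n) * W (norm x powr \<sigma>)) *\<^sub>R x"

definition lapW :: "(real \<Rightarrow> real) \<Rightarrow> 'a \<Rightarrow> real" where
 "lapW f x = \<sigma> * norm x powr (\<sigma> - n) * f (norm x powr \<sigma>)"

lemma gradW_indicator: "gradW (\<lambda>s. indicator {0<..} s * W s) = gradW W"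
 by (auto simp: gradW_def fun_eq_iff indicator_def)

lemma gradW_borel:
 assumes [measurable]: "(\<lambda>s. indicator {0<..} s * W s) \<in> Borel"
 shows "gradW W \<in> Borel"
proof -
 have "(\<lambda>x::'a. (norm x powr (- n) * (\<lambda>s. indicator {0<..} s * W s) (norm x powr \<sigma>)) *\<^sub>R x) \<in> Borel" by measurable
 then have "gradW (\<lambda>s. indicator {0<..} s * W s) \<in> Borel" by (simp add: gradW_def[abs_def])
 then show ?thesis by (simp only: gradW_indicator)
qed

lemma lapW_borel:
 assumes [measurable]: "f \<in> Borel"
 shows "lapW f \<in> Borel"
 unfolding lapW_def[abs_def] by measurable

lemma norm_gradW_diff: "norm (gradW V x - gradW W x) = norm x powr (1 - n) * \<bar>V (norm x powr \<sigma>) - W (norm x powr \<sigma>)\<bar>"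
proof (cases "x = 0")
 case False
 have "norm x powr (- n) * norm x = norm x powr (1 - n)" using False by (simp add: powr_mult_base mult.commute)
 then show ?thesis by (simp add: gradW_def scaleR_diff_left[symmetric] right_diff_distrib[symmetric] abs_mult ac_simps)
qed (simp add: gradW_def)

text \<open>The weight and the Jacobian cancel, so that the energy becomes an unweighted integral.\<close>

lemma
 assumes [measurable]: "f \<in> Borel" "g \<in> Borel" and z: "\<And>s. s \<le> 0 \<Longrightarrow> g s = 0"
 shows laplacian_form_integrable_iff: "integrable lborel (\<lambda>x. lap_form (lapW f) (lapW g) x) \<longleftrightarrow>
   integrable lborel (\<lambda>s. spw (p - 1) (f s) * g s)"
  and laplacian_form: "(LINT x|lborel. lap_form (lapW f) (lapW g) x) =
   sphere_area TYPE('a) * \<bar>\<sigma>\<bar> powr (p - 1) * (LINT s|lborel. spw (p - 1) (f s) * g s)"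
proof -
 let ?F = "\<lambda>s. spw (p - 1) (f s) * g s"
 have sm: "(\<lambda>s. indicator {0<..} s * ?F s) \<in> Borel" unfolding spw_def by measurable
 have 1: "lap_form (lapW f) (lapW g) x =
   \<bar>\<sigma>\<bar> powr p * (norm x powr (\<alpha> + p * (\<sigma> - n)) * ?F (norm x powr \<sigma>))" for x
 proof -
  define r where "r = norm x powr (\<sigma> - n)"
  have a: "\<bar>\<sigma> * r * y\<bar> powr (p - 2) * (\<sigma> * r * y) = sgn \<sigma> * \<bar>\<sigma>\<bar> powr (p - 1) * r powr (p - 1) * spw (p - 1) y" if "0 \<le> r" for y
   unfolding spw_eq using that by (cases "r = 0") (simp_all add: spw_def sgn_mult abs_mult powr_mult)
  have b: "\<bar>\<sigma>\<bar> powr (p - 1) * (sgn \<sigma> * \<sigma>) = \<bar>\<sigma>\<bar> powr p"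
   using nonzero_exponents(1) by (simp add: abs_sgn[symmetric] mult.commute powr_mult_base)
  have c: "r powr (p - 1) * r = r powr p" using p by (cases "r = 0") (simp_all add: r_def powr_mult_base mult.commute)
  have d: "r powr p = norm x powr (p * (\<sigma> - n))" by (simp add: r_def powr_powr mult.commute)
  have "lap_form (lapW f) (lapW g) x =
    norm x powr \<alpha> * ((\<bar>\<sigma>\<bar> powr (p - 1) * (sgn \<sigma> * \<sigma>)) * (r powr (p - 1) * r) * ?F (norm x powr \<sigma>))"
   unfolding lapW_def r_def[symmetric] by (subst a) (simp_all add: r_def)
  also have "\<dots> = \<bar>\<sigma>\<bar> powr p * (norm x powr (\<alpha> + p * (\<sigma> - n)) * ?F (norm x powr \<sigma>))"
   unfolding b c d powr_add by simp
  finally show ?thesis .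
 qed
 have e: "(\<alpha> + p * (\<sigma> - n) + n) / \<sigma> - 1 = 0" using exponents(2) nonzero_exponents by simp
 have 2: "(\<lambda>s. indicator {0<..} s * s powr ((\<alpha> + p * (\<sigma> - n) + n) / \<sigma> - 1) * ?F s) = ?F"
  unfolding e using z by (auto simp: indicator_def fun_eq_iff)
 have s0: "\<bar>\<sigma>\<bar> powr p \<noteq> 0" using nonzero_exponents by simp
 have "\<bar>\<sigma>\<bar> powr p / \<bar>\<sigma>\<bar> = \<bar>\<sigma>\<bar> powr (p - 1)" using nonzero_exponents by (simp add: powr_diff)
 then have s1: "\<bar>\<sigma>\<bar> powr p * (sphere_area TYPE('a) / \<bar>\<sigma>\<bar> * x) = sphere_area TYPE('a) * \<bar>\<sigma>\<bar> powr (p - 1) * x" for x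
  by (metis (no_types) mult.assoc mult.commute times_divide_eq_right)
 show "integrable lborel (\<lambda>x. lap_form (lapW f) (lapW g) x) \<longleftrightarrow> integrable lborel ?F"
  unfolding 1 using radial_integrable_iff[OF sm, of "\<alpha> + p * (\<sigma> - n)"] s0 unfolding 2 by (simp add: integrable_mult_right_iff)
 show "(LINT x|lborel. lap_form (lapW f) (lapW g) x) =
   sphere_area TYPE('a) * \<bar>\<sigma>\<bar> powr (p - 1) * (LINT s|lborel. ?F s)"
  unfolding 1 integral_mult_right_zero radial_integral[OF sm] 2 s1 ..
qed

lemma
 assumes [measurable]: "f \<in> Borel" and z: "\<And>s. s \<le> 0 \<Longrightarrow> f s = 0"
 shows laplacian_energy_integrable_iff: "integrable lborel (\<lambda>x. norm x powr \<alpha> * \<bar>lapW f x\<bar> powr p) \<longleftrightarrow> integrable lborel (\<lambda>s. \<bar>f s\<bar> powr p)"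
  and laplacian_energy: "(LINT x|lborel. norm x powr \<alpha> * \<bar>lapW f x\<bar> powr p) = sphere_area TYPE('a) * \<bar>\<sigma>\<bar> powr (p - 1) * Lp_int p f"
proof -
 have 1: "\<bar>y\<bar> powr (p - 2) * y * y = \<bar>y\<bar> powr p" for y using spw_mult_self[of "p - 1" y] by (simp add: spw_eq)
 have 2: "spw (p - 1) y * y = \<bar>y\<bar> powr p" for y using spw_mult_self[of "p - 1" y] by simp
 show "integrable lborel (\<lambda>x. norm x powr \<alpha> * \<bar>lapW f x\<bar> powr p) \<longleftrightarrow> integrable lborel (\<lambda>s. \<bar>f s\<bar> powr p)"
  using laplacian_form_integrable_iff[OF assms(1) assms(1) z] by (simp only: 1 2)
 show "(LINT x|lborel. norm x powr \<alpha> * \<bar>lapW f x\<bar> powr p) = sphere_area TYPE('a) * \<bar>\<sigma>\<bar> powr (p - 1) * Lp_int p f"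
  using laplacian_form[OF assms(1) assms(1) z] by (simp only: 1 2)
qed

text \<open>The norm contributes q - 2 powers of the factor r powr (1 - n) and the inner product two
  more. Together with the weight they have the exponent of \<open>exponents(3)\<close>, so that
  exactly \<open>wt\<close> remains.\<close>

lemma
 assumes V: "(\<lambda>s. indicator {0<..} s * V s) \<in> Borel" and W: "(\<lambda>s. indicator {0<..} s * W s) \<in> Borel"
 shows gradient_form_integrable_iff: "integrable lborel (\<lambda>x. grad_form (gradW V) (gradW W) x) \<longleftrightarrow>
   integrable lborel (\<lambda>s. wt s * (spw (q - 1) (V s) * W s))"
  and gradient_form: "(LINT x|lborel. grad_form (gradW V) (gradW W) x) =
   sphere_area TYPE('a) / \<bar>\<sigma>\<bar> * (LINT s|lborel. wt s * (spw (q - 1) (V s) * W s))"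
proof -
 let ?F = "\<lambda>s. spw (q - 1) (V s) * W s"
 have "(\<lambda>s. spw (q - 1) (indicator {0<..} s * V s) * (indicator {0<..} s * W s)) \<in> Borel"
  unfolding spw_def using V W by measurable
 also have "(\<lambda>s. spw (q - 1) (indicator {0<..} s * V s) * (indicator {0<..} s * W s)) = (\<lambda>s. indicator {0<..} s * ?F s)"
  by (auto simp: indicator_def fun_eq_iff)
 finally have sm: "(\<lambda>s. indicator {0<..} s * ?F s) \<in> Borel" .
 let ?a = "- beta1 n p \<alpha> q + q * (1 - n)"
 have 1: "grad_form (gradW V) (gradW W) x = norm x powr ?a * ?F (norm x powr \<sigma>)" for x
 proof (cases "x = 0")
  case False
  define r where "r = norm x powr (1 - n)"
  have r: "0 < r" using False by (simp add: r_def)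
  have b: "norm x powr (- n) * norm x = r" using False by (simp add: r_def powr_mult_base mult.commute)
  have N: "norm (gradW V x) = r * \<bar>V (norm x powr \<sigma>)\<bar>" using norm_gradW_diff[of V x "\<lambda>_. 0"] by (simp add: gradW_def[of "\<lambda>_. 0"] r_def)
  have I: "gradW V x \<bullet> gradW W x = r\<^sup>2 * (V (norm x powr \<sigma>) * W (norm x powr \<sigma>))"
   unfolding b[symmetric] by (simp add: gradW_def dot_square_norm power2_eq_square)
  have c: "r powr (q - 2) * r\<^sup>2 = norm x powr (q * (1 - n))"
  proof -
   have "r powr (q - 2) * r\<^sup>2 = r powr (q - 2) * r powr 2" using r by simp
   also have "\<dots> = r powr q" by (simp add: powr_add[symmetric])
   finally show ?thesis by (simp add: r_def powr_powr mult.commute)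
  qed
  have "grad_form (gradW V) (gradW W) x =
    norm x powr (- beta1 n p \<alpha> q) * ((r powr (q - 2) * r\<^sup>2) * ((\<bar>V (norm x powr \<sigma>)\<bar> powr (q - 2) * V (norm x powr \<sigma>)) * W (norm x powr \<sigma>)))"
   unfolding N I using r by (simp add: powr_mult)
  also have "\<dots> = norm x powr ?a * ?F (norm x powr \<sigma>)" unfolding c spw_eq powr_add by simp
  finally show ?thesis .
 qed simp
 have e: "(?a + n) / \<sigma> - 1 = - 1 - q * \<mu>" using exponents(3) nonzero_exponents by simp
 have 2: "(\<lambda>s. indicator {0<..} s * s powr ((?a + n) / \<sigma> - 1) * ?F s) = (\<lambda>s. wt s * ?F s)"
  unfolding e wt_def ..
 show "integrable lborel (\<lambda>x. grad_form (gradW V) (gradW W) x) \<longleftrightarrow>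
   integrable lborel (\<lambda>s. wt s * ?F s)"
  unfolding 1 radial_integrable_iff[OF sm] 2 ..
 show "(LINT x|lborel. grad_form (gradW V) (gradW W) x) =
   sphere_area TYPE('a) / \<bar>\<sigma>\<bar> * (LINT s|lborel. wt s * ?F s)"
  unfolding 1 radial_integral[OF sm] 2 ..
qed

lemma gradient_energy:
 assumes W: "(\<lambda>s. indicator {0<..} s * W s) \<in> Borel"
 shows "(LINT x|lborel. norm x powr (- beta1 n p \<alpha> q) * norm (gradW W x) powr q) =
   sphere_area TYPE('a) / \<bar>\<sigma>\<bar> * wt_int W"
proof -
 have 1: "norm y powr (q - 2) * (y \<bullet> y) = norm y powr q" for y :: 'a
 proof (cases "y = 0")
  case False
  then have "y \<bullet> y = norm y powr 2" by (simp add: dot_square_norm)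
  show ?thesis unfolding \<open>y \<bullet> y = norm y powr 2\<close> powr_add[symmetric] by simp
 qed simp
 have 2: "spw (q - 1) y * y = \<bar>y\<bar> powr q" for y using spw_mult_self[of "q - 1" y] by simp
 show ?thesis using gradient_form[OF W W] by (simp only: 1 2)
qed

text \<open>The dictionary between a radial test function and the half-line: H is its profile and V
  its flux in the variable s. H vanishes at both ends; the one recorded is that from which
  \<open>pot_bound\<close> turns bounds on V into bounds on H.\<close>

definition link :: "('a \<Rightarrow> real) \<Rightarrow> (real \<Rightarrow> real) \<Rightarrow> (real \<Rightarrow> real) \<Rightarrow> (real \<Rightarrow> real) \<Rightarrow> bool" where
 "link \<phi> V V' H \<longleftrightarrow> \<phi> \<in> Ckcr 2 \<and> C1c V V' \<and> (H \<longlongrightarrow> 0) (end_filter \<delta>) \<and>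
   (\<forall>r>0. DERIV H r :> r powr (1 - n) * V (r powr \<sigma>)) \<and> (\<forall>x. x \<noteq> 0 \<longrightarrow> \<phi> x = H (norm x))"

lemma powr_\<sigma>_has_real_derivative: "0 < r \<Longrightarrow> DERIV (\<lambda>r. r powr \<sigma>) r :> \<sigma> * r powr (\<sigma> - 1)"
 by (auto intro!: derivative_eq_intros)

lemma flux_has_real_derivative:
 assumes r: "0 < r" and V: "\<And>s. 0 < s \<Longrightarrow> DERIV V s :> V' s"
 shows "DERIV (\<lambda>r. r powr (1 - n) * V (r powr \<sigma>)) r :>
  \<sigma> * r powr (\<sigma> - n) * V' (r powr \<sigma>) - (n - 1) / r * (r powr (1 - n) * V (r powr \<sigma>))"
proof -
 have a: "DERIV (\<lambda>r. r powr (1 - n)) r :> (1 - n) * r powr (1 - n - 1)"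
  using r by (auto intro!: derivative_eq_intros)
 have b: "DERIV (\<lambda>r. V (r powr \<sigma>)) r :> V' (r powr \<sigma>) * (\<sigma> * r powr (\<sigma> - 1))"
  by (rule DERIV_chain2[OF V powr_\<sigma>_has_real_derivative]) (use r in auto)
 have e1: "r powr (1 - n - 1) = r powr (1 - n) / r" using r powr_diff[of r "1 - n" 1] by simp
 have e2: "r powr (\<sigma> - n) = r powr (\<sigma> - 1) * r powr (1 - n)" by (simp add: powr_add[symmetric])
 show ?thesis using DERIV_mult[OF a b] unfolding e1 e2 by (simp add: algebra_simps minus_divide_left[symmetric] diff_divide_distrib)
qed

lemma link_laplacian:
 assumes L: "link \<phi> V V' H" and x: "x \<noteq> 0"
 shows "partial_deriv b \<phi> x = gradW V x \<bullet> b" "laplacian \<phi> x = lapW V' x"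
proof -
 have V: "\<And>s. DERIV V s :> V' s" using L by (auto simp: link_def elim: C1cE)
 have H: "\<And>r. 0 < r \<Longrightarrow> DERIV H r :> r powr (1 - n) * V (r powr \<sigma>)" and \<phi>: "\<And>x. x \<noteq> 0 \<Longrightarrow> \<phi> x = H (norm x)"
  using L by (auto simp: link_def)
 note R = laplacian_radial[OF x \<phi> H flux_has_real_derivative[OF _ V]]
 have "norm x powr (- n) = norm x powr (1 - n) / norm x" using x powr_diff[of "norm x" "1 - n" 1] by simp
 then show "partial_deriv b \<phi> x = gradW V x \<bullet> b" using R(1)[of b] by (simp add: gradW_def)
 show "laplacian \<phi> x = lapW V' x" using R(2) by (simp add: lapW_def n[symmetric])
qed

lemma Ckcr_link:
 assumes \<phi>: "\<phi> \<in> Ckcr 2"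
 obtains V V' H where "link \<phi> V V' H"
proof -
 obtain H H' H'' a b where ab: "0 < a" "a < b" and \<phi>H: "\<And>x. \<phi> x = H (norm x)"
  and dH: "\<And>r. 0 < r \<Longrightarrow> DERIV H r :> H' r" and dH': "\<And>r. 0 < r \<Longrightarrow> DERIV H' r :> H'' r"
  and cH'': "continuous_on {0<..} H''" and z: "\<And>r. 0 < r \<Longrightarrow> r \<notin> {a..b} \<Longrightarrow> H r = 0 \<and> H' r = 0 \<and> H'' r = 0"
  using Ckcr_2_profile[OF \<phi>] by metis
 \<comment> \<open>With s = r powr \<sigma>, the flux factor r powr (n - 1) is s powr e.\<close>
 define e where "e = (n - 1) / \<sigma>"
 define V where "V = (\<lambda>s. indicator {0<..} s * (s powr e * H' (s powr (1 / \<sigma>))))"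
 define V' where "V' = (\<lambda>s. indicator {0<..} s * (s powr e * (H'' (s powr (1 / \<sigma>)) * ((1 / \<sigma>) * s powr (1 / \<sigma> - 1))) + e * s powr (e - 1) * H' (s powr (1 / \<sigma>))))"
 define a' where "a' = min (a powr \<sigma>) (b powr \<sigma>)"
 define b' where "b' = max (a powr \<sigma>) (b powr \<sigma>) + 1"
 have ab': "0 < a'" "a' < b'" using ab by (auto simp: a'_def b'_def)
 have out: "s powr (1 / \<sigma>) \<notin> {a..b}" if s: "0 < s" "s \<notin> {a'..b'}" for s
  by (rule powr_notin_Icc) (use s nonzero_exponents ab in \<open>auto simp: a'_def b'_def\<close>)
 have V0: "C1c V V'"
 proof (rule C1cI[OF ab'])
  fix s :: real assume s: "0 < s"
  have d1: "DERIV (\<lambda>s. s powr (1 / \<sigma>)) s :> (1 / \<sigma>) * s powr (1 / \<sigma> - 1)"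
   using s by (auto intro!: derivative_eq_intros)
  have d2: "DERIV (\<lambda>s. s powr e) s :> e * s powr (e - 1)"
   using s by (auto intro!: derivative_eq_intros)
  have "DERIV (\<lambda>s. H' (s powr (1 / \<sigma>))) s :> H'' (s powr (1 / \<sigma>)) * ((1 / \<sigma>) * s powr (1 / \<sigma> - 1))"
   by (rule DERIV_chain2[OF dH' d1]) (use s in simp)
  from DERIV_mult[OF d2 this] have "DERIV (\<lambda>s. s powr e * H' (s powr (1 / \<sigma>))) s :> V' s"
   using s by (simp add: V'_def algebra_simps)
  then show "DERIV V s :> V' s"
   by (rule has_field_derivative_transform_within_open[of _ _ _ "{0<..}"]) (use s in \<open>auto simp: V_def\<close>)
 next
  have cH': "continuous_on {0<..} H'" by (rule DERIV_continuous_half_line[OF dH'])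
  have "continuous_on {0<..} (\<lambda>s. s powr e * (H'' (s powr (1 / \<sigma>)) * ((1 / \<sigma>) * s powr (1 / \<sigma> - 1))) + e * s powr (e - 1) * H' (s powr (1 / \<sigma>)))"
   by (intro continuous_intros continuous_on_compose2[OF cH''] continuous_on_compose2[OF cH']) auto
  then show "continuous_on {0<..} V'" by (rule continuous_on_eq) (auto simp: V'_def)
 next
  fix s assume "s \<notin> {a'..b'}"
  have "H' (s powr (1 / \<sigma>)) = 0 \<and> H'' (s powr (1 / \<sigma>)) = 0" if "0 < s"
   using z[OF _ out[OF that \<open>s \<notin> {a'..b'}\<close>]] that by simp
  then show "V s = 0" "V' s = 0" by (auto simp: V_def V'_def indicator_def)
 qed
 have V1: "r powr (1 - n) * V (r powr \<sigma>) = H' r" if "0 < r" for r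
  using that nonzero_exponents by (simp add: V_def e_def powr_powr mult.assoc[symmetric] powr_add[symmetric])
 have lim: "(H \<longlongrightarrow> 0) (end_filter \<delta>)" by (rule tendsto_end_filter_0[OF ab(1)]) (use z in blast)
 show thesis by (rule that[of V V' H]) (use \<phi> V0 lim \<phi>H dH V1 in \<open>auto simp: link_def\<close>)
qed

abbreviation wdist :: "('a \<Rightarrow> real) \<Rightarrow> ('a \<Rightarrow> real) \<Rightarrow> ennreal" where
 "wdist f g \<equiv> \<integral>\<^sup>+x. ennreal (norm x powr (\<alpha> - 2 * p) * \<bar>f x - g x\<bar> powr p) \<partial>lborel"

text \<open>\<psi> is the derivative W' belonging to u. Every element of \<open>Dr\<close> has such
  a \<psi> by \<open>Dr_approx\<close>, and conversely by \<open>approx_Dr\<close>; beyond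
  membership in \<open>Dr\<close>, the relation records the function from which all integrals are
  computed.\<close>

definition approx :: "('a \<Rightarrow> real) \<Rightarrow> (real \<Rightarrow> real) \<Rightarrow> bool" where
 "approx u \<psi> \<longleftrightarrow> u \<in> Borel \<and> (\<exists>\<phi> V V' H. (\<forall>j. link (\<phi> j) (V j) (V' j) (H j)) \<and> C1c_limit V V' \<psi> \<and>
   (\<lambda>j. wdist (\<phi> j) u) \<longlonglongrightarrow> 0)"

lemma lapW_diff: "lapW f x - lapW g x = lapW (\<lambda>s. f s - g s) x"
 by (simp add: lapW_def right_diff_distrib)

lemma D_norm_link:
 assumes "link \<phi> V V' H" "link \<phi>2 V2 V2' H2"
 shows "D_norm p \<alpha> (\<lambda>x. \<phi> x - \<phi>2 x) = (sphere_area TYPE('a) * \<bar>\<sigma>\<bar> powr (p - 1) * Lp_dist p V' V2') powr (1 / p)"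
proof -
 have c: "\<phi> \<in> Ckc 2" "\<phi>2 \<in> Ckc 2" "C1c V V'" "C1c V2 V2'" using assms by (auto simp: link_def Ckcr_def)
 have 1: "norm x powr \<alpha> * \<bar>laplacian (\<lambda>x. \<phi> x - \<phi>2 x) x\<bar> powr p = norm x powr \<alpha> * \<bar>lapW (\<lambda>s. V' s - V2' s) x\<bar> powr p" for x
  using link_laplacian(2)[OF assms(1), of x] link_laplacian(2)[OF assms(2), of x]
  by (cases "x = 0") (auto simp: laplacian_diff[OF c(1,2)] lapW_diff)
 have "(\<lambda>s. V' s - V2' s) \<in> Borel"
  using C1c_eq_prim(2)[OF c(3)] C1c_eq_prim(2)[OF c(4)] by (rule borel_measurable_diff)
 moreover have "V' s - V2' s = 0" if "s \<le> 0" for s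
  using C1c_eq_prim(3)[OF c(3) that] C1c_eq_prim(3)[OF c(4) that] by simp
 ultimately show ?thesis unfolding D_norm_def 1 by (intro arg_cong2[where f = "(powr)"] laplacian_energy refl)
qed

end

subsection \<open>Elements of the radial space\<close>

lemma nn_integral_tendsto_0_iff:
 fixes f :: "nat \<Rightarrow> 'a \<Rightarrow> real"
 assumes "\<And>j. integrable M (f j)" "\<And>j x. 0 \<le> f j x"
 shows "(\<lambda>j. \<integral>\<^sup>+x. ennreal (f j x) \<partial>M) \<longlonglongrightarrow> 0 \<longleftrightarrow> (\<lambda>j. LINT x|M. f j x) \<longlonglongrightarrow> 0"
proof -
 have "(\<lambda>j. \<integral>\<^sup>+x. ennreal (f j x) \<partial>M) = (\<lambda>j. ennreal (LINT x|M. f j x))"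
  using assms by (intro ext nn_integral_eq_integral) auto
 moreover have "(\<lambda>j. ennreal (LINT x|M. f j x)) \<longlonglongrightarrow> ennreal 0 \<longleftrightarrow> (\<lambda>j. LINT x|M. f j x) \<longlonglongrightarrow> 0"
  using assms by (intro tendsto_ennreal_iff) auto
 ultimately show ?thesis by simp
qed

lemma integral_powr_triangle:
 fixes f g h :: "'a \<Rightarrow> real"
 assumes p: "0 \<le> p" and i: "integrable M (\<lambda>x. \<bar>f x - g x\<bar> powr p)" "integrable M (\<lambda>x. \<bar>g x - h x\<bar> powr p)"
 shows "(LINT x|M. \<bar>f x - h x\<bar> powr p) \<le> 2 powr p * ((LINT x|M. \<bar>f x - g x\<bar> powr p) + (LINT x|M. \<bar>g x - h x\<bar> powr p))"
proof -
 have "(LINT x|M. \<bar>f x - h x\<bar> powr p) \<le> (LINT x|M. 2 powr p * (\<bar>f x - g x\<bar> powr p + \<bar>g x - h x\<bar> powr p))"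
 proof (rule integral_mono')
  show "\<bar>f x - h x\<bar> powr p \<le> 2 powr p * (\<bar>f x - g x\<bar> powr p + \<bar>g x - h x\<bar> powr p)" for x
   using powr_add_le[OF p, of "f x - g x" "g x - h x"] by simp
 qed (use i in auto)
 also have "\<dots> = 2 powr p * ((LINT x|M. \<bar>f x - g x\<bar> powr p) + (LINT x|M. \<bar>g x - h x\<bar> powr p))" using i by simp
 finally show ?thesis .
qed

lemma nn_integral_powr_triangle:
 fixes f g h w :: "'a \<Rightarrow> real"
 assumes p: "0 \<le> p" and w: "\<And>x. 0 \<le> w x"
  and [measurable]: "f \<in> borel_measurable M" "g \<in> borel_measurable M" "h \<in> borel_measurable M" "w \<in> borel_measurable M"
 shows "(\<integral>\<^sup>+x. ennreal (w x * \<bar>f x - h x\<bar> powr p) \<partial>M) \<le>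
  ennreal (2 powr p) * ((\<integral>\<^sup>+x. ennreal (w x * \<bar>f x - g x\<bar> powr p) \<partial>M) + (\<integral>\<^sup>+x. ennreal (w x * \<bar>g x - h x\<bar> powr p) \<partial>M))"
proof -
 have "(\<integral>\<^sup>+x. ennreal (w x * \<bar>f x - h x\<bar> powr p) \<partial>M) \<le>
   (\<integral>\<^sup>+x. ennreal (2 powr p) * (ennreal (w x * \<bar>f x - g x\<bar> powr p) + ennreal (w x * \<bar>g x - h x\<bar> powr p)) \<partial>M)"
 proof (rule nn_integral_mono)
  fix x
  have "w x * \<bar>f x - h x\<bar> powr p \<le> w x * (2 powr p * (\<bar>f x - g x\<bar> powr p + \<bar>g x - h x\<bar> powr p))"
   using powr_add_le[OF p, of "f x - g x" "g x - h x"] w[of x] by (intro mult_left_mono) auto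
  also have "\<dots> = 2 powr p * (w x * \<bar>f x - g x\<bar> powr p + w x * \<bar>g x - h x\<bar> powr p)" by (simp add: algebra_simps)
  finally show "ennreal (w x * \<bar>f x - h x\<bar> powr p) \<le> ennreal (2 powr p) * (ennreal (w x * \<bar>f x - g x\<bar> powr p) + ennreal (w x * \<bar>g x - h x\<bar> powr p))"
   using w[of x] by (simp add: ennreal_mult[symmetric] ennreal_plus[symmetric] del: ennreal_plus)
 qed
 also have "\<dots> = ennreal (2 powr p) * ((\<integral>\<^sup>+x. ennreal (w x * \<bar>f x - g x\<bar> powr p) \<partial>M) + (\<integral>\<^sup>+x. ennreal (w x * \<bar>g x - h x\<bar> powr p) \<partial>M))"
  by (simp add: nn_integral_cmult nn_integral_add)
 finally show ?thesis .
qed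

lemma (in bliss) C1c_limit_Cauchy:
 assumes L: "C1c_limit V V' \<psi>" and \<epsilon>: "0 < \<epsilon>"
 shows "\<exists>N. \<forall>j\<ge>N. \<forall>k\<ge>N. Lp_dist p (V' j) (V' k) < \<epsilon>"
proof -
 define \<eta> where "\<eta> = \<epsilon> / (4 * 2 powr p)"
 have \<eta>: "0 < \<eta>" "2 powr p * (\<eta> + \<eta>) < \<epsilon>" using \<epsilon> by (auto simp: \<eta>_def)
 obtain N where N: "\<And>j. N \<le> j \<Longrightarrow> (Lp_dist p (V' j) \<psi>) < \<eta>"
  using order_tendstoD(2)[OF C1c_limitD(5)[OF L] \<eta>(1)] unfolding eventually_sequentially by blast
 have "Lp_dist p (V' j) (V' k) < \<epsilon>" if "N \<le> j" "N \<le> k" for j k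
 proof -
  have i: "integrable lborel (\<lambda>s. \<bar>V' j s - \<psi> s\<bar> powr p)" for j by (rule C1c_limitD(9)[OF L])
  have c: "\<bar>\<psi> s - V' k s\<bar> = \<bar>V' k s - \<psi> s\<bar>" for s by simp
  have "Lp_dist p (V' j) (V' k) \<le> 2 powr p * ((Lp_dist p (V' j) \<psi>) + Lp_dist p \<psi> (V' k))"
   using i p by (intro integral_powr_triangle) (auto simp: c)
  also have "\<dots> \<le> 2 powr p * (\<eta> + \<eta>)"
   unfolding c using N[OF that(1)] N[OF that(2)] by (intro mult_left_mono add_mono) auto
  finally show ?thesis using \<eta>(2) by simp
 qed
 then show ?thesis by blast
qed

context rad
begin

lemma sphere_\<sigma>_pos: "0 < sphere_area TYPE('a) * \<bar>\<sigma>\<bar> powr (p - 1)"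
 by (intro mult_pos_pos sphere_area_pos) (simp add: nonzero_exponents)

lemma link_Ckc:
 assumes "link \<phi> V V' H"
 shows "\<phi> \<in> Ckc 2" "\<phi> \<in> Ckc 1" "\<phi> \<in> Borel" "laplacian \<phi> \<in> Borel"
proof -
 show \<phi>: "\<phi> \<in> Ckc 2" using assms by (auto simp: link_def Ckcr_def)
 then show "\<phi> \<in> Ckc 1" using Ckc_SucD[of \<phi> "Suc 0"] by (simp add: numeral_2_eq_2)
 show "\<phi> \<in> Borel" using \<phi> by (rule Ckc_borel)
 show "laplacian \<phi> \<in> Borel" using Ckc_laplacian[OF \<phi>] by (rule Ckc_borel)
qed

lemma link_laplacian_limit:
 assumes K: "\<And>j. link (\<phi> j) (V j) (V' j) (H j)" and L: "C1c_limit V V' \<psi>"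
 shows "(\<lambda>j. \<integral>\<^sup>+x. ennreal (norm x powr \<alpha> * \<bar>laplacian (\<phi> j) x - lapW \<psi> x\<bar> powr p) \<partial>lborel) \<longlonglongrightarrow> 0"
proof -
 define h where "h j s = V' j s - \<psi> s" for j s
 have m: "h j \<in> Borel" for j
  unfolding h_def[abs_def] using C1c_limitD(6)[OF L] C1c_limitD(2)[OF L] by (rule borel_measurable_diff)
 have z: "h j s = 0" if "s \<le> 0" for j s
  using C1c_limitD(3)[OF L that] C1c_limitD(7)[OF L that] by (simp add: h_def)
 have 1: "norm x powr \<alpha> * \<bar>laplacian (\<phi> j) x - lapW \<psi> x\<bar> powr p = norm x powr \<alpha> * \<bar>lapW (h j) x\<bar> powr p" for j x
  using link_laplacian(2)[OF K[of j], of x] by (cases "x = 0") (auto simp: lapW_diff h_def[abs_def])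
 have 2: "integrable lborel (\<lambda>x. norm x powr \<alpha> * \<bar>lapW (h j) x\<bar> powr p)" for j
  using laplacian_energy_integrable_iff[OF m z, of j] C1c_limitD(9)[OF L, of j] unfolding h_def by blast
 have "(\<lambda>j. sphere_area TYPE('a) * \<bar>\<sigma>\<bar> powr (p - 1) * Lp_int p (h j)) \<longlonglongrightarrow> 0"
  unfolding h_def by (rule tendsto_mult_right_zero[OF C1c_limitD(5)[OF L]])
 then show ?thesis
  unfolding 1 by (subst nn_integral_tendsto_0_iff[OF 2]) (simp_all add: laplacian_energy[OF m z])
qed

text \<open>Off the origin the gradients differ by at most the L^p distance of the derivatives, to
  the power 1 / p, times r powr (\<delta> - 1), and the Laplacians converge in weighted L^p. Both
  imply \<open>L1loc_lim\<close>, under which weak derivatives pass to the limit.\<close>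

lemma
 assumes "approx u \<psi>"
 shows approx_Dr: "u \<in> Dr p \<alpha>" and approx_weak_gradient: "is_weak_gradient u (gradW (prim \<psi>))"
  and approx_weak_laplacian: "is_weak_laplacian u (lapW \<psi>)"
proof -
 obtain \<phi> V V' H where um: "u \<in> Borel" and K: "\<And>j. link (\<phi> j) (V j) (V' j) (H j)" and L: "C1c_limit V V' \<psi>"
  and lim: "(\<lambda>j. wdist (\<phi> j) u) \<longlonglongrightarrow> 0"
  using assms unfolding approx_def by blast
 have u: "L1loc_lim \<phi> u" by (rule L1loc_lim_weighted[OF p link_Ckc(3)[OF K] um lim])
 show "u \<in> Dr p \<alpha>"
  unfolding Dr_def
 proof (intro CollectI conjI exI[of _ \<phi>] allI impI)
  show "u \<in> borel_measurable lborel" using um by simp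
  show "\<phi> j \<in> Ckcr 2" for j using K[of j] by (auto simp: link_def)
  show "(\<lambda>j. wdist (\<phi> j) u) \<longlonglongrightarrow> 0" by (rule lim)
  fix \<epsilon> :: real assume \<epsilon>: "0 < \<epsilon>"
  define S where "S = sphere_area TYPE('a) * \<bar>\<sigma>\<bar> powr (p - 1)"
  have S: "0 < S" unfolding S_def by (rule sphere_\<sigma>_pos)
  obtain N where N: "\<And>j k. N \<le> j \<Longrightarrow> N \<le> k \<Longrightarrow> (Lp_dist p (V' j) (V' k)) < \<epsilon> powr p / S"
   using C1c_limit_Cauchy[OF L, of "\<epsilon> powr p / S"] S \<epsilon> by auto
  have "D_norm p \<alpha> (\<lambda>x. \<phi> j x - \<phi> k x) < \<epsilon>" if "N \<le> j" "N \<le> k" for j k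
  proof -
   have "S * Lp_dist p (V' j) (V' k) < \<epsilon> powr p"
    using N[OF that] S by (simp add: field_simps)
   then have "(S * Lp_dist p (V' j) (V' k)) powr (1 / p) < (\<epsilon> powr p) powr (1 / p)"
    using S p by (intro powr_less_mono2) auto
   also have "(\<epsilon> powr p) powr (1 / p) = \<epsilon>" using \<epsilon> p by (simp add: powr_powr)
   finally show ?thesis unfolding D_norm_link[OF K K] S_def .
  qed
  then show "\<exists>N. \<forall>j\<ge>N. \<forall>k\<ge>N. D_norm p \<alpha> (\<lambda>x. \<phi> j x - \<phi> k x) < \<epsilon>" by blast
 qed
 show "is_weak_laplacian u (lapW \<psi>)"
 proof (rule weak_laplacian_limit[OF link_Ckc(1)[OF K] um u])
  show "lapW \<psi> \<in> Borel" by (rule lapW_borel[OF C1c_limitD(2)[OF L]])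
  then show "L1loc_lim (\<lambda>j. laplacian (\<phi> j)) (lapW \<psi>)"
   by (rule L1loc_lim_weighted[OF p link_Ckc(4)[OF K] _ link_laplacian_limit[OF K L]])
 qed
 show "is_weak_gradient u (gradW (prim \<psi>))"
 proof (rule weak_gradient_limit[OF link_Ckc(2)[OF K] um u])
  have cV: "continuous_on UNIV (V j)" for j using C1c_limitD(1)[OF L, of j] by (rule C1cE)
  have Vm: "V j \<in> Borel" for j by (rule borel_measurable_continuous_onI[OF cV])
  show m1: "gradW (V j) \<in> Borel" for j by (rule gradW_borel) (use Vm[of j] in measurable)
  show m2: "gradW (prim \<psi>) \<in> Borel" by (rule gradW_borel[OF prim_borel[OF L]])
  show "continuous_on (- {0}) (gradW (V j))" for j
   unfolding gradW_def by (intro continuous_intros continuous_on_compose2[OF cV]) auto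
  show "partial_deriv b (\<phi> j) x = gradW (V j) x \<bullet> b" if "x \<noteq> 0" for j b x by (rule link_laplacian(1)[OF K that])
  show "L1loc_lim (\<lambda>j. gradW (V j)) (gradW (prim \<psi>))"
  proof (rule L1loc_lim_dominated[OF m1 m2 _ C1c_limit_dist_tendsto_0[OF L]])
   fix j and x :: 'a assume x: "x \<noteq> 0"
   let ?e = "Lp_dist p (V' j) \<psi> powr (1 / p)"
   have "norm (gradW (V j) x - gradW (prim \<psi>) x) \<le> norm x powr (1 - n) * ((norm x powr \<sigma>) powr \<mu> * ?e)"
    unfolding norm_gradW_diff using C1c_limitD(10)[OF L, of "norm x powr \<sigma>" j] x by (intro mult_left_mono) auto
   also have "\<dots> = ?e * norm x powr (1 - n + \<sigma> * \<mu>)" by (simp add: powr_powr powr_add)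
   finally show "norm (gradW (V j) x - gradW (prim \<psi>) x) \<le> ?e * norm x powr (\<delta> - 1)" by (simp only: exponents(1))
  qed
 qed
qed

text \<open>\<open>D_norm_link\<close> turns the Cauchy condition into one for the V' in unweighted
  L^p on the line, and \<psi> is their limit. Setting it to 0 on the negative half-line can only
  decrease the distances, since all V' vanish there.\<close>

lemma Dr_approx:
 assumes u: "u \<in> Dr p \<alpha>"
 obtains \<psi> where "approx u \<psi>"
proof -
 obtain \<phi> where um: "u \<in> Borel" and \<phi>: "\<And>j. \<phi> j \<in> Ckcr 2"
  and cauchy: "\<And>\<epsilon>. 0 < \<epsilon> \<Longrightarrow> \<exists>N. \<forall>j\<ge>N. \<forall>k\<ge>N. D_norm p \<alpha> (\<lambda>x. \<phi> j x - \<phi> k x) < \<epsilon>"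
  and lim: "(\<lambda>j. wdist (\<phi> j) u) \<longlonglongrightarrow> 0"
  using u unfolding Dr_def by auto
 have "\<exists>t. link (\<phi> j) (fst t) (fst (snd t)) (snd (snd t))" for j
  using Ckcr_link[OF \<phi>[of j]] by (metis fst_conv snd_conv)
 then obtain t where t: "\<And>j. link (\<phi> j) (fst (t j)) (fst (snd (t j))) (snd (snd (t j)))" by metis
 define V V' H where "V j = fst (t j)" and "V' j = fst (snd (t j))" and "H j = snd (snd (t j))" for j
 have K: "link (\<phi> j) (V j) (V' j) (H j)" for j using t by (simp add: V_def V'_def H_def)
 have C: "C1c (V j) (V' j)" for j using K by (simp add: link_def)
 note m [measurable] = C1c_eq_prim(2)[OF C]
 note z = C1c_eq_prim(3)[OF C]
 note i = C1c_integrable(1)[OF C]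
 have ij: "integrable lborel (\<lambda>s. \<bar>V' j s - V' k s\<bar> powr p)" for j k
  by (rule prim_diff_le(1)[OF p m m z z i i, of 1]) auto
 define S where "S = sphere_area TYPE('a) * \<bar>\<sigma>\<bar> powr (p - 1)"
 have S: "0 < S" unfolding S_def by (rule sphere_\<sigma>_pos)
 have cauchy': "\<exists>N. \<forall>j\<ge>N. \<forall>k\<ge>N. (\<integral>\<^sup>+s. ennreal (\<bar>V' j s - V' k s\<bar> powr p) \<partial>lborel) \<le> ennreal e" if e: "0 < e" for e
 proof -
  obtain N where N: "\<And>j k. N \<le> j \<Longrightarrow> N \<le> k \<Longrightarrow> D_norm p \<alpha> (\<lambda>x. \<phi> j x - \<phi> k x) < (S * e) powr (1 / p)"
   using cauchy[of "(S * e) powr (1 / p)"] S e by auto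
  have "(\<integral>\<^sup>+s. ennreal (\<bar>V' j s - V' k s\<bar> powr p) \<partial>lborel) \<le> ennreal e" if "N \<le> j" "N \<le> k" for j k
  proof -
   have "(S * Lp_dist p (V' j) (V' k)) powr (1 / p) < (S * e) powr (1 / p)"
    using N[OF that] unfolding D_norm_link[OF K K] S_def .
   then have "S * Lp_dist p (V' j) (V' k) < S * e"
    using S e p powr_mono2[of "1 / p" "S * e" "S * Lp_dist p (V' j) (V' k)"]
    by (cases "S * e \<le> S * Lp_dist p (V' j) (V' k)") auto
   then have "Lp_dist p (V' j) (V' k) \<le> e" using S by simp
   then show ?thesis using nn_integral_eq_integral[OF ij] by (simp add: ennreal_leI)
  qed
  then show ?thesis by blast
 qed
 obtain g where gm: "g \<in> borel_measurable lborel" and g: "(\<lambda>j. \<integral>\<^sup>+s. ennreal (\<bar>V' j s - g s\<bar> powr p) \<partial>lborel) \<longlonglongrightarrow> 0"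
  by (rule Riesz_Fischer[of p V' lborel, OF _ _ cauchy' that]) (use p m in auto)
 define \<psi> where "\<psi> = (\<lambda>s. indicator {0<..} s * g s)"
 have \<psi>m [measurable]: "\<psi> \<in> Borel" using gm unfolding \<psi>_def by simp
 have \<psi>z: "\<psi> s = 0" if "s \<le> 0" for s using that by (simp add: \<psi>_def)
 have \<psi>lim: "(\<lambda>j. \<integral>\<^sup>+s. ennreal (\<bar>V' j s - \<psi> s\<bar> powr p) \<partial>lborel) \<longlonglongrightarrow> 0"
 proof (rule ennreal_tendsto_0_bound[OF g], rule nn_integral_mono)
  fix j s show "ennreal (\<bar>V' j s - \<psi> s\<bar> powr p) \<le> ennreal (\<bar>V' j s - g s\<bar> powr p)"
   using z[of s j] by (cases "0 < s") (auto simp: \<psi>_def)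
 qed
 have "eventually (\<lambda>j. (\<integral>\<^sup>+s. ennreal (\<bar>V' j s - \<psi> s\<bar> powr p) \<partial>lborel) \<le> ennreal 1) sequentially"
  by (rule ennreal_tendsto_0D[OF \<psi>lim]) simp
 then obtain j where "(\<integral>\<^sup>+s. ennreal (\<bar>V' j s - \<psi> s\<bar> powr p) \<partial>lborel) \<le> ennreal 1"
  using eventually_happens'[OF sequentially_bot] by blast
 then have fin: "(\<integral>\<^sup>+s. ennreal (\<bar>V' j s - \<psi> s\<bar> powr p) \<partial>lborel) < \<infinity>" by (rule le_less_trans) simp
 have \<psi>i: "integrable lborel (\<lambda>s. \<bar>\<psi> s\<bar> powr p)"
  by (rule integrable_powr_triangle[OF _ _ _ i fin]) (use p in auto)
 have "integrable lborel (\<lambda>s. \<bar>V' j s - \<psi> s\<bar> powr p)" for j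
  by (rule prim_diff_le(1)[OF p m \<psi>m z \<psi>z i \<psi>i, of 1]) auto
 from nn_integral_tendsto_0_iff[OF this] \<psi>lim have "(\<lambda>j. Lp_dist p (V' j) \<psi>) \<longlonglongrightarrow> 0" by simp
 then have "C1c_limit V V' \<psi>" unfolding C1c_limit_def using C \<psi>m \<psi>z \<psi>i by blast
 then have "approx u \<psi>" unfolding approx_def using um K lim by blast
 then show thesis by (rule that)
qed

text \<open>A diagonal sequence: among the approximations of the j-th function one is taken within 1
  / (j + 1) in both distances.\<close>

lemma approx_closure:
 assumes a: "\<And>j. approx (u j) (\<psi> j)" and \<psi>m: "\<psi>0 \<in> Borel" and \<psi>z: "\<And>s. s \<le> 0 \<Longrightarrow> \<psi>0 s = 0"
  and \<psi>i: "integrable lborel (\<lambda>s. \<bar>\<psi>0 s\<bar> powr p)" and \<psi>l: "(\<lambda>j. Lp_dist p (\<psi> j) \<psi>0) \<longlonglongrightarrow> 0"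
  and vm: "v \<in> Borel"
  and vl: "(\<lambda>j. wdist (u j) v) \<longlonglongrightarrow> 0"
 shows "approx v \<psi>0"
proof -
 \<comment> \<open>Test function, flux, its derivative and profile form one tuple, so that a single
   choice fixes all four.\<close>
 define P where "P j t \<longleftrightarrow> link (fst t) (fst (snd t)) (fst (snd (snd t))) (snd (snd (snd t))) \<and>
   (LINT s|lborel. \<bar>fst (snd (snd t)) s - \<psi> j s\<bar> powr p) \<le> 1 / real (Suc j) \<and>
   integrable lborel (\<lambda>s. \<bar>fst (snd (snd t)) s - \<psi> j s\<bar> powr p) \<and> integrable lborel (\<lambda>s. \<bar>\<psi> j s - \<psi>0 s\<bar> powr p) \<and> u j \<in> Borel \<and>
   (wdist (fst t) (u j)) \<le> ennreal (1 / real (Suc j))" for j t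
 have "\<exists>t. P j t" for j
 proof -
  obtain \<phi> V V' H where um: "u j \<in> Borel" and K: "\<And>k. link (\<phi> k) (V k) (V' k) (H k)" and L: "C1c_limit V V' (\<psi> j)"
   and lim: "(\<lambda>k. wdist (\<phi> k) (u j)) \<longlonglongrightarrow> 0"
   using a[of j] unfolding approx_def by blast
  have e: "0 < 1 / real (Suc j)" by simp
  have "eventually (\<lambda>k. Lp_dist p (V' k) (\<psi> j) < 1 / real (Suc j) \<and>
    (wdist (\<phi> k) (u j)) \<le> ennreal (1 / real (Suc j))) sequentially"
   by (rule eventually_conj[OF order_tendstoD(2)[OF C1c_limitD(5)[OF L] e] ennreal_tendsto_0D[OF lim e]])
  then obtain k where k: "Lp_dist p (V' k) (\<psi> j) < 1 / real (Suc j)"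
    "wdist (\<phi> k) (u j) \<le> ennreal (1 / real (Suc j))"
   using eventually_happens'[OF sequentially_bot] by blast
  have i: "integrable lborel (\<lambda>s. \<bar>\<psi> j s - \<psi>0 s\<bar> powr p)"
   by (rule prim_diff_le(1)[OF p C1c_limitD(2)[OF L] \<psi>m C1c_limitD(3)[OF L] \<psi>z C1c_limitD(4)[OF L] \<psi>i, of 1]) auto
  show ?thesis unfolding P_def
   by (rule exI[of _ "(\<phi> k, V k, V' k, H k)"]) (use k K[of k] C1c_limitD(9)[OF L, of k] i um in simp)
 qed
 then obtain t where tP: "\<And>j. P j (t j)" by metis
 note tP = tP[unfolded P_def]
 note t = tP[THEN conjunct1] tP[THEN conjunct2, THEN conjunct1] tP[THEN conjunct2, THEN conjunct2, THEN conjunct1]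
  tP[THEN conjunct2, THEN conjunct2, THEN conjunct2, THEN conjunct1] tP[THEN conjunct2, THEN conjunct2, THEN conjunct2, THEN conjunct2, THEN conjunct1]
  tP[THEN conjunct2, THEN conjunct2, THEN conjunct2, THEN conjunct2, THEN conjunct2]
 define \<phi> V V' H where "\<phi> j = fst (t j)" and "V j = fst (snd (t j))" and "V' j = fst (snd (snd (t j)))" and "H j = snd (snd (snd (t j)))" for j
 note defs = \<phi>_def[symmetric] V_def[symmetric] V'_def[symmetric] H_def[symmetric]
 note t = t[unfolded defs]
 have inv: "(\<lambda>j. 1 / real (Suc j)) \<longlonglongrightarrow> 0" using LIMSEQ_inverse_real_of_nat by (simp add: inverse_eq_divide)
 have "(\<lambda>j. Lp_dist p (V' j) \<psi>0) \<longlonglongrightarrow> 0"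
 proof (rule tendsto_sandwich[of "\<lambda>_. 0" _ _ "\<lambda>j. 2 powr p * (1 / real (Suc j) + Lp_dist p (\<psi> j) \<psi>0)"])
  have "(\<lambda>j. 2 powr p * (1 / real (Suc j) + Lp_dist p (\<psi> j) \<psi>0)) \<longlonglongrightarrow> 2 powr p * (0 + 0)"
   by (intro tendsto_intros inv \<psi>l)
  then show "(\<lambda>j. 2 powr p * (1 / real (Suc j) + Lp_dist p (\<psi> j) \<psi>0)) \<longlonglongrightarrow> 0" by simp
  have "Lp_dist p (V' j) \<psi>0 \<le> 2 powr p * (1 / real (Suc j) + Lp_dist p (\<psi> j) \<psi>0)" for j
  proof -
   have "Lp_dist p (V' j) \<psi>0 \<le> 2 powr p * ((Lp_dist p (V' j) (\<psi> j)) + Lp_dist p (\<psi> j) \<psi>0)"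
    using p by (intro integral_powr_triangle t) auto
   also have "\<dots> \<le> 2 powr p * (1 / real (Suc j) + Lp_dist p (\<psi> j) \<psi>0)"
    using t(2)[of j] by (intro mult_left_mono add_right_mono) auto
   finally show ?thesis .
  qed
  then show "eventually (\<lambda>j. Lp_dist p (V' j) \<psi>0 \<le> 2 powr p * (1 / real (Suc j) + Lp_dist p (\<psi> j) \<psi>0)) sequentially"
   by (rule always_eventually[OF allI])
 qed auto
 then have L: "C1c_limit V V' \<psi>0" unfolding C1c_limit_def using t(1) \<psi>m \<psi>z \<psi>i by (auto simp: link_def)
 have "(\<lambda>j. wdist (\<phi> j) v) \<longlonglongrightarrow> 0"
 proof (rule ennreal_tendsto_0_bound)
  have "(\<lambda>j. ennreal (1 / real (Suc j))) \<longlonglongrightarrow> ennreal 0" by (intro tendsto_ennrealI inv)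
  then have "(\<lambda>j. ennreal (2 powr p) * (ennreal (1 / real (Suc j)) + wdist (u j) v)) \<longlonglongrightarrow> ennreal (2 powr p) * (ennreal 0 + 0)"
   by (intro ennreal_tendsto_cmult tendsto_add vl) auto
  then show "(\<lambda>j. ennreal (2 powr p) * (ennreal (1 / real (Suc j)) + wdist (u j) v)) \<longlonglongrightarrow> 0" by simp
  fix j
  note [measurable] = link_Ckc(3)[OF t(1)] t(5) vm
  have "wdist (\<phi> j) v \<le> ennreal (2 powr p) *
    ((wdist (\<phi> j) (u j)) + wdist (u j) v)"
   using p by (intro nn_integral_powr_triangle) auto
  also have "\<dots> \<le> ennreal (2 powr p) * (ennreal (1 / real (Suc j)) + wdist (u j) v)"
   by (intro mult_left_mono add_right_mono t) auto
  finally show "wdist (\<phi> j) v \<le>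
    ennreal (2 powr p) * (ennreal (1 / real (Suc j)) + wdist (u j) v)" .
 qed
 then show ?thesis unfolding approx_def using vm t(1) L by blast
qed

lemma radial_borel:
 fixes H :: "real \<Rightarrow> real"
 assumes "continuous_on {0<..} H"
 shows "(\<lambda>x::'a. H (norm x)) \<in> Borel"
proof -
 have [measurable]: "(\<lambda>r. indicator {0<..} r *\<^sub>R H r) \<in> Borel"
  by (rule borel_measurable_continuous_on_indicator[OF _ assms]) simp
 have "(\<lambda>x::'a. (\<lambda>r. indicator {0<..} r *\<^sub>R H r) (norm x) + indicator {0} x * H 0) \<in> Borel" by measurable
 also have "(\<lambda>x::'a. (\<lambda>r. indicator {0<..} r *\<^sub>R H r) (norm x) + indicator {0} x * H 0) = (\<lambda>x. H (norm x))"
  by (auto simp: indicator_def fun_eq_iff)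
 finally show ?thesis .
qed

text \<open>\<psi> determines u. Profiles with limit 0 at \<open>end_filter \<delta>\<close> differ
  by at most a multiple of r powr \<delta> that tends to 0 with the L^p distance of the derivatives
  (\<open>pot_bound\<close>), so the profiles of the test functions converge pointwise to H. Fatou's
  lemma identifies H with the weighted L^p limit.\<close>

lemma approx_eq_potential:
 assumes a: "approx u \<psi>" and H: "\<And>r. 0 < r \<Longrightarrow> DERIV H r :> r powr (1 - n) * prim \<psi> (r powr \<sigma>)"
  and H0: "(H \<longlongrightarrow> 0) (end_filter \<delta>)"
 shows "AE x in lborel. u x = H (norm x)"
proof -
 obtain \<phi> V V' G where um: "u \<in> Borel" and K: "\<And>j. link (\<phi> j) (V j) (V' j) (G j)" and L: "C1c_limit V V' \<psi>"
  and lim: "(\<lambda>j. wdist (\<phi> j) u) \<longlonglongrightarrow> 0"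
  using a unfolding approx_def by blast
 define e where "e = (\<lambda>j. Lp_dist p (V' j) \<psi> powr (1 / p))"
 have e0: "e \<longlonglongrightarrow> 0" unfolding e_def by (rule C1c_limit_dist_tendsto_0[OF L])
 have bd: "\<bar>G j r - H r\<bar> \<le> e j * r powr \<delta> / \<bar>\<delta>\<bar>" if r: "0 < r" for j r
 proof (rule pot_bound[OF nonzero_exponents(2) _ _ _ r])
  fix r :: real assume r: "0 < r"
  show "DERIV (\<lambda>r. G j r - H r) r :> r powr (1 - n) * V j (r powr \<sigma>) - r powr (1 - n) * prim \<psi> (r powr \<sigma>)"
   using K[of j] r by (intro DERIV_diff H) (auto simp: link_def)
  have "\<bar>r powr (1 - n) * V j (r powr \<sigma>) - r powr (1 - n) * prim \<psi> (r powr \<sigma>)\<bar> = r powr (1 - n) * \<bar>V j (r powr \<sigma>) - prim \<psi> (r powr \<sigma>)\<bar>"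
   by (simp add: right_diff_distrib[symmetric] abs_mult)
  also have "\<dots> \<le> r powr (1 - n) * ((r powr \<sigma>) powr \<mu> * e j)"
   unfolding e_def using C1c_limitD(10)[OF L, of "r powr \<sigma>" j] r by (intro mult_left_mono) auto
  also have "\<dots> = e j * r powr (1 - n + \<sigma> * \<mu>)" by (simp add: powr_powr powr_add)
  finally show "\<bar>r powr (1 - n) * V j (r powr \<sigma>) - r powr (1 - n) * prim \<psi> (r powr \<sigma>)\<bar> \<le> e j * r powr (\<delta> - 1)" by (simp only: exponents(1))
 next
  have "((\<lambda>r. G j r - H r) \<longlongrightarrow> 0 - 0) (end_filter \<delta>)" using K[of j] by (intro tendsto_diff H0) (simp add: link_def)
  then show "((\<lambda>r. G j r - H r) \<longlongrightarrow> 0) (end_filter \<delta>)" by simp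
 qed
 have conv: "(\<lambda>j. G j r) \<longlonglongrightarrow> H r" if r: "0 < r" for r
 proof -
  have "(\<lambda>j. e j * r powr \<delta> / \<bar>\<delta>\<bar>) \<longlonglongrightarrow> 0 * r powr \<delta> / \<bar>\<delta>\<bar>" by (intro tendsto_intros e0) (use nonzero_exponents in simp)
  then have "(\<lambda>j. e j * r powr \<delta> / \<bar>\<delta>\<bar>) \<longlonglongrightarrow> 0" by simp
  then have "(\<lambda>j. G j r - H r) \<longlonglongrightarrow> 0"
   by (rule Lim_null_comparison[rotated]) (use bd[OF r] in \<open>auto intro: always_eventually\<close>)
  then show ?thesis by (simp add: LIM_zero_iff)
 qed
 have [measurable]: "\<phi> j \<in> Borel" "u \<in> Borel" "(\<lambda>x::'a. H (norm x)) \<in> Borel" for j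
  by (rule link_Ckc(3)[OF K], rule um, rule radial_borel[OF DERIV_continuous_half_line[OF H]])
 have le: "wdist (\<lambda>x. H (norm x)) u \<le> ennreal \<eta>" if \<eta>: "0 < \<eta>" for \<eta>
 proof -
  obtain N where N: "\<And>j. N \<le> j \<Longrightarrow> (wdist (\<phi> j) u) \<le> ennreal \<eta>"
   using ennreal_tendsto_0D[OF lim \<eta>] unfolding eventually_sequentially by blast
  show ?thesis
  proof (rule nn_integral_Fatou_bound[OF _ _ N])
   show "AE x in lborel. (\<lambda>j. ennreal (norm x powr (\<alpha> - 2 * p) * \<bar>\<phi> j x - u x\<bar> powr p)) \<longlonglongrightarrow> ennreal (norm x powr (\<alpha> - 2 * p) * \<bar>H (norm x) - u x\<bar> powr p)"
   proof (rule AE_I2)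
    fix x :: 'a
    show "(\<lambda>j. ennreal (norm x powr (\<alpha> - 2 * p) * \<bar>\<phi> j x - u x\<bar> powr p)) \<longlonglongrightarrow> ennreal (norm x powr (\<alpha> - 2 * p) * \<bar>H (norm x) - u x\<bar> powr p)"
    proof (cases "x = 0")
     case False
     then have "\<phi> j x = G j (norm x)" for j using K[of j] by (simp add: link_def)
     then have "(\<lambda>j. \<phi> j x) \<longlonglongrightarrow> H (norm x)" using conv[of "norm x"] False by simp
     then show ?thesis using p by (intro tendsto_ennrealI tendsto_mult tendsto_const tendsto_powr2 tendsto_rabs tendsto_diff) auto
    qed simp
   qed
  qed simp_all
 qed
 have "wdist (\<lambda>x. H (norm x)) u \<le> 0"
 proof (rule ennreal_le_epsilon)
  fix e :: real assume "0 < e"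
  from le[OF this] show "wdist (\<lambda>x. H (norm x)) u \<le> 0 + ennreal e" by (simp only: add_0_left)
 qed
 then have "wdist (\<lambda>x. H (norm x)) u = 0" by simp
 then have "AE x::'a in lborel. ennreal (norm x powr (\<alpha> - 2 * p) * \<bar>H (norm x) - u x\<bar> powr p) = 0"
  by (subst (asm) nn_integral_0_iff_AE) auto
 moreover have "AE x::'a in lborel. x \<noteq> 0" by (rule AE_lborel_singleton)
 ultimately show ?thesis by eventually_elim (auto simp: ennreal_eq_0_iff mult_le_0_iff)
qed

end

subsection \<open>Approximation of potentials\<close>

context bliss
begin

lemma bub_le_powr:
 assumes "0 < s" "0 \<le> e" "e \<le> 1"
 shows "bub s \<le> s powr e"
proof (cases "1 \<le> s")
 case True
 then have "1 \<le> s powr e" using assms by (simp add: ge_one_powr_ge_zero)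
 then show ?thesis using bub_le(2)[OF assms(1)] by simp
next
 case False
 then have "s powr 1 \<le> s powr e" using assms by (intro powr_mono') auto
 then show ?thesis using bub_le(1)[OF assms(1)] assms by simp
qed

lemma one_minus_cut_le:
 assumes s: "0 < s"
 shows "1 - cut j s \<le> 2 * \<bar>ln s\<bar> / real (Suc j)"
proof -
 define t where "t = ln s / real (Suc j)"
 have c: "cut j s = (max 0 (1 - t\<^sup>2))\<^sup>2" using s by (simp add: cut_def t_def)
 have "1 - (max 0 (1 - t\<^sup>2))\<^sup>2 \<le> 2 * \<bar>t\<bar>"
 proof (cases "\<bar>t\<bar> \<le> 1")
  case True
  have t2: "t\<^sup>2 \<le> \<bar>t\<bar>" using True mult_left_le[of "\<bar>t\<bar>" "\<bar>t\<bar>"] by (simp add: power2_eq_square)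
  have "t\<^sup>2 \<le> 1" using t2 True by simp
  then have "(max 0 (1 - t\<^sup>2))\<^sup>2 = 1 - 2 * t\<^sup>2 + (t\<^sup>2)\<^sup>2" by (simp add: power2_diff)
  moreover have "0 \<le> (t\<^sup>2)\<^sup>2" by simp
  ultimately show ?thesis using t2 by linarith
 next
  case False
  have "0 \<le> (max 0 (1 - t\<^sup>2))\<^sup>2" by simp
  then show ?thesis using False by linarith
 qed
 then show ?thesis unfolding c by (simp add: t_def)
qed

text \<open>The logarithm that bounds \<open>1 - cut j s\<close> is absorbed by an arbitrarily small
  power at each end.\<close>

lemma abs_ln_mult_min_powr_le:
 fixes s \<eta> :: real
 assumes s: "0 < s" and \<eta>: "0 < \<eta>"
 shows "\<bar>ln s\<bar> * min (s powr \<eta>) (s powr - \<eta>) \<le> 1 / \<eta>"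
proof (cases "1 \<le> s")
 case True
 have "\<bar>ln s\<bar> * min (s powr \<eta>) (s powr - \<eta>) \<le> ln s * s powr - \<eta>"
  using True by (simp add: mult_left_mono)
 also have "\<dots> \<le> (s powr \<eta> / \<eta>) * s powr - \<eta>"
  using ln_powr_bound[OF True \<eta>] by (intro mult_right_mono) auto
 also have "\<dots> = 1 / \<eta>" using s by (simp add: powr_minus)
 finally show ?thesis .
next
 case False
 have "\<bar>ln s\<bar> * min (s powr \<eta>) (s powr - \<eta>) \<le> ln (1 / s) * s powr \<eta>"
  using False s by (simp add: ln_div mult_left_mono)
 also have "\<dots> \<le> ((1 / s) powr \<eta> / \<eta>) * s powr \<eta>"
  using ln_powr_bound[of "1 / s" \<eta>] \<eta> False s by (intro mult_right_mono) auto
 also have "\<dots> = 1 / \<eta>" using s by (simp add: powr_divide)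
 finally show ?thesis .
qed

lemma C1c_scale:
 assumes W: "C1c W W'" and k: "0 < k"
 shows "C1c (\<lambda>s. c * W (k * s)) (\<lambda>s. c * (k * W' (k * s)))"
proof -
 obtain a b where ab: "0 < a" "a < b" and z: "\<And>s. s \<notin> {a..b} \<Longrightarrow> W s = 0"
  and d: "\<And>s. DERIV W s :> W' s" and cW': "continuous_on UNIV W'"
  using C1cE[OF W] by metis
 have "DERIV (\<lambda>s. c * W (k * s)) s :> c * (k * W' (k * s))" for s
 proof -
  have "DERIV (\<lambda>s. W (k * s)) s :> W' (k * s) * (k * 1)"
   by (rule DERIV_chain2[OF d DERIV_cmult[OF DERIV_ident]])
  from DERIV_cmult[OF this, of c] show ?thesis by (simp add: mult.commute)
 qed
 moreover have "continuous_on UNIV (\<lambda>s. c * (k * W' (k * s)))"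
  by (intro continuous_intros continuous_on_compose2[OF cW']) auto
 moreover have "c * W (k * s) = 0" if "s \<notin> {a / k..b / k}" for s
  using that z[of "k * s"] k by (auto simp: field_simps)
 moreover have "0 < a / k" "a / k < b / k" using ab k by (auto simp: divide_strict_right_mono)
 ultimately show ?thesis unfolding C1c_def by blast
qed

lemma C1c_diff:
 assumes V: "C1c V V'" and W: "C1c W W'"
 shows "C1c (\<lambda>s. V s - W s) (\<lambda>s. V' s - W' s)"
proof -
 obtain a b where ab: "0 < a" "a < b" and z: "\<And>s. s \<notin> {a..b} \<Longrightarrow> V s = 0"
  and d: "\<And>s. DERIV V s :> V' s" and c: "continuous_on UNIV V'"
  using C1cE[OF V] by metis
 obtain a' b' where ab': "0 < a'" "a' < b'" and z': "\<And>s. s \<notin> {a'..b'} \<Longrightarrow> W s = 0"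
  and d': "\<And>s. DERIV W s :> W' s" and c': "continuous_on UNIV W'"
  using C1cE[OF W] by metis
 have "V s - W s = 0" if "s \<notin> {min a a'..max b b'}" for s
  using that z[of s] z'[of s] by (auto simp: min_def max_def split: if_splits)
 moreover have "0 < min a a'" "min a a' < max b b'" using ab ab' by auto
 ultimately show ?thesis unfolding C1c_def using DERIV_diff[OF d d'] continuous_on_diff[OF c c'] by blast
qed

end

context rad
begin

text \<open>The weighted p-integral of r powr \<delta> reduces to that of 1 / r and diverges
  logarithmically at both ends. The second factor gains a power \<eta> at each of them and makes the
  envelope integrable (\<open>env_integrable\<close>).\<close>

definition env :: "real \<Rightarrow> real \<Rightarrow> real" where
 "env \<eta> r = r powr \<delta> * min (r powr \<eta>) (r powr - \<eta>)"

lemma env_nonneg: "0 \<le> env \<eta> r" by (simp add: env_def)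

lemma env_integrable:
 assumes \<eta>: "0 < \<eta>"
 shows "integrable lborel (\<lambda>x::'a. norm x powr (\<alpha> - 2 * p) * env \<eta> (norm x) powr p)"
proof -
 define f where "f = (\<lambda>r. r powr (\<alpha> - 2 * p) * (indicator {0<..} r * env \<eta> r powr p))"
 have fm: "f \<in> Borel" unfolding f_def env_def by measurable
 define g where "g = (\<lambda>s::real. s powr (- 1) * min (s powr \<eta>) (s powr - \<eta>) powr p)"
 have 1: "(\<lambda>x::'a. norm x powr (\<alpha> - 2 * p) * env \<eta> (norm x) powr p) = (\<lambda>x. f (norm x powr 1))"
 proof
  fix x :: 'a show "norm x powr (\<alpha> - 2 * p) * env \<eta> (norm x) powr p = f (norm x powr 1)"
   by (cases "x = 0") (simp_all add: f_def)
 qed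
 have 2: "(s powr (DIM('a) / 1 - 1) * indicator {0<..} s) * f s = indicator {0<..} s * g s" for s
 proof (cases "0 < s")
  case True
  have "env \<eta> s powr p = s powr (\<delta> * p) * min (s powr \<eta>) (s powr - \<eta>) powr p"
   using True by (simp add: env_def powr_mult powr_powr)
  moreover have "s powr (n - 1) * s powr (\<alpha> - 2 * p) * s powr (\<delta> * p) = s powr (- 1)"
  proof -
   have e: "n - 1 + (\<alpha> - 2 * p) + \<delta> * p = - 1" using exponents(4) by (simp add: algebra_simps)
   show ?thesis unfolding powr_add[symmetric] e ..
  qed
  ultimately show ?thesis using True by (simp add: f_def g_def n[symmetric] mult.assoc[symmetric])
 qed simp
 have "integrable lborel (\<lambda>s. indicator {0<..} s * g s)"
 proof (rule integrable_powr_bounds[of "\<eta> * p" _ 1])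
  show "0 < \<eta> * p" using \<eta> p by simp
  show "g \<in> Borel" unfolding g_def by measurable
  have a: "\<bar>g s\<bar> \<le> 1 * s powr (e * p - 1)" if "0 < s" "min (s powr \<eta>) (s powr - \<eta>) \<le> s powr e" for s e
  proof -
   have "min (s powr \<eta>) (s powr - \<eta>) powr p \<le> (s powr e) powr p" using that p by (intro powr_mono2) auto
   then have "s powr (- 1) * min (s powr \<eta>) (s powr - \<eta>) powr p \<le> s powr (- 1) * s powr (e * p)"
    by (intro mult_left_mono) (auto simp: powr_powr)
   also have "\<dots> = s powr (- 1 + e * p)" by (rule powr_add[symmetric])
   also have "- 1 + e * p = e * p - 1" by simp
   finally show ?thesis by (simp add: g_def abs_mult)
  qed
  show "\<bar>g s\<bar> \<le> 1 * s powr (\<eta> * p - 1)" if "0 < s" "s \<le> 1" for s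
   by (rule a) (use that in auto)
  show "\<bar>g s\<bar> \<le> 1 * s powr (- (\<eta> * p) - 1)" if "1 \<le> s" for s
   using a[of s "- \<eta>"] that by simp
 qed
 then show ?thesis unfolding 1 by (subst integrable_norm_powr_iff[OF _ fm]) (simp_all only: 2 one_neq_zero not_False_eq_True)
qed

lemma weighted_tendsto_0:
 fixes f :: "nat \<Rightarrow> 'a \<Rightarrow> real"
 assumes \<eta>: "0 < \<eta>" and c: "c \<longlonglongrightarrow> 0" and bd: "\<And>j x. x \<noteq> 0 \<Longrightarrow> \<bar>f j x\<bar> \<le> c j * env \<eta> (norm x)"
 shows "(\<lambda>j. \<integral>\<^sup>+x. ennreal (norm x powr (\<alpha> - 2 * p) * \<bar>f j x\<bar> powr p) \<partial>lborel) \<longlonglongrightarrow> 0"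
proof (rule ennreal_tendsto_0_bound)
 define B where "B = (LINT (x::'a)|lborel. norm x powr (\<alpha> - 2 * p) * env \<eta> (norm x) powr p)"
 have "(\<lambda>j. \<bar>c j\<bar> powr p * B) \<longlonglongrightarrow> \<bar>0\<bar> powr p * B"
  using p by (intro tendsto_mult tendsto_const tendsto_powr2 tendsto_rabs c) auto
 then have "(\<lambda>j. ennreal (\<bar>c j\<bar> powr p * B)) \<longlonglongrightarrow> ennreal (\<bar>0\<bar> powr p * B)" by (rule tendsto_ennrealI)
 then show "(\<lambda>j. ennreal (\<bar>c j\<bar> powr p * B)) \<longlonglongrightarrow> 0" by simp
 fix j
 have "(\<integral>\<^sup>+x. ennreal (norm x powr (\<alpha> - 2 * p) * \<bar>f j x\<bar> powr p) \<partial>lborel) \<le>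
   (\<integral>\<^sup>+(x::'a). ennreal (\<bar>c j\<bar> powr p * (norm x powr (\<alpha> - 2 * p) * env \<eta> (norm x) powr p)) \<partial>lborel)"
 proof (rule nn_integral_mono, rule ennreal_leI)
  fix x :: 'a
  show "norm x powr (\<alpha> - 2 * p) * \<bar>f j x\<bar> powr p \<le> \<bar>c j\<bar> powr p * (norm x powr (\<alpha> - 2 * p) * env \<eta> (norm x) powr p)"
  proof (cases "x = 0")
   case False
   have "\<bar>f j x\<bar> \<le> \<bar>c j\<bar> * env \<eta> (norm x)"
    using bd[OF False, of j] mult_right_mono[OF abs_ge_self env_nonneg, of "c j" \<eta> "norm x"] by linarith
   then have "\<bar>f j x\<bar> powr p \<le> (\<bar>c j\<bar> * env \<eta> (norm x)) powr p" using p by (intro powr_mono2) auto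
   also have "\<dots> = \<bar>c j\<bar> powr p * env \<eta> (norm x) powr p" using env_nonneg by (simp add: powr_mult)
   finally have "norm x powr (\<alpha> - 2 * p) * \<bar>f j x\<bar> powr p \<le> norm x powr (\<alpha> - 2 * p) * (\<bar>c j\<bar> powr p * env \<eta> (norm x) powr p)"
    by (rule mult_left_mono) simp
   then show ?thesis by (simp only: mult.left_commute)
  qed simp
 qed
 also have "\<dots> = ennreal (LINT (x::'a)|lborel. \<bar>c j\<bar> powr p * (norm x powr (\<alpha> - 2 * p) * env \<eta> (norm x) powr p))"
  by (intro nn_integral_eq_integral integrable_mult_right env_integrable[OF \<eta>]) auto
 also have "\<dots> = ennreal (\<bar>c j\<bar> powr p * B)" by (simp add: B_def)
 finally show "(\<integral>\<^sup>+x. ennreal (norm x powr (\<alpha> - 2 * p) * \<bar>f j x\<bar> powr p) \<partial>lborel) \<le> ennreal (\<bar>c j\<bar> powr p * B)" .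
qed

text \<open>\<open>pot_bound\<close> with the exponents \<delta> + \<eta> and \<delta> - \<eta>; for
  \<eta> < |\<delta>| both have the sign of \<delta> and hence the same end of the
  half-line.\<close>

lemma pot_env_bound:
 assumes \<eta>: "0 < \<eta>" "\<eta> < \<bar>\<delta>\<bar>" and g: "\<And>r. 0 < r \<Longrightarrow> DERIV g r :> g' r"
  and bd: "\<And>r. 0 < r \<Longrightarrow> \<bar>g' r\<bar> \<le> C * (r powr (\<delta> - 1) * min (r powr \<eta>) (r powr - \<eta>))"
  and lim: "(g \<longlongrightarrow> 0) (end_filter \<delta>)" and r: "0 < r"
 shows "\<bar>g r\<bar> \<le> C / (\<bar>\<delta>\<bar> - \<eta>) * env \<eta> r"
proof -
 have C: "0 \<le> C" using order_trans[OF abs_ge_zero bd[of 1]] by simp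
 have 1: "\<bar>g r\<bar> \<le> C / (\<bar>\<delta>\<bar> - \<eta>) * (r powr \<delta> * r powr e)" if e: "\<bar>e\<bar> = \<eta>" for e
 proof -
  have d: "\<delta> + e \<noteq> 0" "end_filter (\<delta> + e) = end_filter \<delta>" "\<bar>\<delta>\<bar> - \<eta> \<le> \<bar>\<delta> + e\<bar>" "0 < \<bar>\<delta>\<bar> - \<eta>"
   using e \<eta> by (auto simp: end_filter_def abs_if split: if_splits)
  have "\<bar>g r\<bar> \<le> C * r powr (\<delta> + e) / \<bar>\<delta> + e\<bar>"
  proof (rule pot_bound[OF d(1) g _ _ r])
   fix t :: real assume t: "0 < t"
   have "min (t powr \<eta>) (t powr - \<eta>) \<le> t powr e" using e by (cases "0 \<le> e") auto
   then have "C * (t powr (\<delta> - 1) * min (t powr \<eta>) (t powr - \<eta>)) \<le> C * (t powr (\<delta> - 1) * t powr e)"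
    by (intro mult_left_mono C) auto
   also have "\<dots> = C * t powr (\<delta> + e - 1)" by (simp add: powr_add[symmetric] algebra_simps)
   finally show "\<bar>g' t\<bar> \<le> C * t powr (\<delta> + e - 1)" using bd[OF t] by linarith
  qed (use lim d in simp_all)
  also have "\<dots> \<le> C * r powr (\<delta> + e) / (\<bar>\<delta>\<bar> - \<eta>)" using C d by (intro divide_left_mono) auto
  finally show ?thesis by (simp add: powr_add)
 qed
 show ?thesis using 1[of \<eta>] 1[of "- \<eta>"] \<eta> by (cases "r powr \<eta> \<le> r powr - \<eta>") (simp_all add: env_def)
qed

text \<open>H is constant near 0 and near infinity, and only one of these constants is forced to be
  0. In H(r) - H(r / \<epsilon>) both cancel. The dilated copy is negligible by scaling: its energy
  carries the factor \<epsilon> powr (- (p * \<delta>)), which tends to 0 when \<epsilon> goes to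
  infinity for \<delta> > 0 and to 0 for \<delta> < 0.\<close>

lemma C1c_potential_approx:
 assumes W: "C1c W W'" and H: "\<And>r. 0 < r \<Longrightarrow> DERIV H r :> r powr (1 - n) * W (r powr \<sigma>)"
  and H0: "(H \<longlongrightarrow> 0) (end_filter \<delta>)"
 shows "approx (\<lambda>x. H (norm x)) W'"
proof -
 obtain a b where ab: "0 < a" "a < b" and Wz: "\<And>s. s \<notin> {a..b} \<Longrightarrow> W s = 0" "\<And>s. s \<notin> {a..b} \<Longrightarrow> W' s = 0"
  and dW: "\<And>s. DERIV W s :> W' s" and cW': "continuous_on UNIV W'" and cW: "continuous_on UNIV W"
  using C1cE[OF W] by metis
 define r0 where "r0 = min (a powr (1 / \<sigma>)) (b powr (1 / \<sigma>))"
 define r1 where "r1 = max (a powr (1 / \<sigma>)) (b powr (1 / \<sigma>))"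
 have r01: "0 < r0" "r0 \<le> r1" using ab by (auto simp: r0_def r1_def)
 have out: "r powr \<sigma> \<notin> {a..b}" if r: "0 < r" "r \<notin> {r0..r1}" for r
  by (rule powr_notin_Icc) (use r nonzero_exponents ab in \<open>auto simp: r0_def r1_def\<close>)
 have Hz: "DERIV H r :> 0" if "0 < r" "r \<notin> {r0..r1}" for r
  using H[OF that(1)] Wz(1)[OF out[OF that]] by simp
 have "\<exists>c. \<forall>r\<in>{0<..<r0}. H r = c"
  by (rule has_field_derivative_zero_constant) (auto intro!: has_field_derivative_at_within[OF Hz])
 then obtain c0 where c0: "\<And>r. 0 < r \<Longrightarrow> r < r0 \<Longrightarrow> H r = c0" by auto
 have "\<exists>c. \<forall>r\<in>{r1<..}. H r = c"
  by (rule has_field_derivative_zero_constant) (use r01 in \<open>auto intro!: has_field_derivative_at_within[OF Hz]\<close>)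
 then obtain c1 where c1: "\<And>r. r1 < r \<Longrightarrow> H r = c1" by auto
 \<comment> \<open>The exponent sgn \<delta> moves the copy towards the end opposite to
   \<open>end_filter \<delta>\<close>, so that \<epsilon> powr (- \<delta>) is a negative power of j
   + 1 in both cases.\<close>
 define \<epsilon> where "\<epsilon> j = real (Suc j) powr sgn \<delta>" for j
 have \<epsilon>: "0 < \<epsilon> j" "1 / real (Suc j) \<le> \<epsilon> j" "\<epsilon> j \<le> real (Suc j)" for j
 proof -
  show "0 < \<epsilon> j" by (simp add: \<epsilon>_def)
  have "1 / real (Suc j) \<le> real (Suc j)" by (simp add: divide_le_eq) (metis le_add1 mult_ge1_I of_nat_0_le_iff le_add_same_cancel1)
  then show "1 / real (Suc j) \<le> \<epsilon> j" "\<epsilon> j \<le> real (Suc j)"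
   using nonzero_exponents(2) by (auto simp: \<epsilon>_def sgn_if powr_minus_divide)
 qed
 have \<epsilon>\<delta>: "\<epsilon> j powr (- (t * \<delta>)) = real (Suc j) powr (- (t * \<bar>\<delta>\<bar>))" for j t
  by (simp add: \<epsilon>_def powr_powr sgn_if)
 define k where "k j = \<epsilon> j powr (- \<sigma>)" for j
 have k: "0 < k j" "(r / \<epsilon> j) powr \<sigma> = k j * r powr \<sigma>" if "0 < r" for j r
  using \<epsilon>(1)[of j] that by (simp_all add: k_def powr_divide powr_minus_divide)
 define G where "G j r = H r - H (r / \<epsilon> j)" for j r
 define \<phi> where "\<phi> j x = (if x = 0 then 0 else G j (norm x))" for j and x :: 'a
 define V where "V j s = W s - \<epsilon> j powr (n - 2) * W (k j * s)" for j s
 define V' where "V' j s = W' s - \<epsilon> j powr (n - 2) * (k j * W' (k j * s))" for j s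
 have k0: "0 < k j" for j using k(1)[of 1] by simp
 have CV: "C1c (V j) (V' j)" for j
  unfolding V_def[abs_def] V'_def[abs_def] by (rule C1c_diff[OF W C1c_scale[OF W k0]])
 have dV: "DERIV (V j) s :> V' j s" for j s using CV[of j] by (auto elim: C1cE)
 have cV: "continuous_on UNIV (V j)" and cV': "continuous_on UNIV (V' j)" for j using CV[of j] by (auto elim: C1cE)
 have dG: "DERIV (G j) r :> r powr (1 - n) * V j (r powr \<sigma>)" if r: "0 < r" for j r
 proof -
  have "0 < r / \<epsilon> j" using r \<epsilon>(1)[of j] by simp
  from DERIV_chain2[OF H[OF this] DERIV_cdivide[OF DERIV_ident]]
  have "DERIV (\<lambda>r. H (r / \<epsilon> j)) r :> (r / \<epsilon> j) powr (1 - n) * W (k j * r powr \<sigma>) * (1 / \<epsilon> j)"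
   unfolding k(2)[OF r] .
  moreover have "(r / \<epsilon> j) powr (1 - n) * (1 / \<epsilon> j) = r powr (1 - n) * \<epsilon> j powr (n - 2)"
  proof -
   have "(r / \<epsilon> j) powr (1 - n) = r powr (1 - n) * \<epsilon> j powr (n - 1)"
    using r \<epsilon>(1)[of j] powr_minus_divide[of "\<epsilon> j" "1 - n"] by (simp add: powr_divide)
   moreover have "\<epsilon> j powr (n - 1) * (1 / \<epsilon> j) = \<epsilon> j powr (n - 2)"
    using \<epsilon>(1)[of j] powr_diff[of "\<epsilon> j" "n - 1" 1] by simp
   ultimately show ?thesis by (metis mult.assoc)
  qed
  then have "(r / \<epsilon> j) powr (1 - n) * W (k j * r powr \<sigma>) * (1 / \<epsilon> j) = r powr (1 - n) * (\<epsilon> j powr (n - 2) * W (k j * r powr \<sigma>))"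
   by (metis mult.assoc mult.commute)
  ultimately have "DERIV (\<lambda>r. H (r / \<epsilon> j)) r :> r powr (1 - n) * (\<epsilon> j powr (n - 2) * W (k j * r powr \<sigma>))"
   by (simp only:)
  from DERIV_diff[OF H[OF r] this] show ?thesis by (simp add: G_def[abs_def] V_def right_diff_distrib)
 qed
 define A where "A j = min r0 (\<epsilon> j * r0)" for j
 define B where "B j = max r1 (\<epsilon> j * r1) + 1" for j
 have AB: "0 < A j" "A j < B j" for j using r01 \<epsilon>(1)[of j] by (auto simp: A_def B_def)
 have Gz: "G j r = 0 \<and> V j (r powr \<sigma>) = 0 \<and> V' j (r powr \<sigma>) = 0" if r: "0 < r" "r \<notin> {A j..B j}" for j r
 proof -
  have re: "0 < r / \<epsilon> j" using r \<epsilon>(1)[of j] by simp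
  have c: "(r < r0 \<and> r / \<epsilon> j < r0) \<or> (r1 < r \<and> r1 < r / \<epsilon> j)"
   using r(2) \<epsilon>(1)[of j] by (auto simp: A_def B_def field_simps)
  have "G j r = 0" using c c0[OF r(1)] c0[OF re] c1[of r] c1[of "r / \<epsilon> j"] by (auto simp: G_def)
  moreover have "r powr \<sigma> \<notin> {a..b}" using c by (intro out r) auto
  moreover have "k j * r powr \<sigma> \<notin> {a..b}" unfolding k(2)[OF r(1), symmetric] using c by (intro out re) auto
  ultimately show ?thesis using Wz by (simp add: V_def V'_def)
 qed
 have \<phi>C: "\<phi> j \<in> Ckcr 2" for j
 proof (rule radial_Ckcr_2[OF AB, of _ "G j" "\<lambda>r. r powr (1 - n) * V j (r powr \<sigma>)"
   "\<lambda>r. \<sigma> * r powr (\<sigma> - n) * V' j (r powr \<sigma>) - (n - 1) / r * (r powr (1 - n) * V j (r powr \<sigma>))"])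
  show "continuous_on {0<..} (\<lambda>r. \<sigma> * r powr (\<sigma> - n) * V' j (r powr \<sigma>) - (n - 1) / r * (r powr (1 - n) * V j (r powr \<sigma>)))"
   by (intro continuous_intros continuous_on_compose2[OF cV] continuous_on_compose2[OF cV']) auto
  show "DERIV (\<lambda>r. r powr (1 - n) * V j (r powr \<sigma>)) r :>
    \<sigma> * r powr (\<sigma> - n) * V' j (r powr \<sigma>) - (n - 1) / r * (r powr (1 - n) * V j (r powr \<sigma>))" if "0 < r" for r
   by (rule flux_has_real_derivative[OF that dV])
 qed (use dG Gz in \<open>auto simp: \<phi>_def\<close>)
 have G0: "(G j \<longlongrightarrow> 0) (end_filter \<delta>)" for j by (rule tendsto_end_filter_0[OF AB(1)]) (use Gz in blast)
 have K: "link (\<phi> j) (V j) (V' j) (G j)" for j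
  using \<phi>C[of j] CV[of j] G0[of j] dG[of _ j] by (simp add: link_def \<phi>_def)
 have N0: "(\<lambda>j. real (Suc j) powr (- t)) \<longlonglongrightarrow> 0" if "0 < t" for t
  by (rule tendsto_neg_powr) (use that filterlim_compose[OF filterlim_real_sequentially filterlim_Suc] in auto)
 have L: "C1c_limit V V' W'"
  unfolding C1c_limit_def
 proof (intro conjI allI impI)
  show "C1c (V j) (V' j)" for j by (rule CV)
  show "W' \<in> Borel" by (rule C1c_eq_prim(2)[OF W])
  show "W' s = 0" if "s \<le> 0" for s by (rule C1c_eq_prim(3)[OF W that])
  show "integrable lborel (\<lambda>s. \<bar>W' s\<bar> powr p)" by (rule C1c_integrable(1)[OF W])
  define E where "E = Lp_int p W'"
  have "Lp_dist p (V' j) W' = real (Suc j) powr (- (p * \<bar>\<delta>\<bar>)) * E" for j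
  proof -
   have k0: "0 < k j" using k(1)[of 1] by simp
   have e: "E = k j * (LINT s|lborel. \<bar>W' (k j * s)\<bar> powr p)"
    unfolding E_def using lborel_integral_real_affine[of "k j" "\<lambda>s. \<bar>W' s\<bar> powr p" 0] k0 by simp
   have "\<bar>V' j s - W' s\<bar> powr p = (\<epsilon> j powr (n - 2) * k j) powr p * \<bar>W' (k j * s)\<bar> powr p" for s
    using k0 by (simp add: V'_def abs_mult powr_mult)
   then have "Lp_dist p (V' j) W' = (\<epsilon> j powr (n - 2) * k j) powr p * (LINT s|lborel. \<bar>W' (k j * s)\<bar> powr p)" by simp
   also have "\<dots> = (\<epsilon> j powr (n - 2) * k j) powr p / k j * E" unfolding e using k0 by simp
   also have "(\<epsilon> j powr (n - 2) * k j) powr p / k j = \<epsilon> j powr (p * (n - 2 - \<sigma>) + \<sigma>)"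
   proof -
    have "\<epsilon> j powr (n - 2) * k j = \<epsilon> j powr (n - 2 - \<sigma>)" by (simp add: k_def powr_add[symmetric])
    moreover have "1 / k j = \<epsilon> j powr \<sigma>" using \<epsilon>(1)[of j] by (simp add: k_def powr_minus_divide)
    ultimately have "(\<epsilon> j powr (n - 2) * k j) powr p * (1 / k j) = \<epsilon> j powr (p * (n - 2 - \<sigma>)) * \<epsilon> j powr \<sigma>"
     by (simp add: powr_powr mult.commute)
    then show ?thesis by (simp add: powr_add)
   qed
   also have "\<dots> = real (Suc j) powr (- (p * \<bar>\<delta>\<bar>))" unfolding exponents(5) by (rule \<epsilon>\<delta>)
   finally show ?thesis .
  qed
  moreover have "(\<lambda>j. real (Suc j) powr (- (p * \<bar>\<delta>\<bar>)) * E) \<longlonglongrightarrow> 0 * E"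
   using p nonzero_exponents by (intro tendsto_mult tendsto_const N0) auto
  ultimately show "(\<lambda>j. Lp_dist p (V' j) W') \<longlonglongrightarrow> 0" by simp
 qed
 \<comment> \<open>Dilating the envelope loses N powr \<eta> and gains N powr (- |\<delta>|), where
   N = j + 1; half of |\<delta>| leaves the decay N powr (- \<eta>).\<close>
 define \<eta> where "\<eta> = \<bar>\<delta>\<bar> / 2"
 have \<eta>: "0 < \<eta>" "\<eta> < \<bar>\<delta>\<bar>" using nonzero_exponents by (auto simp: \<eta>_def)
 define w where "w r = r powr (\<delta> - 1) * min (r powr \<eta>) (r powr - \<eta>)" for r
 have "continuous_on {r0..r1} (\<lambda>r. r powr (1 - n) * W (r powr \<sigma>) / w r)"
  unfolding w_def using r01 by (intro continuous_intros continuous_on_compose2[OF cW]) (auto simp: min_def)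
 then have "bounded ((\<lambda>r. r powr (1 - n) * W (r powr \<sigma>) / w r) ` {r0..r1})"
  by (intro compact_imp_bounded compact_continuous_image) auto
 then obtain C where C: "0 < C" "\<And>r. r \<in> {r0..r1} \<Longrightarrow> \<bar>r powr (1 - n) * W (r powr \<sigma>) / w r\<bar> \<le> C"
  by (auto simp: bounded_pos)
 have Hb: "\<bar>H r\<bar> \<le> C / (\<bar>\<delta>\<bar> - \<eta>) * env \<eta> r" if "0 < r" for r
 proof (rule pot_env_bound[OF \<eta> H _ H0 that])
  fix r :: real assume r: "0 < r"
  have w: "0 < w r" using r by (simp add: w_def)
  show "\<bar>r powr (1 - n) * W (r powr \<sigma>)\<bar> \<le> C * (r powr (\<delta> - 1) * min (r powr \<eta>) (r powr - \<eta>))"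
   unfolding w_def[symmetric]
  proof (cases "r \<in> {r0..r1}")
   case True
   then show "\<bar>r powr (1 - n) * W (r powr \<sigma>)\<bar> \<le> C * w r" using C(2)[OF True] w by (simp add: abs_mult divide_le_eq)
  next
   case False
   then show "\<bar>r powr (1 - n) * W (r powr \<sigma>)\<bar> \<le> C * w r" using Wz(1)[OF out[OF r False]] C(1) w by simp
  qed
 qed
 define c where "c j = C / (\<bar>\<delta>\<bar> - \<eta>) * real (Suc j) powr (- \<eta>)" for j
 have lim: "(\<lambda>j. wdist (\<phi> j) (\<lambda>x. H (norm x))) \<longlonglongrightarrow> 0"
 proof (rule weighted_tendsto_0[OF \<eta>(1), of c])
  have "(\<lambda>j. C / (\<bar>\<delta>\<bar> - \<eta>) * real (Suc j) powr (- \<eta>)) \<longlonglongrightarrow> C / (\<bar>\<delta>\<bar> - \<eta>) * 0"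
   by (intro tendsto_mult tendsto_const N0 \<eta>)
  then show "c \<longlonglongrightarrow> 0" by (simp add: c_def[abs_def])
  fix j and x :: 'a assume x: "x \<noteq> 0"
  define r where "r = norm x"
  have r: "0 < r" using x by (simp add: r_def)
  define N where "N = real (Suc j)"
  have N: "1 \<le> N" "\<epsilon> j \<le> N" "1 / \<epsilon> j \<le> N" using \<epsilon>[of j] by (auto simp: N_def field_simps)
  have m1: "(r / \<epsilon> j) powr \<eta> \<le> N powr \<eta> * r powr \<eta>"
  proof -
   have "(1 / \<epsilon> j) powr \<eta> \<le> N powr \<eta>" using N \<eta> \<epsilon>(1)[of j] by (intro powr_mono2) auto
   moreover have "(r / \<epsilon> j) powr \<eta> = (1 / \<epsilon> j) powr \<eta> * r powr \<eta>" using r \<epsilon>(1)[of j] by (simp add: powr_divide)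
   ultimately show ?thesis by (simp add: mult_right_mono)
  qed
  have m2: "(r / \<epsilon> j) powr - \<eta> \<le> N powr \<eta> * r powr - \<eta>"
  proof -
   have "\<epsilon> j powr \<eta> \<le> N powr \<eta>" using N \<eta> \<epsilon>(1)[of j] by (intro powr_mono2) auto
   moreover have "(r / \<epsilon> j) powr - \<eta> = \<epsilon> j powr \<eta> * r powr - \<eta>" using r \<epsilon>(1)[of j] by (simp add: powr_divide powr_minus_divide)
   ultimately show ?thesis by (simp add: mult_right_mono)
  qed
  have "env \<eta> (r / \<epsilon> j) \<le> (r / \<epsilon> j) powr \<delta> * (N powr \<eta> * min (r powr \<eta>) (r powr - \<eta>))"
   unfolding env_def by (rule mult_left_mono) (use m1 m2 in \<open>auto simp: min_def mult_left_mono\<close>)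
  also have "(r / \<epsilon> j) powr \<delta> = N powr (- \<bar>\<delta>\<bar>) * r powr \<delta>"
   using \<epsilon>\<delta>[of j 1] r \<epsilon>(1)[of j] by (simp add: powr_divide powr_minus_divide N_def)
  also have "N powr (- \<bar>\<delta>\<bar>) * r powr \<delta> * (N powr \<eta> * min (r powr \<eta>) (r powr - \<eta>)) = (N powr (- \<bar>\<delta>\<bar>) * N powr \<eta>) * env \<eta> r"
   by (simp add: env_def)
  also have "N powr (- \<bar>\<delta>\<bar>) * N powr \<eta> = N powr (- \<eta>)"
  proof -
   have e: "- \<bar>\<delta>\<bar> + \<eta> = - \<eta>" by (simp add: \<eta>_def)
   show ?thesis unfolding powr_add[symmetric] e ..
  qed
  finally have "C / (\<bar>\<delta>\<bar> - \<eta>) * env \<eta> (r / \<epsilon> j) \<le> C / (\<bar>\<delta>\<bar> - \<eta>) * (N powr (- \<eta>) * env \<eta> r)"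
   using C \<eta> by (intro mult_left_mono) auto
  moreover have "\<bar>\<phi> j x - H (norm x)\<bar> = \<bar>H (r / \<epsilon> j)\<bar>" using x by (simp add: \<phi>_def G_def r_def)
  moreover have "\<bar>H (r / \<epsilon> j)\<bar> \<le> C / (\<bar>\<delta>\<bar> - \<eta>) * env \<eta> (r / \<epsilon> j)" using r \<epsilon>(1)[of j] by (intro Hb) simp
  ultimately show "\<bar>\<phi> j x - H (norm x)\<bar> \<le> c j * env \<eta> (norm x)" by (simp add: c_def N_def r_def)
 qed
 have "(\<lambda>x::'a. H (norm x)) \<in> Borel"
  by (rule radial_borel[OF DERIV_continuous_half_line[OF H]])
 then show ?thesis unfolding approx_def using K L lim by blast
qed

definition bubk :: "real \<Rightarrow> real" where "bubk r = r powr (1 - n) * bub (r powr \<sigma>)"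

lemma bubk_continuous: "continuous_on {0<..} bubk"
proof -
 have "continuous_on {0<..} bub" by (rule DERIV_continuous_half_line[OF bub_has_real_derivative])
 then show ?thesis unfolding bubk_def[abs_def] by (intro continuous_intros continuous_on_compose2[where f = "\<lambda>r. r powr \<sigma>" and s = "{0<..}" and t = "{0<..}" and g = bub]) auto
qed

lemma powr_\<mu>_le: "0 \<le> w \<Longrightarrow> w \<le> (r powr \<sigma>) powr \<mu> * t \<Longrightarrow> r powr (1 - n) * w \<le> t * r powr (\<delta> - 1)"
proof -
 assume "w \<le> (r powr \<sigma>) powr \<mu> * t"
 then have "r powr (1 - n) * w \<le> r powr (1 - n) * ((r powr \<sigma>) powr \<mu> * t)" by (rule mult_left_mono) simp
 also have "\<dots> = t * r powr (1 - n + \<sigma> * \<mu>)" by (simp add: powr_powr powr_add)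
 finally show ?thesis by (simp only: exponents(1))
qed

lemma bubk_bound: "0 < r \<Longrightarrow> \<bar>bubk r\<bar> \<le> 1 * r powr (\<delta> - 1)"
 using powr_\<mu>_le[of "bub (r powr \<sigma>)" r 1] bub_le_powr[of "r powr \<sigma>" \<mu>] \<mu>(1,2) bub_pos[of "r powr \<sigma>"]
 by (simp add: bubk_def abs_mult)

text \<open>The extremal function is cut off on the half-line, where
  \<open>C1c_potential_approx\<close> applies, and \<open>approx_closure\<close> removes the
  cut-off. Convergence of the potentials in weighted L^p requires more than bub \<le> s powr \<mu>:
  the bounds with exponents \<mu> + 2 \<eta> and \<mu> - 2 \<eta> yield two factors min (s powr
  \<eta>) (s powr - \<eta>), one to absorb the logarithm in \<open>one_minus_cut_le\<close> and one
  to form the envelope.\<close>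

lemma bub_potential_approx: "approx (\<lambda>x. pot \<delta> bubk (norm x)) bubd"
proof -
 define kc where "kc j r = r powr (1 - n) * bubc j (r powr \<sigma>)" for j r
 have cb: "0 \<le> bubc j s" "bubc j s \<le> bub s" if "0 < s" for j s
  using bub_pos[OF that] cut_bounds[of j s] by (auto simp: bubc_def mult_left_le)
 have kcc: "continuous_on {0<..} (kc j)" for j
 proof -
  have "continuous_on UNIV (bubc j)" using C1c_bubc[of j] by (auto elim: C1cE)
  then show ?thesis unfolding kc_def[abs_def]
   by (intro continuous_intros continuous_on_compose2[where f = "\<lambda>r. r powr \<sigma>" and s = "{0<..}" and t = UNIV and g = "bubc j"]) auto
 qed
 have kcb: "\<bar>kc j r\<bar> \<le> 1 * r powr (\<delta> - 1)" if r: "0 < r" for j r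
 proof -
  have "\<bar>kc j r\<bar> \<le> \<bar>bubk r\<bar>" using cb[of "r powr \<sigma>" j] r by (simp add: kc_def bubk_def abs_mult mult_left_mono)
  then show ?thesis using bubk_bound[OF r] by linarith
 qed
 note D = pot_has_real_derivative[OF nonzero_exponents(2)] and Z = pot_tendsto_0[OF nonzero_exponents(2)]
 have a: "approx (\<lambda>x. pot \<delta> (kc j) (norm x)) (bubc' j)" for j
 proof (rule C1c_potential_approx[OF C1c_bubc])
  show "DERIV (pot \<delta> (kc j)) r :> r powr (1 - n) * bubc j (r powr \<sigma>)" if "0 < r" for r
   using D[OF kcc kcb that, of j] unfolding kc_def[of j r] .
  show "(pot \<delta> (kc j) \<longlongrightarrow> 0) (end_filter \<delta>)" by (rule Z[OF kcc kcb])
 qed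
 \<comment> \<open>The first bound keeps \<mu> - 2 \<eta> and \<mu> + 2 \<eta> in the range of
   \<open>bub_le_powr\<close>, the second keeps |\<sigma>| * \<eta> below |\<delta>| for
   \<open>pot_env_bound\<close>.\<close>
 define \<eta> where "\<eta> = min (min \<mu> (1 - \<mu>) / 2) (\<bar>\<delta>\<bar> / (2 * \<bar>\<sigma>\<bar>))"
 have \<eta>: "0 < \<eta>" "0 \<le> \<mu> - 2 * \<eta>" "\<mu> + 2 * \<eta> \<le> 1" using \<mu>(1,2) nonzero_exponents by (auto simp: \<eta>_def min_def)
 have "\<bar>\<sigma>\<bar> * \<eta> \<le> \<bar>\<sigma>\<bar> * (\<bar>\<delta>\<bar> / (2 * \<bar>\<sigma>\<bar>))" by (rule mult_left_mono) (auto simp: \<eta>_def)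
 also have "\<dots> < \<bar>\<delta>\<bar>" using nonzero_exponents by simp
 finally have \<eta>': "0 < \<bar>\<sigma>\<bar> * \<eta>" "\<bar>\<sigma>\<bar> * \<eta> < \<bar>\<delta>\<bar>" using \<eta> nonzero_exponents by auto
 define C where "C j = 2 / (\<eta> * real (Suc j))" for j
 have gb: "bub s * (1 - cut j s) \<le> s powr \<mu> * (C j * min (s powr \<eta>) (s powr - \<eta>))" if s: "0 < s" for j s
 proof -
  let ?m = "min (s powr \<eta>) (s powr - \<eta>)"
  have "bub s \<le> s powr (\<mu> + 2 * \<eta>)" by (rule bub_le_powr[OF s]) (use \<eta> \<mu>(1,2) in auto)
  moreover have "bub s \<le> s powr (\<mu> - 2 * \<eta>)" by (rule bub_le_powr[OF s]) (use \<eta> \<mu>(1,2) in auto)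
  moreover have "s powr (\<mu> + 2 * \<eta>) = s powr \<mu> * (s powr \<eta> * s powr \<eta>)" "s powr (\<mu> - 2 * \<eta>) = s powr \<mu> * (s powr - \<eta> * s powr - \<eta>)"
   by (simp_all add: powr_add[symmetric])
  ultimately have 1: "bub s \<le> s powr \<mu> * (?m * ?m)" by (auto simp: min_def)
  have "bub s * (1 - cut j s) \<le> (s powr \<mu> * (?m * ?m)) * (2 * \<bar>ln s\<bar> / real (Suc j))"
   using 1 one_minus_cut_le[OF s, of j] cut_bounds[of j s] bub_pos[OF s] by (intro mult_mono) auto
  also have "\<dots> = s powr \<mu> * (2 / real (Suc j) * ?m * (\<bar>ln s\<bar> * ?m))" by simp
  also have "\<dots> \<le> s powr \<mu> * (2 / real (Suc j) * ?m * (1 / \<eta>))"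
   by (intro mult_left_mono abs_ln_mult_min_powr_le s \<eta>) auto
  finally show ?thesis by (simp add: C_def mult.commute)
 qed
 have mr: "min ((r powr \<sigma>) powr \<eta>) ((r powr \<sigma>) powr - \<eta>) = min (r powr (\<bar>\<sigma>\<bar> * \<eta>)) (r powr - (\<bar>\<sigma>\<bar> * \<eta>))" for r :: real
  by (cases "0 \<le> \<sigma>") (simp_all add: powr_powr min.commute)
 show ?thesis
 proof (rule approx_closure[OF a bubd_borel bubd_zero bubd_integrable C1c_limitD(5)[OF bubc_limit]])
  show "(\<lambda>x::'a. pot \<delta> bubk (norm x)) \<in> Borel"
   by (rule radial_borel[OF DERIV_continuous_half_line[OF D[OF bubk_continuous bubk_bound]]])
  show "(\<lambda>j. \<integral>\<^sup>+x. ennreal (norm (x::'a) powr (\<alpha> - 2 * p) * \<bar>pot \<delta> (kc j) (norm x) - pot \<delta> bubk (norm x)\<bar> powr p) \<partial>lborel) \<longlonglongrightarrow> 0"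
  proof (rule weighted_tendsto_0[OF \<eta>'(1), of "\<lambda>j. C j / (\<bar>\<delta>\<bar> - \<bar>\<sigma>\<bar> * \<eta>)"])
   have "(\<lambda>j. 2 / \<eta> * inverse (real (Suc j)) / (\<bar>\<delta>\<bar> - \<bar>\<sigma>\<bar> * \<eta>)) \<longlonglongrightarrow> 2 / \<eta> * 0 / (\<bar>\<delta>\<bar> - \<bar>\<sigma>\<bar> * \<eta>)"
    by (intro tendsto_intros LIMSEQ_inverse_real_of_nat) (use \<eta>' in auto)
   then show "(\<lambda>j. C j / (\<bar>\<delta>\<bar> - \<bar>\<sigma>\<bar> * \<eta>)) \<longlonglongrightarrow> 0" by (simp add: C_def divide_inverse mult.assoc)
   fix j and x :: 'a assume x: "x \<noteq> 0"
   show "\<bar>pot \<delta> (kc j) (norm x) - pot \<delta> bubk (norm x)\<bar> \<le> C j / (\<bar>\<delta>\<bar> - \<bar>\<sigma>\<bar> * \<eta>) * env (\<bar>\<sigma>\<bar> * \<eta>) (norm x)"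
   proof (rule pot_env_bound[OF \<eta>', of "\<lambda>r. pot \<delta> (kc j) r - pot \<delta> bubk r" "\<lambda>r. kc j r - bubk r"])
    show "0 < norm x" using x by simp
    show "DERIV (\<lambda>r. pot \<delta> (kc j) r - pot \<delta> bubk r) r :> kc j r - bubk r" if "0 < r" for r
     by (intro DERIV_diff D[OF kcc kcb that] D[OF bubk_continuous bubk_bound that])
    have "((\<lambda>r. pot \<delta> (kc j) r - pot \<delta> bubk r) \<longlongrightarrow> 0 - 0) (end_filter \<delta>)"
     by (intro tendsto_diff Z[OF kcc kcb] Z[OF bubk_continuous bubk_bound])
    then show "((\<lambda>r. pot \<delta> (kc j) r - pot \<delta> bubk r) \<longlongrightarrow> 0) (end_filter \<delta>)" by simp
    fix r :: real assume r: "0 < r"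
    then have s: "0 < r powr \<sigma>" by simp
    have "\<bar>kc j r - bubk r\<bar> = r powr (1 - n) * (bub (r powr \<sigma>) * (1 - cut j (r powr \<sigma>)))"
    proof -
     have "kc j r - bubk r = - (r powr (1 - n) * (bub (r powr \<sigma>) * (1 - cut j (r powr \<sigma>))))"
      by (simp add: kc_def bubk_def bubc_def algebra_simps)
     moreover have "0 \<le> r powr (1 - n) * (bub (r powr \<sigma>) * (1 - cut j (r powr \<sigma>)))"
      using bub_pos[OF s] cut_bounds(2)[of j "r powr \<sigma>"] by simp
     ultimately show ?thesis by simp
    qed
    also have "\<dots> \<le> (C j * min ((r powr \<sigma>) powr \<eta>) ((r powr \<sigma>) powr - \<eta>)) * r powr (\<delta> - 1)"
     by (rule powr_\<mu>_le[OF _ gb[OF s]]) (use bub_pos[OF s] cut_bounds(2)[of j "r powr \<sigma>"] in simp)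
    finally show "\<bar>kc j r - bubk r\<bar> \<le> C j * (r powr (\<delta> - 1) * min (r powr (\<bar>\<sigma>\<bar> * \<eta>)) (r powr - (\<bar>\<sigma>\<bar> * \<eta>)))"
     unfolding mr by (simp only: ac_simps)
   qed
  qed
 qed
qed

end

subsection \<open>Uniqueness and the best constant\<close>

text \<open>The weak derivatives are choices, so their measurability has to come from local
  integrability: f is the limit of its restrictions to annuli, with the value at the origin
  added.\<close>

lemma loc_integrable_borel:
 fixes f :: "'a::euclidean_space \<Rightarrow> 'b::euclidean_space"
 assumes f: "loc_integrable f"
 shows "f \<in> Borel"
proof (rule borel_measurable_LIMSEQ_metric)
 define K where "K j = cball (0::'a) (real (Suc j)) - ball 0 (1 / real (Suc j))" for j
 have "compact (K j)" "0 \<notin> K j" for j by (auto simp: K_def intro!: compact_diff)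
 then have "set_integrable lborel (K j) f" for j using f unfolding loc_integrable_def by blast
 then have [measurable]: "(\<lambda>x. indicator (K j) x *\<^sub>R f x) \<in> Borel" for j
  unfolding set_integrable_def using borel_measurable_integrable by fastforce
 show "(\<lambda>x. indicator (K j) x *\<^sub>R f x + indicator {0} x *\<^sub>R f 0) \<in> Borel" for j by measurable
 fix x
 show "(\<lambda>j. indicator (K j) x *\<^sub>R f x + indicator {0} x *\<^sub>R f 0) \<longlonglongrightarrow> f x"
 proof (cases "x = 0")
  case True
  then show ?thesis by (simp add: K_def)
 next
  case False
  have "(\<lambda>j. 1 / real (Suc j)) \<longlonglongrightarrow> 0" using LIMSEQ_inverse_real_of_nat by (simp add: inverse_eq_divide)
  then have "eventually (\<lambda>j. 1 / real (Suc j) < norm x) sequentially" using False by (intro order_tendstoD(2)[where y = 0]) auto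
  moreover have "eventually (\<lambda>j. norm x \<le> real j) sequentially"
   using filterlim_real_sequentially by (simp add: filterlim_at_top)
  ultimately have "eventually (\<lambda>j. indicator (K j) x *\<^sub>R f x + indicator {0} x *\<^sub>R f 0 = f x) sequentially"
   by eventually_elim (use False in \<open>auto simp: K_def indicator_def\<close>)
  then show ?thesis by (rule tendsto_eventually)
 qed
qed

lemma AE_lborel_scaleR:
 fixes P :: "'a::euclidean_space \<Rightarrow> bool"
 assumes P: "AE x in lborel. P x" and c: "c \<noteq> 0"
 shows "AE x in lborel. P (c *\<^sub>R x)"
proof -
 have "AE x in density (distr lborel borel (\<lambda>x::'a. 0 + c *\<^sub>R x)) (\<lambda>_. ennreal (\<bar>c\<bar> ^ DIM('a))). P x"
  by (subst lborel_affine[OF c, of "0::'a", symmetric]) (rule P)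
 then have "AE x in distr lborel borel (\<lambda>x::'a. 0 + c *\<^sub>R x). P x"
  by (subst (asm) AE_density) (use c in auto)
 then have "AE x::'a in lborel. P (0 + c *\<^sub>R x)" by (rule AE_distrD[rotated]) simp
 then show ?thesis by simp
qed

lemma continuous_on_AE_zero:
 fixes f :: "real \<Rightarrow> real"
 assumes c: "continuous_on {0<..} f" and z: "AE s in lborel. 0 < s \<longrightarrow> f s = 0" and s: "0 < s"
 shows "f s = 0"
proof (rule ccontr)
 assume s0: "f s \<noteq> 0"
 have "open ({0<..} \<inter> f -` (- {0}))" by (rule continuous_open_preimage[OF c]) auto
 moreover have "{0<..} \<inter> f -` (- {0}) \<noteq> {}" using s s0 by auto
 ultimately have "\<not> negligible ({0<..} \<inter> f -` (- {0}))" by (rule open_not_negligible)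
 moreover obtain N where N: "{x \<in> space lborel. \<not> (0 < x \<longrightarrow> f x = 0)} \<subseteq> N" "N \<in> null_sets lborel"
  using z by (auto elim!: AE_E simp: null_sets_def)
 moreover have "negligible N" using N(2) by (simp add: negligible_iff_null_sets null_sets_completionI)
 moreover have "{0<..} \<inter> f -` (- {0}) \<subseteq> N" using N(1) by auto
 ultimately show False using negligible_subset by blast
qed

lemma filterlim_mult_end_filter:
 assumes "0 < \<rho>"
 shows "filterlim (\<lambda>r. \<rho> * r) (end_filter \<delta>) (end_filter \<delta>)"
proof (cases "0 < \<delta>")
 case True
 have "((\<lambda>r. \<rho> * r) \<longlongrightarrow> \<rho> * 0) (at_right 0)" by (intro tendsto_intros)
 moreover have "eventually (\<lambda>r. 0 < \<rho> * r) (at_right 0)"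
  using eventually_at_right_less[of "0::real"] by (rule eventually_mono) (use assms in simp)
 ultimately have "filterlim (\<lambda>r. \<rho> * r) (at_right 0) (at_right 0)"
  by (intro tendsto_imp_filterlim_at_right) simp_all
 then show ?thesis using True by (simp add: end_filter_def)
next
 case False
 have "filterlim (\<lambda>r. \<rho> * r) at_top at_top"
  by (rule filterlim_tendsto_pos_mult_at_top[OF tendsto_const assms filterlim_ident])
 then show ?thesis using False by (simp add: end_filter_def)
qed

lemma spw_mult: "spw r (x * y) = spw r x * spw r y"
 by (simp add: spw_def sgn_mult abs_mult powr_mult)

context rad
begin

lemma
 assumes a: "approx u \<psi>"
 shows wlap_approx: "AE x in lborel. wlap u x = lapW \<psi> x" and wgrad_approx: "AE x in lborel. wgrad u x = gradW (prim \<psi>) x"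
  and wlap_borel: "wlap u \<in> Borel" and wgrad_borel: "wgrad u \<in> Borel"
  and approx_borel: "\<psi> \<in> Borel" and approx_zero: "s \<le> 0 \<Longrightarrow> \<psi> s = 0"
  and approx_integrable: "integrable lborel (\<lambda>s. \<bar>\<psi> s\<bar> powr p)"
  and approx_prim_borel: "(\<lambda>s. indicator {0<..} s * prim \<psi> s) \<in> Borel"
proof -
 show "AE x in lborel. wlap u x = lapW \<psi> x" by (rule wlap_AE[OF approx_weak_laplacian[OF a]])
 show "AE x in lborel. wgrad u x = gradW (prim \<psi>) x" by (rule wgrad_AE[OF approx_weak_gradient[OF a]])
 have "is_weak_laplacian u (wlap u)"
  unfolding wlap_def by (rule someI[where P = "is_weak_laplacian u", OF approx_weak_laplacian[OF a]])
 then show "wlap u \<in> Borel" by (auto simp: is_weak_laplacian_def intro: loc_integrable_borel)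
 have "is_weak_gradient u (wgrad u)"
  unfolding wgrad_def by (rule someI[where P = "is_weak_gradient u", OF approx_weak_gradient[OF a]])
 then show "wgrad u \<in> Borel" by (auto simp: is_weak_gradient_def intro: loc_integrable_borel)
 obtain V V' where L: "C1c_limit V V' \<psi>" using a unfolding approx_def by blast
 show "\<psi> \<in> Borel" "s \<le> 0 \<Longrightarrow> \<psi> s = 0" "integrable lborel (\<lambda>s. \<bar>\<psi> s\<bar> powr p)"
  by (rule C1c_limitD[OF L], rule C1c_limitD(3)[OF L], assumption, rule C1c_limitD(4)[OF L])
 show "(\<lambda>s. indicator {0<..} s * prim \<psi> s) \<in> Borel" by (rule prim_borel[OF L])
qed

lemma
 assumes u: "approx u \<psi>" and v: "approx v \<xi>"
 shows wlap_form_integrable_iff: "integrable lborel (\<lambda>x. lap_form (wlap u) (wlap v) x) \<longleftrightarrow>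
   integrable lborel (\<lambda>s. spw (p - 1) (\<psi> s) * \<xi> s)"
  and wlap_form: "(LINT x|lborel. lap_form (wlap u) (wlap v) x) =
   sphere_area TYPE('a) * \<bar>\<sigma>\<bar> powr (p - 1) * (LINT s|lborel. spw (p - 1) (\<psi> s) * \<xi> s)"
  and wgrad_form_integrable_iff: "integrable lborel (\<lambda>x. grad_form (wgrad u) (wgrad v) x) \<longleftrightarrow>
   integrable lborel (\<lambda>s. wt s * (spw (q - 1) (prim \<psi> s) * prim \<xi> s))"
  and wgrad_form: "(LINT x|lborel. grad_form (wgrad u) (wgrad v) x) =
   sphere_area TYPE('a) / \<bar>\<sigma>\<bar> * (LINT s|lborel. wt s * (spw (q - 1) (prim \<psi> s) * prim \<xi> s))"
proof -
 note [measurable] = wlap_borel[OF u] wlap_borel[OF v] wgrad_borel[OF u] wgrad_borel[OF v] lapW_borel[OF approx_borel[OF u]] lapW_borel[OF approx_borel[OF v]]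
  gradW_borel[OF approx_prim_borel[OF u]] gradW_borel[OF approx_prim_borel[OF v]]
 have 1: "AE x in lborel. lap_form (wlap u) (wlap v) x = lap_form (lapW \<psi>) (lapW \<xi>) x"
  using wlap_approx[OF u] wlap_approx[OF v] by eventually_elim simp
 have 2: "AE x in lborel. grad_form (wgrad u) (wgrad v) x =
   grad_form (gradW (prim \<psi>)) (gradW (prim \<xi>)) x"
  using wgrad_approx[OF u] wgrad_approx[OF v] by eventually_elim simp
 have m1: "(\<lambda>x. lap_form (wlap u) (wlap v) x) \<in> borel_measurable lborel" by measurable
 have m2: "(\<lambda>x. lap_form (lapW \<psi>) (lapW \<xi>) x) \<in> borel_measurable lborel" by measurable
 note F = laplacian_form_integrable_iff[OF approx_borel[OF u] approx_borel[OF v] approx_zero[OF v]]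
  laplacian_form[OF approx_borel[OF u] approx_borel[OF v] approx_zero[OF v]]
  gradient_form_integrable_iff[OF approx_prim_borel[OF u] approx_prim_borel[OF v]]
  gradient_form[OF approx_prim_borel[OF u] approx_prim_borel[OF v]]
 show "integrable lborel (\<lambda>x. lap_form (wlap u) (wlap v) x) \<longleftrightarrow> integrable lborel (\<lambda>s. spw (p - 1) (\<psi> s) * \<xi> s)"
  by (rule trans[OF integrable_cong_AE[OF m1 m2 1] F(1)])
 show "(LINT x|lborel. lap_form (wlap u) (wlap v) x) =
   sphere_area TYPE('a) * \<bar>\<sigma>\<bar> powr (p - 1) * (LINT s|lborel. spw (p - 1) (\<psi> s) * \<xi> s)"
  by (rule trans[OF integral_cong_AE[OF m1 m2 1] F(2)])
 show "integrable lborel (\<lambda>x. grad_form (wgrad u) (wgrad v) x) \<longleftrightarrow>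
   integrable lborel (\<lambda>s. wt s * (spw (q - 1) (prim \<psi> s) * prim \<xi> s))"
  unfolding F(3)[symmetric] by (rule integrable_cong_AE[OF _ _ 2]) measurable
 show "(LINT x|lborel. grad_form (wgrad u) (wgrad v) x) =
   sphere_area TYPE('a) / \<bar>\<sigma>\<bar> * (LINT s|lborel. wt s * (spw (q - 1) (prim \<psi> s) * prim \<xi> s))"
  unfolding F(4)[symmetric] by (rule integral_cong_AE[OF _ _ 2]) measurable
qed

lemma rayleigh_approx:
 assumes u: "approx u \<psi>"
 shows "rayleigh_quotient p \<alpha> q u = sphere_area TYPE('a) * \<bar>\<sigma>\<bar> powr (p - 1) * Lp_int p \<psi> /
  (sphere_area TYPE('a) / \<bar>\<sigma>\<bar> * wt_int (prim \<psi>)) powr (p / q)"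
proof -
 note [measurable] = wlap_borel[OF u] wgrad_borel[OF u] lapW_borel[OF approx_borel[OF u]] gradW_borel[OF approx_prim_borel[OF u]]
 have "(LINT x|lborel. norm x powr \<alpha> * \<bar>wlap u x\<bar> powr p) = (LINT x|lborel. norm x powr \<alpha> * \<bar>lapW \<psi> x\<bar> powr p)"
 proof (rule integral_cong_AE)
  show "AE x in lborel. norm x powr \<alpha> * \<bar>wlap u x\<bar> powr p = norm x powr \<alpha> * \<bar>lapW \<psi> x\<bar> powr p"
   using wlap_approx[OF u] by eventually_elim simp
 qed measurable
 also have "\<dots> = sphere_area TYPE('a) * \<bar>\<sigma>\<bar> powr (p - 1) * Lp_int p \<psi>"
  by (rule laplacian_energy[OF approx_borel[OF u] approx_zero[OF u]])
 finally have 1: "(LINT x|lborel. norm x powr \<alpha> * \<bar>wlap u x\<bar> powr p) = sphere_area TYPE('a) * \<bar>\<sigma>\<bar> powr (p - 1) * Lp_int p \<psi>" .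
 have "(LINT x|lborel. norm x powr (- beta1 n p \<alpha> q) * norm (wgrad u x) powr q) = (LINT x|lborel. norm x powr (- beta1 n p \<alpha> q) * norm (gradW (prim \<psi>) x) powr q)"
 proof (rule integral_cong_AE)
  show "AE x in lborel. norm x powr (- beta1 n p \<alpha> q) * norm (wgrad u x) powr q = norm x powr (- beta1 n p \<alpha> q) * norm (gradW (prim \<psi>) x) powr q"
   using wgrad_approx[OF u] by eventually_elim simp
 qed measurable
 also have "\<dots> = sphere_area TYPE('a) / \<bar>\<sigma>\<bar> * wt_int (prim \<psi>)"
  by (rule gradient_energy[OF approx_prim_borel[OF u]])
 finally show ?thesis unfolding rayleigh_quotient_def n[symmetric] 1 by (simp only:)
qed

text \<open>With a vanishing flux the zero function would be a profile for \<psi>, and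
  \<open>approx_eq_potential\<close> would make u vanish.\<close>

lemma approx_nontrivial:
 assumes u: "approx u \<psi>" and nz: "nonzero u"
 shows "\<exists>s>0. prim \<psi> s \<noteq> 0"
proof (rule ccontr)
 assume "\<not> ?thesis"
 then have z: "prim \<psi> s = 0" if "0 < s" for s using that by blast
 have "AE x in lborel. u x = (\<lambda>_. 0) (norm x)"
  by (rule approx_eq_potential[OF u]) (use z in auto)
 then show False using nz by (simp add: nonzero_def)
qed

definition rayleigh_min :: real where
 "rayleigh_min = sphere_area TYPE('a) * \<bar>\<sigma>\<bar> powr (p - 1) * Nst / (sphere_area TYPE('a) / \<bar>\<sigma>\<bar> * Jst) powr (p / q)"

lemma rayleigh_ge:
 assumes u: "approx u \<psi>" and nz: "nonzero u"
 shows "rayleigh_min \<le> rayleigh_quotient p \<alpha> q u"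
proof -
 obtain V V' where L: "C1c_limit V V' \<psi>" using u unfolding approx_def by blast
 define N where "N = Lp_int p \<psi>"
 define D where "D = wt_int (prim \<psi>)"
 have b: "Nst * D powr (p / q) \<le> N * Jst powr (p / q)" unfolding N_def D_def by (rule bliss_C1c_limit(2)[OF L])
 \<comment> \<open>Division by 0 yields 0, which is below the positive \<open>rayleigh_min\<close>,
   so a vanishing denominator has to be excluded.\<close>
 have "D \<noteq> 0"
 proof
  assume "D = 0"
  then have "AE s in lborel. wt s * \<bar>prim \<psi> s\<bar> powr q = 0"
   unfolding D_def by (subst (asm) integral_nonneg_eq_0_iff_AE[OF bliss_C1c_limit(1)[OF L]]) (auto simp: wt_nonneg)
  then have z: "AE s in lborel. 0 < s \<longrightarrow> prim \<psi> s = 0" by eventually_elim (auto simp: wt_def)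
  obtain s where s: "0 < s" "prim \<psi> s \<noteq> 0" using approx_nontrivial[OF u nz] by blast
  have c: "continuous_on {0<..} (prim \<psi>)" by (rule Lp_prim(3)[OF p C1c_limitD(2,3,4)[OF L]])
  show False using continuous_on_AE_zero[OF c z s(1)] s(2) by simp
 qed
 moreover have "0 \<le> D" unfolding D_def by (rule integral_nonneg_AE) (simp add: wt_nonneg)
 ultimately have D: "0 < D" by simp
 define S1 where "S1 = sphere_area TYPE('a) * \<bar>\<sigma>\<bar> powr (p - 1)"
 define S2 where "S2 = sphere_area TYPE('a) / \<bar>\<sigma>\<bar>"
 have S: "0 < S1" "0 < S2" using sphere_\<sigma>_pos sphere_area_pos[where 'a = 'a] nonzero_exponents by (auto simp: S1_def S2_def)
 have "Nst / Jst powr (p / q) \<le> N / D powr (p / q)" using b D Jst_pos by (simp add: field_simps)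
 then have "S1 / S2 powr (p / q) * (Nst / Jst powr (p / q)) \<le> S1 / S2 powr (p / q) * (N / D powr (p / q))"
  using S by (intro mult_left_mono) auto
 then show ?thesis
  unfolding rayleigh_min_def rayleigh_approx[OF u] N_def[symmetric] D_def[symmetric] S1_def[symmetric] S2_def[symmetric]
  using S D Jst_pos by (simp add: powr_mult)
qed

lemma approx_cmult:
 assumes u: "approx u \<psi>"
 shows "approx (\<lambda>x. c * u x) (\<lambda>s. c * \<psi> s)"
proof -
 obtain \<phi> V V' H where um: "u \<in> Borel" and K: "\<And>j. link (\<phi> j) (V j) (V' j) (H j)" and L: "C1c_limit V V' \<psi>"
  and lim: "(\<lambda>j. wdist (\<phi> j) u) \<longlonglongrightarrow> 0"
  using u unfolding approx_def by blast
 have K': "link (\<lambda>x. c * \<phi> j x) (\<lambda>s. c * V j s) (\<lambda>s. c * V' j s) (\<lambda>r. c * H j r)" for j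
  unfolding link_def
 proof (intro conjI allI impI)
  have \<phi>: "\<phi> j \<in> Ckc 2" "radial (\<phi> j)" using K[of j] by (auto simp: link_def Ckcr_def)
  have "(\<lambda>x. \<phi> j x * c) \<in> Ckc 2" by (rule Ckc_mult[OF \<phi>(1) Ck_const])
  then have "(\<lambda>x. c * \<phi> j x) \<in> Ckc 2" by (simp only: mult.commute)
  moreover have "radial (\<lambda>x. c * \<phi> j x)" using \<phi>(2) unfolding radial_def by metis
  ultimately show "(\<lambda>x. c * \<phi> j x) \<in> Ckcr 2" by (simp add: Ckcr_def)
  show "C1c (\<lambda>s. c * V j s) (\<lambda>s. c * V' j s)" using K[of j] by (intro C1c_cmult) (simp add: link_def)
  show "((\<lambda>r. c * H j r) \<longlongrightarrow> 0) (end_filter \<delta>)" using K[of j] by (intro tendsto_mult_right_zero) (simp add: link_def)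
  show "DERIV (\<lambda>r. c * H j r) r :> r powr (1 - n) * (c * V j (r powr \<sigma>))" if "0 < r" for r
  proof -
   have "DERIV (H j) r :> r powr (1 - n) * V j (r powr \<sigma>)" using K[of j] that by (simp add: link_def)
   from DERIV_cmult[OF this, of c] show ?thesis by (simp only: mult.left_commute)
  qed
  show "c * \<phi> j x = c * H j (norm x)" if "x \<noteq> 0" for x using K[of j] that by (simp add: link_def)
 qed
 have L': "C1c_limit (\<lambda>j s. c * V j s) (\<lambda>j s. c * V' j s) (\<lambda>s. c * \<psi> s)"
  unfolding C1c_limit_def
 proof (intro conjI allI impI)
  show "C1c (\<lambda>s. c * V j s) (\<lambda>s. c * V' j s)" for j by (rule C1c_cmult[OF C1c_limitD(1)[OF L]])
  show "(\<lambda>s. c * \<psi> s) \<in> Borel" using C1c_limitD(2)[OF L] by simp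
  show "c * \<psi> s = 0" if "s \<le> 0" for s using C1c_limitD(3)[OF L that] by simp
  have m: "\<bar>c * y\<bar> powr p = \<bar>c\<bar> powr p * \<bar>y\<bar> powr p" for y by (simp add: abs_mult powr_mult)
  show "integrable lborel (\<lambda>s. \<bar>c * \<psi> s\<bar> powr p)" unfolding m by (intro integrable_mult_right C1c_limitD(4)[OF L])
  have "(\<lambda>j. \<bar>c\<bar> powr p * Lp_dist p (V' j) \<psi>) \<longlonglongrightarrow> 0"
   by (rule tendsto_mult_right_zero[OF C1c_limitD(5)[OF L]])
  then show "(\<lambda>j. LINT s|lborel. \<bar>c * V' j s - c * \<psi> s\<bar> powr p) \<longlonglongrightarrow> 0"
   by (simp add: right_diff_distrib[symmetric] m)
 qed
 have lim': "(\<lambda>j. \<integral>\<^sup>+x. ennreal (norm x powr (\<alpha> - 2 * p) * \<bar>c * \<phi> j x - c * u x\<bar> powr p) \<partial>lborel) \<longlonglongrightarrow> 0"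
 proof -
  note [measurable] = link_Ckc(3)[OF K] um
  have "(\<integral>\<^sup>+x. ennreal (norm x powr (\<alpha> - 2 * p) * \<bar>c * \<phi> j x - c * u x\<bar> powr p) \<partial>lborel) =
    ennreal (\<bar>c\<bar> powr p) * wdist (\<phi> j) u" for j
  proof -
   have "ennreal (norm x powr (\<alpha> - 2 * p) * \<bar>c * \<phi> j x - c * u x\<bar> powr p) =
     ennreal (\<bar>c\<bar> powr p) * ennreal (norm x powr (\<alpha> - 2 * p) * \<bar>\<phi> j x - u x\<bar> powr p)" for x
    unfolding right_diff_distrib[symmetric]
    by (simp add: ennreal_mult[symmetric] abs_mult powr_mult ac_simps)
   then show ?thesis by (simp add: nn_integral_cmult)
  qed
  moreover have "(\<lambda>j. ennreal (\<bar>c\<bar> powr p) * wdist (\<phi> j) u) \<longlonglongrightarrow> ennreal (\<bar>c\<bar> powr p) * 0"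
   by (intro ennreal_tendsto_cmult lim) simp
  ultimately show ?thesis by simp
 qed
 have "(\<lambda>x. c * u x) \<in> Borel" using um by simp
 then show ?thesis
  unfolding approx_def
  by (intro conjI exI[of _ "\<lambda>j x. c * \<phi> j x"] exI[of _ "\<lambda>j s. c * V j s"] exI[of _ "\<lambda>j s. c * V' j s"] exI[of _ "\<lambda>j r. c * H j r"] allI K' L' lim')
qed

section \<open>The explicit candidate\<close>

abbreviation K0 :: real where "K0 \<equiv> kconst n p \<alpha> q"

text \<open>K0 is the amplitude that the relation \<open>\<mu> * A = c / q * K powr (q - p)\<close>
  of the Emden-Fowler system gives for A = 1 and c = |\<sigma>| powr (- p).\<close>

lemma K0: "0 < K0" "K0 powr (q - p) = \<mu> * q * \<bar>\<sigma>\<bar> powr p"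
proof -
 have g: "0 < \<bar>n * p - n - \<alpha>\<bar>" using \<alpha> by auto
 define X where "X = q / p * (\<bar>n * p - n - \<alpha>\<bar> powr p / (p - 1) powr (p - 1))"
 have X: "0 < X" unfolding X_def using g p q(1) by (intro mult_pos_pos divide_pos_pos) auto
 have K: "K0 = X powr (1 / (q - p))" by (simp add: kconst_def X_def)
 show "0 < K0" unfolding K using X by simp
 have "K0 powr (q - p) = X" unfolding K using X pq by (simp add: powr_powr)
 also have "X = \<mu> * q * \<bar>\<sigma>\<bar> powr p"
 proof -
  have "\<bar>\<sigma>\<bar> = \<bar>n * p - n - \<alpha>\<bar> / (p - 1)" using p by (simp add: \<sigma>_def abs_divide)
  then have "\<bar>\<sigma>\<bar> powr p = \<bar>n * p - n - \<alpha>\<bar> powr p / (p - 1) powr p" using p by (simp add: powr_divide)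
  moreover have "(p - 1) powr p = (p - 1) powr (p - 1) * (p - 1)" using p powr_add[of "p - 1" "p - 1" 1] by simp
  ultimately show ?thesis using p by (simp add: X_def \<mu>_def)
 qed
 finally show "K0 powr (q - p) = \<mu> * q * \<bar>\<sigma>\<bar> powr p" .
qed

text \<open>The factor t powr \<sigma> of bub (t powr \<sigma>) combines with t powr (1 - n) into
  the first power.\<close>

lemma profile_eq: "profile n p \<alpha> q t = bubk t"
proof -
 have s: "1 - \<alpha> / (p - 1) = 1 - n + \<sigma>" using p by (simp add: \<sigma>_def field_simps)
 have e: "((n * p - n - \<alpha>) * (q - p)) / (p * (p - 1)) = \<sigma> * m" by (simp add: \<sigma>_def m_def)
 have f: "p / (p - q) = - (1 / m)" using pq p by (simp add: m_def minus_divide_right)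
 show ?thesis unfolding profile_def bubk_def bub_def s e f powr_add powr_powr by simp
qed

lemma
 shows pot_bubk_has_real_derivative: "0 < r \<Longrightarrow> DERIV (pot \<delta> bubk) r :> bubk r"
  and pot_bubk_tendsto_0: "(pot \<delta> bubk \<longlongrightarrow> 0) (end_filter \<delta>)"
 by (rule pot_has_real_derivative[OF nonzero_exponents(2) bubk_continuous bubk_bound], assumption+)
  (rule pot_tendsto_0[OF nonzero_exponents(2) bubk_continuous bubk_bound])

text \<open>The potential is strictly increasing and tends to 0 at one end.\<close>

lemma pot_bubk_nonzero:
 assumes r: "0 < r"
 shows "pot \<delta> bubk r \<noteq> 0"
proof -
 have pos: "0 < bubk r" if "0 < r" for r using that bub_pos[of "r powr \<sigma>"] by (simp add: bubk_def)
 have mono: "pot \<delta> bubk x < pot \<delta> bubk y" if "0 < x" "x < y" for x y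
  by (rule DERIV_pos_imp_increasing[OF that(2)]) (use that pos pot_bubk_has_real_derivative in \<open>meson less_le_trans\<close>)
 show ?thesis
 proof (cases "0 < \<delta>")
  case True
  have "eventually (\<lambda>x. x \<in> {0<..<r / 2}) (at_right 0)" by (rule eventually_at_right_real) (use r in simp)
  then have "eventually (\<lambda>x. pot \<delta> bubk x \<le> pot \<delta> bubk (r / 2)) (at_right 0)" by (rule eventually_mono) (auto intro!: less_imp_le mono)
  then have "0 \<le> pot \<delta> bubk (r / 2)"
   using pot_bubk_tendsto_0 True by (intro tendsto_upperbound[of "pot \<delta> bubk" 0 "at_right 0"]) (auto simp: end_filter_def)
  then show ?thesis using mono[of "r / 2" r] r by simp
 next
  case False
  have "eventually (\<lambda>x. 2 * r < x) at_top" by (rule eventually_gt_at_top)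
  then have "eventually (\<lambda>x. pot \<delta> bubk (2 * r) \<le> pot \<delta> bubk x) at_top" by (rule eventually_mono) (use r in \<open>auto intro!: less_imp_le mono\<close>)
  then have "pot \<delta> bubk (2 * r) \<le> 0"
   using pot_bubk_tendsto_0 False by (intro tendsto_lowerbound[of "pot \<delta> bubk" 0 at_top]) (auto simp: end_filter_def)
  then show ?thesis using mono[of r "2 * r"] r by simp
 qed
qed

lemma extremal:
 fixes U :: "'a \<Rightarrow> real"
 assumes c: "\<bar>c\<bar> = K0" and U: "U = (\<lambda>x. c * pot \<delta> bubk (norm x))"
 shows "weak_solution p \<alpha> q U" "nonzero U" "rayleigh_quotient p \<alpha> q U = rayleigh_min"
proof -
 have c0: "c \<noteq> 0" using c K0(1) by auto
 have aU: "approx U (\<lambda>s. c * bubd s)" unfolding U by (rule approx_cmult[OF bub_potential_approx])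
 have pU: "prim (\<lambda>s. c * bubd s) s = c * bub s" if "0 < s" for s
  using prim_bubd[OF that] by (simp add: prim_def set_lebesgue_integral_def mult.left_commute)
 show "weak_solution p \<alpha> q U"
  unfolding weak_solution_def n[symmetric]
 proof (intro conjI ballI)
  show "U \<in> Dr p \<alpha>" by (rule approx_Dr[OF aU])
  fix \<phi> :: "'a \<Rightarrow> real" assume "\<phi> \<in> Dr p \<alpha>"
  then obtain \<psi> where a: "approx \<phi> \<psi>" using Dr_approx by blast
  obtain V V' where L: "C1c_limit V V' \<psi>" using a unfolding approx_def by blast
  have 1: "spw (p - 1) (c * bubd s) * \<psi> s = spw (p - 1) c * (bubd s powr (p - 1) * \<psi> s)" for s
  proof -
   have "spw (p - 1) (bubd s) = bubd s powr (p - 1)" using bub'_pos[of s] by (cases "0 < s") (simp_all add: spw_def bubd_def)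
   then show ?thesis unfolding spw_mult by simp
  qed
  have 2: "wt s * (spw (q - 1) (prim (\<lambda>s. c * bubd s) s) * prim \<psi> s) = spw (q - 1) c * (wt s * (bub s powr (q - 1) * prim \<psi> s))" for s
   by (cases "0 < s") (simp_all add: pU spw_mult spw_pos bub_pos wt_def)
  note F = wlap_form_integrable_iff[OF aU a] wlap_form[OF aU a] wgrad_form_integrable_iff[OF aU a] wgrad_form[OF aU a]
  show "integrable lborel (\<lambda>x. lap_form (wlap U) (wlap \<phi>) x)"
   unfolding F(1) 1 by (intro integrable_mult_right bub_weak(1)[OF L])
  show "integrable lborel (\<lambda>x. grad_form (wgrad U) (wgrad \<phi>) x)"
   unfolding F(3) 2 by (intro integrable_mult_right bub_weak(2)[OF L])
  define I where "I = bubJ (prim \<psi>)"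
  \<comment> \<open>The prefactors of the two forms differ by |\<sigma>| powr p and
    \<open>bub_weak\<close> contributes \<mu> * q; the choice of K0 balances them.\<close>
  have c1: "spw (q - 1) c = \<bar>\<sigma>\<bar> powr p * (\<mu> * q) * spw (p - 1) c"
  proof -
   have "\<bar>\<sigma>\<bar> powr p * (\<mu> * q) = \<bar>c\<bar> powr (q - p)" using K0(2) c by (simp add: ac_simps)
   moreover have "\<bar>c\<bar> powr (q - p) * \<bar>c\<bar> powr (p - 1) = \<bar>c\<bar> powr (q - 1)" by (simp add: powr_add[symmetric])
   ultimately show ?thesis by (simp add: spw_def)
  qed
  have "\<bar>\<sigma>\<bar> powr p = \<bar>\<sigma>\<bar> * \<bar>\<sigma>\<bar> powr (p - 1)"
   using nonzero_exponents powr_add[of "\<bar>\<sigma>\<bar>" 1 "p - 1"] by simp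
  then have k: "\<bar>\<sigma>\<bar> powr (p - 1) * (spw (p - 1) c * (\<mu> * q * I)) = 1 / \<bar>\<sigma>\<bar> * (spw (q - 1) c * I)"
   unfolding c1 using nonzero_exponents by simp
  show "(LINT x|lborel. lap_form (wlap U) (wlap \<phi>) x) =
    (LINT x|lborel. grad_form (wgrad U) (wgrad \<phi>) x)"
   unfolding F(2,4) 1 2 integral_mult_right_zero bub_weak(3)[OF L] I_def[symmetric]
   using k by (metis mult.assoc mult.commute times_divide_eq_right mult_1)
 qed
 show "nonzero U"
  unfolding nonzero_def
 proof
  assume "AE x in lborel. U x = 0"
  moreover have "AE x::'a in lborel. x \<noteq> 0" by (rule AE_lborel_singleton)
  ultimately have "AE x::'a in lborel. False"
   by eventually_elim (use c0 pot_bubk_nonzero in \<open>auto simp: U\<close>)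
  then show False using AE_iff_null_sets[of "UNIV :: 'a set" lborel] by (simp add: null_sets_def)
 qed
 have "(LINT s|lborel. \<bar>c * bubd s\<bar> powr p) = \<bar>c\<bar> powr p * Nst"
  by (simp add: abs_mult powr_mult bubd_powr Nst_def)
 moreover have "(LINT s|lborel. wt s * \<bar>prim (\<lambda>s. c * bubd s) s\<bar> powr q) = \<bar>c\<bar> powr q * Jst"
 proof -
  have "wt s * \<bar>prim (\<lambda>s. c * bubd s) s\<bar> powr q = \<bar>c\<bar> powr q * jst s" for s
  proof (cases "0 < s")
   case True
   have "wt s * bub s powr q = jst s" using bub_powr[OF True] True by (simp add: wt_def jst_def)
   then show ?thesis using True bub_pos[OF True] by (simp add: pU abs_mult powr_mult)
  qed (simp add: wt_def jst_def)
  then show ?thesis by (simp add: Jst_def)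
 qed
 moreover have "(\<bar>c\<bar> powr q) powr (p / q) = \<bar>c\<bar> powr p" using q(1) by (simp add: powr_powr)
 moreover have "0 < sphere_area TYPE('a) / \<bar>\<sigma>\<bar>" using sphere_area_pos[where 'a = 'a] nonzero_exponents by simp
 ultimately have "(sphere_area TYPE('a) / \<bar>\<sigma>\<bar> * (LINT s|lborel. wt s * \<bar>prim (\<lambda>s. c * bubd s) s\<bar> powr q)) powr (p / q) =
   \<bar>c\<bar> powr p * (sphere_area TYPE('a) / \<bar>\<sigma>\<bar> * Jst) powr (p / q)"
  and N: "(LINT s|lborel. \<bar>c * bubd s\<bar> powr p) = \<bar>c\<bar> powr p * Nst"
  using Jst_pos powr_mult[of "\<bar>c\<bar> powr q" "sphere_area TYPE('a) / \<bar>\<sigma>\<bar> * Jst" "p / q"] by (simp_all add: ac_simps)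
 then show "rayleigh_quotient p \<alpha> q U = rayleigh_min"
  unfolding rayleigh_approx[OF aU] rayleigh_min_def using c0 by simp
qed

section \<open>Uniqueness of weak solutions\<close>

lemma
 assumes m: "\<psi> \<in> Borel" and z: "\<And>s. s \<le> 0 \<Longrightarrow> \<psi> s = 0" and i: "integrable lborel (\<lambda>s. \<bar>\<psi> s\<bar> powr p)"
 shows kernel_continuous: "continuous_on {0<..} (\<lambda>r. r powr (1 - n) * prim \<psi> (r powr \<sigma>))"
  and kernel_bound: "0 < r \<Longrightarrow> \<bar>r powr (1 - n) * prim \<psi> (r powr \<sigma>)\<bar> \<le> (Lp_int p \<psi>) powr (1 / p) * r powr (\<delta> - 1)"
proof -
 show "continuous_on {0<..} (\<lambda>r. r powr (1 - n) * prim \<psi> (r powr \<sigma>))"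
  by (intro continuous_intros continuous_on_compose2[OF Lp_prim(3)[OF p m z i]]) auto
 assume r: "0 < r"
 let ?C = "(Lp_int p \<psi>) powr (1 / p)"
 have "\<bar>prim \<psi> (r powr \<sigma>) - prim (\<lambda>_. 0) (r powr \<sigma>)\<bar> \<le> (r powr \<sigma>) powr ((p - 1) / p) * (LINT s|lborel. \<bar>\<psi> s - 0\<bar> powr p) powr (1 / p)"
  by (rule prim_diff_le(2)[OF p m _ z _ i]) (use r p in auto)
 then have "\<bar>prim \<psi> (r powr \<sigma>)\<bar> \<le> (r powr \<sigma>) powr \<mu> * ?C" by (simp add: prim_def \<mu>_def)
 from powr_\<mu>_le[OF abs_ge_zero this] show "\<bar>r powr (1 - n) * prim \<psi> (r powr \<sigma>)\<bar> \<le> ?C * r powr (\<delta> - 1)"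
  by (simp add: abs_mult)
qed

text \<open>Every test function of the half-line is the flux of an element of the space, so a weak
  solution can be tested with all of them and satisfies the equation of
  \<open>ef_weak\<close>.\<close>

lemma C1c_test_function:
 assumes "C1c \<Phi> \<Phi>'"
 obtains v where "approx v \<Phi>'"
proof -
 note K = C1c_eq_prim(2,3)[OF assms] C1c_integrable(1)[OF assms]
 let ?k = "\<lambda>r. r powr (1 - n) * prim \<Phi>' (r powr \<sigma>)"
 have "approx (\<lambda>x. pot \<delta> ?k (norm x)) \<Phi>'"
 proof (rule C1c_potential_approx[OF assms])
  show "DERIV (pot \<delta> ?k) r :> r powr (1 - n) * \<Phi> (r powr \<sigma>)" if "0 < r" for r
   unfolding C1c_eq_prim(1)[OF assms] by (rule pot_has_real_derivative[OF nonzero_exponents(2) kernel_continuous[OF K] kernel_bound[OF K] that])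
  show "(pot \<delta> ?k \<longlongrightarrow> 0) (end_filter \<delta>)"
   by (rule pot_tendsto_0[OF nonzero_exponents(2) kernel_continuous[OF K] kernel_bound[OF K]])
 qed
 then show thesis by (rule that)
qed

text \<open>\<open>ef_weak\<close> yields the flux; since an element of the space is determined by
  its flux (\<open>approx_eq_potential\<close>), it remains to recognise that flux as the one of a
  rescaled candidate.\<close>

lemma weak_solution_eq:
 fixes V :: "'a \<Rightarrow> real"
 assumes W: "weak_solution p \<alpha> q V" and nz: "nonzero V"
 shows "\<exists>\<epsilon>\<in>{1, -1}. \<exists>\<rho>>0. AE x in lborel. V x = \<epsilon> * (K0 * \<rho> powr (- \<delta>) * pot \<delta> bubk (\<rho> * norm x))"
proof -
 obtain \<psi> where a: "approx V \<psi>" using W by (auto simp: weak_solution_def intro: Dr_approx)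
 \<comment> \<open>The quotient of the prefactors of the two forms, 1 / |\<sigma>| and |\<sigma>|
   powr (p - 1).\<close>
 define c where "c = \<bar>\<sigma>\<bar> powr (- p)"
 have c: "0 < c" using nonzero_exponents by (simp add: c_def)
 have weak: "(LINT s|lborel. spw (p - 1) (\<psi> s) * \<Phi>' s) = c * (LINT s|lborel. wt s * (spw (q - 1) (prim \<psi> s) * \<Phi> s))" if \<Phi>: "C1c \<Phi> \<Phi>'" for \<Phi> \<Phi>'
 proof -
  obtain v where v: "approx v \<Phi>'" using C1c_test_function[OF \<Phi>] .
  define I where "I = (LINT s|lborel. wt s * (spw (q - 1) (prim \<psi> s) * \<Phi> s))"
  define S where "S = sphere_area TYPE('a)"
  have S: "0 < S" unfolding S_def by (rule sphere_area_pos)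
  have "S * \<bar>\<sigma>\<bar> powr (p - 1) * (LINT s|lborel. spw (p - 1) (\<psi> s) * \<Phi>' s) = S / \<bar>\<sigma>\<bar> * I"
   unfolding I_def S_def C1c_eq_prim(1)[OF \<Phi>] wlap_form[OF a v, symmetric] wgrad_form[OF a v, symmetric]
   using W approx_Dr[OF v] by (simp add: weak_solution_def n[symmetric])
  then have "\<bar>\<sigma>\<bar> powr p * (LINT s|lborel. spw (p - 1) (\<psi> s) * \<Phi>' s) = I"
   using S nonzero_exponents powr_diff[of "\<bar>\<sigma>\<bar>" p 1] by (simp add: field_simps)
  then show ?thesis using nonzero_exponents by (auto simp: c_def I_def powr_minus field_simps)
 qed
 obtain \<epsilon> K A where \<epsilon>: "\<epsilon> \<in> {1, -1}" and KA: "0 < K" "0 < A" "\<mu> * A = c / q * K powr (q - p)"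
  and \<psi>: "\<And>s. 0 < s \<Longrightarrow> prim \<psi> s = \<epsilon> * (K * s * (1 + A * s powr m) powr (- (1 / m)))"
  using ef_weak[OF c approx_borel[OF a] approx_zero[OF a] approx_integrable[OF a] weak approx_nontrivial[OF a nz]] by blast
 \<comment> \<open>A * s powr m = (b * s) powr m and b * s = (\<rho> * r) powr \<sigma>, so the
   parameter A amounts to a dilation in r.\<close>
 define b where "b = A powr (1 / m)"
 define \<rho> where "\<rho> = b powr (1 / \<sigma>)"
 have b: "0 < b" "b powr m = A" using KA m(1) by (simp_all add: b_def powr_powr)
 have \<rho>: "0 < \<rho>" "\<rho> powr \<sigma> = b" using b nonzero_exponents by (simp_all add: \<rho>_def powr_powr)
 have "K powr (q - p) = K0 powr (q - p) * b powr m"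
 proof -
  have "c * (\<mu> * q * \<bar>\<sigma>\<bar> powr p) = \<mu> * q" using nonzero_exponents by (simp add: c_def powr_minus)
  then have "c * (K0 powr (q - p) * b powr m) = q * (\<mu> * A)" unfolding K0(2) b(2) by (metis mult.assoc mult.commute)
  also have "\<dots> = c * K powr (q - p)" unfolding KA(3) using q(1) by simp
  finally show ?thesis using c by simp
 qed
 also have "\<dots> = (K0 * b powr (1 / p)) powr (q - p)"
  using K0(1) b(1) p by (simp add: powr_mult powr_powr m_def)
 finally have "(K powr (q - p)) powr (1 / (q - p)) = ((K0 * b powr (1 / p)) powr (q - p)) powr (1 / (q - p))" by simp
 then have K: "K = K0 * b powr (1 / p)" using KA(1) K0(1) b(1) pq by (simp add: powr_powr)
 \<comment> \<open>The relation between A and K leaves no freedom for the amplitude: it is K0 times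
   \<rho> powr (- \<delta>), the factor of the scaling in \<open>identified\<close>.\<close>
 have Kb: "K / b * \<rho> powr (n - 2) = K0 * \<rho> powr (- \<delta>)"
 proof -
  have "b powr (1 / p) / b = \<rho> powr (\<sigma> * (1 / p - 1))"
   unfolding \<rho>(2)[symmetric] by (simp add: powr_powr powr_diff right_diff_distrib)
  moreover have "\<sigma> * (1 / p - 1) + (n - 2) = - \<delta>" using exponents(1) unfolding \<mu>(4) by (simp add: algebra_simps)
  ultimately have "b powr (1 / p) / b * \<rho> powr (n - 2) = \<rho> powr (- \<delta>)" by (simp add: powr_add[symmetric])
  then have "K0 * (b powr (1 / p) / b * \<rho> powr (n - 2)) = K0 * \<rho> powr (- \<delta>)" by (simp only:)
  then show ?thesis unfolding K by simp
 qed
 define H where "H r = \<epsilon> * (K0 * \<rho> powr (- \<delta>) * pot \<delta> bubk (\<rho> * r))" for r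
 have "AE x in lborel. V x = H (norm x)"
 proof (rule approx_eq_potential[OF a])
  fix r :: real assume r: "0 < r"
  have r': "0 < \<rho> * r" "0 < r powr \<sigma>" using r \<rho> by auto
  have "DERIV (\<lambda>r. pot \<delta> bubk (\<rho> * r)) r :> bubk (\<rho> * r) * (\<rho> * 1)"
   by (rule DERIV_chain2[OF pot_bubk_has_real_derivative[OF r'(1)] DERIV_cmult[OF DERIV_ident]])
  from DERIV_cmult[OF this, of "\<epsilon> * (K0 * \<rho> powr (- \<delta>))"]
  have d: "DERIV H r :> \<epsilon> * (K0 * \<rho> powr (- \<delta>)) * (bubk (\<rho> * r) * (\<rho> * 1))"
   by (simp add: H_def[abs_def] mult.assoc)
  have "bubk (\<rho> * r) * \<rho> = \<rho> powr (2 - n) * (r powr (1 - n) * bub (b * r powr \<sigma>))"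
  proof -
   have "\<rho> powr (1 - n) * \<rho> = \<rho> powr (2 - n)" using \<rho>(1) powr_add[of \<rho> "1 - n" 1] by simp
   moreover have "bubk (\<rho> * r) * \<rho> = (\<rho> powr (1 - n) * \<rho>) * (r powr (1 - n) * bub (b * r powr \<sigma>))"
    using \<rho> r by (simp add: bubk_def powr_mult)
   ultimately show ?thesis by (simp only:)
  qed
  moreover have "\<rho> powr (n - 2) * \<rho> powr (2 - n) = 1" using \<rho>(1) by (simp add: powr_add[symmetric])
  then have "K / b * \<rho> powr (n - 2) * (\<rho> powr (2 - n) * y) = K / b * y" for y
   by (metis mult.assoc mult_1)
  ultimately have "K0 * \<rho> powr (- \<delta>) * (bubk (\<rho> * r) * \<rho>) = K / b * (r powr (1 - n) * bub (b * r powr \<sigma>))"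
   unfolding Kb[symmetric] by (simp only:)
  moreover have "\<epsilon> * (K / b * bub (b * r powr \<sigma>)) = prim \<psi> (r powr \<sigma>)"
   unfolding \<psi>[OF r'(2)] bub_def using b r'(2) by (simp add: powr_mult)
  ultimately have "\<epsilon> * (K0 * \<rho> powr (- \<delta>)) * (bubk (\<rho> * r) * (\<rho> * 1)) = r powr (1 - n) * prim \<psi> (r powr \<sigma>)"
   by (metis mult.assoc mult.commute mult_1)
  with d show "DERIV H r :> r powr (1 - n) * prim \<psi> (r powr \<sigma>)" by simp
 next
  have "((\<lambda>r. pot \<delta> bubk (\<rho> * r)) \<longlongrightarrow> 0) (end_filter \<delta>)"
   by (rule filterlim_compose[OF pot_bubk_tendsto_0 filterlim_mult_end_filter[OF \<rho>(1)]])
  then show "(H \<longlongrightarrow> 0) (end_filter \<delta>)" unfolding H_def[abs_def] mult.assoc[symmetric] by (rule tendsto_mult_right_zero)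
 qed
 then show ?thesis using \<epsilon> \<rho>(1) unfolding H_def by blast
qed

lemma weak_solutions_identified:
 fixes V W :: "'a \<Rightarrow> real"
 assumes V: "weak_solution p \<alpha> q V" "nonzero V" and W: "weak_solution p \<alpha> q W" "nonzero W"
 shows "identified p \<alpha> V W"
proof -
 obtain \<epsilon> \<rho> where 1: "\<epsilon> \<in> {1, -1}" "0 < \<rho>" "AE x in lborel. V x = \<epsilon> * (K0 * \<rho> powr (- \<delta>) * pot \<delta> bubk (\<rho> * norm x))"
  using weak_solution_eq[OF V] by blast
 obtain \<epsilon>' \<rho>' where 2: "\<epsilon>' \<in> {1, -1}" "0 < \<rho>'" "AE x in lborel. W x = \<epsilon>' * (K0 * \<rho>' powr (- \<delta>) * pot \<delta> bubk (\<rho>' * norm x))"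
  using weak_solution_eq[OF W] by blast
 \<comment> \<open>Both solutions are dilations of one profile, so the quotient of their parameters
   leads from V to W, and the signs multiply.\<close>
 define t where "t = \<rho>' / \<rho>"
 have t: "0 < t" "\<rho> * t = \<rho>'" "t powr (- \<delta>) * \<rho> powr (- \<delta>) = \<rho>' powr (- \<delta>)"
  using 1 2 by (auto simp: t_def powr_divide)
 have e: "(real DIM('a) - 2 * p + \<alpha>) / p = - \<delta>" using exponents(4) p by (simp add: n[symmetric] field_simps)
 have "AE x in lborel. V (t *\<^sub>R x) = \<epsilon> * (K0 * \<rho> powr (- \<delta>) * pot \<delta> bubk (\<rho> * norm (t *\<^sub>R x)))"
  by (rule AE_lborel_scaleR[OF 1(3)]) (use t in simp)
 then have "AE x in lborel. W x = (\<epsilon> * \<epsilon>') * (t powr (- \<delta>) * V (t *\<^sub>R x))"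
  using 2(3)
 proof eventually_elim
  case (elim x)
  have r: "\<rho> * norm (t *\<^sub>R x) = \<rho>' * norm x" using t(1) by (simp add: t(2)[symmetric])
  have e: "\<epsilon> * \<epsilon> = 1" using 1(1) by auto
  have "(\<epsilon> * \<epsilon>') * (t powr (- \<delta>) * (\<epsilon> * (K0 * \<rho> powr (- \<delta>) * pot \<delta> bubk (\<rho>' * norm x)))) =
    (\<epsilon> * \<epsilon>) * (\<epsilon>' * (K0 * (t powr (- \<delta>) * \<rho> powr (- \<delta>)) * pot \<delta> bubk (\<rho>' * norm x)))" by (simp only: ac_simps)
  then show ?case unfolding elim t(3)[symmetric] r e mult_1 by (rule sym)
 qed
 moreover have "\<epsilon> * \<epsilon>' \<in> {1, -1}" using 1(1) 2(1) by auto
 ultimately show ?thesis unfolding identified_def e using t(1) by blast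
qed

lemma best_constant_eq:
 fixes U :: "'a \<Rightarrow> real"
 assumes U: "weak_solution p \<alpha> q U" "nonzero U" "rayleigh_quotient p \<alpha> q U = rayleigh_min"
 shows "rayleigh_quotient p \<alpha> q U = best_constant TYPE('a) p \<alpha> q"
proof -
 have "best_constant TYPE('a) p \<alpha> q = rayleigh_quotient p \<alpha> q U"
  unfolding best_constant_def
 proof (rule cInf_eq_minimum)
  show "rayleigh_quotient p \<alpha> q U \<in> rayleigh_quotient p \<alpha> q ` {u :: 'a \<Rightarrow> real. u \<in> Dr p \<alpha> \<and> nonzero u}"
   using U by (intro imageI) (auto simp: weak_solution_def)
  fix y assume "y \<in> rayleigh_quotient p \<alpha> q ` {u :: 'a \<Rightarrow> real. u \<in> Dr p \<alpha> \<and> nonzero u}"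
  then obtain u :: "'a \<Rightarrow> real" where u: "u \<in> Dr p \<alpha>" "nonzero u" "y = rayleigh_quotient p \<alpha> q u" by blast
  obtain \<psi> where "approx u \<psi>" using Dr_approx[OF u(1)] .
  then show "rayleigh_quotient p \<alpha> q U \<le> y" unfolding u(3) U(3) using rayleigh_ge u(2) by blast
 qed
 then show ?thesis ..
qed

end

theorem theorem1p5:
  fixes p q \<alpha> n :: real and U :: "real ^ 'n \<Rightarrow> real"
  assumes n_def: "n = real CARD('n)"
    and n_ge_2: "CARD('n) \<ge> 2"
    and p_gt_1: "p > 1"
    and alpha: "\<alpha> \<notin> {2 * p - n, n * p - n}"
    and q_gt_p: "q > p"
    and U_gt: "\<alpha> > 2 * p - n \<Longrightarrow>
      U = (\<lambda>x. kconst n p \<alpha> q * (LINT t:{norm x..}|lborel. profile n p \<alpha> q t))"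
    and U_lt: "\<alpha> < 2 * p - n \<Longrightarrow>
      U = (\<lambda>x. kconst n p \<alpha> q * (LINT t:{0..norm x}|lborel. profile n p \<alpha> q t))"
  shows "weak_solution p \<alpha> q U \<and> nonzero U
    \<and> (\<forall>V W :: real ^ 'n \<Rightarrow> real.
         weak_solution p \<alpha> q V \<and> nonzero V \<and> weak_solution p \<alpha> q W \<and> nonzero W
           \<longrightarrow> identified p \<alpha> V W)
    \<and> rayleigh_quotient p \<alpha> q U = best_constant TYPE(real ^ 'n) p \<alpha> q"
proof -
 interpret rad p q \<alpha> n "TYPE(real ^ 'n)"
  by unfold_locales (use assms in auto)
 have \<delta>: "0 < \<delta> \<longleftrightarrow> \<alpha> < 2 * p - n" unfolding \<delta>_def using p_gt_1 by (subst pos_less_divide_eq) auto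
 \<comment> \<open>For \<delta> < 0 the potential is minus the integral over the outer ray; the
   factor sgn \<delta> compensates this, and both formulas for U become one.\<close>
 have U: "U = (\<lambda>x. (sgn \<delta> * kconst n p \<alpha> q) * pot \<delta> bubk (norm x))"
 proof (cases "0 < \<delta>")
  case True
  then show ?thesis using U_lt \<delta> by (simp add: pot_def profile_eq)
 next
  case False
  then have "\<delta> < 0" "2 * p - n < \<alpha>" using \<delta> alpha nonzero_exponents by auto
  then show ?thesis using U_gt by (simp add: pot_def profile_eq)
 qed
 have "\<bar>sgn \<delta> * kconst n p \<alpha> q\<bar> = kconst n p \<alpha> q" using K0(1) nonzero_exponents by (simp add: abs_mult)
 note E = extremal[OF this U]
 show ?thesis using E(1,2) weak_solutions_identified best_constant_eq[OF E] by blast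
qed

end
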